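(* Let $n\ge 2$, $1\le k\le n-1$ with $k$ even, let $X$ be one of $\mathbb{R}^n$, $\mathbb{S}^n$, $\mathbb{H}^n$, and let $\Xi$ be the set of all $k$-dimensional totally geodesic submanifolds of $X$. Let $f:X\to\mathbb{C}$ be infinitely differentiable; if $X=\mathbb{R}^n$ or $X=\mathbb{H}^n$ assume that $f$ is rapidly decreasing together with its derivatives of all orders, and if $X=\mathbb{S}^n$ assume that $f$ is even. Let $\varphi=Rf$ be the totally geodesic Radon transform of $f$, and let $R^*_r$ be the shifted dual Radon transform. Then for every $x\in X$, $$\partial_r^k\big[\lambda_X(r)\,(R^*_r\varphi)(x)\big]\Big|_{r=0}=c_X\,f(x),$$ where $$\lambda_X(r)=\begin{cases}1 & \text{if } X=\mathbb{R}^n,\\ (1-r^2)^{(k-1)/2} & \text{if } X=\mathbb{S}^n,\\ (1+r^2)^{(k-1)/2} & \text{if } X=\mathbb{H}^n,\end{cases}\qquad c_X=\begin{cases}(-1)^{k/2}(k-1)!\,\sigma_{k-1} & \text{if } X=\mathbb{R}^n \text{ or } \mathbb{H}^n,\\ 2(-1)^{k/2}(k-1)!\,\sigma_{k-1} & \text{if } X=\mathbb{S}^n.\end{cases}$$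
   Context: Notation: $\sigma_{m-1}=2\pi^{m/2}/\Gamma(m/2)$ is the surface area of the unit sphere in $\mathbb{R}^m$. $\partial_r^{j}[\cdot]|_{r=0}$ means $\lim_{r\to0^+}\partial_r^{j}[\cdot]$. Spaces. $\mathbb{S}^n$ is the unit sphere in $\mathbb{R}^{n+1}$. $\mathbb{H}^n$ is the hyperboloid $\{x\in\mathbb{R}^{n+1}:[x,x]=1,\ x_{n+1}>0\}$, where $[x,y]=-x_1y_1-\dots-x_ny_n+x_{n+1}y_{n+1}$, with geodesic distance $d(x,y)=\cosh^{-1}[x,y]$ (curvature $-1$). A function on $\mathbb{S}^n$ is even if $f(-x)=f(x)$. On $\mathbb{R}^n$ "rapidly decreasing together with derivatives of all orders" means $f$ is a Schwartz function; on $\mathbb{H}^n$ it means that for every $N\ge 0$ and every differential operator $D$ arising from the action of the universal enveloping algebra of the Lie algebra of $SO_0(n,1)$ on $C^\infty(\mathbb{H}^n)$, $\sup_x e^{N d(x,x_0)}|Df(x)|<\infty$, where $x_0=(0,\dots,0,1)$. Totally geodesic submanifolds. For $X=\mathbb{R}^n$, $\Xi$ is the set of affine $k$-planes; for $X=\mathbb{S}^n$, $\Xi$ is the set of intersections of $\mathbb{S}^n$ with $(k+1)$-dimensional linear subspaces of $\mathbb{R}^{n+1}$; for $X=\mathbb{H}^n$, $\Xi$ is the set of nonempty intersections of $\mathbb{H}^n$ with $(k+1)$-dimensional linear subspaces of $\mathbb{R}^{n+1}$ on which the form $[\cdot,\cdot]$ is nondegenerate of signature with one plus and $k$ minuses.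 Radon transform. $(Rf)(\xi)=\int_\xi f(x)\,d_\xi x$, where $d_\xi x$ is the $k$-dimensional Riemannian volume measure on $\xi$ (Lebesgue measure on $k$-planes, surface measure on great $k$-spheres, hyperbolic volume in $\mathbb{H}^n$). Distance function. With $d(x,\xi)$ the geodesic distance from $x$ to $\xi$: $\rho(x,\xi)=d(x,\xi)$ if $X=\mathbb{R}^n$; $\rho(x,\xi)=\sin d(x,\xi)$ if $X=\mathbb{S}^n$; $\rho(x,\xi)=\sinh d(x,\xi)$ if $X=\mathbb{H}^n$. Shifted dual Radon transform. For $x\in X$ and $r>0$ (with $r<1$ if $X=\mathbb{S}^n$), $$(R^*_r\varphi)(x)=\int_{\rho(x,\xi)=r}\varphi(\xi)\,d\mu(\xi),$$ where $\mu$ is the unique probability measure on $\{\xi\in\Xi:\rho(x,\xi)=r\}$ invariant under the stabilizer of $x$ in the isometry group of $X$ (which acts transitively on this set). For instance, for $X=\mathbb{R}^n$, $(R^*_r\varphi)(x)=\int_{SO(n)}\varphi(\gamma\zeta_0+x+r\gamma e_n)\,d\gamma$ with $d\gamma$ the Haar probability measure, $e_n=(0,\dots,0,1)$, and $\zeta_0$ a fixed $k$-dimensional linear subspace orthogonal to $e_n$. *)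

theory Defs
  imports "HOL-Analysis.Analysis" "HOL-Probability.Probability"
begin

section \<open>Smooth functions\<close>

primrec iter_deriv ::
  "'a::real_normed_vector list \<Rightarrow> ('a \<Rightarrow> 'b::real_normed_vector) \<Rightarrow> 'a \<Rightarrow> 'b" where
  "iter_deriv [] f = f"
| "iter_deriv (v # vs) f = (\<lambda>x. frechet_derivative (iter_deriv vs f) (at x) v)"

definition smooth_on_open ::
  "'a::real_normed_vector set \<Rightarrow> ('a \<Rightarrow> 'b::real_normed_vector) \<Rightarrow> bool" where
  "smooth_on_open U f \<longleftrightarrow> open U \<and> (\<forall>vs. \<forall>x\<in>U. iter_deriv vs f differentiable (at x))"

text \<open>
  Smoothness of a function on an embedded submanifold of a Euclidean space, by local smooth
  extension.  Values of the function outside the submanifold are irrelevant.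
\<close>

definition smooth_on_submanifold ::
  "'a::real_normed_vector set \<Rightarrow> ('a \<Rightarrow> 'b::real_normed_vector) \<Rightarrow> bool" where
  "smooth_on_submanifold X f \<longleftrightarrow>
     (\<forall>p\<in>X. \<exists>U g. p \<in> U \<and> smooth_on_open U g \<and> (\<forall>x\<in>X \<inter> U. g x = f x))"

definition schwartz :: "('a::real_normed_vector \<Rightarrow> 'b::real_normed_vector) \<Rightarrow> bool" where
  "schwartz f \<longleftrightarrow> smooth_on_open UNIV f \<and>
     (\<forall>(N::nat) vs. bdd_above (range (\<lambda>x. (1 + norm x) ^ N * norm (iter_deriv vs f x))))"


section \<open>The hyperboloid\<close>

text \<open>
  \<open>\<real>\<^sup>n\<^sup>+\<^sup>1\<close> is \<open>real^'n \<times> real\<close>; the second component is the last coordinate.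
\<close>

definition lform :: "(real^'n) \<times> real \<Rightarrow> (real^'n) \<times> real \<Rightarrow> real" where
  "lform x y = - (fst x \<bullet> fst y) + snd x * snd y"

definition hyperboloid :: "((real^'n) \<times> real) set" where
  "hyperboloid = {x. lform x x = 1 \<and> snd x > 0}"

definition hyp_dist :: "(real^'n) \<times> real \<Rightarrow> (real^'n) \<times> real \<Rightarrow> real" where
  "hyp_dist x y = arcosh (lform x y)"

text \<open>The Lie algebra of \<open>SO\<^sub>0(n,1)\<close>; an element \<open>A\<close> acts by \<open>(A f)(x) = d/dt f(exp(-tA) x)\<close> at \<open>t = 0\<close>.\<close>

definition lorentz_algebra :: "((real^'n) \<times> real \<Rightarrow> (real^'n) \<times> real) set" where
  "lorentz_algebra = {A. linear A \<and> (\<forall>x y. lform (A x) y + lform x (A y) = 0)}"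

definition exp_linear :: "('a::real_normed_vector \<Rightarrow> 'a) \<Rightarrow> 'a \<Rightarrow> 'a" where
  "exp_linear A x = (\<Sum>m. (A ^^ m) x /\<^sub>R fact m)"

definition lie_action ::
  "('a::real_normed_vector \<Rightarrow> 'a) \<Rightarrow> ('a \<Rightarrow> complex) \<Rightarrow> 'a \<Rightarrow> complex" where
  "lie_action A f x = vector_derivative (\<lambda>t. f (exp_linear (\<lambda>y. (- t) *\<^sub>R A y) x)) (at 0)"

text \<open>
  The image of the (complexified) universal enveloping algebra in the operators on functions:
  the unital algebra generated by the operators of the Lie algebra.
\<close>

inductive_set enveloping_operators ::
  "(((real^'n) \<times> real \<Rightarrow> complex) \<Rightarrow> ((real^'n) \<times> real \<Rightarrow> complex)) set" where
  one: "(\<lambda>f. f) \<in> enveloping_operators"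
| lie: "A \<in> lorentz_algebra \<Longrightarrow> D \<in> enveloping_operators \<Longrightarrow>
    (\<lambda>f. lie_action A (D f)) \<in> enveloping_operators"
| add: "D \<in> enveloping_operators \<Longrightarrow> D' \<in> enveloping_operators \<Longrightarrow>
    (\<lambda>f x. D f x + D' f x) \<in> enveloping_operators"
| scale: "D \<in> enveloping_operators \<Longrightarrow> (\<lambda>f x. a * D f x) \<in> enveloping_operators"

definition hyp_rapidly_decreasing :: "((real^'n) \<times> real \<Rightarrow> complex) \<Rightarrow> bool" where
  "hyp_rapidly_decreasing f \<longleftrightarrow>
     (\<forall>D\<in>enveloping_operators. \<forall>N\<ge>0.
        bdd_above ((\<lambda>x. exp (N * hyp_dist x (0, 1)) * norm (D f x)) ` hyperboloid))"


section \<open>Riemannian volume\<close>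

definition gram_det :: "('a \<Rightarrow> 'a \<Rightarrow> real) \<Rightarrow> nat \<Rightarrow> (nat \<Rightarrow> 'a) \<Rightarrow> real" where
  "gram_det g k v =
     (\<Sum>p | p permutes {..<k}. of_int (sign p) * (\<Prod>i<k. g (v i) (v (p i))))"

text \<open>
  Volume measure on \<open>\<xi>\<close> in the coordinates given by a parametrization \<open>\<psi>\<close>, defined on the
  part \<open>U\<close> of \<open>\<real>\<^sup>k\<close> and covering \<open>\<xi>\<close> up to a null set: the Lebesgue measure with density
  \<open>sqrt (det (g (\<partial>\<^sub>i \<psi>) (\<partial>\<^sub>j \<psi>)))\<close>, transported to \<open>\<xi>\<close>.  Here \<open>\<real>\<^sup>k\<close> is realized by the
  product measure over \<open>{..<k}\<close>, and \<open>g\<close> is a bilinear form on the ambient space inducing the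
  Riemannian metric on \<open>\<xi>\<close>.
\<close>

definition riemannian_volume ::
  "('a::real_normed_vector \<Rightarrow> 'a \<Rightarrow> real) \<Rightarrow> nat \<Rightarrow> (nat \<Rightarrow> real) set \<Rightarrow>
     ((nat \<Rightarrow> real) \<Rightarrow> 'a) \<Rightarrow> 'a set \<Rightarrow> 'a measure" where
  "riemannian_volume g k U \<psi> \<xi> =
     distr
       (density (restrict_space (\<Pi>\<^sub>M i\<in>{..<k}. lborel) U)
         (\<lambda>c. ennreal (sqrt (gram_det g k
            (\<lambda>i. vector_derivative (\<lambda>t. \<psi> (c(i := t))) (at (c i)))))))
       (restrict_space borel \<xi>) \<psi>"

text \<open>
  \<open>b 0, \<dots>, b (m - 1)\<close> are pairwise orthogonal for the form \<open>g\<close>, with \<open>g (b i) (b i) = s i\<close>.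
\<close>

definition form_frame :: "('a \<Rightarrow> 'a \<Rightarrow> real) \<Rightarrow> nat \<Rightarrow> (nat \<Rightarrow> real) \<Rightarrow> (nat \<Rightarrow> 'a) \<Rightarrow> bool" where
  "form_frame g m s b \<longleftrightarrow> (\<forall>i<m. \<forall>j<m. g (b i) (b j) = (if i = j then s i else 0))"

text \<open>One plus and \<open>k\<close> minuses; the plus sign is put last.\<close>

definition lorentz_sign :: "nat \<Rightarrow> nat \<Rightarrow> real" where
  "lorentz_sign k i = (if i = k then 1 else - 1)"

definition flat_volume :: "nat \<Rightarrow> (real^'n) set \<Rightarrow> (real^'n) measure" where
  "flat_volume k \<xi> =
     (let (p, b) = (SOME (p, b). form_frame inner k (\<lambda>_. 1) b \<and> \<xi> = (+) p ` span (b ` {..<k}))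
      in riemannian_volume inner k UNIV (\<lambda>c. p + (\<Sum>i<k. c i *\<^sub>R b i)) \<xi>)"

text \<open>
  Stereographic projection from \<open>- b k\<close>.  For \<open>\<kappa> = 1\<close> and an orthonormal frame it parametrizes
  the great \<open>k\<close>-sphere in the span of the frame without the point \<open>- b k\<close>; for \<open>\<kappa> = - 1\<close>, a
  frame orthonormal for the Lorentz form, and \<open>b k\<close> on the hyperboloid, it is the
  Poincare ball model of hyperbolic \<open>k\<close>-space in the span of the frame.
\<close>

definition stereo_domain :: "real \<Rightarrow> nat \<Rightarrow> (nat \<Rightarrow> real) set" where
  "stereo_domain \<kappa> k = {c. 1 + \<kappa> * (\<Sum>i<k. (c i)\<^sup>2) > 0}"

definition stereo ::
  "real \<Rightarrow> nat \<Rightarrow> (nat \<Rightarrow> 'a::real_vector) \<Rightarrow> (nat \<Rightarrow> real) \<Rightarrow> 'a" where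
  "stereo \<kappa> k b c =
     (let q = \<kappa> * (\<Sum>i<k. (c i)\<^sup>2)
      in ((\<Sum>i<k. (2 * c i) *\<^sub>R b i) + (1 - q) *\<^sub>R b k) /\<^sub>R (1 + q))"

definition sphere_volume :: "nat \<Rightarrow> ((real^'n) \<times> real) set \<Rightarrow> ((real^'n) \<times> real) measure" where
  "sphere_volume k \<xi> =
     (let b = (SOME b. form_frame inner (Suc k) (\<lambda>_. 1) b \<and>
                 \<xi> = sphere 0 1 \<inter> span (b ` {..k}))
      in riemannian_volume inner k (stereo_domain 1 k) (stereo 1 k b) \<xi>)"

definition hyp_volume :: "nat \<Rightarrow> ((real^'n) \<times> real) set \<Rightarrow> ((real^'n) \<times> real) measure" where
  "hyp_volume k \<xi> =
     (let b = (SOME b. form_frame lform (Suc k) (lorentz_sign k) b \<and> b k \<in> hyperboloid \<and>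
                 \<xi> = hyperboloid \<inter> span (b ` {..k}))
      in riemannian_volume (\<lambda>u v. - lform u v) k (stereo_domain (- 1) k) (stereo (- 1) k b) \<xi>)"


section \<open>The three geometries\<close>

text \<open>
  \<open>submfds\<close> is the set \<open>\<Xi>\<close> of totally geodesic submanifolds (for a fixed \<open>k\<close>), \<open>vol\<close> gives the
  volume measure on each of them, and \<open>\<rho>(x,\<xi>) = profile (d(x,\<xi>))\<close>.
\<close>

record 'a geometry =
  points :: "'a set"
  gdist :: "'a \<Rightarrow> 'a \<Rightarrow> real"
  profile :: "real \<Rightarrow> real"
  submfds :: "'a set set"
  vol :: "'a set \<Rightarrow> 'a measure"

definition euclidean_geometry :: "nat \<Rightarrow> (real^'n) geometry" where
  "euclidean_geometry k =
     \<lparr> points = UNIV,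
       gdist = dist,
       profile = (\<lambda>t. t),
       submfds = {\<xi>. affine \<xi> \<and> aff_dim \<xi> = int k},
       vol = flat_volume k \<rparr>"

definition spherical_geometry :: "nat \<Rightarrow> ((real^'n) \<times> real) geometry" where
  "spherical_geometry k =
     \<lparr> points = sphere 0 1,
       gdist = (\<lambda>x y. arccos (x \<bullet> y)),
       profile = sin,
       submfds = {sphere 0 1 \<inter> W | W. subspace W \<and> dim W = k + 1},
       vol = sphere_volume k \<rparr>"

definition hyperbolic_geometry :: "nat \<Rightarrow> ((real^'n) \<times> real) geometry" where
  "hyperbolic_geometry k =
     \<lparr> points = hyperboloid,
       gdist = hyp_dist,
       profile = sinh,
       submfds = {hyperboloid \<inter> W | W. subspace W \<and> dim W = k + 1 \<and>
         (\<exists>b. form_frame lform (Suc k) (lorentz_sign k) b \<and> W = span (b ` {..k})) \<and>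
         hyperboloid \<inter> W \<noteq> {}},
       vol = hyp_volume k \<rparr>"


section \<open>The Radon transform and the shifted dual Radon transform\<close>

definition radon :: "'a geometry \<Rightarrow> ('a \<Rightarrow> complex) \<Rightarrow> 'a set \<Rightarrow> complex" where
  "radon G f \<xi> = (LINT x | vol G \<xi>. f x)"

definition set_gdist :: "'a geometry \<Rightarrow> 'a \<Rightarrow> 'a set \<Rightarrow> real" where
  "set_gdist G x \<xi> = (INF y\<in>\<xi>. gdist G x y)"

definition rho :: "'a geometry \<Rightarrow> 'a \<Rightarrow> 'a set \<Rightarrow> real" where
  "rho G x \<xi> = profile G (set_gdist G x \<xi>)"

definition stabilizer :: "'a geometry \<Rightarrow> 'a \<Rightarrow> ('a \<Rightarrow> 'a) set" where
  "stabilizer G x =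
     {g. bij_betw g (points G) (points G) \<and>
         (\<forall>y\<in>points G. \<forall>z\<in>points G. gdist G (g y) (g z) = gdist G y z) \<and> g x = x}"

definition submfds_at :: "'a geometry \<Rightarrow> 'a \<Rightarrow> real \<Rightarrow> 'a set set" where
  "submfds_at G x r = {\<xi> \<in> submfds G. rho G x \<xi> = r}"

text \<open>
  The Borel sets of a family \<open>Y\<close> of submanifolds: the sigma-algebra generated by the functions
  \<open>\<xi> \<mapsto> d(y,\<xi>)\<close> on \<open>Y\<close>.  These functions are continuous and separate points, so for the
  compact homogeneous spaces \<open>submfds_at G x r\<close> this is the usual Borel structure.
\<close>

definition submfd_borel :: "'a geometry \<Rightarrow> 'a set set \<Rightarrow> 'a set measure" where
  "submfd_borel G Y = sigma Y {{\<xi> \<in> Y. set_gdist G y \<xi> < a} | y a. y \<in> points G}"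

definition invariant_probability :: "'a geometry \<Rightarrow> 'a \<Rightarrow> real \<Rightarrow> 'a set measure \<Rightarrow> bool" where
  "invariant_probability G x r M \<longleftrightarrow>
     prob_space M \<and> space M = submfds_at G x r \<and>
     sets M = sets (submfd_borel G (submfds_at G x r)) \<and>
     (\<forall>g\<in>stabilizer G x. (`) g \<in> M \<rightarrow>\<^sub>M M \<and> distr M M ((`) g) = M)"

definition shifted_dual_radon ::
  "'a geometry \<Rightarrow> real \<Rightarrow> ('a set \<Rightarrow> complex) \<Rightarrow> 'a \<Rightarrow> complex" where
  "shifted_dual_radon G r \<phi> x = (LINT \<xi> | (THE M. invariant_probability G x r M). \<phi> \<xi>)"


section \<open>Constants and one-sided derivatives\<close>

text \<open>\<open>\<sigma>\<^sub>j\<close> is the area of the unit sphere of dimension \<open>j\<close>, which lies in dimension \<open>m = j + 1\<close>.\<close>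

definition sphere_area :: "nat \<Rightarrow> real" where
  "sphere_area j = 2 * pi powr (real (j + 1) / 2) / Gamma (real (j + 1) / 2)"

definition nth_deriv :: "nat \<Rightarrow> (real \<Rightarrow> complex) \<Rightarrow> real \<Rightarrow> complex" where
  "nth_deriv j F = ((\<lambda>H r. vector_derivative H (at r)) ^^ j) F"

text \<open>
  \<open>F\<close> is \<open>j\<close> times differentiable on some interval to the right of 0, and its derivative of
  order \<open>j\<close> has the limit \<open>L\<close> at 0 from the right.
\<close>

definition has_nth_deriv_at_right_0 :: "nat \<Rightarrow> (real \<Rightarrow> complex) \<Rightarrow> complex \<Rightarrow> bool" where
  "has_nth_deriv_at_right_0 j F L \<longleftrightarrow>
     (\<forall>\<^sub>F r in at_right 0. \<forall>i<j. nth_deriv i F differentiable (at r)) \<and>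
     (nth_deriv j F \<longlongrightarrow> L) (at_right 0)"

end

theory Submission
 imports Defs
begin

text \<open>
 The three geometries are treated with a sign \<open>\<kappa> = 0, 1, - 1\<close>.  The stabilizer of \<open>x\<close> is the
 orthogonal group, so \<open>R\<^sup>*\<^sub>r\<close> is an average over the Haar measure of this group, which exists by
 Gram--Schmidt orthonormalization of a random matrix.  In the chart \<open>v \<mapsto> (v, sqrt (1 - \<kappa> |v|\<^sup>2))\<close>
 centred at \<open>x\<close> a submanifold at distance parameter \<open>r\<close> is parametrized by its gnomonic (Klein)
 coordinates \<open>z \<in> \<real>\<^sup>k\<close>, and its point has \<open>|v|\<^sup>2 = (|z|\<^sup>2 + r\<^sup>2) / (1 + \<kappa> |z|\<^sup>2)\<close>.  Averaging
 over rotations replaces \<open>f\<close> by its spherical mean \<open>F(|v|)\<close>, and polar coordinates give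
 \<open>\<lambda>\<^sub>X(r) (R\<^sup>*\<^sub>r R f)(x) = c \<sigma>\<^sub>k\<^sub>-\<^sub>1 \<integral>\<^sub>r F(t) (t\<^sup>2 - r\<^sup>2)\<^sup>(\<^sup>k\<^sup>-\<^sup>2\<^sup>)\<^sup>/\<^sup>2 (1 - \<kappa> t\<^sup>2)\<^sup>-\<^sup>1\<^sup>/\<^sup>2 t dt\<close>.
 For even \<open>k\<close> the exponent \<open>(k - 2) / 2\<close> is an integer, and differentiating \<open>k\<close> times in \<open>r\<close>
 leaves \<open>F(0) = f(x)\<close> in the limit; \<open>F\<close> is even and smooth near 0.
\<close>

section \<open>Lebesgue measure in coordinates\<close>

text \<open>The factor \<open>\<lambda>\<^sub>X\<close> cancels the power of
  \<open>1 - \<kappa> r^2\<close> that the passage from gnomonic radius to distance leaves outside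
  the integral. The sphere area is \<open>k\<close> times the volume of the unit ball, and the 2 of
  the sphere counts a point and its antipode, which an even function does not distinguish. One
  derivative of the integral gives \<open>- 2 n r\<close> times the integral with exponent
  \<open>n\<close> lowered by one; the stray factors \<open>r\<close> are controlled by keeping,
  with the limit of a derivative, the vanishing of \<open>r^i\<close> times the higher ones, and
  they produce the factorial. Two definitions resist computation. On the curved spaces the volume
  uses a frame picked by \<open>SOME\<close> in stereographic coordinates, where a change of frame
  is not linear; integrating over the cone generated by the submanifold makes it linear. The measure
  of \<open>R\<^sup>*\<^sub>r\<close> is picked by \<open>THE\<close> as invariant under all metric
  isometries fixing \<open>x\<close>, on the sigma-algebra generated by distance functions. So these
  isometries must be shown to be orthogonal, the invariant measure to be unique, and
  \<open>Rf\<close> to be measurable.\<close>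

text \<open>
 The linear change of variables of the library is restricted to well-ordered index types, so
 an arbitrary finite index type is copied to a well-ordered one.
\<close>

typedef 'n ordered = "UNIV :: 'n set" ..

lemma card_ordered [simp]: "CARD('n ordered) = CARD('n)" by (rule type_definition.card[OF type_definition_ordered])

definition ordered_index :: "'n::finite ordered => nat" where
 "ordered_index i = (SOME f :: 'n => nat. inj f) (Rep_ordered i)"

lemma inj_ordered_index: "inj (ordered_index :: 'n::finite ordered => nat)"
proof -
 have "\<exists>f :: 'n => nat. inj f"
  using finite_imp_inj_to_nat_seg[OF finite[of "UNIV :: 'n set"]] by blast
 then have "inj (SOME f :: 'n => nat. inj f)" by (rule someI_ex)
 then show ?thesis by (intro injI) (unfold ordered_index_def, drule injD, assumption, simp add: Rep_ordered_inject)
qed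

instance ordered :: (finite) finite
proof
 have "range (Abs_ordered :: 'a => 'a ordered) = UNIV" by (metis Rep_ordered_inverse surj_def)
 then show "finite (UNIV :: 'a ordered set)" by (metis finite finite_imageI)
qed

instantiation ordered :: (finite) wellorder
begin

definition less_eq_ordered :: "'a ordered => 'a ordered => bool" where
 "less_eq_ordered i j \<longleftrightarrow> ordered_index i \<le> ordered_index j"

definition less_ordered :: "'a ordered => 'a ordered => bool" where
 "less_ordered i j \<longleftrightarrow> ordered_index i < ordered_index j"

instance
proof
 fix P :: "'a ordered => bool" and i
 assume step: "\<And>i. (\<And>j. j < i ==> P j) ==> P i"
 show "P i" by (induction i rule: measure_induct_rule[of ordered_index]) (auto intro: step simp: less_ordered_def)
qed (use inj_ordered_index in \<open>auto simp: less_eq_ordered_def less_ordered_def inj_def\<close>)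

end

text \<open>Boxes determine Lebesgue measure. The preimage of a box is the image of a translated box
  under the inverse matrix \<open>B\<close>, whose determinant also has modulus 1, so
  \<open>measure_linear_image\<close> contributes no factor.\<close>

lemma distr_lborel_affine:
 fixes A :: "(real^'n::{finite,wellorder})^'n::{finite,wellorder}"
 assumes "\<bar>det A\<bar> = 1"
 shows "distr lborel borel (\<lambda>v. t + A *v v) = lborel"
proof (rule lborel_eqI[symmetric])
 have "invertible A" using assms by (auto simp: invertible_det_nz)
 then obtain B where AB: "A ** B = mat 1" and BA: "B ** A = mat 1" by (auto simp: invertible_def)
 have "det A * det B = 1" using AB by (metis det_I det_mul)
 with assms have dB: "\<bar>det B\<bar> = 1" by (metis abs_mult abs_one mult_1)
 fix l u :: "real^'n::{finite,wellorder}"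
 assume lu: "\<And>b. b \<in> Basis ==> l \<bullet> b \<le> u \<bullet> b"
 have meas: "(\<lambda>v. t + A *v v) \<in> borel_measurable lborel"
  by (simp only: measurable_lborel2, intro borel_measurable_continuous_onI continuous_intros)
 let ?X = "(\<lambda>v. t + A *v v) -` box l u"
 have X: "?X = ((*v) B) ` ((\<lambda>w. w - t) ` box l u)"
 proof (intro equalityI subsetI)
  fix v assume v: "v \<in> ?X"
  then have "v = B *v ((t + A *v v) - t)" by (simp add: matrix_vector_mul_assoc BA)
  with v show "v \<in> ((*v) B) ` ((\<lambda>w. w - t) ` box l u)" by blast
 next
  fix v assume "v \<in> ((*v) B) ` ((\<lambda>w. w - t) ` box l u)"
  then obtain w where "w \<in> box l u" "v = B *v (w - t)" by auto
  then show "v \<in> ?X" by (simp add: matrix_vector_mul_assoc AB)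
 qed
 have lm: "(\<lambda>w. w - t) ` box l u \<in> lmeasurable" by (simp add: measurable_translation_subtract)
 have Xm: "?X \<in> lmeasurable" unfolding X by (rule measurable_linear_image[OF matrix_vector_mul_linear lm])
 have Xb: "?X \<in> sets borel" using measurable_sets[OF meas, of "box l u"] by simp
 have "emeasure (distr lborel borel (\<lambda>v. t + A *v v)) (box l u) = emeasure lborel ?X"
  using meas by (subst emeasure_distr) auto
 also have "\<dots> = emeasure lebesgue ?X" using Xb by simp
 also have "\<dots> = ennreal (measure lebesgue ?X)" using Xm by (simp add: emeasure_eq_measure2)
 also have "measure lebesgue ?X = measure lebesgue (box l u)"
  unfolding X using measure_linear_image[OF matrix_vector_mul_linear lm, of B] dB
  by (simp add: measure_translation_subtract)
 also have "\<dots> = (\<Prod>b\<in>Basis. (u - l) \<bullet> b)" using lu by (simp add: measure_lborel_box)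
 finally show "emeasure (distr lborel borel (\<lambda>v. t + A *v v)) (box l u) = (\<Prod>b\<in>Basis. (u - l) \<bullet> b)" .
qed simp

lemma borel_measurable_vec_lambdaI:
 fixes p :: "'n::finite => 'i"
 assumes "\<And>j. p j \<in> I"
 shows "(\<lambda>c. \<chi> j. c (p j)) \<in> borel_measurable (\<Pi>\<^sub>M i\<in>I. (lborel :: real measure))"
proof (rule borel_measurable_euclidean_space[THEN iffD2], rule ballI)
 fix b :: "real^'n" assume "b \<in> Basis"
 then obtain j where b: "b = axis j 1" by (auto simp: Basis_vec_def)
 have "(\<lambda>c. c (p j)) \<in> (\<Pi>\<^sub>M i\<in>I. lborel) \<rightarrow>\<^sub>M (lborel :: real measure)"
  using assms by (rule measurable_component_singleton)
 then show "(\<lambda>c. (\<chi> j. c (p j)) \<bullet> b) \<in> borel_measurable (\<Pi>\<^sub>M i\<in>I. (lborel :: real measure))"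
  by (simp add: b inner_axis)
qed

lemma distr_PiM_lborel_vec:
 fixes e :: "'i => 'n::finite"
 assumes e: "bij_betw e I UNIV"
 shows "distr (\<Pi>\<^sub>M i\<in>I. lborel) borel (\<lambda>c. \<chi> j. c (inv_into I e j)) = (lborel :: (real^'n) measure)"
proof (rule lborel_eqI[symmetric])
 interpret product_sigma_finite "\<lambda>_. lborel :: real measure" ..
 have fin: "finite I" using bij_betw_finite[OF e] by simp
 have inI: "inv_into I e j \<in> I" for j using e by (metis UNIV_I bij_betw_def inv_into_into)
 have einv: "e (inv_into I e j) = j" for j using e by (metis UNIV_I bij_betw_inv_into_right)
 have inve: "i \<in> I ==> inv_into I e (e i) = i" for i using e by (metis bij_betw_inv_into_left)
 have meas: "(\<lambda>c. (\<chi> j. c (inv_into I e j)) :: real^'n) \<in> borel_measurable (\<Pi>\<^sub>M i\<in>I. lborel)"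
  by (rule borel_measurable_vec_lambdaI[where p="inv_into I e", OF inI])
 fix l u :: "real^'n"
 assume lu: "\<And>b. b \<in> Basis ==> l \<bullet> b \<le> u \<bullet> b"
 have lu': "l $ j \<le> u $ j" for j using lu[of "axis j 1"] by (simp add: inner_axis)
 have pre: "(\<lambda>c. \<chi> j. c (inv_into I e j)) -` box l u \<inter> space (\<Pi>\<^sub>M i\<in>I. lborel)
   = (\<Pi>\<^sub>E i\<in>I. {l $ e i <..< u $ e i})"
 proof -
  have "(\<forall>j. l $ j < c (inv_into I e j) \<and> c (inv_into I e j) < u $ j)
    \<longleftrightarrow> (\<forall>i\<in>I. l $ e i < c i \<and> c i < u $ e i)" for c by (metis einv inve inI)
  then show ?thesis by (simp add: set_eq_iff mem_box_cart space_PiM PiE_iff conj_commute)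
 qed
 have "emeasure (distr (\<Pi>\<^sub>M i\<in>I. lborel) borel (\<lambda>c. \<chi> j. c (inv_into I e j))) (box l u)
   = emeasure (\<Pi>\<^sub>M i\<in>I. lborel) (\<Pi>\<^sub>E i\<in>I. {l $ e i <..< u $ e i})"
  using meas by (subst emeasure_distr) (auto simp: pre)
 also have "\<dots> = (\<Prod>i\<in>I. emeasure lborel {l $ e i <..< u $ e i})" using fin by (subst emeasure_PiM) auto
 also have "\<dots> = (\<Prod>i\<in>I. ennreal (u $ e i - l $ e i))" using lu' by (intro prod.cong) auto
 also have "\<dots> = (\<Prod>j\<in>UNIV. ennreal (u $ j - l $ j))" using e by (intro prod.reindex_bij_betw)
 also have "\<dots> = ennreal (\<Prod>j\<in>UNIV. u $ j - l $ j)" using lu' by (intro prod_ennreal) auto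
 also have "(\<Prod>j\<in>UNIV. u $ j - l $ j) = (\<Prod>b\<in>Basis. (u - l) \<bullet> b)"
 proof (rule prod.reindex_bij_witness[where j="\<lambda>j. axis j 1" and i="\<lambda>b. THE j. b = axis j 1"])
  fix b :: "real^'n" assume "b \<in> Basis"
  then obtain j where "b = axis j 1" by (auto simp: Basis_vec_def)
  then show "axis (THE j. b = axis j 1) 1 = b" by (auto simp: axis_eq_axis)
 qed (auto simp: axis_eq_axis Basis_vec_def inner_axis)
 finally show "emeasure (distr (\<Pi>\<^sub>M i\<in>I. lborel) borel (\<lambda>c. \<chi> j. c (inv_into I e j))) (box l u)
   = (\<Prod>b\<in>Basis. (u - l) \<bullet> b)" .
qed simp

text \<open>The hypothesis on \<open>a\<close> says that \<open>a\<close> preserves the diagonal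
  form with signs \<open>s\<close>, hence has determinant 1 or -1; orthogonal and Lorentz matrices
  are covered at once. The result on vectors is reached by placing R^m in R^N, with \<open>a\<close>
  extended by the identity and the remaining coordinates confined to the unit cube, which has
  measure 1.\<close>

lemma nn_integral_PiM_affine_wellorder:
 fixes a :: "nat => nat => real" and s t :: "nat => real"
 assumes m: "m \<le> CARD('n::{finite,wellorder})"
  and s: "\<And>i. i < m ==> s i = 1 \<or> s i = - 1"
  and a: "\<And>i j. i < m ==> j < m ==> (\<Sum>l<m. s l * a l i * a l j) = (if i = j then s i else 0)"
  and f[measurable]: "f \<in> borel_measurable (\<Pi>\<^sub>M i\<in>{..<m}. lborel)"
 shows "(\<integral>\<^sup>+y. f (\<lambda>i\<in>{..<m}. t i + (\<Sum>j<m. a i j * y j)) \<partial>(\<Pi>\<^sub>M i\<in>{..<m}. lborel))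
    = (\<integral>\<^sup>+y. f y \<partial>(\<Pi>\<^sub>M i\<in>{..<m}. lborel))"
proof -
 interpret product_sigma_finite "\<lambda>_. lborel :: real measure" ..
 define N where "N = CARD('n::{finite,wellorder})"
 obtain e :: "nat => 'n::{finite,wellorder}" where e: "bij_betw e {..<N} UNIV"
  using ex_bij_betw_nat_finite[of "UNIV :: 'n::{finite,wellorder} set"] by (auto simp: N_def atLeast0LessThan)
 define g where "g = inv_into {..<N} e"
 have g: "g j < N" "e (g j) = j" for j using e unfolding g_def
  by (metis UNIV_I bij_betw_def inv_into_into lessThan_iff, metis UNIV_I bij_betw_inv_into_right e)
 have ge: "i < N ==> g (e i) = i" for i
  using e unfolding g_def by (metis bij_betw_inv_into_left lessThan_iff)
 have mN: "m \<le> N" using m by (simp add: N_def)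
 define R :: "real^'n::{finite,wellorder} => nat => real" where "R v = (\<lambda>i\<in>{..<m}. v $ e i)" for v
 define Q :: "(real^'n::{finite,wellorder}) set" where "Q = {v. \<forall>j. m \<le> g j \<longrightarrow> 0 \<le> v $ j \<and> v $ j \<le> 1}"
 have Rm[measurable]: "R \<in> lborel \<rightarrow>\<^sub>M (\<Pi>\<^sub>M i\<in>{..<m}. lborel)"
  unfolding R_def by (intro measurable_restrict) simp
 have "closed Q" unfolding Q_def by (intro closed_Collect_all closed_Collect_imp closed_Collect_conj closed_Collect_le
    continuous_intros) auto
 then have Qm[measurable]: "Q \<in> sets borel" by auto
 have X: "(\<integral>\<^sup>+y. h y \<partial>(\<Pi>\<^sub>M i\<in>{..<m}. lborel)) = (\<integral>\<^sup>+v. h (R v) * indicator Q v \<partial>lborel)"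
  if h[measurable]: "h \<in> borel_measurable (\<Pi>\<^sub>M i\<in>{..<m}. lborel)" for h
 proof -
  let ?V = "\<lambda>c. (\<chi> j. c (inv_into {..<N} e j)) :: real^'n::{finite,wellorder}"
  have mV: "?V \<in> borel_measurable (\<Pi>\<^sub>M i\<in>{..<N}. lborel)"
   by (rule borel_measurable_vec_lambdaI[where p="inv_into {..<N} e"]) (use g(1) in \<open>simp add: g_def\<close>)
  have un: "{..<N} = {..<m} \<union> {m..<N}" using mN by auto
  have hm: "(\<lambda>c. h (restrict c {..<m}) * indicator (\<Pi>\<^sub>E i\<in>{m..<N}. {0..1::real}) (restrict c {m..<N}))
    \<in> borel_measurable (\<Pi>\<^sub>M i\<in>{..<m} \<union> {m..<N}. lborel)"
  proof (intro borel_measurable_times_ennreal)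
   show "(\<lambda>c. h (restrict c {..<m})) \<in> borel_measurable (\<Pi>\<^sub>M i\<in>{..<m} \<union> {m..<N}. lborel)"
    using measurable_compose[OF measurable_restrict_subset h] by auto
   have "indicator (\<Pi>\<^sub>E i\<in>{m..<N}. {0..1::real}) \<in> borel_measurable (\<Pi>\<^sub>M i\<in>{m..<N}. lborel)"
    by (intro borel_measurable_indicator sets_PiM_I_finite) auto
   then show "(\<lambda>c. indicator (\<Pi>\<^sub>E i\<in>{m..<N}. {0..1::real}) (restrict c {m..<N})) \<in> borel_measurable (\<Pi>\<^sub>M i\<in>{..<m} \<union> {m..<N}. lborel)"
    using measurable_compose[OF measurable_restrict_subset] by auto
  qed
  have "(\<integral>\<^sup>+v. h (R v) * indicator Q v \<partial>lborel)
    = (\<integral>\<^sup>+v. h (R v) * indicator Q v \<partial>distr (\<Pi>\<^sub>M i\<in>{..<N}. lborel) borel ?V)"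
   by (simp add: distr_PiM_lborel_vec[OF e])
  also have "\<dots> = (\<integral>\<^sup>+c. h (R (?V c)) * indicator Q (?V c) \<partial>(\<Pi>\<^sub>M i\<in>{..<N}. lborel))"
   by (subst nn_integral_distr[OF mV]) auto
  also have "\<dots> = (\<integral>\<^sup>+c. h (restrict c {..<m}) * indicator (\<Pi>\<^sub>E i\<in>{m..<N}. {0..1::real}) (restrict c {m..<N})
    \<partial>(\<Pi>\<^sub>M i\<in>{..<N}. lborel))"
  proof (rule nn_integral_cong)
   fix c :: "nat => real"
   have 1: "R (?V c) = restrict c {..<m}" unfolding R_def using mN by (auto simp: g_def[symmetric] ge)
   have 2: "?V c \<in> Q \<longleftrightarrow> restrict c {m..<N} \<in> (\<Pi>\<^sub>E i\<in>{m..<N}. {0..1::real})"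
   proof -
    have "(\<forall>j. m \<le> g j \<longrightarrow> 0 \<le> c (g j) \<and> c (g j) \<le> 1) \<longleftrightarrow> (\<forall>i\<in>{m..<N}. 0 \<le> c i \<and> c i \<le> 1)"
     using g(1) ge by (metis atLeastLessThan_iff)
    then show ?thesis unfolding Q_def by (simp add: g_def[symmetric] PiE_iff)
   qed
   show "h (R (?V c)) * indicator Q (?V c) = h (restrict c {..<m}) * indicator (\<Pi>\<^sub>E i\<in>{m..<N}. {0..1::real}) (restrict c {m..<N})"
    unfolding 1 using 2 by (auto split: split_indicator)
  qed
  also have "\<dots> = (\<integral>\<^sup>+x. (\<integral>\<^sup>+y. h (restrict (merge {..<m} {m..<N} (x, y)) {..<m}) *
     indicator (\<Pi>\<^sub>E i\<in>{m..<N}. {0..1::real}) (restrict (merge {..<m} {m..<N} (x, y)) {m..<N})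
    \<partial>(\<Pi>\<^sub>M i\<in>{m..<N}. lborel)) \<partial>(\<Pi>\<^sub>M i\<in>{..<m}. lborel))"
   unfolding un by (rule product_nn_integral_fold) (use hm in auto)
  also have "\<dots> = (\<integral>\<^sup>+x. (\<integral>\<^sup>+y. h x * indicator (\<Pi>\<^sub>E i\<in>{m..<N}. {0..1::real}) y
    \<partial>(\<Pi>\<^sub>M i\<in>{m..<N}. lborel)) \<partial>(\<Pi>\<^sub>M i\<in>{..<m}. lborel))"
  proof (intro nn_integral_cong)
   fix x y :: "nat => real" assume xy: "x \<in> space (\<Pi>\<^sub>M i\<in>{..<m}. lborel)" "y \<in> space (\<Pi>\<^sub>M i\<in>{m..<N}. lborel)"
   have 1: "restrict (merge {..<m} {m..<N} (x, y)) {..<m} = x"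
    using xy by (auto simp: fun_eq_iff merge_def space_PiM PiE_def extensional_def)
   have 2: "restrict (merge {..<m} {m..<N} (x, y)) {m..<N} = y"
    using xy by (auto simp: fun_eq_iff merge_def space_PiM PiE_def extensional_def)
   show "h (restrict (merge {..<m} {m..<N} (x, y)) {..<m}) *
     indicator (\<Pi>\<^sub>E i\<in>{m..<N}. {0..1::real}) (restrict (merge {..<m} {m..<N} (x, y)) {m..<N})
    = h x * indicator (\<Pi>\<^sub>E i\<in>{m..<N}. {0..1::real}) y" unfolding 1 2 ..
  qed
  also have "\<dots> = (\<integral>\<^sup>+x. h x \<partial>(\<Pi>\<^sub>M i\<in>{..<m}. lborel))"
   by (subst nn_integral_cmult_indicator) (auto simp: emeasure_PiM)
  finally show ?thesis ..
 qed
 define A :: "(real^'n::{finite,wellorder})^'n::{finite,wellorder}" where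
  "A = (\<chi> j l. if g j < m \<and> g l < m then a (g j) (g l) else if j = l then 1 else 0)"
 define J :: "'n::{finite,wellorder} => real" where "J j = (if g j < m then s (g j) else 1)" for j
 define JM :: "(real^'n::{finite,wellorder})^'n::{finite,wellorder}" where
  "JM = (\<chi> i j. if i = j then J i else 0)"
 define T :: "real^'n::{finite,wellorder}" where "T = (\<chi> j. if g j < m then t (g j) else 0)"
 have sum_split: "(\<Sum>p\<in>UNIV. if g p < m then h (g p) else 0) = (\<Sum>i<m. h i)" for h :: "nat => real"
 proof -
  have "(\<Sum>p\<in>UNIV. if g p < m then h (g p) else 0) = (\<Sum>p | g p < m. h (g p))" by (simp add: sum.If_cases)
  also have "\<dots> = (\<Sum>i<m. h i)" by (rule sum.reindex_bij_witness[where i=e and j=g]) (use g ge mN in auto)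
  finally show ?thesis .
 qed
 have AJA: "transpose A ** JM ** A = JM"
 proof -
  have "(\<Sum>p\<in>UNIV. A $ p $ j * J p * A $ p $ l) = (if j = l then J j else 0)" for j l
  proof (cases "g j < m \<and> g l < m")
   case True
   have "(\<Sum>p\<in>UNIV. A $ p $ j * J p * A $ p $ l)
     = (\<Sum>p\<in>UNIV. if g p < m then s (g p) * a (g p) (g j) * a (g p) (g l) else 0)"
    using True by (intro sum.cong) (auto simp: A_def J_def)
   also have "\<dots> = (\<Sum>i<m. s i * a i (g j) * a i (g l))" by (rule sum_split)
   also have "\<dots> = (if g j = g l then s (g j) else 0)" using True a by blast
   also have "(g j = g l) = (j = l)" using g(2) by metis
   finally show ?thesis using True by (simp add: J_def)
  next
   case False
   have col: "A $ p $ q = (if p = q then 1 else 0)" if "\<not> g q < m" for p q using that by (simp add: A_def)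
   have row: "A $ q $ p = (if p = q then 1 else 0)" if "\<not> g q < m" for p q using that by (auto simp: A_def)
   consider "\<not> g j < m" | "\<not> g l < m" using False by blast
   then show ?thesis
   proof cases
    case 1
    then show ?thesis by (auto simp: col[OF 1] row[OF 1] if_distrib[of "\<lambda>x. x * _"] J_def cong: if_cong)
   next
    case 2
    then show ?thesis by (auto simp: col[OF 2] row[OF 2] if_distrib[of "\<lambda>x. _ * x"] J_def cong: if_cong)
   qed
  qed
  then show ?thesis by (simp add: JM_def vec_eq_iff matrix_matrix_mult_def transpose_def
     if_distrib[of "\<lambda>x. _ * x"] cong: if_cong)
 qed
 have "det JM \<noteq> 0"
 proof -
  have "J i \<noteq> 0" for i using s[of "g i"] by (auto simp: J_def)
  then show ?thesis by (subst det_diagonal) (auto simp: JM_def)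
 qed
 then have "(det A)^2 = 1" using arg_cong[OF AJA, of det] by (simp add: det_mul power2_eq_square)
 then have dA: "\<bar>det A\<bar> = 1" by (simp add: power2_eq_1_iff abs_if) linarith
 have RA: "R (T + A *v v) = (\<lambda>i\<in>{..<m}. t i + (\<Sum>j<m. a i j * R v j))" for v
 proof -
  have "(A *v v) $ e i = (\<Sum>j<m. a i j * v $ e j)" if "i < m" for i
  proof -
   have "(A *v v) $ e i = (\<Sum>p\<in>UNIV. if g p < m then a i (g p) * v $ e (g p) else 0)"
    unfolding matrix_vector_mult_def using that mN g by (auto simp: A_def ge intro!: sum.cong)
   also have "\<dots> = (\<Sum>j<m. a i j * v $ e j)" by (rule sum_split)
   finally show ?thesis .
  qed
  then show ?thesis unfolding R_def using mN by (auto simp: T_def ge)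
 qed
 have QA: "T + A *v v \<in> Q \<longleftrightarrow> v \<in> Q" for v
 proof -
  have "(T + A *v v) $ j = v $ j" if "m \<le> g j" for j
   using that by (simp add: T_def A_def matrix_vector_mult_def if_distrib[of "\<lambda>x. x * _"] cong: if_cong)
  then show ?thesis by (auto simp: Q_def)
 qed
 have am[measurable]: "(\<lambda>y. \<lambda>i\<in>{..<m}. t i + (\<Sum>j<m. a i j * y j)) \<in> (\<Pi>\<^sub>M i\<in>{..<m}. lborel) \<rightarrow>\<^sub>M (\<Pi>\<^sub>M i\<in>{..<m}. lborel)"
  by (intro measurable_restrict) (auto intro!: borel_measurable_add borel_measurable_sum borel_measurable_times, measurable)
 have Am: "(\<lambda>v. T + A *v v) \<in> borel_measurable lborel"
  by (simp only: measurable_lborel2, intro borel_measurable_continuous_onI continuous_intros)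
 have "(\<integral>\<^sup>+y. f (\<lambda>i\<in>{..<m}. t i + (\<Sum>j<m. a i j * y j)) \<partial>(\<Pi>\<^sub>M i\<in>{..<m}. lborel))
   = (\<integral>\<^sup>+v. f (\<lambda>i\<in>{..<m}. t i + (\<Sum>j<m. a i j * R v j)) * indicator Q v \<partial>lborel)"
  by (rule X) (rule measurable_compose[OF am f])
 also have "\<dots> = (\<integral>\<^sup>+v. f (R (T + A *v v)) * indicator Q (T + A *v v) \<partial>lborel)"
  by (intro nn_integral_cong) (auto simp: RA QA split: split_indicator)
 also have "\<dots> = (\<integral>\<^sup>+v. f (R v) * indicator Q v \<partial>distr lborel borel (\<lambda>v. T + A *v v))"
  using Am by (subst nn_integral_distr) auto
 also have "\<dots> = (\<integral>\<^sup>+y. f y \<partial>(\<Pi>\<^sub>M i\<in>{..<m}. lborel))"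
  by (simp add: distr_lborel_affine[OF dA] X[OF f])
 finally show ?thesis .
qed

lemma nn_integral_PiM_affine:
 fixes a :: "nat => nat => real" and s t :: "nat => real"
 assumes "m \<le> CARD('n::finite)"
  and "\<And>i. i < m ==> s i = 1 \<or> s i = - 1"
  and "\<And>i j. i < m ==> j < m ==> (\<Sum>l<m. s l * a l i * a l j) = (if i = j then s i else 0)"
  and "f \<in> borel_measurable (\<Pi>\<^sub>M i\<in>{..<m}. lborel)"
 shows "(\<integral>\<^sup>+y. f (\<lambda>i\<in>{..<m}. t i + (\<Sum>j<m. a i j * y j)) \<partial>(\<Pi>\<^sub>M i\<in>{..<m}. lborel))
    = (\<integral>\<^sup>+y. f y \<partial>(\<Pi>\<^sub>M i\<in>{..<m}. lborel))"
 by (rule nn_integral_PiM_affine_wellorder[where 'n="'n ordered" and s=s]) (use assms in simp_all)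

lemma distr_lborel_orthogonal:
 fixes A :: "(real^'n::finite)^'n::finite"
 assumes A: "orthogonal_matrix A"
 shows "distr lborel borel ((*v) A) = lborel"
proof -
 define N where "N = CARD('n)"
 obtain e :: "nat => 'n" where e: "bij_betw e {..<N} UNIV"
  using ex_bij_betw_nat_finite[of "UNIV :: 'n set"] by (auto simp: N_def atLeast0LessThan)
 define g where "g = inv_into {..<N} e"
 have g: "g j < N" "e (g j) = j" for j using e unfolding g_def
  by (metis UNIV_I bij_betw_def inv_into_into lessThan_iff, metis UNIV_I bij_betw_inv_into_right e)
 have ge: "i < N ==> g (e i) = i" for i
  using e unfolding g_def by (metis bij_betw_inv_into_left lessThan_iff)
 let ?V = "\<lambda>c. (\<chi> j. c (g j)) :: real^'n"
 let ?P = "\<Pi>\<^sub>M i\<in>{..<N}. (lborel :: real measure)"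
 let ?a = "\<lambda>i j. A $ e i $ e j"
 have V: "distr ?P borel ?V = lborel" using distr_PiM_lborel_vec[OF e] by (simp add: g_def)
 have mV[measurable]: "?V \<in> borel_measurable ?P"
  by (rule borel_measurable_vec_lambdaI[where p=g]) (use g(1) in simp)
 have mA[measurable]: "(*v) A \<in> borel_measurable borel"
  by (intro borel_measurable_continuous_onI continuous_intros)
 have AV: "A *v ?V c = ?V (\<lambda>i\<in>{..<N}. 0 + (\<Sum>j<N. ?a i j * c j))" for c
 proof -
  have "(\<Sum>j\<in>UNIV. A $ i $ j * c (g j)) = (\<Sum>j<N. A $ i $ e j * c j)" for i
   by (rule sum.reindex_bij_witness[where i=e and j=g]) (use g ge in auto)
  then show ?thesis using g by (simp add: vec_eq_iff matrix_vector_mult_def)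
 qed
 have orth: "(\<Sum>l<N. 1 * ?a l i * ?a l j) = (if i = j then 1 else 0)" if "i < N" "j < N" for i j
 proof -
  have "(\<Sum>l<N. 1 * ?a l i * ?a l j) = (\<Sum>l\<in>UNIV. A $ l $ e i * A $ l $ e j)"
   by (rule sum.reindex_bij_witness[where i=g and j=e]) (use g ge in auto)
  also have "\<dots> = (transpose A ** A) $ e i $ e j" by (simp add: matrix_matrix_mult_def transpose_def)
  also have "\<dots> = (if i = j then 1 else 0)"
   using A that ge unfolding orthogonal_matrix_def by (auto simp: mat_def) (metis ge)+
  finally show ?thesis .
 qed
 show ?thesis
 proof (rule measure_eqI)
  fix X assume "X \<in> sets (distr lborel borel ((*v) A))"
  then have X[measurable]: "X \<in> sets borel" by simp
  have "emeasure (distr lborel borel ((*v) A)) X = (\<integral>\<^sup>+v. indicator X (A *v v) \<partial>lborel)"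
   by (subst nn_integral_indicator[symmetric]) (simp, subst nn_integral_distr, auto)
  also have "\<dots> = (\<integral>\<^sup>+v. indicator X (A *v v) \<partial>distr ?P borel ?V)" by (simp add: V)
  also have "\<dots> = (\<integral>\<^sup>+c. indicator X (?V (\<lambda>i\<in>{..<N}. 0 + (\<Sum>j<N. ?a i j * c j))) \<partial>?P)"
   by (subst nn_integral_distr) (auto simp: AV)
  also have "\<dots> = (\<integral>\<^sup>+c. indicator X (?V c) \<partial>?P)"
   by (rule nn_integral_PiM_affine[where 'n='n and s="\<lambda>_. 1"]) (use orth measurable_compose[OF mV borel_measurable_indicator[OF X]] in \<open>auto simp: N_def\<close>)
  also have "\<dots> = (\<integral>\<^sup>+v. indicator X v \<partial>distr ?P borel ?V)"
   by (subst nn_integral_distr) auto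
  also have "\<dots> = emeasure lborel X" by (simp add: V)
  finally show "emeasure (distr lborel borel ((*v) A)) X = emeasure lborel X" .
 qed simp
qed

section \<open>Scaling and polar coordinates on the product space\<close>

lemma nn_integral_PiM_scale:
 fixes a :: real
 assumes I: "finite I" and a: "a \<noteq> 0"
  and f[measurable]: "f \<in> borel_measurable (\<Pi>\<^sub>M i\<in>I. lborel)"
 shows "(\<integral>\<^sup>+y. f y \<partial>(\<Pi>\<^sub>M i\<in>I. lborel))
    = ennreal (\<bar>a\<bar> ^ card I) * (\<integral>\<^sup>+y. f (\<lambda>i\<in>I. a * y i) \<partial>(\<Pi>\<^sub>M i\<in>I. lborel))"
proof -
 interpret product_sigma_finite "\<lambda>_. lborel :: real measure" ..
 have m[measurable]: "(\<lambda>y. \<lambda>i\<in>I. a * y i) \<in> (\<Pi>\<^sub>M i\<in>I. lborel) \<rightarrow>\<^sub>M (\<Pi>\<^sub>M i\<in>I. lborel)"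
  by (intro measurable_restrict) (auto intro!: borel_measurable_times, measurable)
 let ?P = "scale_measure (ennreal (\<bar>a\<bar> ^ card I)) (distr (\<Pi>\<^sub>M i\<in>I. lborel) (\<Pi>\<^sub>M i\<in>I. lborel) (\<lambda>y. \<lambda>i\<in>I. a * y i))"
 have "?P = (\<Pi>\<^sub>M i\<in>I. lborel)"
 proof (rule PiM_eqI[OF I])
  fix A :: "'a => real set" assume A: "\<And>i. i \<in> I ==> A i \<in> sets lborel"
  have pre: "(\<lambda>y. \<lambda>i\<in>I. a * y i) -` Pi\<^sub>E I A \<inter> space (\<Pi>\<^sub>M i\<in>I. lborel) = (\<Pi>\<^sub>E i\<in>I. (*) a -` A i)"
   by (auto simp: space_PiM PiE_iff)
  have Aa: "(*) a -` A i \<in> sets lborel" if "i \<in> I" for i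
   using measurable_sets[of "(*) a" borel borel "A i"] A[OF that] by auto
  have "emeasure ?P (Pi\<^sub>E I A) = ennreal (\<bar>a\<bar> ^ card I) * emeasure (\<Pi>\<^sub>M i\<in>I. lborel) (\<Pi>\<^sub>E i\<in>I. (*) a -` A i)"
   using A I by (simp add: emeasure_distr pre sets_PiM_I_finite)
  also have "\<dots> = ennreal (\<bar>a\<bar> ^ card I) * (\<Prod>i\<in>I. emeasure lborel ((*) a -` A i))"
   using Aa I by (subst emeasure_PiM) auto
  also have "\<dots> = (\<Prod>i\<in>I. ennreal \<bar>a\<bar> * emeasure lborel ((*) a -` A i))"
   by (simp add: prod.distrib ennreal_power)
  also have "\<dots> = (\<Prod>i\<in>I. emeasure lborel (A i))"
  proof (rule prod.cong[OF refl])
   fix i assume "i \<in> I"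
   then have [measurable]: "A i \<in> sets borel" using A by auto
   have "emeasure lborel (A i) = (\<integral>\<^sup>+x. indicator (A i) x \<partial>lborel)" by simp
   also have "\<dots> = ennreal \<bar>a\<bar> * (\<integral>\<^sup>+x. indicator (A i) (0 + a * x) \<partial>lborel)"
    by (rule nn_integral_real_affine[OF _ a]) measurable
   also have "(\<integral>\<^sup>+x. indicator (A i) (0 + a * x) \<partial>lborel) = (\<integral>\<^sup>+x. indicator ((*) a -` A i) x \<partial>lborel)"
    by (intro nn_integral_cong) (auto split: split_indicator)
   finally show "ennreal \<bar>a\<bar> * emeasure lborel ((*) a -` A i) = emeasure lborel (A i)"
    using Aa[OF \<open>i \<in> I\<close>] by simp
  qed
  finally show "emeasure ?P (Pi\<^sub>E I A) = (\<Prod>i\<in>I. emeasure lborel (A i))" .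
 qed simp
 then have "(\<integral>\<^sup>+y. f y \<partial>(\<Pi>\<^sub>M i\<in>I. lborel)) = (\<integral>\<^sup>+y. f y \<partial>?P)"
  by simp
 also have "\<dots> = ennreal (\<bar>a\<bar> ^ card I) * (\<integral>\<^sup>+y. f y \<partial>distr (\<Pi>\<^sub>M i\<in>I. lborel) (\<Pi>\<^sub>M i\<in>I. lborel) (\<lambda>y. \<lambda>i\<in>I. a * y i))"
  by (rule nn_integral_scale_measure) simp
 also have "\<dots> = ennreal (\<bar>a\<bar> ^ card I) * (\<integral>\<^sup>+y. f (\<lambda>i\<in>I. a * y i) \<partial>(\<Pi>\<^sub>M i\<in>I. lborel))"
  by (subst nn_integral_distr) auto
 finally show ?thesis .
qed

definition cnorm :: "nat => (nat => real) => real" where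
 "cnorm k c = sqrt (\<Sum>i<k. (c i)\<^sup>2)"

abbreviation lborel_PiM :: "nat => (nat => real) measure" where
 "lborel_PiM k \<equiv> \<Pi>\<^sub>M i\<in>{..<k}. lborel"

lemma cnorm_nonneg [simp]: "0 \<le> cnorm k c" by (simp add: cnorm_def sum_nonneg)

lemma cnorm_power2: "(cnorm k c)^2 = (\<Sum>i<k. (c i)\<^sup>2)" by (simp add: cnorm_def sum_nonneg)

lemma cnorm_scale: "cnorm k (\<lambda>i\<in>{..<k}. a * c i) = \<bar>a\<bar> * cnorm k c"
proof -
 have "(\<Sum>i<k. ((\<lambda>i\<in>{..<k}. a * c i) i)\<^sup>2) = a^2 * (\<Sum>i<k. (c i)\<^sup>2)"
  by (simp add: sum_distrib_left power_mult_distrib)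
 then show ?thesis by (simp add: cnorm_def real_sqrt_mult)
qed

lemma measurable_PiM_lborel_component:
 "i < k ==> (\<lambda>c. c i) \<in> borel_measurable (lborel_PiM k)"
 using measurable_component_singleton[of i "{..<k}" "\<lambda>_. lborel :: real measure"] by simp

lemma measurable_cnorm [measurable]: "cnorm k \<in> borel_measurable (lborel_PiM k)"
proof -
 have [measurable]: "(\<lambda>c. c i) \<in> borel_measurable (lborel_PiM k)" if "i \<in> {..<k}" for i
  using that measurable_PiM_lborel_component by simp
 show ?thesis unfolding cnorm_def by measurable
qed

lemma measurable_PiM_lborel_scale [measurable (raw)]:
 assumes "g \<in> borel_measurable M" "h \<in> M \<rightarrow>\<^sub>M lborel_PiM k"
 shows "(\<lambda>x. \<lambda>i\<in>{..<k}. g x * h x i) \<in> M \<rightarrow>\<^sub>M lborel_PiM k"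
proof (rule measurable_restrict)
 fix i assume "i \<in> {..<k}"
 then have "(\<lambda>x. h x i) \<in> borel_measurable M"
  using measurable_compose[OF assms(2) measurable_PiM_lborel_component[of i k]] by simp
 with assms(1) show "(\<lambda>x. g x * h x i) \<in> M \<rightarrow>\<^sub>M lborel" by simp
qed

lemma sigma_finite_lborel_PiM: "sigma_finite_measure (lborel_PiM k)"
proof -
 interpret product_sigma_finite "\<lambda>_. lborel :: real measure" ..
 show ?thesis by (rule sigma_finite) simp
qed

lemma AE_cnorm_pos:
 assumes "k \<ge> 1"
 shows "AE c in lborel_PiM k. cnorm k c > 0"
proof (rule AE_I)
 interpret product_sigma_finite "\<lambda>_. lborel :: real measure" ..
 show "{c \<in> space (lborel_PiM k). \<not> cnorm k c > 0} \<subseteq> (\<Pi>\<^sub>E i\<in>{..<k}. {0})"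
 proof
  fix c assume c: "c \<in> {c \<in> space (lborel_PiM k). \<not> cnorm k c > 0}"
  then have "cnorm k c = 0" using cnorm_nonneg[of k c] by auto
  then have "\<forall>i<k. (c i)\<^sup>2 = 0" by (simp add: cnorm_def sum_nonneg_eq_0_iff)
  with c show "c \<in> (\<Pi>\<^sub>E i\<in>{..<k}. {0})" by (auto simp: space_PiM PiE_def extensional_def)
 qed
 show "emeasure (lborel_PiM k) (\<Pi>\<^sub>E i\<in>{..<k}. {0}) = 0" using assms by (subst emeasure_PiM) auto
 show "(\<Pi>\<^sub>E i\<in>{..<k}. {0}) \<in> sets (lborel_PiM k)" by (intro sets_PiM_I_finite) auto
qed

text \<open>Normalizes the averaging in \<open>nn_integral_polar\<close>: with
  \<open>N = cnorm k c\<close> the integral cancels the factor \<open>cnorm k c ^ k\<close>.\<close>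

lemma nn_integral_inverse_power:
 fixes N :: real
 assumes "k \<ge> 1" "N > 0"
 shows "(\<integral>\<^sup>+s. ennreal (k / s ^ Suc k) * indicator {N..} s \<partial>lborel) = ennreal (1 / N ^ k)"
proof -
 have "(\<integral>\<^sup>+s. ennreal (k / s ^ Suc k) * indicator {N..} s \<partial>lborel) = 0 - (- (1 / N ^ k))"
 proof (rule nn_integral_FTC_atLeast)
  fix s :: real assume s: "N \<le> s"
  have "((\<lambda>s. - (1 / s ^ k)) has_real_derivative (k * s ^ (k - 1)) / (s ^ k)^2) (at s)"
   using s assms by (auto intro!: derivative_eq_intros simp: power2_eq_square)
  also have "(k * s ^ (k - 1)) / (s ^ k)^2 = k / s ^ Suc k"
  proof -
   have "s ^ (k - 1) * s ^ Suc k = (s ^ k)^2" using assms by (cases k) (simp_all add: power2_eq_square)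
   then show ?thesis using s assms by (simp add: frac_eq_eq)
  qed
  finally show "((\<lambda>s. - (1 / s ^ k)) has_real_derivative k / s ^ Suc k) (at s)" .
  show "0 \<le> k / s ^ Suc k" using s assms by simp
 next
  have "((\<lambda>s::real. 1 / s ^ k) \<longlongrightarrow> 0) at_top"
   using assms by (intro tendsto_divide_0[OF tendsto_const] filterlim_at_top_imp_at_infinity
     filterlim_pow_at_top filterlim_ident) auto
  then show "((\<lambda>s::real. - (1 / s ^ k)) \<longlongrightarrow> 0) at_top" using tendsto_minus by fastforce
 qed simp
 then show ?thesis by simp
qed

text \<open>Polar coordinates without a surface measure: directions are averaged over the unit ball,
  and the inner integrand sees \<open>w\<close> only through \<open>w / cnorm k w\<close>. To prove
  it, the radius is rescaled by \<open>cnorm k w\<close>, the integrals are exchanged,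
  \<open>s w\<close> is renamed \<open>c\<close>, and the remaining integral over
  \<open>s \<ge> cnorm k c\<close> is explicit.\<close>

lemma nn_integral_polar:
 assumes k: "k \<ge> 1" and F[measurable]: "F \<in> borel_measurable (lborel_PiM k)"
 shows "(\<integral>\<^sup>+c. F c \<partial>lborel_PiM k) =
  (\<integral>\<^sup>+w. indicator {..1} (cnorm k w) *
    (\<integral>\<^sup>+s. F (\<lambda>i\<in>{..<k}. s / cnorm k w * w i) * ennreal (k * s ^ (k - 1)) * indicator {0<..} s \<partial>lborel)
   \<partial>lborel_PiM k)"
proof -
 let ?P = "lborel_PiM k"
 let ?N = "cnorm k"
 interpret P: sigma_finite_measure ?P by (rule sigma_finite_lborel_PiM)
 interpret pair_sigma_finite ?P "lborel :: real measure" ..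
 have "(\<integral>\<^sup>+w. indicator {..1} (?N w) *
    (\<integral>\<^sup>+s. F (\<lambda>i\<in>{..<k}. s / ?N w * w i) * ennreal (k * s ^ (k - 1)) * indicator {0<..} s \<partial>lborel) \<partial>?P)
  = (\<integral>\<^sup>+w. (\<integral>\<^sup>+s. indicator {..1} (?N w) * ennreal (?N w ^ k) * F (\<lambda>i\<in>{..<k}. s * w i) *
     ennreal (k * s ^ (k - 1)) * indicator {0<..} s \<partial>lborel) \<partial>?P)"
 proof (rule nn_integral_cong_AE, use AE_cnorm_pos[OF k] AE_space in eventually_elim)
  fix w assume N: "?N w > 0" and w: "w \<in> space ?P"
  have wm: "(\<lambda>_. w) \<in> borel \<rightarrow>\<^sub>M ?P" using w by simp
  have Fm[measurable]: "(\<lambda>s. F (\<lambda>i\<in>{..<k}. g s * w i)) \<in> borel_measurable borel"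
   if "g \<in> borel_measurable borel" for g :: "real => real"
   by (rule measurable_compose[OF measurable_PiM_lborel_scale[OF that wm] F])
  have inner: "(\<integral>\<^sup>+s. F (\<lambda>i\<in>{..<k}. s / ?N w * w i) * ennreal (k * s ^ (k - 1)) * indicator {0<..} s \<partial>lborel)
   = ennreal (?N w ^ k) * (\<integral>\<^sup>+s. (F (\<lambda>i\<in>{..<k}. s * w i) *
      ennreal (k * s ^ (k - 1)) * indicator {0<..} s) \<partial>lborel)" (is "?I = _")
  proof -
  have "?I = ennreal \<bar>?N w\<bar> * (\<integral>\<^sup>+s. F (\<lambda>i\<in>{..<k}. (0 + ?N w * s) / ?N w * w i) *
      ennreal (k * (0 + ?N w * s) ^ (k - 1)) * indicator {0<..} (0 + ?N w * s) \<partial>lborel)"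
   by (rule nn_integral_real_affine) (use N in \<open>auto intro!: borel_measurable_times_ennreal Fm\<close>)
  also have "\<dots> = ennreal (?N w) * (\<integral>\<^sup>+s. ennreal (?N w ^ (k - 1)) * (F (\<lambda>i\<in>{..<k}. s * w i) *
      ennreal (k * s ^ (k - 1)) * indicator {0<..} s) \<partial>lborel)"
  proof -
   have "F (\<lambda>i\<in>{..<k}. (0 + ?N w * s) / ?N w * w i) *
      ennreal (k * (0 + ?N w * s) ^ (k - 1)) * indicator {0<..} (0 + ?N w * s)
    = ennreal (?N w ^ (k - 1)) * (F (\<lambda>i\<in>{..<k}. s * w i) *
      ennreal (k * s ^ (k - 1)) * indicator {0<..} s)" for s :: real
   proof (cases "s > 0")
    case True
    have "ennreal (k * (?N w * s) ^ (k - 1)) = ennreal (?N w ^ (k - 1)) * ennreal (k * s ^ (k - 1))"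
     using True N by (subst ennreal_mult[symmetric]) (auto simp: power_mult_distrib mult_ac)
    then show ?thesis using True N by (simp add: mult_ac)
   next
    case False
    then show ?thesis using N by (simp add: zero_less_mult_iff)
   qed
   then show ?thesis using N by simp
  qed
  also have "\<dots> = ennreal (?N w) * (ennreal (?N w ^ (k - 1)) * (\<integral>\<^sup>+s. (F (\<lambda>i\<in>{..<k}. s * w i) *
      ennreal (k * s ^ (k - 1)) * indicator {0<..} s) \<partial>lborel))"
   by (subst nn_integral_cmult) (auto intro!: borel_measurable_times_ennreal Fm)
  also have "\<dots> = ennreal (?N w ^ k) * (\<integral>\<^sup>+s. (F (\<lambda>i\<in>{..<k}. s * w i) *
      ennreal (k * s ^ (k - 1)) * indicator {0<..} s) \<partial>lborel)"
   using N k by (subst mult.assoc[symmetric], subst ennreal_mult[symmetric])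
    (auto simp: power_Suc[symmetric] simp del: power_Suc)
  finally show ?thesis .
  qed
  have "indicator {..1} (?N w) * (ennreal (?N w ^ k) * (\<integral>\<^sup>+s. (F (\<lambda>i\<in>{..<k}. s * w i) *
      ennreal (k * s ^ (k - 1)) * indicator {0<..} s) \<partial>lborel)) = (\<integral>\<^sup>+s. indicator {..1} (?N w) * ennreal (?N w ^ k) * F (\<lambda>i\<in>{..<k}. s * w i) *
     ennreal (k * s ^ (k - 1)) * indicator {0<..} s \<partial>lborel)"
   by (subst mult.assoc[symmetric], subst nn_integral_cmult[symmetric])
    (auto intro!: borel_measurable_times_ennreal Fm simp: mult.assoc)
  then show "indicator {..1} (?N w) *
    (\<integral>\<^sup>+s. F (\<lambda>i\<in>{..<k}. s / ?N w * w i) * ennreal (k * s ^ (k - 1)) * indicator {0<..} s \<partial>lborel) =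
   (\<integral>\<^sup>+s. indicator {..1} (?N w) * ennreal (?N w ^ k) * F (\<lambda>i\<in>{..<k}. s * w i) *
     ennreal (k * s ^ (k - 1)) * indicator {0<..} s \<partial>lborel)" unfolding inner .
 qed
 also have "\<dots> = (\<integral>\<^sup>+s. (\<integral>\<^sup>+w. indicator {..1} (?N w) * ennreal (?N w ^ k) * F (\<lambda>i\<in>{..<k}. s * w i) *
     ennreal (k * s ^ (k - 1)) * indicator {0<..} s \<partial>?P) \<partial>lborel)"
  by (rule Fubini'[symmetric]) measurable
 \<comment> \<open>With \<open>c = s w\<close> the condition that \<open>w\<close> lies in the unit
   ball becomes \<open>cnorm k c \<le> s\<close>; the Jacobian and the factor
   \<open>cnorm k w ^ k\<close> turn \<open>k * s ^ (k - 1)\<close> into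
   \<open>cnorm k c ^ k * k / s ^ Suc k\<close>.\<close>
 also have "\<dots> = (\<integral>\<^sup>+s. (\<integral>\<^sup>+c. F c * ennreal (?N c ^ k) * (ennreal (k / s ^ Suc k) * (if ?N c \<le> s then 1 else 0)) * indicator {0<..} s \<partial>?P) \<partial>lborel)"
 proof (rule nn_integral_cong)
  fix s :: real
  show "(\<integral>\<^sup>+w. indicator {..1} (?N w) * ennreal (?N w ^ k) * F (\<lambda>i\<in>{..<k}. s * w i) *
     ennreal (k * s ^ (k - 1)) * indicator {0<..} s \<partial>?P)
   = (\<integral>\<^sup>+c. F c * ennreal (?N c ^ k) * (ennreal (k / s ^ Suc k) * (if ?N c \<le> s then 1 else 0)) * indicator {0<..} s \<partial>?P)"
  proof (cases "s > 0")
   case True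
   have "(\<integral>\<^sup>+c. F c * ennreal (?N c ^ k) * (ennreal (k / s ^ Suc k) * (if ?N c \<le> s then 1 else 0)) * indicator {0<..} s \<partial>?P)
    = ennreal (\<bar>s\<bar> ^ card {..<k}) * (\<integral>\<^sup>+w. F (\<lambda>i\<in>{..<k}. s * w i) * ennreal (?N (\<lambda>i\<in>{..<k}. s * w i) ^ k) *
      (ennreal (k / s ^ Suc k) * (if ?N (\<lambda>i\<in>{..<k}. s * w i) \<le> s then 1 else 0)) * indicator {0<..} s \<partial>?P)"
    by (rule nn_integral_PiM_scale) (use True in \<open>auto, measurable\<close>)
   also have "\<dots> = (\<integral>\<^sup>+w. ennreal (s ^ k) * (F (\<lambda>i\<in>{..<k}. s * w i) * ennreal (?N (\<lambda>i\<in>{..<k}. s * w i) ^ k) *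
      (ennreal (k / s ^ Suc k) * (if ?N (\<lambda>i\<in>{..<k}. s * w i) \<le> s then 1 else 0)) * indicator {0<..} s) \<partial>?P)"
    using True by (subst nn_integral_cmult) (simp_all, measurable)
   also have "\<dots> = (\<integral>\<^sup>+w. indicator {..1} (?N w) * ennreal (?N w ^ k) * F (\<lambda>i\<in>{..<k}. s * w i) *
     ennreal (k * s ^ (k - 1)) * indicator {0<..} s \<partial>?P)"
   proof (rule nn_integral_cong)
    fix w
    have "s ^ k * ((s * ?N w) ^ k * (k / s ^ Suc k)) = ?N w ^ k * (k * s ^ (k - 1))"
     using True k by (cases k) (auto simp: field_simps power_mult_distrib)
    then have "ennreal (s ^ k) * (ennreal ((s * ?N w) ^ k) * ennreal (k / s ^ Suc k))
      = ennreal (?N w ^ k) * ennreal (k * s ^ (k - 1))"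
     using True by (simp add: ennreal_mult[symmetric] del: power_Suc)
    moreover have "(if s * ?N w \<le> s then 1 else 0) = (indicator {..1} (?N w) :: ennreal)"
     using True by (auto split: split_indicator)
    moreover have "a * (f * b * (c * i)) = a * (b * c) * (f * i)" for a b c f i :: ennreal by (simp add: mult_ac)
    ultimately show "ennreal (s ^ k) * (F (\<lambda>i\<in>{..<k}. s * w i) * ennreal (?N (\<lambda>i\<in>{..<k}. s * w i) ^ k) *
      (ennreal (k / s ^ Suc k) * (if ?N (\<lambda>i\<in>{..<k}. s * w i) \<le> s then 1 else 0)) * indicator {0<..} s)
     = indicator {..1} (?N w) * ennreal (?N w ^ k) * F (\<lambda>i\<in>{..<k}. s * w i) *
     ennreal (k * s ^ (k - 1)) * indicator {0<..} s"
     using True by (simp add: cnorm_scale del: power_Suc) (simp add: mult_ac del: power_Suc)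
   qed
   finally show ?thesis ..
  qed simp
 qed
 also have "\<dots> = (\<integral>\<^sup>+c. (\<integral>\<^sup>+s. F c * ennreal (?N c ^ k) * (ennreal (k / s ^ Suc k) * (if ?N c \<le> s then 1 else 0)) * indicator {0<..} s \<partial>lborel) \<partial>?P)"
  by (rule Fubini') measurable
 also have "\<dots> = (\<integral>\<^sup>+c. F c \<partial>?P)"
 proof (rule nn_integral_cong_AE, use AE_cnorm_pos[OF k] in eventually_elim)
  fix c assume N: "?N c > 0"
  have "(\<integral>\<^sup>+s. F c * ennreal (?N c ^ k) * (ennreal (k / s ^ Suc k) * (if ?N c \<le> s then 1 else 0)) * indicator {0<..} s \<partial>lborel)
   = (\<integral>\<^sup>+s. F c * ennreal (?N c ^ k) * (ennreal (k / s ^ Suc k) * indicator {?N c..} s) \<partial>lborel)"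
   using N by (intro nn_integral_cong) (auto split: split_indicator)
  also have "\<dots> = F c * ennreal (?N c ^ k) * ennreal (1 / ?N c ^ k)"
   by (subst nn_integral_cmult) (auto simp: nn_integral_inverse_power[OF k N] simp del: power_Suc)
  also have "\<dots> = F c * (ennreal (?N c ^ k) * ennreal (1 / ?N c ^ k))" by (simp add: mult.assoc)
  also have "\<dots> = F c" using N by (subst ennreal_mult[symmetric]) auto
  finally show "(\<integral>\<^sup>+s. F c * ennreal (?N c ^ k) * (ennreal (k / s ^ Suc k) * (if ?N c \<le> s then 1 else 0)) * indicator {0<..} s \<partial>lborel) = F c" .
 qed
 finally show ?thesis ..
qed

lemma nn_integral_radial:
 assumes k: "k \<ge> 1" and h[measurable]: "h \<in> borel_measurable borel"
 shows "(\<integral>\<^sup>+c. h (cnorm k c) \<partial>lborel_PiM k) =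
  ennreal (unit_ball_vol k) * (\<integral>\<^sup>+s. h s * ennreal (k * s ^ (k - 1)) * indicator {0<..} s \<partial>lborel)"
proof -
 let ?I = "\<integral>\<^sup>+s. h s * ennreal (k * s ^ (k - 1)) * indicator {0<..} s \<partial>lborel"
 have "(\<integral>\<^sup>+c. h (cnorm k c) \<partial>lborel_PiM k) =
  (\<integral>\<^sup>+w. indicator {..1} (cnorm k w) *
    (\<integral>\<^sup>+s. h (cnorm k (\<lambda>i\<in>{..<k}. s / cnorm k w * w i)) * ennreal (k * s ^ (k - 1)) * indicator {0<..} s \<partial>lborel)
   \<partial>lborel_PiM k)" by (rule nn_integral_polar[OF k]) measurable
 also have "\<dots> = (\<integral>\<^sup>+w. indicator {..1} (cnorm k w) * ?I \<partial>lborel_PiM k)"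
 proof (rule nn_integral_cong_AE, use AE_cnorm_pos[OF k] in eventually_elim)
  fix w assume "cnorm k w > 0"
  then have "cnorm k w \<noteq> 0" "cnorm k w > 0" by auto
  then have "(\<integral>\<^sup>+s. h (cnorm k (\<lambda>i\<in>{..<k}. s / cnorm k w * w i)) * ennreal (k * s ^ (k - 1)) * indicator {0<..} s \<partial>lborel) = ?I"
  proof (intro nn_integral_cong)
   fix s :: real
   have "cnorm k (\<lambda>i\<in>{..<k}. s / cnorm k w * w i) = s" if "s > 0"
    using that \<open>cnorm k w \<noteq> 0\<close> unfolding cnorm_scale by simp
   then show "h (cnorm k (\<lambda>i\<in>{..<k}. s / cnorm k w * w i)) * ennreal (k * s ^ (k - 1)) * indicator {0<..} s
     = h s * ennreal (k * s ^ (k - 1)) * indicator {0<..} s" by (auto split: split_indicator)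
  qed
  then show "indicator {..1} (cnorm k w) *
    (\<integral>\<^sup>+s. h (cnorm k (\<lambda>i\<in>{..<k}. s / cnorm k w * w i)) * ennreal (k * s ^ (k - 1)) * indicator {0<..} s \<partial>lborel)
   = indicator {..1} (cnorm k w) * ?I" by simp
 qed
 also have "\<dots> = (\<integral>\<^sup>+w. indicator {..1} (cnorm k w) \<partial>lborel_PiM k) * ?I"
  by (rule nn_integral_multc) measurable
 also have "(\<integral>\<^sup>+w. indicator {..1} (cnorm k w) \<partial>lborel_PiM k)
   = (\<integral>\<^sup>+w. indicator ({f. sqrt (\<Sum>i<k. (f i)\<^sup>2) \<le> 1} \<inter> space (lborel_PiM k)) w \<partial>lborel_PiM k)"
  by (intro nn_integral_cong) (auto simp: cnorm_def split: split_indicator)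
 also have "\<dots> = emeasure (lborel_PiM k) ({f. sqrt (\<Sum>i<k. (f i)\<^sup>2) \<le> 1} \<inter> space (lborel_PiM k))"
 proof (rule nn_integral_indicator)
  have "{f. sqrt (\<Sum>i<k. (f i)\<^sup>2) \<le> 1} \<inter> space (lborel_PiM k) = cnorm k -` {..1} \<inter> space (lborel_PiM k)"
   by (auto simp: cnorm_def)
  then show "{f. sqrt (\<Sum>i<k. (f i)\<^sup>2) \<le> 1} \<inter> space (lborel_PiM k) \<in> sets (lborel_PiM k)"
   using measurable_sets[OF measurable_cnorm[of k], of "{..1}"] by simp
 qed
 also have "\<dots> = ennreal (unit_ball_vol k)" using emeasure_cball_aux[of "{..<k}" 1] by simp
 finally show ?thesis .
qed

section \<open>Substitution on open intervals; stereographic against gnomonic radius\<close>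

lemma nn_integral_substitution_einterval:
 fixes f :: "real => ennreal" and g g' :: "real => real"
 assumes f[measurable]: "f \<in> borel_measurable borel" and ab: "a < b"
  and deriv: "\<And>x. x \<in> einterval a b ==> (g has_real_derivative g' x) (at x)"
  and cont: "continuous_on (einterval a b) g'"
  and nonneg: "\<And>x. x \<in> einterval a b ==> 0 \<le> g' x"
 shows "(\<integral>\<^sup>+y. f y * indicator (g ` einterval a b) y \<partial>lborel)
    = (\<integral>\<^sup>+x. f (g x) * ennreal (g' x) * indicator (einterval a b) x \<partial>lborel)"
proof -
 \<comment> \<open>The radius maps have poles and unbounded ranges, so the rule for compact
   intervals is applied along an exhaustion and passed to the limit by monotone convergence.\<close>
 obtain u l where ul: "einterval a b = (\<Union>i. {l i .. u i})" "incseq u" "decseq l"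
  "\<And>i. l i < u i" "\<And>i. a < l i" "\<And>i. u i < b" by (rule einterval_Icc_approximation[OF ab]) blast
 have sub: "{l i..u i} \<subseteq> einterval a b" for i using ul(1) by auto
 have mono: "g x \<le> g y" if "x \<le> y" "x \<in> {l i..u i}" "y \<in> {l i..u i}" for x y i
 proof (rule DERIV_nonneg_imp_nondecreasing[OF that(1)])
  fix z assume "x \<le> z" "z \<le> y"
  with that(2,3) have "z \<in> {l i..u i}" by simp
  then have "z \<in> einterval a b" using sub by blast
  then show "\<exists>d. (g has_real_derivative d) (at z) \<and> 0 \<le> d" using deriv nonneg by blast
 qed
 have im: "g ` {l i..u i} = {g (l i)..g (u i)}" for i
 proof
  show "g ` {l i..u i} \<subseteq> {g (l i)..g (u i)}"
   using mono[of _ _ i] ul(4)[of i] by (auto intro!: mono[of _ _ i] simp: less_imp_le)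
  have "continuous_on {l i..u i} g"
   using sub[of i] deriv by (intro continuous_at_imp_continuous_on) (auto intro: DERIV_isCont)
  then show "{g (l i)..g (u i)} \<subseteq> g ` {l i..u i}"
   using ul(4)[of i] IVT'[of g "l i" _ "u i"] by (force simp: less_imp_le)
 qed
 have inc: "incseq (\<lambda>i. {l i..u i})"
 proof (rule incseq_SucI)
  fix i
  have "u i \<le> u (Suc i)" "l (Suc i) \<le> l i" using ul(2,3) by (simp_all add: incseq_SucD decseq_SucD)
  then show "{l i..u i} \<subseteq> {l (Suc i)..u (Suc i)}" by simp
 qed
 then have inc': "incseq (\<lambda>i. {g (l i)..g (u i)})" unfolding im[symmetric] incseq_def by blast
 have img: "g ` einterval a b = (\<Union>i. {g (l i)..g (u i)})" unfolding ul(1) image_UN im ..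
 have SUPind: "(SUP i. F x * indicator (A i) x) = F x * indicator (\<Union>i. A i) x"
  for F :: "real => ennreal" and A :: "nat => real set" and x
 proof (cases "x \<in> (\<Union>i. A i)")
  case True
  then obtain j where j: "x \<in> A j" by blast
  have "F x * indicator (A j) x \<le> (SUP i. F x * indicator (A i) x)" by (rule SUP_upper) simp
  moreover have "(SUP i. F x * indicator (A i) x) \<le> F x" by (rule SUP_least) (simp split: split_indicator)
  ultimately show ?thesis using True j by (simp add: antisym)
 qed simp
 have incind: "incseq (\<lambda>i x. F x * indicator (A i) x)"
  if "incseq A" for F :: "real => ennreal" and A :: "nat => real set"
 proof (intro incseq_SucI le_funI)
  fix i x
  have "A i \<subseteq> A (Suc i)" using that by (rule incseq_SucD)
  then show "F x * indicator (A i) x \<le> F x * indicator (A (Suc i)) x" by (auto split: split_indicator)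
 qed
 have gm: "(\<lambda>x. f (g x) * ennreal (g' x) * indicator {l i..u i} x) \<in> borel_measurable lborel" for i
 proof -
  have cg: "continuous_on {l i..u i} g"
   using sub[of i] deriv by (intro continuous_at_imp_continuous_on) (auto intro: DERIV_isCont)
  have cg': "continuous_on {l i..u i} g'" using continuous_on_subset[OF cont sub] .
  have [measurable]: "(\<lambda>x. indicator {l i..u i} x *\<^sub>R g x) \<in> borel_measurable borel"
   "(\<lambda>x. indicator {l i..u i} x *\<^sub>R g' x) \<in> borel_measurable borel"
   by (intro borel_measurable_continuous_on_indicator cg cg'; simp)+
  have "(\<lambda>x. f (g x) * ennreal (g' x) * indicator {l i..u i} x) =
   (\<lambda>x. f (indicator {l i..u i} x *\<^sub>R g x) * ennreal (indicator {l i..u i} x *\<^sub>R g' x) * indicator {l i..u i} x)"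
   by (auto split: split_indicator)
  also have "\<dots> \<in> borel_measurable lborel" unfolding measurable_lborel2
   by (intro borel_measurable_times_ennreal measurable_compose[OF _ f] measurable_compose[OF _ measurable_ennreal])
    (use \<open>(\<lambda>x. indicator {l i..u i} x *\<^sub>R g x) \<in> borel_measurable borel\<close>
     \<open>(\<lambda>x. indicator {l i..u i} x *\<^sub>R g' x) \<in> borel_measurable borel\<close> in auto)
  finally show ?thesis .
 qed
 have "(\<integral>\<^sup>+y. f y * indicator (g ` einterval a b) y \<partial>lborel) = (\<integral>\<^sup>+y. (SUP i. f y * indicator {g (l i)..g (u i)} y) \<partial>lborel)"
  by (simp only: img SUPind[of f _ "\<lambda>i. {g (l i)..g (u i)}"])
 also have "\<dots> = (SUP i. \<integral>\<^sup>+y. f y * indicator {g (l i)..g (u i)} y \<partial>lborel)"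
  by (rule nn_integral_monotone_convergence_SUP[OF incind[OF inc']]) measurable
 also have "\<dots> = (SUP i. \<integral>\<^sup>+x. f (g x) * ennreal (g' x) * indicator {l i..u i} x \<partial>lborel)"
  using sub ul(4) continuous_on_subset[OF cont sub] deriv nonneg
  by (intro SUP_cong refl nn_integral_substitution_aux) (auto simp: subset_iff)
 also have "\<dots> = (\<integral>\<^sup>+x. (SUP i. f (g x) * ennreal (g' x) * indicator {l i..u i} x) \<partial>lborel)"
  by (rule nn_integral_monotone_convergence_SUP[OF incind[OF inc] gm, symmetric])
 also have "\<dots> = (\<integral>\<^sup>+x. f (g x) * ennreal (g' x) * indicator (einterval a b) x \<partial>lborel)"
  by (simp only: ul(1) SUPind[of "\<lambda>x. f (g x) * ennreal (g' x)" _ "\<lambda>i. {l i..u i}"])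
 finally show ?thesis .
qed

text \<open>The density of the Riemannian volume in gnomonic coordinates, that is under central
  projection to a tangent plane; it is 1 for \<open>\<kappa> = 0\<close>. The value 0 outside the
  Klein ball allows integrals over all of R^k in the hyperbolic case.\<close>

definition klein_weight :: "real => nat => real => real" where
 "klein_weight \<kappa> k s = (if 1 + \<kappa> * s^2 > 0 then (1 + \<kappa> * s^2) powr (- ((real k + 1) / 2)) else 0)"

lemma klein_weight_nonneg [simp]: "0 \<le> klein_weight \<kappa> k s" by (simp add: klein_weight_def)

lemma measurable_klein_weight [measurable]: "klein_weight \<kappa> k \<in> borel_measurable borel"
 unfolding klein_weight_def by measurable

text \<open>The map \<open>g\<close> is the double-angle formula: a stereographic radius is the
  tangent of half the angle, a gnomonic radius the tangent of the angle (hyperbolic tangents for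
  \<open>\<kappa> = - 1\<close>). With \<open>A = 1 + \<kappa> s^2\<close> and
  \<open>B = |1 - \<kappa> s^2|\<close> one has \<open>1 + \<kappa> g^2 = (A / B)^2\<close>, and all
  powers of \<open>B\<close> cancel.\<close>

lemma klein_weight_stereo:
 assumes \<kappa>: "\<kappa> = 1 \<or> \<kappa> = - 1" and k: "k \<ge> 1" and s: "s > 0" "1 + \<kappa> * s^2 > 0" "1 - \<kappa> * s^2 \<noteq> 0"
 defines "g \<equiv> 2 * s / (1 - \<kappa> * s^2)" and "g' \<equiv> 2 * (1 + \<kappa> * s^2) / (1 - \<kappa> * s^2)^2"
 shows "klein_weight \<kappa> k g * (real k * \<bar>g\<bar> ^ (k - 1)) * g' = (2 / (1 + \<kappa> * s^2)) ^ k * (real k * s ^ (k - 1))"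
proof -
 define A where "A = 1 + \<kappa> * s^2"
 define B where "B = \<bar>1 - \<kappa> * s^2\<bar>"
 have A: "A > 0" and B: "B > 0" using s by (auto simp: A_def B_def)
 have B2: "B\<^sup>2 = (1 - \<kappa> * s^2)^2" by (simp add: B_def)
 have "1 + \<kappa> * g^2 = ((1 - \<kappa> * s^2)^2 + 4 * \<kappa> * s^2) / (1 - \<kappa> * s^2)^2"
  using s(3) by (simp add: g_def power_divide field_simps)
 also have "(1 - \<kappa> * s^2)^2 + 4 * \<kappa> * s^2 = A^2"
  unfolding A_def by (simp add: power2_eq_square algebra_simps)
 finally have q: "1 + \<kappa> * g^2 = (A / B)^2" by (simp add: B2 power_divide)
 have "klein_weight \<kappa> k g = ((A / B)^2) powr (- ((real k + 1) / 2))"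
  unfolding klein_weight_def q using A B by simp
 also have "\<dots> = ((A / B) powr 2) powr (- ((real k + 1) / 2))" using A B by simp
 also have "\<dots> = (A / B) powr (2 * - ((real k + 1) / 2))" by (simp only: powr_powr)
 also have "2 * - ((real k + 1) / 2) = - real (Suc k)"
 proof -
  have "2 * - (x / 2) = - x" for x :: real by simp
  from this[of "real k + 1"] show ?thesis by (simp only: of_nat_Suc add.commute)
 qed
 also have "(A / B) powr (- real (Suc k)) = (B / A) ^ Suc k"
  using A B by (simp only: powr_minus powr_realpow divide_pos_pos) (simp add: power_divide)
 finally have w: "klein_weight \<kappa> k g = (B / A) ^ Suc k" .
 have g: "\<bar>g\<bar> = 2 * s / B" using s by (simp add: g_def B_def)
 have g': "g' = 2 * A / B^2" by (simp add: g'_def A_def B2)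
 obtain j where j: "k = Suc j" using k by (cases k) auto
 show ?thesis unfolding w g g' A_def[symmetric] using A B by (simp add: j field_simps power2_eq_square)
qed

lemma stereo_radius_deriv:
 assumes "1 - \<kappa> * s^2 \<noteq> 0"
 shows "((\<lambda>s. 2 * s / (1 - \<kappa> * s^2)) has_real_derivative 2 * (1 + \<kappa> * s^2) / (1 - \<kappa> * s^2)^2) (at s)"
 using assms by (auto intro!: derivative_eq_intros simp: field_simps power2_eq_square)

lemma stereo_radius_image_hyp: "(\<lambda>s. 2 * s / (1 + s^2)) ` {0<..<1} = {0<..<1::real}"
proof (intro equalityI subsetI)
 fix y :: real assume y: "y \<in> {0<..<1}"
 define r where "r = sqrt (1 - y\<^sup>2)"
 have y2: "y\<^sup>2 < 1" using y by (simp add: power2_less_1_iff abs_if)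
 have r: "0 < r" "r < 1" "r\<^sup>2 = 1 - y\<^sup>2" using y y2 by (auto simp: r_def)
 \<comment> \<open>The root of \<open>y s^2 - 2 s + y = 0\<close> that lies between 0 and 1.\<close>
 define s where "s = (1 - r) / y"
 have "(1 - r)^2 < y^2"
 proof -
  have "y\<^sup>2 - (1 - r)\<^sup>2 = 2 * r * (1 - r)" using r(3) by (simp add: power2_eq_square algebra_simps)
  also have "\<dots> > 0" using r by simp
  finally show ?thesis by simp
 qed
 then have "1 - r < y" using y by (simp add: power2_less_imp_less)
 then have s: "s \<in> {0<..<1}" using y r by (simp add: s_def)
 have "1 + s^2 = (y\<^sup>2 + (1 - r)^2) / y^2"
  using y by (simp add: s_def power_divide field_simps)
 also have "y\<^sup>2 + (1 - r)^2 = 2 * (1 - r)" using r(3) by (simp add: power2_eq_square algebra_simps)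
 finally have "2 * s / (1 + s^2) = y" using y r by (simp add: s_def field_simps power2_eq_square)
 with s show "y \<in> (\<lambda>s. 2 * s / (1 + s^2)) ` {0<..<1}" by (intro image_eqI[of _ _ s]) simp_all
next
 fix y :: real assume "y \<in> (\<lambda>s. 2 * s / (1 + s^2)) ` {0<..<1}"
 then obtain s where s: "0 < s" "s < 1" "y = 2 * s / (1 + s^2)" by auto
 have "0 < (1 - s)^2" using s by simp
 then have "2 * s < 1 + s^2" by (simp add: power2_eq_square algebra_simps)
 then show "y \<in> {0<..<1}" using s by (simp add: divide_less_eq add_pos_nonneg)
qed

text \<open>The two roots of \<open>y s^2 + 2 s - y = 0\<close>: the first inverts the doubling on
  (0, 1) for positive \<open>y\<close>, the second beyond 1 for negative \<open>y\<close>.\<close>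

lemma stereo_radius_root:
 fixes y :: real
 assumes "y \<noteq> 0"
 defines "r \<equiv> sqrt (1 + y^2)"
 shows "2 * ((r - 1) / y) / (1 - ((r - 1) / y)\<^sup>2) = y" and "2 * ((- r - 1) / y) / (1 - ((- r - 1) / y)\<^sup>2) = y"
  and "1 < r" "\<bar>y\<bar> < r" "r - 1 < \<bar>y\<bar>"
proof -
 have r2: "r\<^sup>2 = 1 + y^2" by (simp add: r_def)
 show r1: "1 < r" using assms by (simp add: r_def)
 show "\<bar>y\<bar> < r" unfolding r_def by (rule real_less_rsqrt) simp
 have "y\<^sup>2 - (r - 1)\<^sup>2 = 2 * (r - 1)" using r2 by (simp add: power2_eq_square algebra_simps)
 then have "(r - 1)^2 < \<bar>y\<bar>\<^sup>2" using r1 by simp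
 then show "r - 1 < \<bar>y\<bar>" by (rule power2_less_imp_less) simp
 have *: "2 * (a / y) / (1 - (a / y)\<^sup>2) = y" if "y\<^sup>2 - a\<^sup>2 = 2 * a" "a \<noteq> 0" for a
 proof -
  have "1 - (a / y)\<^sup>2 = 2 * a / y^2"
   unfolding that(1)[symmetric] using assms(1) by (simp add: power_divide diff_divide_distrib)
  then show ?thesis using that(2) assms(1) by (simp add: power2_eq_square)
 qed
 show "2 * ((r - 1) / y) / (1 - ((r - 1) / y)\<^sup>2) = y"
  using r1 r2 by (intro *) (auto simp: power2_eq_square algebra_simps)
 show "2 * ((- r - 1) / y) / (1 - ((- r - 1) / y)\<^sup>2) = y"
  using r1 r2 by (intro *) (auto simp: power2_eq_square algebra_simps)
qed

lemma stereo_radius_image_sphere: "(\<lambda>s. 2 * s / (1 - s\<^sup>2)) ` {0<..<1} = {(0::real)<..}"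
proof (intro equalityI subsetI)
 fix y :: real assume y: "y \<in> {0<..}"
 define s where "s = (sqrt (1 + y^2) - 1) / y"
 have "s \<in> {0<..<1}" "2 * s / (1 - s\<^sup>2) = y"
  using stereo_radius_root[of y] y by (auto simp: s_def divide_less_eq)
 then show "y \<in> (\<lambda>s. 2 * s / (1 - s\<^sup>2)) ` {0<..<1}" by (intro image_eqI[of _ _ s]) simp_all
next
 fix y :: real assume "y \<in> (\<lambda>s. 2 * s / (1 - s\<^sup>2)) ` {0<..<1}"
 then obtain s where s: "0 < s" "s < 1" "y = 2 * s / (1 - s\<^sup>2)" by auto
 then show "y \<in> {0<..}" by (simp add: power2_less_1_iff abs_if)
qed

text \<open>Stereographic radii above 1 belong to the far hemisphere, where central projection
  reverses the direction; hence the negative radii.\<close>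

lemma stereo_radius_image_sphere': "(\<lambda>s. 2 * s / (1 - s\<^sup>2)) ` {1<..} = {..<(0::real)}"
proof (intro equalityI subsetI)
 fix y :: real assume y: "y \<in> {..<0}"
 define s where "s = (- sqrt (1 + y^2) - 1) / y"
 have "s \<in> {1<..}" "2 * s / (1 - s\<^sup>2) = y"
  using stereo_radius_root[of y] y by (auto simp: s_def less_divide_eq)
 then show "y \<in> (\<lambda>s. 2 * s / (1 - s\<^sup>2)) ` {1<..}" by (intro image_eqI[of _ _ s]) simp_all
next
 fix y :: real assume "y \<in> (\<lambda>s. 2 * s / (1 - s\<^sup>2)) ` {1<..}"
 then obtain s where s: "1 < s" "y = 2 * s / (1 - s\<^sup>2)" by auto
 then have "1 < s^2" by (simp add: one_less_power)
 then show "y \<in> {..<0}" using s by (simp add: divide_less_0_iff)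
qed

lemma nn_integral_stereo_radius:
 assumes \<kappa>: "\<kappa> = 1 \<or> \<kappa> = - 1" and k: "k \<ge> 1"
  and H[measurable]: "H \<in> borel_measurable borel"
  and E: "E = einterval a b" "a < b" "\<And>s. s \<in> E ==> s > 0 \<and> 1 + \<kappa> * s^2 > 0 \<and> 1 - \<kappa> * s^2 \<noteq> 0"
 shows "(\<integral>\<^sup>+s. H (2 * s / (1 - \<kappa> * s^2)) * ennreal ((2 / (1 + \<kappa> * s^2)) ^ k * (real k * s ^ (k - 1))) * indicator E s \<partial>lborel)
  = (\<integral>\<^sup>+y. H y * ennreal (klein_weight \<kappa> k y * (real k * \<bar>y\<bar> ^ (k - 1))) * indicator ((\<lambda>s. 2 * s / (1 - \<kappa> * s^2)) ` E) y \<partial>lborel)"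
proof -
 let ?g = "\<lambda>s. 2 * s / (1 - \<kappa> * s^2)" and ?g' = "\<lambda>s. 2 * (1 + \<kappa> * s^2) / (1 - \<kappa> * s^2)^2"
 let ?f = "\<lambda>y. H y * ennreal (klein_weight \<kappa> k y * (real k * \<bar>y\<bar> ^ (k - 1)))"
 have "(\<integral>\<^sup>+y. ?f y * indicator (?g ` E) y \<partial>lborel) = (\<integral>\<^sup>+s. ?f (?g s) * ennreal (?g' s) * indicator E s \<partial>lborel)"
  unfolding E(1)
 proof (rule nn_integral_substitution_einterval[OF _ E(2)])
  show "?f \<in> borel_measurable borel" by measurable
  show "continuous_on (einterval a b) ?g'" using E by (intro continuous_intros) auto
  fix x assume "x \<in> einterval a b"
  then have x: "1 + \<kappa> * x^2 > 0" "1 - \<kappa> * x^2 \<noteq> 0" using E by auto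
  show "(?g has_real_derivative ?g' x) (at x)" using x(2) by (rule stereo_radius_deriv)
  show "0 \<le> ?g' x" using x(1) by simp
 qed
 also have "\<dots> = (\<integral>\<^sup>+s. H (?g s) * ennreal ((2 / (1 + \<kappa> * s^2)) ^ k * (real k * s ^ (k - 1))) * indicator E s \<partial>lborel)"
 proof (rule nn_integral_cong)
  fix s
  show "?f (?g s) * ennreal (?g' s) * indicator E s
   = H (?g s) * ennreal ((2 / (1 + \<kappa> * s^2)) ^ k * (real k * s ^ (k - 1))) * indicator E s"
  proof (cases "s \<in> E")
   case True
   note s = E(3)[OF True]
   have "ennreal (klein_weight \<kappa> k (?g s) * (real k * \<bar>?g s\<bar> ^ (k - 1))) * ennreal (?g' s)
     = ennreal ((2 / (1 + \<kappa> * s^2)) ^ k * (real k * s ^ (k - 1)))"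
    using s klein_weight_stereo[OF \<kappa> k, of s]
    by (subst ennreal_mult[symmetric]) (auto intro!: mult_nonneg_nonneg)
   then show ?thesis by (simp add: mult.assoc)
  qed simp
 qed
 finally show ?thesis ..
qed

text \<open>In polar coordinates only the radius changes. For \<open>\<kappa> = - 1\<close> the
  Poincare ball is mapped onto the Klein ball. For \<open>\<kappa> = 1\<close> each of the two
  hemispheres covers all of R^k, the far one with reversed directions, and the reflection of R^k
  shows that both contribute equally; this is the factor 2.\<close>

lemma nn_integral_stereo_Klein:
 assumes \<kappa>: "\<kappa> = 1 \<or> \<kappa> = - 1" and k: "k \<ge> 1"
  and G[measurable]: "G \<in> borel_measurable (lborel_PiM k)"
 shows "(\<integral>\<^sup>+c. G (\<lambda>i\<in>{..<k}. 2 / (1 - \<kappa> * (cnorm k c)^2) * c i) *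
    ennreal (if 1 + \<kappa> * (cnorm k c)^2 > 0 then (2 / (1 + \<kappa> * (cnorm k c)^2)) ^ k else 0) \<partial>lborel_PiM k)
  = (if \<kappa> = 1 then 2 else 1) * (\<integral>\<^sup>+z. G z * ennreal (klein_weight \<kappa> k (cnorm k z)) \<partial>lborel_PiM k)"
proof -
 let ?P = "lborel_PiM k"
 let ?W = "\<lambda>s. if 1 + \<kappa> * s^2 > 0 then (2 / (1 + \<kappa> * s^2)) ^ k else 0"
 define H where "H w y = G (\<lambda>i\<in>{..<k}. y / cnorm k w * w i)" for w y
 define I where "I w = (\<integral>\<^sup>+s. H w s * ennreal (klein_weight \<kappa> k s * (real k * \<bar>s\<bar> ^ (k - 1))) * indicator {0<..} s \<partial>lborel)" for w
 have Hm2[measurable]: "(\<lambda>(w, y). H w y) \<in> borel_measurable (?P \<Otimes>\<^sub>M borel)"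
  unfolding H_def by measurable
 have Hm: "H w \<in> borel_measurable borel" if "w \<in> space ?P" for w using measurable_Pair2[OF Hm2 that] by simp
 interpret sigma_finite_measure "lborel :: real measure" ..
 have Im: "I \<in> borel_measurable ?P" unfolding I_def by measurable
 have polar_right: "(\<integral>\<^sup>+z. G z * ennreal (klein_weight \<kappa> k (cnorm k z)) \<partial>?P) = (\<integral>\<^sup>+w. indicator {..1} (cnorm k w) * I w \<partial>?P)"
 proof -
  have "(\<integral>\<^sup>+z. G z * ennreal (klein_weight \<kappa> k (cnorm k z)) \<partial>?P)
   = (\<integral>\<^sup>+w. indicator {..1} (cnorm k w) * (\<integral>\<^sup>+s. G (\<lambda>i\<in>{..<k}. s / cnorm k w * w i) *
      ennreal (klein_weight \<kappa> k (cnorm k (\<lambda>i\<in>{..<k}. s / cnorm k w * w i))) * ennreal (k * s ^ (k - 1)) * indicator {0<..} s \<partial>lborel) \<partial>?P)"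
   by (rule nn_integral_polar[OF k]) measurable
  also have "\<dots> = (\<integral>\<^sup>+w. indicator {..1} (cnorm k w) * I w \<partial>?P)"
  proof (rule nn_integral_cong_AE, use AE_cnorm_pos[OF k] in eventually_elim)
   fix w assume w: "cnorm k w > 0"
   have "G (\<lambda>i\<in>{..<k}. s / cnorm k w * w i) *
      ennreal (klein_weight \<kappa> k (cnorm k (\<lambda>i\<in>{..<k}. s / cnorm k w * w i))) * ennreal (k * s ^ (k - 1)) * indicator {0<..} s
     = H w s * ennreal (klein_weight \<kappa> k s * (real k * \<bar>s\<bar> ^ (k - 1))) * indicator {0<..} s" for s :: real
   proof (cases "s > 0")
    case True
    then have "cnorm k (\<lambda>i\<in>{..<k}. s / cnorm k w * w i) = s" using w unfolding cnorm_scale by auto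
    then show ?thesis using True by (simp add: H_def ennreal_mult mult.assoc)
   qed simp
   then show "indicator {..1} (cnorm k w) * (\<integral>\<^sup>+s. G (\<lambda>i\<in>{..<k}. s / cnorm k w * w i) *
      ennreal (klein_weight \<kappa> k (cnorm k (\<lambda>i\<in>{..<k}. s / cnorm k w * w i))) * ennreal (k * s ^ (k - 1)) * indicator {0<..} s \<partial>lborel)
    = indicator {..1} (cnorm k w) * I w" by (simp add: I_def)
  qed
  finally show ?thesis .
 qed
 define S where "S w = (\<integral>\<^sup>+s. H w (2 * s / (1 - \<kappa> * s^2)) * ennreal (?W s * (real k * s ^ (k - 1))) * indicator {0<..} s \<partial>lborel)" for w
 have polar_left: "(\<integral>\<^sup>+c. G (\<lambda>i\<in>{..<k}. 2 / (1 - \<kappa> * (cnorm k c)^2) * c i) * ennreal (?W (cnorm k c)) \<partial>?P)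
   = (\<integral>\<^sup>+w. indicator {..1} (cnorm k w) * S w \<partial>?P)"
 proof -
  let ?F = "\<lambda>c. G (\<lambda>i\<in>{..<k}. 2 / (1 - \<kappa> * (cnorm k c)^2) * c i) * ennreal (?W (cnorm k c))"
  have "(\<integral>\<^sup>+c. ?F c \<partial>?P)
   = (\<integral>\<^sup>+w. indicator {..1} (cnorm k w) * (\<integral>\<^sup>+s. ?F (\<lambda>i\<in>{..<k}. s / cnorm k w * w i) * ennreal (k * s ^ (k - 1)) * indicator {0<..} s \<partial>lborel) \<partial>?P)"
   by (rule nn_integral_polar[OF k]) measurable
  also have "\<dots> = (\<integral>\<^sup>+w. indicator {..1} (cnorm k w) * S w \<partial>?P)"
  proof (rule nn_integral_cong_AE, use AE_cnorm_pos[OF k] in eventually_elim)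
   fix w assume w: "cnorm k w > 0"
   have "?F (\<lambda>i\<in>{..<k}. s / cnorm k w * w i) * ennreal (k * s ^ (k - 1)) * indicator {0<..} s
     = H w (2 * s / (1 - \<kappa> * s^2)) * ennreal (?W s * (real k * s ^ (k - 1))) * indicator {0<..} s" for s :: real
   proof (cases "s > 0")
    case True
    then have n: "cnorm k (\<lambda>i\<in>{..<k}. s / cnorm k w * w i) = s" using w unfolding cnorm_scale by auto
    have "(\<lambda>i\<in>{..<k}. 2 / (1 - \<kappa> * s^2) * (\<lambda>i\<in>{..<k}. s / cnorm k w * w i) i)
      = (\<lambda>i\<in>{..<k}. (2 * s / (1 - \<kappa> * s^2)) / cnorm k w * w i)" by (intro restrict_ext) simp
    then have "G (\<lambda>i\<in>{..<k}. 2 / (1 - \<kappa> * s^2) * (\<lambda>i\<in>{..<k}. s / cnorm k w * w i) i) = H w (2 * s / (1 - \<kappa> * s^2))"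
     by (simp only: H_def)
    moreover have "ennreal (?W s) * ennreal (k * s ^ (k - 1)) = ennreal (?W s * (real k * s ^ (k - 1)))"
     using True by (subst ennreal_mult[symmetric]) auto
    ultimately show ?thesis using True unfolding n by (simp only: mult.assoc)
   qed simp
   then show "indicator {..1} (cnorm k w) * (\<integral>\<^sup>+s. ?F (\<lambda>i\<in>{..<k}. s / cnorm k w * w i) * ennreal (k * s ^ (k - 1)) * indicator {0<..} s \<partial>lborel)
    = indicator {..1} (cnorm k w) * S w" by (simp only: S_def)
  qed
  finally show ?thesis .
 qed
 \<comment> \<open>The reflection \<open>w \<mapsto> - w\<close> preserves the measure and the unit
   ball; it absorbs the reversed directions of the far hemisphere.\<close>
 have mirror: "(\<integral>\<^sup>+w. indicator {..1} (cnorm k w) * I (\<lambda>i\<in>{..<k}. - 1 * w i) \<partial>?P) = (\<integral>\<^sup>+w. indicator {..1} (cnorm k w) * I w \<partial>?P)"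
  using nn_integral_PiM_scale[of "{..<k}" "- 1" "\<lambda>w. indicator {..1} (cnorm k w) * I w"] Im
  by (simp only: cnorm_scale) (simp add: borel_measurable_times_ennreal)
 have neg: "(\<integral>\<^sup>+y. H w y * ennreal (klein_weight \<kappa> k y * (real k * \<bar>y\<bar> ^ (k - 1))) * indicator {..<0} y \<partial>lborel) = I (\<lambda>i\<in>{..<k}. - 1 * w i)"
  if w: "w \<in> space ?P" for w
 proof -
  note [measurable] = Hm[OF w]
  have "(\<integral>\<^sup>+y. H w y * ennreal (klein_weight \<kappa> k y * (real k * \<bar>y\<bar> ^ (k - 1))) * indicator {..<0} y \<partial>lborel)
   = ennreal \<bar>-1\<bar> * (\<integral>\<^sup>+y. H w (0 + -1 * y) * ennreal (klein_weight \<kappa> k (0 + -1 * y) * (real k * \<bar>0 + -1 * y\<bar> ^ (k - 1))) * indicator {..<0} (0 + -1 * y) \<partial>lborel)"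
   by (rule nn_integral_real_affine) (measurable, auto intro!: open_Collect_less continuous_intros)
  also have "\<dots> = I (\<lambda>i\<in>{..<k}. - 1 * w i)"
  proof -
   have "H w (0 + -1 * y) = H (\<lambda>i\<in>{..<k}. - 1 * w i) y" for y
   proof -
    have "(\<lambda>i\<in>{..<k}. (0 + -1 * y) / cnorm k w * w i)
      = (\<lambda>i\<in>{..<k}. y / cnorm k (\<lambda>i\<in>{..<k}. - 1 * w i) * (\<lambda>i\<in>{..<k}. - 1 * w i) i)"
     unfolding cnorm_scale by (auto simp: fun_eq_iff)
    then show ?thesis by (simp only: H_def)
   qed
   then show ?thesis
    unfolding I_def by (simp add: klein_weight_def) (intro nn_integral_cong, auto split: split_indicator)
  qed
  finally show ?thesis .
 qed
 show ?thesis
 proof (cases "\<kappa> = 1")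
  case False
  then have \<kappa>1: "\<kappa> = - 1" using \<kappa> by simp
  have nz: "1 + s^2 \<noteq> 0" for s :: real using zero_le_power2[of s] by linarith
  have SI: "S w = I w" if w: "w \<in> space ?P" for w
  proof -
   have "S w = (\<integral>\<^sup>+s. H w (2 * s / (1 - \<kappa> * s^2)) * ennreal ((2 / (1 + \<kappa> * s^2)) ^ k * (real k * s ^ (k - 1))) * indicator {0<..<1} s \<partial>lborel)"
    unfolding S_def \<kappa>1 by (intro nn_integral_cong) (auto split: split_indicator simp: abs_square_less_1 power2_less_1_iff)
   also have "\<dots> = (\<integral>\<^sup>+y. H w y * ennreal (klein_weight \<kappa> k y * (real k * \<bar>y\<bar> ^ (k - 1))) * indicator ((\<lambda>s. 2 * s / (1 - \<kappa> * s^2)) ` {0<..<1}) y \<partial>lborel)"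
    by (rule nn_integral_stereo_radius[OF \<kappa> k Hm[OF w], where a=0 and b=1])
     (auto simp: einterval_def \<kappa>1 nz power2_less_1_iff add_pos_nonneg dest: abs_square_less_1[THEN iffD2] intro: less_imp_neq[symmetric] add_pos_nonneg)
   also have "(\<lambda>s. 2 * s / (1 - \<kappa> * s^2)) ` {0<..<1} = {0<..<1}"
    using stereo_radius_image_hyp by (simp add: \<kappa>1)
   also have "(\<integral>\<^sup>+y. H w y * ennreal (klein_weight \<kappa> k y * (real k * \<bar>y\<bar> ^ (k - 1))) * indicator {0<..<1} y \<partial>lborel) = I w"
    unfolding I_def \<kappa>1 by (intro nn_integral_cong) (auto split: split_indicator simp: klein_weight_def power2_less_1_iff)
   finally show ?thesis .
  qed
  then have "(\<integral>\<^sup>+w. indicator {..1} (cnorm k w) * S w \<partial>?P) = (\<integral>\<^sup>+w. indicator {..1} (cnorm k w) * I w \<partial>?P)"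
   by (intro nn_integral_cong) simp
  then show ?thesis using False polar_left polar_right by simp
 next
  case True
  have SI: "S w = I w + I (\<lambda>i\<in>{..<k}. - 1 * w i)" if w: "w \<in> space ?P" for w
  proof -
   note [measurable] = Hm[OF w]
   let ?j = "\<lambda>s. H w (2 * s / (1 - \<kappa> * s^2)) * ennreal ((2 / (1 + \<kappa> * s^2)) ^ k * (real k * s ^ (k - 1)))"
   let ?K = "\<lambda>y. H w y * ennreal (klein_weight \<kappa> k y * (real k * \<bar>y\<bar> ^ (k - 1)))"
   \<comment> \<open>The equator \<open>s = 1\<close>, where the gnomonic radius has its pole, is a
     null set.\<close>
   have "S w = (\<integral>\<^sup>+s. ?j s * indicator {0<..<1} s + ?j s * indicator {1<..} s \<partial>lborel)"
    unfolding S_def True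
   proof (rule nn_integral_cong_AE, use AE_lborel_singleton[of "1::real"] in eventually_elim)
    fix s :: real assume "s \<noteq> 1"
    then show "H w (2 * s / (1 - 1 * s^2)) * ennreal ((if 1 + 1 * s^2 > 0 then (2 / (1 + 1 * s^2)) ^ k else 0) * (real k * s ^ (k - 1))) * indicator {0<..} s
     = H w (2 * s / (1 - 1 * s^2)) * ennreal ((2 / (1 + 1 * s^2)) ^ k * (real k * s ^ (k - 1))) * indicator {0<..<1} s
      + H w (2 * s / (1 - 1 * s^2)) * ennreal ((2 / (1 + 1 * s^2)) ^ k * (real k * s ^ (k - 1))) * indicator {1<..} s"
     by (auto split: split_indicator simp: add_pos_nonneg)
   qed
   also have "\<dots> = (\<integral>\<^sup>+s. ?j s * indicator {0<..<1} s \<partial>lborel) + (\<integral>\<^sup>+s. ?j s * indicator {1<..} s \<partial>lborel)"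
    by (rule nn_integral_add) measurable
   also have "(\<integral>\<^sup>+s. ?j s * indicator {0<..<1} s \<partial>lborel) = (\<integral>\<^sup>+y. ?K y * indicator ((\<lambda>s. 2 * s / (1 - \<kappa> * s^2)) ` {0<..<1}) y \<partial>lborel)"
    by (rule nn_integral_stereo_radius[OF \<kappa> k Hm[OF w], where a=0 and b=1])
     (auto simp: einterval_def True add_pos_nonneg power2_eq_1_iff)
   also have "(\<lambda>s. 2 * s / (1 - \<kappa> * s^2)) ` {0<..<1} = {0<..}"
    using stereo_radius_image_sphere by (simp add: True)
   also have "(\<integral>\<^sup>+s. ?j s * indicator {1<..} s \<partial>lborel) = (\<integral>\<^sup>+y. ?K y * indicator ((\<lambda>s. 2 * s / (1 - \<kappa> * s^2)) ` {1<..}) y \<partial>lborel)"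
    by (rule nn_integral_stereo_radius[OF \<kappa> k Hm[OF w], where a=1 and b=\<infinity>])
     (auto simp: einterval_def True add_pos_nonneg power2_eq_1_iff)
   also have "(\<lambda>s. 2 * s / (1 - \<kappa> * s^2)) ` {1<..} = {..<0}"
    using stereo_radius_image_sphere' by (simp add: True)
   finally show ?thesis by (simp only: neg[OF w]) (simp only: I_def)
  qed
  have [measurable]: "(\<lambda>w. I (\<lambda>i\<in>{..<k}. - 1 * w i)) \<in> borel_measurable ?P"
   by (rule measurable_compose[OF _ Im]) measurable
  note Im[measurable]
  have "(\<integral>\<^sup>+w. indicator {..1} (cnorm k w) * S w \<partial>?P)
   = (\<integral>\<^sup>+w. indicator {..1} (cnorm k w) * I w + indicator {..1} (cnorm k w) * I (\<lambda>i\<in>{..<k}. - 1 * w i) \<partial>?P)"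
   by (intro nn_integral_cong) (simp only: SI distrib_left)
  also have "\<dots> = (\<integral>\<^sup>+w. indicator {..1} (cnorm k w) * I w \<partial>?P) + (\<integral>\<^sup>+w. indicator {..1} (cnorm k w) * I (\<lambda>i\<in>{..<k}. - 1 * w i) \<partial>?P)"
   by (rule nn_integral_add) measurable
  also have "\<dots> = 2 * (\<integral>\<^sup>+w. indicator {..1} (cnorm k w) * I w \<partial>?P)"
   by (simp only: mirror) (simp add: mult_2)
  finally show ?thesis unfolding polar_left polar_right using True by simp
 qed
qed

section \<open>From the gnomonic radius to the distance from the centre\<close>

lemma klein_radius_image:
 assumes \<kappa>: "\<kappa> = 0 \<or> \<kappa> = 1 \<or> \<kappa> = - 1" and r: "0 < r" "\<kappa> * r^2 < 1"
 shows "(\<lambda>t. sqrt ((t\<^sup>2 - r\<^sup>2) / (1 - \<kappa> * t^2))) ` {t. r < t \<and> \<kappa> * t^2 < 1} = {s. 0 < s \<and> 1 + \<kappa> * s^2 > 0}"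
proof (intro equalityI subsetI)
 fix s assume "s \<in> (\<lambda>t. sqrt ((t\<^sup>2 - r\<^sup>2) / (1 - \<kappa> * t^2))) ` {t. r < t \<and> \<kappa> * t^2 < 1}"
 then obtain t where t: "r < t" "\<kappa> * t^2 < 1" and s: "s = sqrt ((t\<^sup>2 - r\<^sup>2) / (1 - \<kappa> * t^2))"
  by auto
 have tr: "r\<^sup>2 < t^2" using t r by (simp add: power_strict_mono)
 have s2: "s\<^sup>2 = (t\<^sup>2 - r\<^sup>2) / (1 - \<kappa> * t^2)" and s0: "0 < s" using s t tr by auto
 have "1 + \<kappa> * s^2 = (1 - \<kappa> * r^2) / (1 - \<kappa> * t^2)"
  using t unfolding s2 by (simp add: field_simps)
 then show "s \<in> {s. 0 < s \<and> 1 + \<kappa> * s^2 > 0}" using s0 t r by simp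
next
 fix s assume "s \<in> {s. 0 < s \<and> 1 + \<kappa> * s^2 > 0}"
 then have s: "0 < s" "1 + \<kappa> * s^2 > 0" by auto
 \<comment> \<open>Obtained by solving \<open>s^2 = (t^2 - r^2) / (1 - \<kappa> t^2)\<close> for
   \<open>t\<close>.\<close>
 define t where "t = sqrt ((s\<^sup>2 + r^2) / (1 + \<kappa> * s^2))"
 have t2: "t\<^sup>2 = (s\<^sup>2 + r^2) / (1 + \<kappa> * s^2)"
  using s by (simp add: t_def add_nonneg_nonneg)
 have "t\<^sup>2 - r\<^sup>2 = s^2 * (1 - \<kappa> * r^2) / (1 + \<kappa> * s^2)"
  using s unfolding t2 by (simp add: field_simps)
 moreover have "\<dots> > 0" using s r by simp
 ultimately have "r\<^sup>2 < t^2" and num: "t\<^sup>2 - r\<^sup>2 = s^2 * (1 - \<kappa> * r^2) / (1 + \<kappa> * s^2)"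
  by auto
 moreover have "0 \<le> t" using s by (simp add: t_def)
 ultimately have rt: "r < t" using power_less_imp_less_base by blast
 have den: "1 - \<kappa> * t^2 = (1 - \<kappa> * r^2) / (1 + \<kappa> * s^2)"
  using s unfolding t2 by (simp add: field_simps)
 then have "1 - \<kappa> * t^2 > 0" using r s by simp
 moreover have "sqrt ((t\<^sup>2 - r\<^sup>2) / (1 - \<kappa> * t^2)) = s" unfolding num den using s r by simp
 ultimately show "s \<in> (\<lambda>t. sqrt ((t\<^sup>2 - r\<^sup>2) / (1 - \<kappa> * t^2))) ` {t. r < t \<and> \<kappa> * t^2 < 1}"
  using rt by (intro image_eqI[of _ _ t]) auto
qed

text \<open>The kernel of an Abel-type integral for \<open>k = 2 * m\<close>. The cut-off
  \<open>\<kappa> * t^2 < 1\<close> is the equator of the sphere around the centre; for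
  \<open>\<kappa> \<le> 0\<close> it holds for every \<open>t\<close>.\<close>

definition radial_density :: "real => nat => real => real => real" where
 "radial_density \<kappa> m r t = (if r < t \<and> \<kappa> * t^2 < 1
   then (t\<^sup>2 - r\<^sup>2) ^ (m - 1) * t * (1 - \<kappa> * t^2) powr (- (1 / 2)) else 0)"

lemma radial_density_nonneg: "0 \<le> r ==> 0 \<le> radial_density \<kappa> m r t"
 by (auto simp: radial_density_def intro!: mult_nonneg_nonneg zero_le_power power_mono)

lemma measurable_radial_density [measurable]: "radial_density \<kappa> m r \<in> borel_measurable borel"
 unfolding radial_density_def by measurable

text \<open>With \<open>A = 1 - \<kappa> r^2\<close>, \<open>B = 1 - \<kappa> t^2\<close>,
  \<open>C = t^2 - r^2\<close> one has \<open>g^2 = C / B\<close> and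
  \<open>1 + \<kappa> g^2 = A / B\<close>. The powers of \<open>B\<close> add up to - 1/2; the power
  of \<open>A\<close> does not depend on \<open>t\<close> and is the inverse of the factor \<lambda>
  of the theorem.\<close>

lemma klein_radius_weight:
 assumes m: "m \<ge> 1" and r: "0 < r" "\<kappa> * r^2 < 1" and t: "r < t" "\<kappa> * t^2 < 1"
 defines "g \<equiv> sqrt ((t\<^sup>2 - r\<^sup>2) / (1 - \<kappa> * t^2))"
  and "g' \<equiv> t * (1 - \<kappa> * r^2) / (1 - \<kappa> * t^2)^2 / sqrt ((t\<^sup>2 - r\<^sup>2) / (1 - \<kappa> * t^2))"
 shows "klein_weight \<kappa> (2 * m) g * (real (2 * m) * g ^ (2 * m - 1)) * g'
  = real (2 * m) * (1 - \<kappa> * r^2) powr (- ((real (2 * m) - 1) / 2)) * radial_density \<kappa> m r t"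
proof -
 define A where "A = 1 - \<kappa> * r^2"
 define B where "B = 1 - \<kappa> * t^2"
 define C where "C = t^2 - r\<^sup>2"
 have A: "A > 0" and B: "B > 0" and C: "C > 0" using r t by (auto simp: A_def B_def C_def power_strict_mono)
 have g: "g > 0" "g\<^sup>2 = C / B" using B C by (simp_all add: g_def B_def[symmetric] C_def[symmetric])
 have "1 + \<kappa> * g^2 = A / B" unfolding g(2) A_def B_def C_def using t by (simp add: field_simps)
 then have w: "klein_weight \<kappa> (2 * m) g = (A / B) powr (- (real m + 1 / 2))"
 proof -
  have "(real (2 * m) + 1) / 2 = real m + 1 / 2" by (simp add: add_divide_distrib)
  moreover have "A / B > 0" using A B by simp
  ultimately show ?thesis
   unfolding klein_weight_def \<open>1 + \<kappa> * g^2 = A / B\<close> by (simp only: if_True)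
 qed
 have g': "g' = t * A / B^2 / g" by (simp add: g'_def g_def A_def B_def)
 obtain j where j: "m = Suc j" using m by (cases m) auto
 have "g ^ (2 * m - 1) * g' = (g\<^sup>2) ^ j * t * A / B^2"
  using g(1) by (simp add: j g' power_mult[symmetric])
 also have "\<dots> = C ^ j * t * A / (B ^ j * B^2)" by (simp add: g(2) power_divide)
 also have "\<dots> = C ^ j * t * A * B powr (- (real j + 2))"
  using B by (simp only: powr_minus powr_add powr_realpow powr_numeral divide_inverse)
 finally have gg: "g ^ (2 * m - 1) * g' = C ^ j * t * A * B powr (- (real j + 2))" .
 have AB: "(A / B) powr (- (real m + 1 / 2)) = A powr (- (real m + 1 / 2)) * B powr (real m + 1 / 2)"
 proof -
  define x where "x = real m + 1 / 2"
  have "(A / B) powr (- x) = A powr (- x) / B powr (- x)" using A B by (simp add: powr_divide)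
  then show ?thesis unfolding x_def[symmetric] by (simp add: powr_minus divide_inverse)
 qed
 have "klein_weight \<kappa> (2 * m) g * (g ^ (2 * m - 1) * g')
   = C ^ j * t * (A powr (- (real m + 1 / 2)) * A powr 1) * (B powr (real m + 1 / 2) * B powr (- (real j + 2)))"
  using A unfolding w gg AB by (simp add: mult_ac)
 also have "A powr (- (real m + 1 / 2)) * A powr 1 = A powr (- ((real (2 * m) - 1) / 2))"
  unfolding powr_add[symmetric] by (rule arg_cong[where f="(powr) A"]) (simp add: field_simps)
 also have "B powr (real m + 1 / 2) * B powr (- (real j + 2)) = B powr (- (1 / 2))"
  by (subst powr_add[symmetric]) (simp add: j)
 finally have "klein_weight \<kappa> (2 * m) g * (g ^ (2 * m - 1) * g')
   = C ^ j * t * A powr (- ((real (2 * m) - 1) / 2)) * B powr (- (1 / 2))" .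
 then show ?thesis using t by (simp add: radial_density_def j A_def B_def C_def mult_ac)
qed

lemma nn_integral_klein_radius:
 assumes \<kappa>: "\<kappa> = 0 \<or> \<kappa> = 1 \<or> \<kappa> = - 1" and m: "m \<ge> 1" and r: "0 < r" "\<kappa> * r^2 < 1"
  and h[measurable]: "h \<in> borel_measurable borel"
 shows "(\<integral>\<^sup>+z. h (sqrt (((cnorm (2 * m) z)^2 + r^2) / (1 + \<kappa> * (cnorm (2 * m) z)^2))) *
    ennreal (klein_weight \<kappa> (2 * m) (cnorm (2 * m) z)) \<partial>lborel_PiM (2 * m))
  = ennreal (real (2 * m) * unit_ball_vol (real (2 * m)) * (1 - \<kappa> * r^2) powr (- ((real (2 * m) - 1) / 2))) *
   (\<integral>\<^sup>+t. h t * ennreal (radial_density \<kappa> m r t) \<partial>lborel)"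
proof -
 let ?k = "2 * m"
 let ?v = "\<lambda>s. sqrt ((s\<^sup>2 + r^2) / (1 + \<kappa> * s^2))"
 let ?g = "\<lambda>t. sqrt ((t\<^sup>2 - r\<^sup>2) / (1 - \<kappa> * t^2))"
 let ?g' = "\<lambda>t. t * (1 - \<kappa> * r^2) / (1 - \<kappa> * t^2)^2 / sqrt ((t\<^sup>2 - r\<^sup>2) / (1 - \<kappa> * t^2))"
 let ?f = "\<lambda>s. h (?v s) * ennreal (klein_weight \<kappa> ?k s) * ennreal (real ?k * s ^ (?k - 1))"
 define c where "c = real ?k * (1 - \<kappa> * r^2) powr (- ((real ?k - 1) / 2))"
 \<comment> \<open>The supremum of the admissible radii: the chart is the unit ball on the sphere
   and the whole space otherwise.\<close>
 define b :: ereal where "b = (if \<kappa> = 1 then 1 else \<infinity>)"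
 have E: "einterval r b = {t. r < t \<and> \<kappa> * t^2 < 1}"
 proof -
  have "t\<^sup>2 < 1 \<longleftrightarrow> t < 1" if "r < t" for t
   using that r(1) by (simp add: power2_less_1_iff abs_if)
  moreover have "- t\<^sup>2 < 1" for t :: real by (rule le_less_trans[of _ 0]) auto
  ultimately show ?thesis using \<kappa> by (auto simp: einterval_def b_def)
 qed
 have rb: "ereal r < b" using r \<kappa> by (auto simp: b_def power2_less_1_iff abs_if)
 have "(\<integral>\<^sup>+z. h (?v (cnorm ?k z)) * ennreal (klein_weight \<kappa> ?k (cnorm ?k z)) \<partial>lborel_PiM ?k)
   = ennreal (unit_ball_vol ?k) * (\<integral>\<^sup>+s. h (?v s) * ennreal (klein_weight \<kappa> ?k s) * ennreal (real ?k * s ^ (?k - 1)) * indicator {0<..} s \<partial>lborel)"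
  by (rule nn_integral_radial) (use m in \<open>simp, measurable\<close>)
 also have "(\<integral>\<^sup>+s. h (?v s) * ennreal (klein_weight \<kappa> ?k s) * ennreal (real ?k * s ^ (?k - 1)) * indicator {0<..} s \<partial>lborel)
   = (\<integral>\<^sup>+s. ?f s * indicator (?g ` einterval r b) s \<partial>lborel)"
  unfolding E klein_radius_image[OF \<kappa> r]
  by (intro nn_integral_cong) (auto split: split_indicator simp: klein_weight_def)
 also have "\<dots> = (\<integral>\<^sup>+t. ?f (?g t) * ennreal (?g' t) * indicator (einterval r b) t \<partial>lborel)"
 proof (rule nn_integral_substitution_einterval[OF _ rb])
  show "?f \<in> borel_measurable borel" by measurable
  have pos: "t\<^sup>2 - r\<^sup>2 > 0" "1 - \<kappa> * t^2 > 0" "t > 0" if "t \<in> einterval r b" for t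
   using that r by (auto simp: E power_strict_mono)
  show "continuous_on (einterval r b) ?g'" using pos by (intro continuous_intros ballI) (fastforce dest: pos)+
  fix t assume "t \<in> einterval r b"
  note p = pos[OF this]
  have "((\<lambda>t. (t\<^sup>2 - r\<^sup>2) / (1 - \<kappa> * t^2)) has_real_derivative 2 * t * (1 - \<kappa> * r^2) / (1 - \<kappa> * t^2)^2) (at t)"
   using p by (auto intro!: derivative_eq_intros simp: power2_eq_square divide_simps) (simp add: algebra_simps)
  from DERIV_real_sqrt[THEN DERIV_chain2, OF _ this]
  have "(?g has_real_derivative inverse (?g t) / 2 * (2 * t * (1 - \<kappa> * r^2) / (1 - \<kappa> * t^2)^2)) (at t)"
   using p by simp
  also have "inverse (?g t) / 2 * (2 * t * (1 - \<kappa> * r^2) / (1 - \<kappa> * t^2)^2) = ?g' t"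
  proof -
   have *: "x * inverse 2 * (2 * t * b * y) = t * b * y * x" for x y b :: real by simp
   show ?thesis
    unfolding divide_inverse[of _ "?g t"] divide_inverse[of _ 2] divide_inverse[of _ "(1 - \<kappa> * t^2)^2"] by (rule *)
  qed
  finally show "(?g has_real_derivative ?g' t) (at t)" .
  show "0 \<le> ?g' t"
   using p r less_imp_le[OF p(1)] by (intro divide_nonneg_nonneg mult_nonneg_nonneg real_sqrt_ge_zero) (linarith | simp)+
 qed
 also have "\<dots> = (\<integral>\<^sup>+t. ennreal c * (h t * ennreal (radial_density \<kappa> m r t)) \<partial>lborel)"
 proof (rule nn_integral_cong)
  fix t
  show "?f (?g t) * ennreal (?g' t) * indicator (einterval r b) t = ennreal c * (h t * ennreal (radial_density \<kappa> m r t))"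
  proof (cases "t \<in> einterval r b")
   case True
   then have t: "r < t" "\<kappa> * t^2 < 1" by (auto simp: E)
   have tr: "t\<^sup>2 - r\<^sup>2 > 0" using t r by (simp add: power_strict_mono)
   have g: "?g t > 0" "(?g t)^2 = (t\<^sup>2 - r\<^sup>2) / (1 - \<kappa> * t^2)" using tr t by auto
   have g'0: "0 \<le> ?g' t"
    using tr t r less_imp_le[OF tr] by (intro divide_nonneg_nonneg mult_nonneg_nonneg real_sqrt_ge_zero) (linarith | simp)+
   have "?v (?g t) = sqrt (t\<^sup>2)"
   proof -
    have d: "1 + \<kappa> * (?g t)^2 = (1 - \<kappa> * r^2) / (1 - \<kappa> * t^2)"
     using t unfolding g(2) by (simp add: field_simps)
    have n: "(?g t)^2 + r^2 = t^2 * (1 - \<kappa> * r^2) / (1 - \<kappa> * t^2)"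
     using t unfolding g(2) by (simp add: field_simps)
    show ?thesis unfolding d n using t r by simp
   qed
   then have v: "?v (?g t) = t" using t r by simp
   have "ennreal (klein_weight \<kappa> ?k (?g t)) * ennreal (real ?k * ?g t ^ (?k - 1)) * ennreal (?g' t)
     = ennreal (klein_weight \<kappa> ?k (?g t) * (real ?k * ?g t ^ (?k - 1)) * ?g' t)"
    using g(1) g'0 by (simp only: ennreal_mult[symmetric] mult_nonneg_nonneg klein_weight_nonneg
      of_nat_0_le_iff zero_le_power less_imp_le)
   also have "\<dots> = ennreal (c * radial_density \<kappa> m r t)" unfolding klein_radius_weight[OF m r t] c_def ..
   also have "\<dots> = ennreal c * ennreal (radial_density \<kappa> m r t)"
    using r by (intro ennreal_mult) (auto simp: c_def radial_density_nonneg)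
   finally have "ennreal (klein_weight \<kappa> ?k (?g t)) * ennreal (real ?k * ?g t ^ (?k - 1)) * ennreal (?g' t)
     = ennreal c * ennreal (radial_density \<kappa> m r t)" .
   then show ?thesis
    using True unfolding v by (simp only: mult.assoc indicator_simps mult_1_right) (simp only: mult.left_commute)
  next
   case False
   then have "radial_density \<kappa> m r t = 0" by (auto simp: E radial_density_def)
   then show ?thesis using False by simp
  qed
 qed
 also have "\<dots> = ennreal c * (\<integral>\<^sup>+t. h t * ennreal (radial_density \<kappa> m r t) \<partial>lborel)"
  by (rule nn_integral_cmult) measurable
 also have "ennreal (unit_ball_vol ?k) * (ennreal c * (\<integral>\<^sup>+t. h t * ennreal (radial_density \<kappa> m r t) \<partial>lborel))
  = ennreal (real ?k * unit_ball_vol (real ?k) * (1 - \<kappa> * r^2) powr (- ((real ?k - 1) / 2))) *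
   (\<integral>\<^sup>+t. h t * ennreal (radial_density \<kappa> m r t) \<partial>lborel)"
  by (subst mult.assoc[symmetric], subst ennreal_mult[symmetric]) (auto simp: c_def mult_ac)
 finally show ?thesis .
qed

section \<open>Haar measure on the orthogonal group\<close>

abbreviation orthogonal_matrices :: "((real^'n)^'n) set" where
 "orthogonal_matrices \<equiv> {A. orthogonal_matrix A}"

abbreviation borel_orthogonal :: "((real^'n)^'n) measure" where
 "borel_orthogonal \<equiv> restrict_space borel orthogonal_matrices"

lemma continuous_on_matrix_mult:
 fixes f g :: "'a::topological_space => (real^'n)^'n"
 assumes "continuous_on S f" "continuous_on S g"
 shows "continuous_on S (\<lambda>x. f x ** g x)" unfolding matrix_matrix_mult_def by (intro continuous_intros assms)

lemma continuous_on_transpose: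
 fixes f :: "'a::topological_space => (real^'n)^'n"
 assumes "continuous_on S f"
 shows "continuous_on S (\<lambda>x. transpose (f x))" unfolding transpose_def by (intro continuous_intros assms)

text \<open>The law of one column of the random matrix; any rotation-invariant probability measure
  that vanishes on proper subspaces would serve.\<close>

definition ball_measure :: "(real^'n::finite) measure" where
 "ball_measure = uniform_measure lborel (ball 0 1)"

lemma emeasure_unit_ball_pos: "emeasure lborel (ball (0 :: real^'n::finite) 1) > 0" by (simp add: emeasure_ball)

lemma prob_space_ball_measure: "prob_space (ball_measure :: (real^'n::finite) measure)" unfolding ball_measure_def
proof (rule prob_space_uniform_measure)
 show "emeasure lborel (ball (0 :: real^'n) 1) \<noteq> 0" using emeasure_unit_ball_pos by (metis less_irrefl)
qed (simp add: emeasure_ball)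

lemma sets_ball_measure [simp, measurable_cong]: "sets ball_measure = sets borel" by (simp add: ball_measure_def)

lemma distr_ball_measure:
 fixes A :: "(real^'n::finite)^'n::finite"
 assumes A: "orthogonal_matrix A"
 shows "distr ball_measure borel ((*v) A) = ball_measure"
proof (rule measure_eqI)
 have mA[measurable]: "(*v) A \<in> borel_measurable borel"
  by (intro borel_measurable_continuous_onI continuous_intros)
 have norm: "norm (A *v v) = norm v" for v
  using A by (metis orthogonal_transformation_matrix matrix_of_matrix_vector_mul matrix_vector_mul_linear orthogonal_transformation_norm)
 fix X assume "X \<in> sets (distr ball_measure borel ((*v) A))"
 then have X[measurable]: "X \<in> sets borel" by simp
 have "emeasure (distr ball_measure borel ((*v) A)) X = emeasure ball_measure ((*v) A -` X)"
  by (subst emeasure_distr) (auto simp: measurable_def[of ball_measure] ball_measure_def)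
 also have "\<dots> = emeasure lborel (ball 0 1 \<inter> (*v) A -` X) / emeasure lborel (ball (0 :: real^'n) 1)"
  unfolding ball_measure_def using measurable_sets[OF mA X] by (subst emeasure_uniform_measure) auto
 also have "ball 0 1 \<inter> (*v) A -` X = (*v) A -` (ball 0 1 \<inter> X)" by (auto simp: norm)
 also have "emeasure lborel ((*v) A -` (ball 0 1 \<inter> X)) = emeasure (distr lborel borel ((*v) A)) (ball 0 1 \<inter> X)"
  by (subst emeasure_distr) auto
 also have "\<dots> = emeasure lborel (ball 0 1 \<inter> X)" by (simp add: distr_lborel_orthogonal[OF A])
 also have "\<dots> / emeasure lborel (ball (0 :: real^'n) 1) = emeasure ball_measure X"
  unfolding ball_measure_def by (subst emeasure_uniform_measure) auto
 finally show "emeasure (distr ball_measure borel ((*v) A)) X = emeasure ball_measure X" .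
qed simp

lemma emeasure_ball_measure_span:
 fixes S :: "(real^'n::finite) set"
 assumes "finite S" "card S < CARD('n)"
 shows "emeasure ball_measure (span S) = 0" and "span S \<in> sets borel"
proof -
 have cl: "closed (span S)" by (rule closed_subspace) simp
 then show b: "span S \<in> sets borel" by (rule borel_closed)
 have "dim (span S) < DIM(real^'n)" using assms dim_le_card'[of S] by (simp add: le_less_trans)
 then have "negligible (span S)" by (rule negligible_lowdim)
 then have "emeasure lborel (span S) = 0" using b by (simp add: negligible_iff_emeasure0)
 then have "emeasure lborel (ball 0 1 \<inter> span S) = 0"
  using b by (metis Int_commute emeasure_mono inf_le1 le_zero_eq sets_lborel)
 then show "emeasure ball_measure (span S) = 0"
  unfolding ball_measure_def using b by (subst emeasure_uniform_measure) auto
qed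

text \<open>\<open>sgn\<close> normalizes and sends 0 to 0, so the recursion is total;
  orthonormality holds where no residue vanishes.\<close>

fun gram_schmidt :: "(nat => 'a::real_inner) => nat => 'a" where
 "gram_schmidt V i = sgn (V i - (\<Sum>j<i. (V i \<bullet> gram_schmidt V j) *\<^sub>R gram_schmidt V j))"

declare gram_schmidt.simps [simp del]

definition gs_residue :: "(nat => 'a::real_inner) => nat => 'a" where
 "gs_residue V i = V i - (\<Sum>j<i. (V i \<bullet> gram_schmidt V j) *\<^sub>R gram_schmidt V j)"

lemma gram_schmidt_eq: "gram_schmidt V i = sgn (gs_residue V i)"
 by (simp add: gram_schmidt.simps[of V i] gs_residue_def)

lemma gram_schmidt_cong:
 assumes "\<And>j. j \<le> i ==> V j = V' j"
 shows "gram_schmidt V i = gram_schmidt V' i" using assms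
proof (induction i rule: less_induct)
 case (less i)
 then show ?case by (simp add: gram_schmidt.simps[of _ i])
qed

lemma gram_schmidt_orthonormal:
 assumes "\<And>i. i < N ==> gs_residue V i \<noteq> 0" "i < N" "j < N"
 shows "gram_schmidt V i \<bullet> gram_schmidt V j = (if i = j then 1 else 0)"
proof -
 have unit: "gram_schmidt V i \<bullet> gram_schmidt V i = 1" if "i < N" for i
  using assms(1)[OF that] by (simp add: gram_schmidt_eq norm_sgn dot_square_norm)
 have orth: "gram_schmidt V i \<bullet> gram_schmidt V j = 0" if "j < i" "i < N" for i j using that
 proof (induction i arbitrary: j rule: less_induct)
  case (less i)
  have "gram_schmidt V l \<bullet> gram_schmidt V j = (if l = j then 1 else 0)" if "l < i" for l
   using less that unit[of j] by (metis inner_commute linorder_neqE_nat order.strict_trans)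
  then have "(\<Sum>l<i. (V i \<bullet> gram_schmidt V l) * (gram_schmidt V l \<bullet> gram_schmidt V j)) = V i \<bullet> gram_schmidt V j"
   using less.prems by (simp add: if_distrib[of "\<lambda>x. _ * x"] cong: if_cong)
  then have "gs_residue V i \<bullet> gram_schmidt V j = 0"
   by (simp add: gs_residue_def inner_diff_left inner_sum_left)
  then show ?case by (simp add: gram_schmidt_eq[of V i] sgn_div_norm)
 qed
 show ?thesis using orth unit assms(2,3) by (metis inner_commute linorder_neqE_nat)
qed

text \<open>The process uses only inner products and linear combinations, so it commutes with
  orthogonal maps. This equivariance becomes left invariance of the Haar measure.\<close>

lemma gram_schmidt_orthogonal_transformation:
 assumes "orthogonal_transformation f"
 shows "gram_schmidt (\<lambda>i. f (V i)) i = f (gram_schmidt V i)"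
proof (induction i rule: less_induct)
 case (less i)
 interpret linear f using assms by (rule orthogonal_transformation_linear)
 have "gs_residue (\<lambda>i. f (V i)) i = f (gs_residue V i)"
  using less assms by (simp add: gs_residue_def diff sum scale orthogonal_transformation_def)
 then show ?case using assms by (simp add: gram_schmidt_eq sgn_div_norm orthogonal_transformation_norm scale)
qed

lemma measurable_gram_schmidt:
 fixes V :: "'b => nat => 'a::euclidean_space"
 assumes "\<And>j. j \<le> i ==> (\<lambda>c. V c j) \<in> borel_measurable M"
 shows "(\<lambda>c. gram_schmidt (V c) i) \<in> borel_measurable M"
  and "(\<lambda>c. gs_residue (V c) i) \<in> borel_measurable M"
proof -
 have *: "(\<lambda>c. gram_schmidt (V c) i) \<in> borel_measurable M \<and> (\<lambda>c. gs_residue (V c) i) \<in> borel_measurable M"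
  using assms
 proof (induction i rule: less_induct)
  case (less i)
  have IH[measurable]: "(\<lambda>c. gram_schmidt (V c) j) \<in> borel_measurable M" if "j \<in> {..<i}" for j
   using less that by auto
  have [measurable]: "(\<lambda>c. V c i) \<in> borel_measurable M" using less.prems by simp
  have "(\<lambda>c. gs_residue (V c) i) \<in> borel_measurable M" unfolding gs_residue_def by measurable
  then show ?case by (simp add: gram_schmidt_eq sgn_div_norm)
 qed
 then show "(\<lambda>c. gram_schmidt (V c) i) \<in> borel_measurable M" "(\<lambda>c. gs_residue (V c) i) \<in> borel_measurable M"
  by auto
qed

text \<open>Integrate over the \<open>i\<close>-th vector with the others held fixed: its residue
  vanishes only if it lies in the span of the \<open>i < N\<close> vectors constructed before, and
  that span is a null set.\<close>

lemma AE_gs_residue: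
 assumes "N = CARD('n::finite)"
 shows "AE V in (\<Pi>\<^sub>M i\<in>{..<N}. (ball_measure :: (real^'n) measure)). \<forall>i<N. gs_residue V i \<noteq> 0"
proof -
 let ?B = "ball_measure :: (real^'n) measure"
 interpret B: prob_space ?B by (rule prob_space_ball_measure)
 interpret product_prob_space "\<lambda>_. ?B" "{..<N}" ..
 have "AE V in (\<Pi>\<^sub>M i\<in>{..<N}. ?B). gs_residue V i \<noteq> 0" if i: "i < N" for i
 proof -
  let ?I = "{..<N} - {i}"
  have ins: "{..<N} = insert i ?I" using i by auto
  have comp: "(\<lambda>V. V j) \<in> borel_measurable (\<Pi>\<^sub>M i\<in>{..<N}. ?B)" if "j \<le> i" for j
   using measurable_component_singleton[of j "{..<N}" "\<lambda>_. ?B"] that i by simp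
  have meas: "(\<lambda>V. gs_residue V i) \<in> borel_measurable (\<Pi>\<^sub>M i\<in>{..<N}. ?B)"
   using comp by (rule measurable_gram_schmidt)
  then have fm: "(\<lambda>V. indicator {0} (gs_residue V i) :: ennreal) \<in> borel_measurable (\<Pi>\<^sub>M i\<in>{..<N}. ?B)"
   by measurable
  have "(\<integral>\<^sup>+V. indicator {0} (gs_residue V i) \<partial>(\<Pi>\<^sub>M i\<in>{..<N}. ?B))
   = (\<integral>\<^sup>+V. (\<integral>\<^sup>+y. indicator {0} (gs_residue (V(i := y)) i) \<partial>?B) \<partial>(\<Pi>\<^sub>M i\<in>?I. ?B))"
   using product_nn_integral_insert[of ?I i "\<lambda>V. indicator {0} (gs_residue V i)"] fm
   by (simp only: ins[symmetric] finite_Diff finite_lessThan Diff_iff insert_iff simp_thms)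
  also have "\<dots> = (\<integral>\<^sup>+V. 0 \<partial>(\<Pi>\<^sub>M i\<in>?I. ?B))"
  proof (rule nn_integral_cong)
   fix V :: "nat => real^'n"
   let ?S = "gram_schmidt V ` {..<i}"
   have S: "finite ?S" "card ?S < CARD('n)" using i assms card_image_le[of "{..<i}" "gram_schmidt V"] by auto
   have gs: "gram_schmidt (V(i := y)) j = gram_schmidt V j" if "j < i" for y j
    using that by (intro gram_schmidt_cong) auto
   have "y \<in> span ?S" if "gs_residue (V(i := y)) i = 0" for y
   proof -
    have "y = (\<Sum>j<i. (y \<bullet> gram_schmidt V j) *\<^sub>R gram_schmidt V j)"
     using that by (simp add: gs_residue_def gs)
    also have "\<dots> \<in> span ?S" by (intro span_sum span_scale span_base) auto
    finally show ?thesis .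
   qed
   then have "(\<integral>\<^sup>+y. indicator {0} (gs_residue (V(i := y)) i) \<partial>?B) \<le> (\<integral>\<^sup>+y. indicator (span ?S) y \<partial>?B)"
    by (intro nn_integral_mono) (auto split: split_indicator)
   also have "\<dots> = 0" using emeasure_ball_measure_span[OF S] by simp
   finally show "(\<integral>\<^sup>+y. indicator {0} (gs_residue (V(i := y)) i) \<partial>?B) = 0" by simp
  qed
  finally have "(\<integral>\<^sup>+V. indicator {0} (gs_residue V i) \<partial>(\<Pi>\<^sub>M i\<in>{..<N}. ?B)) = 0"
   by simp
  then have "AE V in (\<Pi>\<^sub>M i\<in>{..<N}. ?B). indicator {0} (gs_residue V i) = (0::ennreal)"
   using nn_integral_0_iff_AE[OF fm] by simp
  then show ?thesis by eventually_elim (auto split: split_indicator_asm)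
 qed
 then have "AE V in (\<Pi>\<^sub>M i\<in>{..<N}. ?B). \<forall>i\<in>{..<N}. gs_residue V i \<noteq> 0"
  by (subst AE_finite_all) auto
 then show ?thesis by eventually_elim auto
qed

section \<open>Haar measure as the law of a random orthonormal frame\<close>

lemma space_borel_orthogonal [simp]: "space borel_orthogonal = orthogonal_matrices"
 by (simp add: space_restrict_space)

lemma measurable_matrix_mult:
 "(\<lambda>p. fst p ** (snd p :: (real^'n)^'n)) \<in> (borel :: ((real^'n)^'n) measure) \<Otimes>\<^sub>M borel \<rightarrow>\<^sub>M borel"
 unfolding borel_prod by (intro borel_measurable_continuous_onI continuous_on_matrix_mult continuous_intros)

text \<open>The columns of the random matrix are the Gram-Schmidt frame of independent uniform
  vectors. Left multiplication by an orthogonal \<open>C\<close> acts on each of these vectors,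
  whose joint law it preserves, and Gram-Schmidt commutes with it.\<close>

lemma left_haar_exists:
 "\<exists>\<mu> :: ((real^'n::finite)^'n::finite) measure. prob_space \<mu> \<and> sets \<mu> = sets borel_orthogonal \<and>
   (\<forall>B. orthogonal_matrix B \<longrightarrow> distr \<mu> \<mu> (\<lambda>A. B ** A) = \<mu>)"
proof -
 define N where "N = CARD('n)"
 obtain e :: "nat => 'n" where e: "bij_betw e {..<N} UNIV"
  using ex_bij_betw_nat_finite[of "UNIV :: 'n set"] by (auto simp: N_def atLeast0LessThan)
 define g where "g = inv_into {..<N} e"
 have g: "g j < N" "e (g j) = j" for j using e unfolding g_def
  by (metis UNIV_I bij_betw_def inv_into_into lessThan_iff, metis UNIV_I bij_betw_inv_into_right e)
 let ?B = "ball_measure :: (real^'n) measure"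
 let ?P = "\<Pi>\<^sub>M i\<in>{..<N}. ?B"
 interpret B: prob_space ?B by (rule prob_space_ball_measure)
 interpret product_prob_space "\<lambda>_. ?B" "{..<N}" ..
 interpret P: prob_space ?P by (rule prob_space_PiM) (rule prob_space_ball_measure)
 define U :: "(nat => real^'n) => (real^'n)^'n" where
  "U V = (\<chi> i j. gram_schmidt V (g j) $ i)" for V
 \<comment> \<open>The identity matrix is a default on the null set of degenerate samples, so that
   \<open>Q\<close> always takes values in the group.\<close>
 define Q where "Q V = (if orthogonal_matrix (U V) then U V else mat 1)" for V
 have U_orth: "orthogonal_matrix (U V)" if "\<forall>i<N. gs_residue V i \<noteq> 0" for V
 proof -
  have "(\<Sum>p\<in>UNIV. gram_schmidt V (g i) $ p * gram_schmidt V (g j) $ p) = (if i = j then 1 else 0)" for i j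
   using gram_schmidt_orthonormal[of N V "g i" "g j"] that g by (simp add: inner_vec_def) (metis g(2))
  then show ?thesis unfolding orthogonal_matrix
   by (simp add: vec_eq_iff matrix_matrix_mult_def transpose_def U_def mat_def)
 qed
 have [measurable]: "Measurable.pred borel (orthogonal_matrix :: (real^'n)^'n => bool)"
 proof -
  have "closed (orthogonal_matrices :: ((real^'n)^'n) set)" unfolding orthogonal_matrix
   by (intro closed_Collect_eq continuous_on_matrix_mult continuous_intros continuous_on_transpose)
  then show ?thesis by (simp add: pred_def borel_closed)
 qed
 have comp: "(\<lambda>V. V j) \<in> borel_measurable ?P" if "j < N" for j
  using measurable_component_singleton[of j "{..<N}" "\<lambda>_. ?B"] that by simp
 have Um[measurable]: "U \<in> borel_measurable ?P"
 proof -
  have gm: "(\<lambda>V. gram_schmidt V (g j)) \<in> borel_measurable ?P" for j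
   by (rule measurable_gram_schmidt) (use comp g le_less_trans in blast)
  show ?thesis
  proof (rule borel_measurable_euclidean_space[THEN iffD2], rule ballI)
   fix b :: "(real^'n)^'n" assume "b \<in> Basis"
   then obtain i j where b: "b = axis i (axis j 1)" by (auto simp: Basis_vec_def)
   have "(\<lambda>V. gram_schmidt V (g j) \<bullet> axis i 1) \<in> borel_measurable ?P" using gm by measurable
   then show "(\<lambda>V. U V \<bullet> b) \<in> borel_measurable ?P" by (simp add: b inner_axis U_def)
  qed
 qed
 have Qm[measurable]: "Q \<in> ?P \<rightarrow>\<^sub>M borel_orthogonal"
  by (rule measurable_restrict_space2) (auto simp: Q_def orthogonal_matrix_id, unfold Q_def, measurable)
 define \<mu> where "\<mu> = distr ?P borel_orthogonal Q"
 have "distr \<mu> \<mu> (\<lambda>A. C ** A) = \<mu>" if C: "orthogonal_matrix C" for C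
 proof -
  have Cm: "(\<lambda>A :: (real^'n)^'n. C ** A) \<in> borel_orthogonal \<rightarrow>\<^sub>M borel_orthogonal"
  proof (rule measurable_restrict_space3)
   show "(\<lambda>A :: (real^'n)^'n. C ** A) \<in> borel_measurable borel"
    by (intro borel_measurable_continuous_onI continuous_on_matrix_mult continuous_intros)
   show "(\<lambda>A :: (real^'n)^'n. C ** A) \<in> orthogonal_matrices \<rightarrow> orthogonal_matrices"
    using C by (auto intro: orthogonal_matrix_mul)
  qed
  have Cv: "(*v) C \<in> ?B \<rightarrow>\<^sub>M ?B"
   unfolding measurable_cong_sets[OF sets_ball_measure sets_ball_measure]
   by (intro borel_measurable_continuous_onI continuous_intros)
  have Comp: "compose {..<N} ((*v) C) \<in> ?P \<rightarrow>\<^sub>M ?P" unfolding compose_def using Cv by measurable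
  have Ct: "orthogonal_transformation ((*v) C)" using C by (simp add: orthogonal_transformation_matrix)
  have "distr \<mu> \<mu> (\<lambda>A. C ** A) = distr ?P borel_orthogonal (\<lambda>V. C ** Q V)"
   unfolding \<mu>_def using Cm by (subst distr_distr) (auto simp: comp_def cong: distr_cong)
  also have "\<dots> = distr ?P borel_orthogonal (Q \<circ> compose {..<N} ((*v) C))"
  proof (rule distr_cong_AE)
   show "AE V in ?P. C ** Q V = (Q \<circ> compose {..<N} ((*v) C)) V" using AE_gs_residue[OF N_def]
   proof eventually_elim
    fix V :: "nat => real^'n" assume V: "\<forall>i<N. gs_residue V i \<noteq> 0"
    have "gram_schmidt (compose {..<N} ((*v) C) V) (g j) = C *v gram_schmidt V (g j)" for j
    proof -
     have "gram_schmidt (compose {..<N} ((*v) C) V) (g j) = gram_schmidt (\<lambda>i. C *v V i) (g j)"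
      using g(1)[of j] by (intro gram_schmidt_cong) (auto simp: compose_def)
     then show ?thesis using gram_schmidt_orthogonal_transformation[OF Ct] by simp
    qed
    then have "U (compose {..<N} ((*v) C) V) = C ** U V"
     by (simp add: vec_eq_iff U_def matrix_matrix_mult_def matrix_vector_mult_def)
    then show "C ** Q V = (Q \<circ> compose {..<N} ((*v) C)) V"
     using U_orth[OF V] C by (simp add: Q_def orthogonal_matrix_mul)
   qed
   show "(\<lambda>V. C ** Q V) \<in> ?P \<rightarrow>\<^sub>M borel_orthogonal" using measurable_compose[OF Qm Cm] .
   show "Q \<circ> compose {..<N} ((*v) C) \<in> ?P \<rightarrow>\<^sub>M borel_orthogonal"
    by (rule measurable_comp[OF Comp Qm])
  qed (rule refl)+
  also have "\<dots> = distr (distr ?P ?P (compose {..<N} ((*v) C))) borel_orthogonal Q"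
   by (rule distr_distr[OF Qm Comp, symmetric])
  also have "distr ?P ?P (compose {..<N} ((*v) C)) = (\<Pi>\<^sub>M i\<in>{..<N}. distr ?B ?B ((*v) C))"
   by (rule distr_PiM_finite_prob_space) (use Cv in \<open>auto intro!: product_prob_spaceI prob_space_ball_measure\<close>)
  also have "distr ?B ?B ((*v) C) = ?B" using distr_ball_measure[OF C] by (metis distr_cong sets_ball_measure)
  finally show ?thesis by (simp add: \<mu>_def)
 qed
 moreover have "prob_space \<mu>" unfolding \<mu>_def by (rule P.prob_space_distr) (rule Qm)
 moreover have "sets \<mu> = sets borel_orthogonal" by (simp add: \<mu>_def)
 ultimately show ?thesis by blast
qed


section \<open>Two-sided invariance\<close>

lemma measurable_orthogonal_mult:
 assumes "orthogonal_matrix (B :: (real^'n::finite)^'n::finite)"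
 shows "(\<lambda>A :: (real^'n)^'n. B ** A) \<in> borel_orthogonal \<rightarrow>\<^sub>M borel_orthogonal"
  and "(\<lambda>A :: (real^'n)^'n. A ** B) \<in> borel_orthogonal \<rightarrow>\<^sub>M borel_orthogonal"
proof -
 have "(\<lambda>A :: (real^'n)^'n. B ** A) \<in> borel_measurable borel" "(\<lambda>A :: (real^'n)^'n. A ** B) \<in> borel_measurable borel"
  by (intro borel_measurable_continuous_onI continuous_on_matrix_mult continuous_intros)+
 then show "(\<lambda>A :: (real^'n)^'n. B ** A) \<in> borel_orthogonal \<rightarrow>\<^sub>M borel_orthogonal"
  and "(\<lambda>A :: (real^'n)^'n. A ** B) \<in> borel_orthogonal \<rightarrow>\<^sub>M borel_orthogonal"
  using assms by (auto intro!: measurable_restrict_space3 orthogonal_matrix_mul)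
qed

lemma measurable_orthogonal_transpose:
 "(transpose :: (real^'n::finite)^'n::finite => _) \<in> borel_orthogonal \<rightarrow>\<^sub>M borel_orthogonal"
proof -
 have "(transpose :: (real^'n)^'n => _) \<in> borel_measurable borel"
  by (intro borel_measurable_continuous_onI continuous_on_transpose continuous_intros)
 then show ?thesis by (auto intro!: measurable_restrict_space3 simp: orthogonal_matrix_transpose)
qed

text \<open>
 A left-invariant probability measure on the orthogonal group agrees with its image under
 inversion, because both arise by integrating the product of two independent elements.
\<close>

lemma haar_exists:
 "\<exists>\<mu> :: ((real^'n::finite)^'n::finite) measure. prob_space \<mu> \<and> sets \<mu> = sets borel_orthogonal \<and>
   (\<forall>B. orthogonal_matrix B \<longrightarrow> distr \<mu> \<mu> (\<lambda>A. B ** A) = \<mu> \<and> distr \<mu> \<mu> (\<lambda>A. A ** B) = \<mu>)"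
proof -
 obtain \<mu> :: "((real^'n)^'n) measure" where \<mu>: "prob_space \<mu>" "sets \<mu> = sets borel_orthogonal"
  "\<And>B. orthogonal_matrix B ==> distr \<mu> \<mu> (\<lambda>A. B ** A) = \<mu>"
  using left_haar_exists by blast
 interpret prob_space \<mu> by (rule \<mu>(1))
 interpret pair_sigma_finite \<mu> \<mu> ..
 note [measurable_cong] = \<mu>(2)
 have sp: "space \<mu> = orthogonal_matrices" using sets_eq_imp_space_eq[OF \<mu>(2)] by simp
 have mult[measurable]: "(\<lambda>p. fst p ** snd p) \<in> \<mu> \<Otimes>\<^sub>M \<mu> \<rightarrow>\<^sub>M \<mu>"
 proof -
  have id: "(\<lambda>A. A) \<in> \<mu> \<rightarrow>\<^sub>M borel"
   unfolding measurable_cong_sets[OF \<mu>(2) refl] by (rule measurable_restrict_space1) simp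
  have "(\<lambda>p. (fst p, snd p)) \<in> \<mu> \<Otimes>\<^sub>M \<mu> \<rightarrow>\<^sub>M borel \<Otimes>\<^sub>M borel"
   using measurable_compose[OF measurable_fst id] measurable_compose[OF measurable_snd id] by (rule measurable_Pair)
  from measurable_compose[OF this measurable_matrix_mult]
  have "(\<lambda>p. fst p ** snd p) \<in> \<mu> \<Otimes>\<^sub>M \<mu> \<rightarrow>\<^sub>M borel" by simp
  then show ?thesis unfolding measurable_cong_sets[OF refl \<mu>(2)]
   by (intro measurable_restrict_space2) (auto simp: space_pair_measure sp orthogonal_matrix_mul)
 qed
 have tr[measurable]: "transpose \<in> \<mu> \<rightarrow>\<^sub>M \<mu>"
  unfolding measurable_cong_sets[OF \<mu>(2) \<mu>(2)] by (rule measurable_orthogonal_transpose)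
 have left[measurable]: "(\<lambda>A. B ** A) \<in> \<mu> \<rightarrow>\<^sub>M \<mu>" and right[measurable]: "(\<lambda>A. A ** B) \<in> \<mu> \<rightarrow>\<^sub>M \<mu>"
  if "orthogonal_matrix B" for B
  unfolding measurable_cong_sets[OF \<mu>(2) \<mu>(2)] using measurable_orthogonal_mult[OF that] by auto
 have left_int: "(\<integral>\<^sup>+A. f (B ** A) \<partial>\<mu>) = (\<integral>\<^sup>+A. f A \<partial>\<mu>)"
  if "orthogonal_matrix B" and [measurable]: "f \<in> borel_measurable \<mu>" for f B
  using that(1) by (subst (2) \<mu>(3)[OF that(1), symmetric]) (subst nn_integral_distr, auto)
 have right_int: "(\<integral>\<^sup>+A. f (transpose (A ** B)) \<partial>\<mu>) = (\<integral>\<^sup>+A. f (transpose A) \<partial>\<mu>)" (is "?L = ?R")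
  if B: "orthogonal_matrix B" and [measurable]: "f \<in> borel_measurable \<mu>" for f B
 proof -
  have key: "(\<integral>\<^sup>+A. f (transpose A) \<partial>\<mu>) = (\<integral>\<^sup>+A. f A \<partial>\<mu>)"
   if [measurable]: "f \<in> borel_measurable \<mu>" for f
  proof -
   have "(\<integral>\<^sup>+A. f (transpose A) \<partial>\<mu>) = (\<integral>\<^sup>+C. (\<integral>\<^sup>+A. f (transpose (transpose C ** A)) \<partial>\<mu>) \<partial>\<mu>)"
   proof -
    have "(\<integral>\<^sup>+A. f (transpose (transpose C ** A)) \<partial>\<mu>) = (\<integral>\<^sup>+A. f (transpose A) \<partial>\<mu>)" if "C \<in> space \<mu>" for C
     using that by (intro left_int) (auto simp: sp)
    then show ?thesis by (simp add: emeasure_space_1 cong: nn_integral_cong)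
   qed
   also have "\<dots> = (\<integral>\<^sup>+C. (\<integral>\<^sup>+A. f (transpose A ** C) \<partial>\<mu>) \<partial>\<mu>)"
    by (simp add: matrix_transpose_mul)
   also have "\<dots> = (\<integral>\<^sup>+A. (\<integral>\<^sup>+C. f (transpose A ** C) \<partial>\<mu>) \<partial>\<mu>)"
   proof (rule Fubini')
    have "(\<lambda>p. (transpose (fst p), snd p)) \<in> \<mu> \<Otimes>\<^sub>M \<mu> \<rightarrow>\<^sub>M \<mu> \<Otimes>\<^sub>M \<mu>"
     by measurable
    from measurable_compose[OF measurable_compose[OF this mult] \<open>f \<in> borel_measurable \<mu>\<close>]
    show "(\<lambda>(A, C). f (transpose A ** C)) \<in> borel_measurable (\<mu> \<Otimes>\<^sub>M \<mu>)"
     by (simp add: case_prod_beta)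
   qed
   also have "\<dots> = (\<integral>\<^sup>+A. f A \<partial>\<mu>)"
   proof -
    have "(\<integral>\<^sup>+C. f (transpose A ** C) \<partial>\<mu>) = (\<integral>\<^sup>+A. f A \<partial>\<mu>)" if "A \<in> space \<mu>" for A
     using that by (intro left_int) (auto simp: sp)
    then show ?thesis by (simp add: emeasure_space_1 cong: nn_integral_cong)
   qed
   finally show ?thesis .
  qed
  have "?L = (\<integral>\<^sup>+A. f (transpose B ** transpose A) \<partial>\<mu>)"
   by (simp add: matrix_transpose_mul)
  also have "\<dots> = (\<integral>\<^sup>+A. f (transpose B ** A) \<partial>\<mu>)"
   using B by (intro key[of "\<lambda>A. f (transpose B ** A)"]) (simp add: orthogonal_matrix_transpose)
  also have "\<dots> = (\<integral>\<^sup>+A. f A \<partial>\<mu>)" using B by (intro left_int) auto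
  also have "\<dots> = ?R" by (rule key[symmetric]) measurable
  finally show ?thesis .
 qed
 have "distr \<mu> \<mu> (\<lambda>A. A ** B) = \<mu>" if B: "orthogonal_matrix B" for B
 proof (rule measure_eqI)
  fix X assume "X \<in> sets (distr \<mu> \<mu> (\<lambda>A. A ** B))"
  then have X: "X \<in> sets \<mu>" by simp
  have [measurable]: "(\<lambda>A. indicator X (transpose A) :: ennreal) \<in> borel_measurable \<mu>"
   using measurable_compose[OF tr borel_measurable_indicator[OF X]] .
  \<comment> \<open>The double transpose brings the indicator into the shape of
    \<open>right_int\<close>, which speaks of functions of \<open>transpose A\<close>.\<close>
  have "emeasure (distr \<mu> \<mu> (\<lambda>A. A ** B)) X = (\<integral>\<^sup>+A. indicator X (transpose (transpose (A ** B))) \<partial>\<mu>)"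
   using X B by (simp add: nn_integral_indicator[symmetric] nn_integral_distr del: nn_integral_indicator)
  also have "\<dots> = (\<integral>\<^sup>+A. indicator X (transpose (transpose A)) \<partial>\<mu>)"
   by (rule right_int[OF B, of "\<lambda>A. indicator X (transpose A)"]) measurable
  finally show "emeasure (distr \<mu> \<mu> (\<lambda>A. A ** B)) X = emeasure \<mu> X" using X by simp
 qed simp
 with \<mu> show ?thesis by blast
qed

section \<open>The shifted dual transform as an average over the orthogonal group\<close>

lemma orthogonal_matrix_inverse:
 "orthogonal_matrix A ==> transpose A ** A = mat 1" "orthogonal_matrix A ==> A ** transpose A = mat 1"
 by (auto simp: orthogonal_matrix_def)

lemma compact_orthogonal_matrices: "compact (orthogonal_matrices :: ((real^'n::finite)^'n::finite) set)"
proof -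
 have "closed (orthogonal_matrices :: ((real^'n)^'n) set)" unfolding orthogonal_matrix
  by (intro closed_Collect_eq continuous_on_matrix_mult continuous_intros continuous_on_transpose)
 moreover have "norm A \<le> real CARD('n)" if "orthogonal_matrix A" for A :: "(real^'n)^'n"
 proof -
  have "norm (A $ i) = 1" for i
  proof -
   have "A $ i \<bullet> A $ i = (A ** transpose A) $ i $ i"
    by (simp add: inner_vec_def matrix_matrix_mult_def transpose_def)
   then show ?thesis using orthogonal_matrix_inverse(2)[OF that] by (simp add: norm_eq_1 mat_def)
  qed
  then show ?thesis
   using norm_vec_def[of A] L2_set_le_sum[of UNIV "\<lambda>i. norm (A $ i)"] by (simp add: norm_vec_def)
 qed
 then have "bounded (orthogonal_matrices :: ((real^'n)^'n) set)" unfolding bounded_iff by blast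
 ultimately show ?thesis by (simp add: compact_eq_bounded_closed)
qed

text \<open>By continuity in \<open>A\<close>, the inequality \<open>h A \<xi> < a\<close> holds iff
  near some point \<open>B\<close> of a countable dense set, in a ball of radius
  \<open>1 / Suc n\<close> containing \<open>A\<close>, all dense points \<open>B'\<close> satisfy
  \<open>h B' \<xi> \<le> a - 1 / Suc n\<close>. This writes the set as a countable union of
  measurable rectangles.\<close>

lemma borel_measurable_caratheodory:
 fixes h :: "'b::{metric_space, second_countable_topology} => 'c => real"
 assumes cont: "\<And>\<xi>. \<xi> \<in> space M ==> continuous_on S (\<lambda>A. h A \<xi>)"
  and meas: "\<And>A. A \<in> S ==> h A \<in> borel_measurable M"
 shows "(\<lambda>p. h (fst p) (snd p)) \<in> borel_measurable (restrict_space borel S \<Otimes>\<^sub>M M)"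
proof (rule borel_measurable_iff_less[THEN iffD2], rule allI)
 fix a :: real
 let ?M = "restrict_space borel S \<Otimes>\<^sub>M M"
 obtain D where D: "countable D" "D \<subseteq> S" "S \<subseteq> closure D" using separable by blast
 define E where "E B n = {A \<in> S. dist A B < 1 / real (Suc n)} \<times>
  {\<xi> \<in> space M. \<forall>B'\<in>D. dist B' B < 1 / real (Suc n) \<longrightarrow> h B' \<xi> \<le> a - 1 / real (Suc n)}" for B n
 have "{p \<in> space ?M. h (fst p) (snd p) < a} = (\<Union>B\<in>D. \<Union>n. E B n)"
 proof (intro equalityI subsetI)
  fix p assume p: "p \<in> {p \<in> space ?M. h (fst p) (snd p) < a}"
  obtain A \<xi> where p': "p = (A, \<xi>)" "A \<in> S" "\<xi> \<in> space M" "h A \<xi> < a"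
   using p by (cases p) (auto simp: space_pair_measure space_restrict_space)
  obtain n1 where n1: "1 / real (Suc n1) < (a - h A \<xi>) / 2"
   using p'(4) nat_approx_posE[of "(a - h A \<xi>) / 2"] by auto
  obtain d where d: "d > 0" "\<And>B. B \<in> S ==> dist B A < d ==> dist (h B \<xi>) (h A \<xi>) < (a - h A \<xi>) / 2"
   using cont[OF p'(3)] p'(2,4) unfolding continuous_on_iff by (metis diff_gt_0_iff_gt half_gt_zero)
  obtain n2 where n2: "1 / real (Suc n2) < d / 2" using d(1) nat_approx_posE[of "d / 2"] by auto
  define n where "n = max n1 n2"
  have n: "1 / real (Suc n) \<le> 1 / real (Suc n1)" "1 / real (Suc n) \<le> 1 / real (Suc n2)"
   by (auto simp: n_def intro!: divide_left_mono)
  obtain B where B: "B \<in> D" "dist B A < 1 / real (Suc n)"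
   using D(3) p'(2) closure_approachable[of A D] by (metis of_nat_0_less_iff subsetD zero_less_Suc zero_less_divide_1_iff)
  have "h B' \<xi> \<le> a - 1 / real (Suc n)" if "B' \<in> D" "dist B' B < 1 / real (Suc n)" for B'
  proof -
   have "dist B' A < d" using dist_triangle[of B' A B] that(2) B(2) n(2) n2 by linarith
   then have "dist (h B' \<xi>) (h A \<xi>) < (a - h A \<xi>) / 2" using d(2) D(2) that(1) by blast
   then have 1: "h B' \<xi> - h A \<xi> < (a - h A \<xi>) / 2"
    unfolding dist_real_def by (rule le_less_trans[OF abs_ge_self])
   have 2: "1 / real (Suc n) < (a - h A \<xi>) / 2" using n(1) n1 by (rule le_less_trans)
   have "(a - h A \<xi>) / 2 + (a - h A \<xi>) / 2 = a - h A \<xi>" by simp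
   with add_strict_mono[OF 1 2] show ?thesis by (simp add: algebra_simps)
  qed
  then have "p \<in> E B n" using p' B by (auto simp: E_def dist_commute)
  then show "p \<in> (\<Union>B\<in>D. \<Union>n. E B n)" using B by blast
 next
  fix p assume "p \<in> (\<Union>B\<in>D. \<Union>n. E B n)"
  then obtain B n A \<xi> where B: "B \<in> D" and p: "p = (A, \<xi>)" "A \<in> S" "dist A B < 1 / real (Suc n)" "\<xi> \<in> space M"
   "\<And>B'. B' \<in> D ==> dist B' B < 1 / real (Suc n) ==> h B' \<xi> \<le> a - 1 / real (Suc n)"
   by (auto simp: E_def)
  have "h A \<xi> \<le> a - 1 / real (Suc n)"
  proof (rule field_le_epsilon)
   fix e :: real assume "e > 0"
   then obtain d where d: "d > 0" "\<And>B. B \<in> S ==> dist B A < d ==> dist (h B \<xi>) (h A \<xi>) < e"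
    using cont[OF p(4)] p(2) unfolding continuous_on_iff by metis
   have "min d (1 / real (Suc n) - dist A B) > 0" using d(1) p(3) by simp
   then obtain B' where B': "B' \<in> D" "dist B' A < min d (1 / real (Suc n) - dist A B)"
    using D(3) p(2) closure_approachable[of A D] by blast
   then have "h B' \<xi> \<le> a - 1 / real (Suc n)" using dist_triangle[of B' B A] by (intro p(5)) auto
   moreover have "dist (h B' \<xi>) (h A \<xi>) < e" using B' D(2) by (intro d(2)) auto
   ultimately show "h A \<xi> \<le> a - 1 / real (Suc n) + e" unfolding dist_real_def by linarith
  qed
  moreover have "1 / real (Suc n) > 0" by simp
  ultimately have "h A \<xi> < a" by linarith
  then show "p \<in> {p \<in> space ?M. h (fst p) (snd p) < a}"
   using p by (auto simp: space_pair_measure space_restrict_space)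
 qed
 moreover have "E B n \<in> sets ?M" for B n unfolding E_def
 proof (rule pair_measureI)
  have "{A \<in> S. dist A B < 1 / real (Suc n)} = S \<inter> ball B (1 / real (Suc n))" by (auto simp: dist_commute)
  then show "{A \<in> S. dist A B < 1 / real (Suc n)} \<in> sets (restrict_space borel S)"
   unfolding sets_restrict_space by auto
  have [measurable]: "h B' \<in> borel_measurable M" if "B' \<in> D" for B' using meas D(2) that by auto
  show "{\<xi> \<in> space M. \<forall>B'\<in>D. dist B' B < 1 / real (Suc n) \<longrightarrow> h B' \<xi> \<le> a - 1 / real (Suc n)} \<in> sets M"
   using D(1) by measurable
 qed
 ultimately show "{p \<in> space ?M. h (fst p) (snd p) < a} \<in> sets ?M"
  using D(1) by (auto intro!: sets.countable_UN')
qed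

text \<open>Collects what identifies the invariant measure. By \<open>act_full\<close> every
  isometry fixing \<open>x\<close> acts on the points as some \<open>\<alpha> A\<close>, so
  invariance under \<open>stabilizer G x\<close> is invariance under the group; by
  \<open>orbit\<close> the group is transitive; \<open>dist_cont\<close> and
  \<open>dist_zero\<close> let the distance functions tell the submanifolds of the orbit
  apart.\<close>

locale orthogonal_action =
 fixes G :: "'a::{metric_space, second_countable_topology} geometry" and x :: 'a and r :: real
  and \<alpha> :: "(real^'n::finite)^'n::finite => 'a => 'a" and \<xi>0 :: "'a set"
 assumes act_points: "orthogonal_matrix A ==> y \<in> points G ==> \<alpha> A y \<in> points G"
  and act_dist: "orthogonal_matrix A ==> y \<in> points G ==> z \<in> points G ==> gdist G (\<alpha> A y) (\<alpha> A z) = gdist G y z"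
  and act_mult: "orthogonal_matrix A ==> orthogonal_matrix B ==> y \<in> points G ==> \<alpha> (A ** B) y = \<alpha> A (\<alpha> B y)"
  and act_one: "y \<in> points G ==> \<alpha> (mat 1) y = y"
  and act_fix: "orthogonal_matrix A ==> \<alpha> A x = x"
  and act_cont: "y \<in> points G ==> continuous_on orthogonal_matrices (\<lambda>A. \<alpha> A y)"
  and act_cont_point: "orthogonal_matrix A ==> continuous_on (points G) (\<alpha> A)"
  and act_full: "g \<in> stabilizer G x ==> \<exists>A. orthogonal_matrix A \<and> (\<forall>y\<in>points G. g y = \<alpha> A y)"
  and orbit: "submfds_at G x r = {\<alpha> A ` \<xi>0 | A. orthogonal_matrix A}"
  and base_sub: "\<xi>0 \<subseteq> points G"
  and dist_cont: "continuous_on (points G) (\<lambda>y. set_gdist G y \<xi>0)"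
  and dist_zero: "y \<in> points G ==> set_gdist G y \<xi>0 = 0 \<longleftrightarrow> y \<in> \<xi>0"
begin

abbreviation "Y \<equiv> submfds_at G x r"
abbreviation "N \<equiv> submfd_borel G Y"

lemma act_inv:
 assumes "orthogonal_matrix A" "y \<in> points G"
 shows "\<alpha> (transpose A) (\<alpha> A y) = y" "\<alpha> A (\<alpha> (transpose A) y) = y"
 using assms act_mult[of "transpose A" A y] act_mult[of A "transpose A" y]
 by (simp_all add: act_one orthogonal_matrix_inverse orthogonal_matrix_transpose)

lemma act_image_mult:
 assumes "orthogonal_matrix A" "orthogonal_matrix B" "\<xi> \<subseteq> points G"
 shows "\<alpha> (A ** B) ` \<xi> = \<alpha> A ` \<alpha> B ` \<xi>"
 unfolding image_image using act_mult[OF assms(1,2)] assms(3) by (intro image_cong) auto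

lemma Y_sub: "\<xi> \<in> Y ==> \<xi> \<subseteq> points G" using orbit base_sub act_points by auto

lemma act_Y:
 assumes A: "orthogonal_matrix A" and "\<xi> \<in> Y"
 shows "\<alpha> A ` \<xi> \<in> Y"
proof -
 obtain B where B: "orthogonal_matrix B" "\<xi> = \<alpha> B ` \<xi>0" using assms(2) unfolding orbit by auto
 have "\<alpha> A ` \<xi> = \<alpha> (A ** B) ` \<xi>0"
  unfolding B(2) by (rule act_image_mult[OF A B(1) base_sub, symmetric])
 then show ?thesis unfolding orbit using A B(1) orthogonal_matrix_mul by blast
qed

lemma set_gdist_act:
 assumes "orthogonal_matrix A" "y \<in> points G" "\<xi> \<subseteq> points G"
 shows "set_gdist G y (\<alpha> A ` \<xi>) = set_gdist G (\<alpha> (transpose A) y) \<xi>"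
proof -
 have "gdist G y (\<alpha> A z) = gdist G (\<alpha> (transpose A) y) z" if "z \<in> \<xi>" for z
 proof -
  have z: "z \<in> points G" using that assms(3) by auto
  have "gdist G (\<alpha> A (\<alpha> (transpose A) y)) (\<alpha> A z) = gdist G (\<alpha> (transpose A) y) z"
   using assms z by (intro act_dist act_points) (auto simp: orthogonal_matrix_transpose)
  then show ?thesis using act_inv assms by simp
 qed
 then show ?thesis unfolding set_gdist_def image_image by (intro INF_cong) auto
qed

lemma act_transpose_cont:
 assumes "y \<in> points G"
 shows "continuous_on orthogonal_matrices (\<lambda>A. \<alpha> (transpose A) y)"
 by (rule continuous_on_compose2[OF act_cont[OF assms]])
  (auto intro!: continuous_on_transpose continuous_intros simp: orthogonal_matrix_transpose)

lemma set_gdist_cont: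
 assumes "\<xi> \<in> Y"
 shows "continuous_on (points G) (\<lambda>y. set_gdist G y \<xi>)"
proof -
 obtain A where A: "orthogonal_matrix A" "\<xi> = \<alpha> A ` \<xi>0" using orbit assms by auto
 then have tA: "orthogonal_matrix (transpose A)" by (simp add: orthogonal_matrix_transpose)
 have "continuous_on (points G) (\<lambda>y. set_gdist G (\<alpha> (transpose A) y) \<xi>0)"
  by (rule continuous_on_compose2[OF dist_cont act_cont_point[OF tA]]) (use act_points tA in auto)
 then show ?thesis by (rule continuous_on_eq) (use A set_gdist_act base_sub in auto)
qed

lemma set_gdist_zero:
 assumes "\<xi> \<in> Y" "y \<in> points G"
 shows "set_gdist G y \<xi> = 0 \<longleftrightarrow> y \<in> \<xi>"
proof -
 obtain A where A: "orthogonal_matrix A" "\<xi> = \<alpha> A ` \<xi>0" using orbit assms(1) by auto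
 have tA: "orthogonal_matrix (transpose A)" using A by (simp add: orthogonal_matrix_transpose)
 have "set_gdist G y \<xi> = 0 \<longleftrightarrow> \<alpha> (transpose A) y \<in> \<xi>0"
  using A assms(2) base_sub by (simp add: set_gdist_act dist_zero act_points[OF tA])
 also have "\<dots> \<longleftrightarrow> y \<in> \<xi>"
 proof
  assume "\<alpha> (transpose A) y \<in> \<xi>0"
  then show "y \<in> \<xi>" using act_inv(2)[OF A(1) assms(2)] unfolding A(2) by (metis imageI)
 next
  assume "y \<in> \<xi>"
  then obtain z where "z \<in> \<xi>0" "y = \<alpha> A z" unfolding A(2) by blast
  then show "\<alpha> (transpose A) y \<in> \<xi>0" using act_inv(1)[OF A(1), of z] base_sub by auto
 qed
 finally show ?thesis .
qed

lemma act_dist_cont: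
 assumes "\<xi> \<in> Y" "y \<in> points G"
 shows "continuous_on orthogonal_matrices (\<lambda>A. set_gdist G y (\<alpha> A ` \<xi>))"
proof -
 have "continuous_on orthogonal_matrices (\<lambda>A. set_gdist G (\<alpha> (transpose A) y) \<xi>)"
  by (rule continuous_on_compose2[OF set_gdist_cont[OF assms(1)] act_transpose_cont[OF assms(2)]])
   (use act_points assms orthogonal_matrix_transpose in blast)
 then show ?thesis by (rule continuous_on_eq) (use assms set_gdist_act Y_sub in auto)
qed

section \<open>The sigma-algebra generated by the distance functions\<close>

lemma space_N [simp]: "space N = Y" unfolding submfd_borel_def by (rule space_measure_of) auto

lemma borel_measurable_set_gdist:
 assumes "y \<in> points G"
 shows "set_gdist G y \<in> borel_measurable N"
proof (rule borel_measurable_iff_less[THEN iffD2], rule allI)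
 fix a
 have "{\<xi> \<in> Y. set_gdist G y \<xi> < a} \<in> sigma_sets Y {{\<xi> \<in> Y. set_gdist G y \<xi> < a} | y a. y \<in> points G}"
  using assms by (intro sigma_sets.Basic) auto
 then show "{\<xi> \<in> space N. set_gdist G y \<xi> < a} \<in> sets N"
  unfolding space_N unfolding submfd_borel_def by (subst sets_measure_of) auto
qed

lemma measurable_N_I:
 assumes "\<And>w. w \<in> space M ==> f w \<in> Y"
  and "\<And>y. y \<in> points G ==> (\<lambda>w. set_gdist G y (f w)) \<in> borel_measurable M"
 shows "f \<in> M \<rightarrow>\<^sub>M N" unfolding submfd_borel_def
proof (rule measurable_measure_of)
 fix X assume "X \<in> {{\<xi> \<in> Y. set_gdist G y \<xi> < a} | y a. y \<in> points G}"
 then obtain y a where X: "X = {\<xi> \<in> Y. set_gdist G y \<xi> < a}" "y \<in> points G" by auto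
 have "f -` X \<inter> space M = {w \<in> space M. set_gdist G y (f w) < a}" using X assms(1) by auto
 then show "f -` X \<inter> space M \<in> sets M"
  using borel_measurable_iff_less[THEN iffD1, OF assms(2)[OF X(2)]] by simp
qed (use assms(1) in auto)

lemma measurable_orbit_map:
 assumes "\<xi> \<in> Y"
 shows "(\<lambda>A. \<alpha> A ` \<xi>) \<in> borel_orthogonal \<rightarrow>\<^sub>M N"
proof (rule measurable_N_I)
 show "\<alpha> A ` \<xi> \<in> Y" if "A \<in> space borel_orthogonal" for A using act_Y assms that by simp
 show "(\<lambda>A. set_gdist G y (\<alpha> A ` \<xi>)) \<in> borel_measurable borel_orthogonal" if "y \<in> points G" for y
  using act_dist_cont[OF assms that] by (rule borel_measurable_continuous_on_restrict)
qed

lemma measurable_act: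
 assumes "orthogonal_matrix A"
 shows "(\<lambda>\<xi>. \<alpha> A ` \<xi>) \<in> N \<rightarrow>\<^sub>M N"
proof (rule measurable_N_I)
 fix y assume y: "y \<in> points G"
 have "set_gdist G (\<alpha> (transpose A) y) \<in> borel_measurable N"
  using assms y by (intro borel_measurable_set_gdist act_points) (auto simp: orthogonal_matrix_transpose)
 then show "(\<lambda>\<xi>. set_gdist G y (\<alpha> A ` \<xi>)) \<in> borel_measurable N"
  by (rule measurable_cong[THEN iffD2, rotated]) (use assms y Y_sub set_gdist_act in auto)
qed (use act_Y assms in auto)

text \<open>Serves Fubini in the uniqueness proof: a distance function of the moved submanifold is
  continuous in the matrix and measurable in the submanifold.\<close>

lemma measurable_joint_act:
 "(\<lambda>p. \<alpha> (fst p) ` snd p) \<in> borel_orthogonal \<Otimes>\<^sub>M N \<rightarrow>\<^sub>M N"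
proof (rule measurable_N_I)
 show "\<alpha> (fst p) ` snd p \<in> Y" if "p \<in> space (borel_orthogonal \<Otimes>\<^sub>M N)" for p
  using that act_Y by (auto simp: space_pair_measure)
 fix y assume y: "y \<in> points G"
 show "(\<lambda>p. set_gdist G y (\<alpha> (fst p) ` snd p)) \<in> borel_measurable (borel_orthogonal \<Otimes>\<^sub>M N)"
 proof (rule borel_measurable_caratheodory)
  show "continuous_on orthogonal_matrices (\<lambda>A. set_gdist G y (\<alpha> A ` \<xi>))" if "\<xi> \<in> space N" for \<xi>
   using act_dist_cont that y by simp
  show "(\<lambda>\<xi>. set_gdist G y (\<alpha> A ` \<xi>)) \<in> borel_measurable N" if "A \<in> orthogonal_matrices" for A
   using measurable_compose[OF measurable_act borel_measurable_set_gdist[OF y]] that by auto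
 qed
qed

lemma base_Y: "\<xi>0 \<in> Y"
proof -
 have "\<alpha> (mat 1) ` \<xi>0 = \<xi>0"
  using act_one base_sub by (subst image_cong[OF refl, of _ _ "\<lambda>y. y"]) auto
 then show ?thesis unfolding orbit using orthogonal_matrix_id by blast
qed

lemma act_stabilizer:
 assumes A: "orthogonal_matrix A"
 shows "\<alpha> A \<in> stabilizer G x"
proof -
 have "bij_betw (\<alpha> A) (points G) (points G)" by (rule bij_betw_byWitness[where f'="\<alpha> (transpose A)"])
   (use A act_inv act_points orthogonal_matrix_transpose in auto)
 then show ?thesis using A act_dist act_fix by (simp add: stabilizer_def)
qed

text \<open>
 Averaging an invariant measure over the group turns it into the image of Haar measure on the
 orbit; this gives uniqueness.
\<close>

lemma invariant_probability_iff:
 assumes \<mu>: "prob_space \<mu>" "sets \<mu> = sets borel_orthogonal"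
  "\<And>B. orthogonal_matrix B ==> distr \<mu> \<mu> (\<lambda>A. B ** A) = \<mu>"
  "\<And>B. orthogonal_matrix B ==> distr \<mu> \<mu> (\<lambda>A. A ** B) = \<mu>"
 shows "invariant_probability G x r M \<longleftrightarrow> M = distr \<mu> N (\<lambda>A. \<alpha> A ` \<xi>0)"
proof
 interpret mu: prob_space \<mu> by (rule \<mu>(1))
 have sp: "space \<mu> = orthogonal_matrices" using sets_eq_imp_space_eq[OF \<mu>(2)] by simp
 have om: "(\<lambda>A. \<alpha> A ` \<xi>) \<in> \<mu> \<rightarrow>\<^sub>M N" if "\<xi> \<in> Y" for \<xi>
  unfolding measurable_cong_sets[OF \<mu>(2) refl] using that by (rule measurable_orbit_map)
 have mm: "(\<lambda>A. B ** A) \<in> \<mu> \<rightarrow>\<^sub>M \<mu>" "(\<lambda>A. A ** B) \<in> \<mu> \<rightarrow>\<^sub>M \<mu>" if "orthogonal_matrix B" for B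
  unfolding measurable_cong_sets[OF \<mu>(2) \<mu>(2)] using measurable_orthogonal_mult[OF that] by auto
 {
  assume inv: "invariant_probability G x r M"
  then interpret M: prob_space M by (simp add: invariant_probability_def)
  have sM: "sets M = sets N" and spM: "space M = Y" using inv by (auto simp: invariant_probability_def)
  interpret pair_sigma_finite M \<mu> ..
  show "M = distr \<mu> N (\<lambda>A. \<alpha> A ` \<xi>0)"
  proof (rule measure_eqI)
   fix E assume E: "E \<in> sets M"
   then have EN: "E \<in> sets N" by (simp add: sM)
   have actM: "(\<lambda>\<xi>. \<alpha> A ` \<xi>) \<in> M \<rightarrow>\<^sub>M M" if "orthogonal_matrix A" for A
    unfolding measurable_cong_sets[OF sM sM] using that by (rule measurable_act)
   have 1: "(\<integral>\<^sup>+\<xi>. indicator E (\<alpha> A ` \<xi>) \<partial>M) = emeasure M E" if A: "orthogonal_matrix A" for A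
   proof -
    have "distr M M (\<lambda>\<xi>. \<alpha> A ` \<xi>) = M"
     using inv act_stabilizer[OF A] by (auto simp: invariant_probability_def)
    then have "emeasure M E = (\<integral>\<^sup>+\<xi>. indicator E \<xi> \<partial>distr M M (\<lambda>\<xi>. \<alpha> A ` \<xi>))"
     using E by simp
    also have "\<dots> = (\<integral>\<^sup>+\<xi>. indicator E (\<alpha> A ` \<xi>) \<partial>M)"
     using E actM[OF A] by (intro nn_integral_distr) auto
    finally show ?thesis ..
   qed
   \<comment> \<open>Right invariance of the Haar measure moves \<open>\<xi>\<close> back to the
     base point, so the average over the group is the same for all \<open>\<xi>\<close>.\<close>
   have 2: "(\<integral>\<^sup>+A. indicator E (\<alpha> A ` \<xi>) \<partial>\<mu>) = emeasure (distr \<mu> N (\<lambda>A. \<alpha> A ` \<xi>0)) E" if "\<xi> \<in> Y" for \<xi>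
   proof -
    obtain B where B: "orthogonal_matrix B" "\<xi> = \<alpha> B ` \<xi>0"
     using orbit \<open>\<xi> \<in> Y\<close> by auto
    have "(\<integral>\<^sup>+A. indicator E (\<alpha> A ` \<xi>) \<partial>\<mu>) = (\<integral>\<^sup>+A. indicator E (\<alpha> (A ** B) ` \<xi>0) \<partial>\<mu>)"
     using B act_image_mult base_sub sp by (intro nn_integral_cong) auto
    also have "\<dots> = (\<integral>\<^sup>+A. indicator E (\<alpha> A ` \<xi>0) \<partial>distr \<mu> \<mu> (\<lambda>A. A ** B))"
     using mm(2)[OF B(1)] measurable_compose[OF om[OF base_Y] borel_measurable_indicator[OF EN]]
     by (subst nn_integral_distr) auto
    also have "\<dots> = (\<integral>\<^sup>+\<xi>. indicator E \<xi> \<partial>distr \<mu> N (\<lambda>A. \<alpha> A ` \<xi>0))"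
     unfolding \<mu>(4)[OF B(1)] using om[OF base_Y] EN by (subst nn_integral_distr) auto
    also have "\<dots> = emeasure (distr \<mu> N (\<lambda>A. \<alpha> A ` \<xi>0)) E" using EN by simp
    finally show ?thesis .
   qed
   have J: "(\<lambda>(\<xi>, A). indicator E (\<alpha> A ` \<xi>) :: ennreal) \<in> borel_measurable (M \<Otimes>\<^sub>M \<mu>)"
   proof -
    have "(\<lambda>p. (snd p, fst p)) \<in> M \<Otimes>\<^sub>M \<mu> \<rightarrow>\<^sub>M borel_orthogonal \<Otimes>\<^sub>M N"
    proof (rule measurable_Pair)
     show "snd \<in> M \<Otimes>\<^sub>M \<mu> \<rightarrow>\<^sub>M borel_orthogonal"
      unfolding measurable_cong_sets[OF refl \<mu>(2)[symmetric]] by simp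
     show "fst \<in> M \<Otimes>\<^sub>M \<mu> \<rightarrow>\<^sub>M N"
      unfolding measurable_cong_sets[OF refl sM[symmetric]] by simp
    qed
    from measurable_compose[OF measurable_compose[OF this measurable_joint_act] borel_measurable_indicator[OF EN]]
    show ?thesis by (simp add: case_prod_unfold)
   qed
   have "emeasure M E = (\<integral>\<^sup>+A. (\<integral>\<^sup>+\<xi>. indicator E (\<alpha> A ` \<xi>) \<partial>M) \<partial>\<mu>)"
   proof -
    have "(\<integral>\<^sup>+A. (\<integral>\<^sup>+\<xi>. indicator E (\<alpha> A ` \<xi>) \<partial>M) \<partial>\<mu>) = (\<integral>\<^sup>+A. emeasure M E \<partial>\<mu>)"
     using 1 sp by (intro nn_integral_cong) auto
    then show ?thesis by (simp add: mu.emeasure_space_1)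
   qed
   also have "\<dots> = (\<integral>\<^sup>+\<xi>. (\<integral>\<^sup>+A. indicator E (\<alpha> A ` \<xi>) \<partial>\<mu>) \<partial>M)"
    by (rule Fubini'[OF J])
   also have "\<dots> = emeasure (distr \<mu> N (\<lambda>A. \<alpha> A ` \<xi>0)) E"
   proof -
    have "(\<integral>\<^sup>+\<xi>. (\<integral>\<^sup>+A. indicator E (\<alpha> A ` \<xi>) \<partial>\<mu>) \<partial>M) = (\<integral>\<^sup>+\<xi>. emeasure (distr \<mu> N (\<lambda>A. \<alpha> A ` \<xi>0)) E \<partial>M)"
     using 2 spM by (intro nn_integral_cong) simp
    then show ?thesis by (simp add: M.emeasure_space_1)
   qed
   finally show "emeasure M E = emeasure (distr \<mu> N (\<lambda>A. \<alpha> A ` \<xi>0)) E" .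
  qed (simp add: sM)
 }
 assume M: "M = distr \<mu> N (\<lambda>A. \<alpha> A ` \<xi>0)"
 have sM: "sets M = sets N" and spM: "space M = Y" by (simp_all add: M)
 show "invariant_probability G x r M" unfolding invariant_probability_def
 proof (intro conjI ballI)
  show "prob_space M" unfolding M by (rule mu.prob_space_distr[OF om[OF base_Y]])
  fix g assume "g \<in> stabilizer G x"
  then obtain A where A: "orthogonal_matrix A" "\<And>y. y \<in> points G ==> g y = \<alpha> A y"
   using act_full by blast
  have gA: "g ` \<xi> = \<alpha> A ` \<xi>" if "\<xi> \<in> Y" for \<xi>
   using A(2) Y_sub[OF that] by (intro image_cong) auto
  have mA: "(\<lambda>\<xi>. \<alpha> A ` \<xi>) \<in> M \<rightarrow>\<^sub>M M"
   unfolding measurable_cong_sets[OF sM sM] using A(1) by (rule measurable_act)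
  show "(`) g \<in> M \<rightarrow>\<^sub>M M"
   using mA by (rule measurable_cong[THEN iffD2, rotated]) (simp add: spM gA)
  have "distr M M ((`) g) = distr M M (\<lambda>\<xi>. \<alpha> A ` \<xi>)" by (rule distr_cong) (auto simp: spM gA)
  also have "\<dots> = distr M N (\<lambda>\<xi>. \<alpha> A ` \<xi>)" by (rule distr_cong) (auto simp: sM)
  also have "\<dots> = distr \<mu> N (\<lambda>C. \<alpha> A ` \<alpha> C ` \<xi>0)"
   unfolding M using om[OF base_Y] measurable_act[OF A(1)] by (subst distr_distr) (auto simp: comp_def)
  also have "\<dots> = distr \<mu> N (\<lambda>C. \<alpha> (A ** C) ` \<xi>0)"
   using A(1) base_sub by (intro distr_cong) (auto simp: sp act_image_mult)
  also have "\<dots> = distr (distr \<mu> \<mu> (\<lambda>C. A ** C)) N (\<lambda>C. \<alpha> C ` \<xi>0)"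
   using om[OF base_Y] mm(1)[OF A(1)] by (subst distr_distr) (auto simp: comp_def)
  also have "\<dots> = M" by (simp add: \<mu>(3)[OF A(1)] M)
  finally show "distr M M ((`) g) = M" .
 qed (simp_all add: sM spM)
qed

text \<open>
 The functions \<open>set_gdist G y\<close> for \<open>y\<close> in a countable dense set separate the points of the orbit,
 so by compactness of the group the preimage of a closed set under a continuous function on the
 orbit is described by countably many conditions on these functions.
\<close>

lemma borel_measurable_orbit:
 fixes \<phi> :: "'a set => 'b::{metric_space}"
 assumes cont: "continuous_on orthogonal_matrices (\<lambda>A. \<phi> (\<alpha> A ` \<xi>0))"
 shows "\<phi> \<in> borel_measurable N"
proof (rule borel_measurableI)
 fix U :: "'b set" assume U: "open U"
 define C where "C = - U"
 have C: "closed C" unfolding C_def using U by (rule closed_Compl)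
 define K where "K = {A. orthogonal_matrix A \<and> \<phi> (\<alpha> A ` \<xi>0) \<in> C}"
 have "K = orthogonal_matrices \<inter> (\<lambda>A. \<phi> (\<alpha> A ` \<xi>0)) -` C" by (auto simp: K_def)
 then have "closed K"
  using continuous_closed_preimage[OF cont compact_imp_closed[OF compact_orthogonal_matrices] C] by simp
 then have K: "compact K"
 proof -
  have "orthogonal_matrices \<inter> K = K" by (auto simp: K_def)
  then show ?thesis using compact_Int_closed[OF compact_orthogonal_matrices \<open>closed K\<close>] by simp
 qed
 obtain D where D: "countable D" "D \<subseteq> K" "K \<subseteq> closure D" using separable by blast
 obtain E where E: "countable E" "E \<subseteq> points G" "points G \<subseteq> closure E" using separable by blast
 have "\<phi> -` C \<inter> space N \<in> sets N"
 proof (cases "E = {}")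
  case True
  then have "points G = {}" using E(3) by simp
  then have "Y \<subseteq> {{}}" using Y_sub by auto
  then have "\<phi> -` C \<inter> space N = {} \<or> \<phi> -` C \<inter> space N = space N" by auto
  then show ?thesis by (metis sets.empty_sets sets.top)
 next
  case False
  define y where "y = from_nat_into E"
  have yE: "range y = E" unfolding y_def using E(1) False by simp
  then have yp: "y i \<in> points G" for i using E(2) by blast
  \<comment> \<open>\<open>S n\<close> collects the submanifolds whose distances to the first
    \<open>n + 1\<close> test points agree up to \<open>1 / Suc n\<close> with those of some orbit
    point taken from the countable dense subset \<open>D\<close> of \<open>K\<close>.\<close>
  define S where "S n = (\<Union>A\<in>D. {\<xi> \<in> space N. \<forall>i\<in>{..n}. \<bar>set_gdist G (y i) \<xi> - set_gdist G (y i) (\<alpha> A ` \<xi>0)\<bar> < 1 / real (Suc n)})" for n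
  have "\<phi> -` C \<inter> space N = (\<Inter>n. S n)"
  proof (intro equalityI subsetI)
   fix \<xi> assume "\<xi> \<in> \<phi> -` C \<inter> space N"
   then have \<xi>: "\<xi> \<in> Y" and "\<phi> \<xi> \<in> C" by simp_all
   from \<xi> obtain A where "orthogonal_matrix A" and A2: "\<xi> = \<alpha> A ` \<xi>0" unfolding orbit by blast
   with \<open>\<phi> \<xi> \<in> C\<close> have A: "A \<in> K" "\<xi> = \<alpha> A ` \<xi>0" by (simp_all add: K_def)
   have "\<xi> \<in> S n" for n
   proof -
    have "\<exists>d>0. \<forall>B\<in>orthogonal_matrices. dist B A < d \<longrightarrow>
      \<bar>set_gdist G (y i) (\<alpha> B ` \<xi>0) - set_gdist G (y i) (\<alpha> A ` \<xi>0)\<bar> < 1 / real (Suc n)" for i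
     using act_dist_cont[OF base_Y yp[of i]] A(1) unfolding continuous_on_iff K_def dist_real_def
     by (auto dest!: spec[of _ "1 / real (Suc n)"])
    then obtain d where d: "\<And>i. d i > 0" "\<And>i B. orthogonal_matrix B ==> dist B A < d i ==>
      \<bar>set_gdist G (y i) (\<alpha> B ` \<xi>0) - set_gdist G (y i) (\<alpha> A ` \<xi>0)\<bar> < 1 / real (Suc n)"
     by (metis mem_Collect_eq)
    have "Min (d ` {..n}) > 0" using d(1) by simp
    then obtain B where B: "B \<in> D" "dist B A < Min (d ` {..n})"
     using D(3) A(1) closure_approachable[of A D] by blast
    then have "orthogonal_matrix B" using D(2) by (auto simp: K_def)
    moreover have "dist B A < d i" if "i \<le> n" for i
     using B(2) that by (meson Min_le atMost_iff finite_atMost finite_imageI imageI less_le_trans)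
    ultimately have "\<forall>i\<in>{..n}. \<bar>set_gdist G (y i) \<xi> - set_gdist G (y i) (\<alpha> B ` \<xi>0)\<bar> < 1 / real (Suc n)"
     unfolding A(2) by (intro ballI, subst abs_minus_commute, intro d(2)) auto
    then show ?thesis using B(1) \<xi> by (auto simp: S_def)
   qed
   then show "\<xi> \<in> (\<Inter>n. S n)" by blast
  next
   fix \<xi> assume S: "\<xi> \<in> (\<Inter>n. S n)"
   then have \<xi>: "\<xi> \<in> Y" by (auto simp: S_def)
   have "\<forall>n. \<exists>A. A \<in> K \<and> (\<forall>i\<le>n. \<bar>set_gdist G (y i) \<xi> - set_gdist G (y i) (\<alpha> A ` \<xi>0)\<bar> < 1 / real (Suc n))"
    using S D(2) by (auto simp: S_def) blast
   then obtain B where B: "\<And>n. B n \<in> K"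
    "\<And>n i. i \<le> n ==> \<bar>set_gdist G (y i) \<xi> - set_gdist G (y i) (\<alpha> (B n) ` \<xi>0)\<bar> < 1 / real (Suc n)"
    by metis
   \<comment> \<open>A limit of the approximating matrices stays in the compact \<open>K\<close> and
     has exactly the distances of \<open>\<xi>\<close> to all test points, so it represents
     \<open>\<xi>\<close>.\<close>
   obtain A s where A: "A \<in> K" and s: "strict_mono s" "(B \<circ> s) \<longlonglongrightarrow> A"
    using K B(1) unfolding compact_def by metis
   have Ao: "orthogonal_matrix A" "\<phi> (\<alpha> A ` \<xi>0) \<in> C" using A by (auto simp: K_def)
   have eqE: "set_gdist G (y i) \<xi> = set_gdist G (y i) (\<alpha> A ` \<xi>0)" for i
   proof -
    have "(\<lambda>n. set_gdist G (y i) (\<alpha> ((B \<circ> s) n) ` \<xi>0)) \<longlonglongrightarrow> set_gdist G (y i) (\<alpha> A ` \<xi>0)"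
     using act_dist_cont[OF base_Y yp[of i]] s(2) Ao(1) B(1)
     by (intro continuous_on_tendsto_compose[of orthogonal_matrices "\<lambda>A. set_gdist G (y i) (\<alpha> A ` \<xi>0)"])
       (auto simp: K_def o_def)
    moreover have "(\<lambda>n. set_gdist G (y i) (\<alpha> ((B \<circ> s) n) ` \<xi>0)) \<longlonglongrightarrow> set_gdist G (y i) \<xi>"
    proof -
     have "(\<lambda>n. set_gdist G (y i) (\<alpha> (B n) ` \<xi>0)) \<longlonglongrightarrow> set_gdist G (y i) \<xi>"
     proof (rule metric_LIMSEQ_I)
      fix e :: real assume "e > 0"
      then obtain n0 where n0: "1 / real (Suc n0) < e" using nat_approx_posE by blast
      have "dist (set_gdist G (y i) (\<alpha> (B n) ` \<xi>0)) (set_gdist G (y i) \<xi>) < e" if "n \<ge> max i n0" for n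
      proof -
       have "1 / real (Suc n) \<le> 1 / real (Suc n0)" using that by (intro divide_left_mono) auto
       then show ?thesis using B(2)[of i n] that n0 by (simp add: dist_real_def abs_minus_commute)
      qed
      then show "\<exists>no. \<forall>n\<ge>no. dist (set_gdist G (y i) (\<alpha> (B n) ` \<xi>0)) (set_gdist G (y i) \<xi>) < e"
       by blast
     qed
     from LIMSEQ_subseq_LIMSEQ[OF this s(1)] show ?thesis by (simp add: comp_def)
    qed
    ultimately show ?thesis by (metis LIMSEQ_unique)
   qed
   have "set_gdist G z \<xi> = set_gdist G z (\<alpha> A ` \<xi>0)" if z: "z \<in> points G" for z
   proof -
    obtain q where q: "\<And>n. q n \<in> E" "q \<longlonglongrightarrow> z"
     using E(3) z closure_sequential[of z E] by blast
    have qp: "q n \<in> points G" for n using q(1) E(2) by blast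
    have "set_gdist G (q n) \<xi> = set_gdist G (q n) (\<alpha> A ` \<xi>0)" for n
     using q(1)[of n] yE eqE by (metis imageE)
    then have seq: "(\<lambda>n. set_gdist G (q n) \<xi>) = (\<lambda>n. set_gdist G (q n) (\<alpha> A ` \<xi>0))"
     by (rule ext)
    have 1: "(\<lambda>n. set_gdist G (q n) \<xi>) \<longlonglongrightarrow> set_gdist G z \<xi>"
     using q(2) qp z by (intro continuous_on_tendsto_compose[OF set_gdist_cont[OF \<xi>]]) auto
    have 2: "(\<lambda>n. set_gdist G (q n) (\<alpha> A ` \<xi>0)) \<longlonglongrightarrow> set_gdist G z (\<alpha> A ` \<xi>0)"
     using q(2) qp z by (intro continuous_on_tendsto_compose[OF set_gdist_cont[OF act_Y[OF Ao(1) base_Y]]]) auto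
    show ?thesis using 1 unfolding seq by (rule LIMSEQ_unique[OF _ 2])
   qed
   then have "z \<in> \<xi> \<longleftrightarrow> z \<in> \<alpha> A ` \<xi>0" if "z \<in> points G" for z
    using that set_gdist_zero \<xi> act_Y[OF Ao(1) base_Y] by metis
   then have "\<xi> = \<alpha> A ` \<xi>0" using Y_sub[OF \<xi>] Y_sub[OF act_Y[OF Ao(1) base_Y]] by blast
   then show "\<xi> \<in> \<phi> -` C \<inter> space N" using \<xi> Ao by simp
  qed
  moreover have "S n \<in> sets N" for n unfolding S_def
  proof (intro sets.countable_UN'[OF D(1)] subsetI, elim imageE, simp only:)
   fix A
   have [measurable]: "set_gdist G (y i) \<in> borel_measurable N" for i using yp by (rule borel_measurable_set_gdist)
   show "{\<xi> \<in> space N. \<forall>i\<in>{..n}. \<bar>set_gdist G (y i) \<xi> - set_gdist G (y i) (\<alpha> A ` \<xi>0)\<bar> < 1 / real (Suc n)} \<in> sets N"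
    by measurable
  qed
  ultimately show ?thesis by auto
 qed
 then have "space N - \<phi> -` C \<inter> space N \<in> sets N" by (rule sets.compl_sets)
 also have "space N - \<phi> -` C \<inter> space N = \<phi> -` U \<inter> space N" by (auto simp: C_def)
 finally show "\<phi> -` U \<inter> space N \<in> sets N" .
qed

text \<open>Continuity along the group is all that is asked of \<open>\<phi>\<close>: it makes
  \<open>\<phi>\<close> Borel for the distance sigma-algebra, so the integral against the unique
  invariant measure is pulled back along the orbit map.\<close>

theorem shifted_dual_radon_orbit:
 assumes \<mu>: "prob_space \<mu>" "sets \<mu> = sets borel_orthogonal"
  "\<And>B. orthogonal_matrix B ==> distr \<mu> \<mu> (\<lambda>A. B ** A) = \<mu>"
  "\<And>B. orthogonal_matrix B ==> distr \<mu> \<mu> (\<lambda>A. A ** B) = \<mu>"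
  and cont: "continuous_on orthogonal_matrices (\<lambda>A. \<phi> (\<alpha> A ` \<xi>0))"
 shows "shifted_dual_radon G r \<phi> x = (LINT A|\<mu>. \<phi> (\<alpha> A ` \<xi>0))"
proof -
 have "(THE M. invariant_probability G x r M) = distr \<mu> N (\<lambda>A. \<alpha> A ` \<xi>0)"
  using invariant_probability_iff[OF \<mu>] by simp
 moreover have "(\<lambda>A. \<alpha> A ` \<xi>0) \<in> \<mu> \<rightarrow>\<^sub>M N"
  unfolding measurable_cong_sets[OF \<mu>(2) refl] by (rule measurable_orbit_map[OF base_Y])
 ultimately show ?thesis using borel_measurable_orbit[OF cont] by (simp add: shifted_dual_radon_def integral_distr)
qed

end

section \<open>One-sided derivatives of radial integrals\<close>

lemma nth_deriv_0 [simp]: "nth_deriv 0 F = F" by (simp add: nth_deriv_def)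

lemma nth_deriv_Suc: "nth_deriv (Suc i) F = (\<lambda>r. vector_derivative (nth_deriv i F) (at r))"
 by (simp add: nth_deriv_def)

lemma vector_derivative_cong_open:
 assumes "open S" "r \<in> S" "\<And>s. s \<in> S ==> F s = G s"
 shows "vector_derivative F (at r) = vector_derivative G (at r)"
 using assms by (intro vector_derivative_cong_eq) (auto simp: eventually_nhds)

lemma nth_deriv_cong_open:
 assumes "open S" "\<And>s. s \<in> S ==> F s = G s" "r \<in> S"
 shows "nth_deriv i F r = nth_deriv i G r" using assms(3)
proof (induction i arbitrary: r)
 case (Suc i)
 then show ?case unfolding nth_deriv_Suc by (intro vector_derivative_cong_open[OF assms(1)]) auto
qed (use assms in simp)

lemma differentiable_cong_open:
 fixes F G :: "real => complex"
 assumes "open S" "\<And>s. s \<in> S ==> F s = G s" "r \<in> S" "F differentiable (at r)"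
 shows "G differentiable (at r)"
proof -
 obtain D where "(F has_derivative D) (at r)" using assms(4) by (auto simp: differentiable_def)
 then have "(G has_derivative D) (at r)" by (rule has_derivative_transform_within_open[OF _ assms(1,3,2)])
 then show ?thesis by (auto simp: differentiable_def)
qed

definition smooth_on_reals :: "real set => (real => complex) => bool" where
 "smooth_on_reals S F \<longleftrightarrow> open S \<and> (\<forall>i. \<forall>r\<in>S. nth_deriv i F differentiable (at r))"

lemma smooth_on_reals_has_deriv:
 assumes "smooth_on_reals S F" "r \<in> S"
 shows "(nth_deriv i F has_vector_derivative nth_deriv (Suc i) F r) (at r)"
 using assms unfolding smooth_on_reals_def nth_deriv_Suc by (simp add: vector_derivative_works)

text \<open>\<open>nth_deriv\<close> iterates \<open>vector_derivative\<close>, whose value at a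
  point depends on nearby values; candidates \<open>D i\<close> for the derivatives are therefore
  matched on an open set, by induction on the order.\<close>

lemma smooth_on_realsI:
 assumes "open S" "\<And>i r. r \<in> S ==> (D i has_vector_derivative D (Suc i) r) (at r)"
  and "\<And>r. r \<in> S ==> F r = D 0 r"
 shows "smooth_on_reals S F" and "r \<in> S ==> nth_deriv i F r = D i r"
proof -
 have eq: "nth_deriv i F r = D i r" if "r \<in> S" for i r using that
 proof (induction i arbitrary: r)
  case (Suc i)
  have "vector_derivative (nth_deriv i F) (at r) = vector_derivative (D i) (at r)"
   using Suc by (intro vector_derivative_cong_open[OF assms(1)]) auto
  also have "\<dots> = D (Suc i) r" using assms(2)[OF Suc.prems] by (rule vector_derivative_at)
  finally show ?case by (simp add: nth_deriv_Suc)
 qed (use assms(3) in simp)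
 then show "r \<in> S ==> nth_deriv i F r = D i r" by blast
 have "nth_deriv i F differentiable (at r)" if "r \<in> S" for i r
  by (rule differentiable_cong_open[OF assms(1) _ that, of "D i"])
   (use eq differentiableI_vector[OF assms(2)[OF that]] in auto)
 then show "smooth_on_reals S F" using assms(1) by (simp add: smooth_on_reals_def)
qed

lemma smooth_on_reals_integral:
 assumes "\<And>r. r \<in> S ==> (F has_vector_derivative H r) (at r)" "smooth_on_reals S H"
 shows "smooth_on_reals S F" and "r \<in> S ==> nth_deriv (Suc i) F r = nth_deriv i H r"
proof -
 let ?D = "\<lambda>i. case i of 0 => F | Suc j => nth_deriv j H"
 have S: "open S" using assms(2) by (simp add: smooth_on_reals_def)
 have D: "(?D i has_vector_derivative ?D (Suc i) r) (at r)" if "r \<in> S" for i r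
  using assms(1)[OF that] smooth_on_reals_has_deriv[OF assms(2) that] by (cases i) auto
 show "smooth_on_reals S F" by (rule smooth_on_realsI(1)[where D="?D", OF S D]) auto
 show "r \<in> S ==> nth_deriv (Suc i) F r = nth_deriv i H r"
  using smooth_on_realsI(2)[where D="?D", OF S D, of F r "Suc i"] by simp
qed

lemma smooth_on_reals_times:
 assumes "smooth_on_reals S G"
 shows "smooth_on_reals S (\<lambda>r. of_real r * G r)"
  and "r \<in> S ==> nth_deriv i (\<lambda>r. of_real r * G r) r = of_real r * nth_deriv i G r + of_nat i * nth_deriv (i - 1) G r"
proof -
 \<comment> \<open>For \<open>i = 0\<close> the truncated index \<open>i - 1\<close> does no harm,
   since its coefficient is 0.\<close>
 let ?D = "\<lambda>i r. of_real r * nth_deriv i G r + of_nat i * nth_deriv (i - 1) G r"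
 have S: "open S" using assms by (simp add: smooth_on_reals_def)
 have D: "(?D i has_vector_derivative ?D (Suc i) r) (at r)" if "r \<in> S" for i r
 proof -
  note d = smooth_on_reals_has_deriv[OF assms that]
  have 1: "((\<lambda>r. of_real r * nth_deriv i G r) has_vector_derivative
    (of_real r * nth_deriv (Suc i) G r + 1 * nth_deriv i G r)) (at r)"
   by (rule has_vector_derivative_mult[OF _ d]) (auto intro!: derivative_eq_intros simp: has_vector_derivative_def scaleR_conv_of_real)
  have 2: "((\<lambda>r. of_nat i * nth_deriv (i - 1) G r) has_vector_derivative of_nat i * nth_deriv i G r) (at r)"
  proof (cases i)
   case (Suc j)
   then show ?thesis using has_vector_derivative_mult_right[OF d[of j], of "of_nat i"] by simp
  qed simp
  show ?thesis using has_vector_derivative_add[OF 1 2] by (simp add: algebra_simps)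
 qed
 show "smooth_on_reals S (\<lambda>r. of_real r * G r)" by (rule smooth_on_realsI(1)[where D="?D", OF S D]) auto
 show "r \<in> S ==> nth_deriv i (\<lambda>r. of_real r * G r) r = ?D i r"
  using smooth_on_realsI(2)[where D="?D", OF S D, of "\<lambda>r. of_real r * G r" r i] by simp
qed

lemma smooth_on_reals_cmult:
 assumes "smooth_on_reals S G"
 shows "smooth_on_reals S (\<lambda>r. c * G r)" and "r \<in> S ==> nth_deriv i (\<lambda>r. c * G r) r = c * nth_deriv i G r"
proof -
 have S: "open S" using assms by (simp add: smooth_on_reals_def)
 have D: "((\<lambda>r. c * nth_deriv i G r) has_vector_derivative c * nth_deriv (Suc i) G r) (at r)" if "r \<in> S" for i r
  by (rule has_vector_derivative_mult_right[OF smooth_on_reals_has_deriv[OF assms that]])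
 show "smooth_on_reals S (\<lambda>r. c * G r)"
  by (rule smooth_on_realsI(1)[where D="\<lambda>i r. c * nth_deriv i G r", OF S D]) auto
 show "r \<in> S ==> nth_deriv i (\<lambda>r. c * G r) r = c * nth_deriv i G r"
  using smooth_on_realsI(2)[where D="\<lambda>i r. c * nth_deriv i G r", OF S D, of "\<lambda>r. c * G r" r i] by simp
qed

text \<open>
 \<open>jet_limit j a G\<close> is stable under integration and under multiplication by the variable, which
 is not the case for the first conjunct alone.
\<close>

definition jet_limit :: "nat => complex => (real => complex) => bool" where
 "jet_limit j a G \<longleftrightarrow> (nth_deriv j G \<longlongrightarrow> a) (at_right 0) \<and>
   (\<forall>i\<ge>1. ((\<lambda>r. of_real r ^ i * nth_deriv (j + i) G r) \<longlongrightarrow> 0) (at_right 0))"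

lemma eventually_at_right_0: "\<delta> > 0 ==> eventually (\<lambda>r. r \<in> {0<..<\<delta>}) (at_right (0::real))"
 unfolding eventually_at_right_field by (intro exI[of _ \<delta>]) auto

lemma jet_limit_integral:
 assumes "\<delta> > 0" "\<And>r. r \<in> {0<..<\<delta>} ==> (F has_vector_derivative H r) (at r)"
  "smooth_on_reals {0<..<\<delta>} H" "jet_limit j a H"
 shows "jet_limit (Suc j) a F"
proof -
 have ev: "eventually (\<lambda>r. nth_deriv i H r = nth_deriv (Suc i) F r) (at_right 0)" for i
  using eventually_at_right_0[OF assms(1)]
  by eventually_elim (rule smooth_on_reals_integral(2)[OF assms(2,3), symmetric])
 show ?thesis unfolding jet_limit_def
 proof (intro conjI allI impI)
  show "(nth_deriv (Suc j) F \<longlongrightarrow> a) (at_right 0)"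
   using assms(4) tendsto_cong[OF ev[of j]] by (simp add: jet_limit_def)
  fix i :: nat assume "1 \<le> i"
  then have "((\<lambda>r. of_real r ^ i * nth_deriv (j + i) H r) \<longlongrightarrow> 0) (at_right 0)"
   using assms(4) by (simp add: jet_limit_def)
  then show "((\<lambda>r. of_real r ^ i * nth_deriv (Suc j + i) F r) \<longlongrightarrow> 0) (at_right 0)"
   by (rule Lim_transform_eventually) (use ev[of "j + i"] in eventually_elim, simp)
 qed
qed

text \<open>By Leibniz the derivative of order \<open>Suc j\<close> is \<open>r\<close> times that
  of \<open>G\<close> of the same order plus \<open>Suc j\<close> times the one of order
  \<open>j\<close>; the first term tends to 0 by the second conjunct of \<open>jet_limit\<close>.
  The weighted higher derivatives are treated alike.\<close>

lemma jet_limit_times: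
 assumes "\<delta> > 0" "smooth_on_reals {0<..<\<delta>} G" "jet_limit j a G"
 shows "jet_limit (Suc j) (of_nat (Suc j) * a) (\<lambda>r. of_real r * G r)"
proof -
 let ?D = "\<lambda>i r. of_real r * nth_deriv i G r + of_nat i * nth_deriv (i - 1) G r"
 have ev: "eventually (\<lambda>r. ?D i r = nth_deriv i (\<lambda>r. of_real r * G r) r) (at_right 0)" for i
  using eventually_at_right_0[OF assms(1)] by eventually_elim (rule smooth_on_reals_times(2)[OF assms(2), symmetric])
 have z: "((\<lambda>r. of_real r ^ i * nth_deriv (j + i) G r) \<longlongrightarrow> 0) (at_right 0)" if "1 \<le> i" for i
  using assms(3) that by (simp add: jet_limit_def)
 show ?thesis unfolding jet_limit_def
 proof (intro conjI allI impI)
  have "(?D (Suc j) \<longlongrightarrow> 0 + of_nat (Suc j) * a) (at_right 0)"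
   using z[of 1] assms(3) by (intro tendsto_add tendsto_mult_left) (auto simp: jet_limit_def)
  then show "(nth_deriv (Suc j) (\<lambda>r. of_real r * G r) \<longlongrightarrow> of_nat (Suc j) * a) (at_right 0)"
   using tendsto_cong[OF ev[of "Suc j"]] by simp
  fix i :: nat assume i: "1 \<le> i"
  have "((\<lambda>r. of_real r ^ Suc i * nth_deriv (j + Suc i) G r +
    of_nat (Suc j + i) * (of_real r ^ i * nth_deriv (j + i) G r)) \<longlongrightarrow> 0 + of_nat (Suc j + i) * 0) (at_right 0)"
   using z[of i] z[of "Suc i"] i by (intro tendsto_add tendsto_mult_left) auto
  then have "((\<lambda>r. of_real r ^ Suc i * nth_deriv (j + Suc i) G r +
    of_nat (Suc j + i) * (of_real r ^ i * nth_deriv (j + i) G r)) \<longlongrightarrow> 0) (at_right 0)" by simp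
  then show "((\<lambda>r. of_real r ^ i * nth_deriv (Suc j + i) (\<lambda>r. of_real r * G r) r) \<longlongrightarrow> 0) (at_right 0)"
  proof (rule Lim_transform_eventually)
   show "\<forall>\<^sub>F r in at_right 0. of_real r ^ Suc i * nth_deriv (j + Suc i) G r +
     of_nat (Suc j + i) * (of_real r ^ i * nth_deriv (j + i) G r)
    = of_real r ^ i * nth_deriv (Suc j + i) (\<lambda>r. of_real r * G r) r" using ev[of "Suc j + i"]
   proof eventually_elim
    case (elim r)
    have "j + Suc i = Suc j + i" "Suc j + i - 1 = j + i" by auto
    then show ?case unfolding elim[symmetric] by (simp add: algebra_simps)
   qed
  qed
 qed
qed

lemma jet_limit_cmult:
 assumes "\<delta> > 0" "smooth_on_reals {0<..<\<delta>} G" "jet_limit j a G"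
 shows "jet_limit j (c * a) (\<lambda>r. c * G r)"
proof -
 have ev: "eventually (\<lambda>r. c * nth_deriv i G r = nth_deriv i (\<lambda>r. c * G r) r) (at_right 0)" for i
  using eventually_at_right_0[OF assms(1)] by eventually_elim (rule smooth_on_reals_cmult(2)[OF assms(2), symmetric])
 show ?thesis unfolding jet_limit_def
 proof (intro conjI allI impI)
  have "((\<lambda>r. c * nth_deriv j G r) \<longlongrightarrow> c * a) (at_right 0)"
   using assms(3) by (intro tendsto_mult_left) (auto simp: jet_limit_def)
  then show "(nth_deriv j (\<lambda>r. c * G r) \<longlongrightarrow> c * a) (at_right 0)"
   using tendsto_cong[OF ev[of j]] by simp
  fix i :: nat assume i: "1 \<le> i"
  have "((\<lambda>r. c * (of_real r ^ i * nth_deriv (j + i) G r)) \<longlongrightarrow> c * 0) (at_right 0)"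
   using assms(3) i by (intro tendsto_mult_left) (auto simp: jet_limit_def)
  then have "((\<lambda>r. c * (of_real r ^ i * nth_deriv (j + i) G r)) \<longlongrightarrow> 0) (at_right 0)" by simp
  then show "((\<lambda>r. of_real r ^ i * nth_deriv (j + i) (\<lambda>r. c * G r) r) \<longlongrightarrow> 0) (at_right 0)"
   by (rule Lim_transform_eventually) (use ev[of "j + i"] in \<open>eventually_elim, simp add: mult_ac\<close>)
 qed
qed

text \<open>Passing from \<open>D n\<close> to \<open>D (Suc n)\<close> multiplies by
  \<open>r\<close>, which contributes \<open>2 * n + 3\<close> to the limit, then by
  \<open>- (2 * n + 2)\<close>, and integrates. Two more orders of differentiation thus cost
  \<open>- (2 * n + 2) * (2 * n + 3)\<close>; starting from - 1 at \<open>n = 0\<close>, these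
  factors multiply to the signed factorial.\<close>

lemma jet_limit_recursion:
 assumes \<delta>: "\<delta> > 0" and F: "smooth_on_reals {0<..<\<delta>} F" "jet_limit 0 a F"
  and D0: "\<And>r. r \<in> {0<..<\<delta>} ==> (D 0 has_vector_derivative - 1 * (of_real r * F r)) (at r)"
  and DS: "\<And>n r. r \<in> {0<..<\<delta>} ==> n < N ==> (D (Suc n) has_vector_derivative (- 2 * of_nat (Suc n)) * (of_real r * D n r)) (at r)"
 shows "n \<le> N ==> smooth_on_reals {0<..<\<delta>} (D n) \<and> jet_limit (2 * Suc n) ((- 1) ^ Suc n * fact (2 * n + 1) * a) (D n)"
proof (induction n)
 case 0
 let ?H = "\<lambda>r. - 1 * (of_real r * F r)"
 have s: "smooth_on_reals {0<..<\<delta>} ?H" by (intro smooth_on_reals_cmult(1) smooth_on_reals_times(1) F)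
 have "jet_limit (Suc 0) (- 1 * (of_nat (Suc 0) * a)) ?H"
  by (rule jet_limit_cmult[OF \<delta> smooth_on_reals_times(1)[OF F(1)] jet_limit_times[OF \<delta> F]])
 from jet_limit_integral[OF \<delta> D0 s this] smooth_on_reals_integral(1)[OF D0 s]
 show ?case by (simp add: numeral_2_eq_2)
next
 case (Suc n)
 then have IH: "smooth_on_reals {0<..<\<delta>} (D n)" "jet_limit (2 * Suc n) ((- 1) ^ Suc n * fact (2 * n + 1) * a) (D n)"
  and n: "n < N" by auto
 let ?H = "\<lambda>r. (- 2 * of_nat (Suc n)) * (of_real r * D n r)"
 have s: "smooth_on_reals {0<..<\<delta>} ?H" by (intro smooth_on_reals_cmult(1) smooth_on_reals_times(1) IH)
 have "jet_limit (Suc (2 * Suc n)) ((- 2 * of_nat (Suc n)) * (of_nat (Suc (2 * Suc n)) * ((- 1) ^ Suc n * fact (2 * n + 1) * a))) ?H"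
  by (rule jet_limit_cmult[OF \<delta> smooth_on_reals_times(1)[OF IH(1)] jet_limit_times[OF \<delta> IH]])
 from jet_limit_integral[OF \<delta> DS[OF _ n] s this] smooth_on_reals_integral(1)[OF DS[OF _ n] s]
 have "smooth_on_reals {0<..<\<delta>} (D (Suc n))"
  "jet_limit (2 * Suc (Suc n)) ((- 2 * of_nat (Suc n)) * (of_nat (Suc (2 * Suc n)) * ((- 1) ^ Suc n * fact (2 * n + 1) * a))) (D (Suc n))"
  by auto
 moreover have "(- 2 * of_nat (Suc n)) * (of_nat (Suc (2 * Suc n)) * ((- 1) ^ Suc n * fact (2 * n + 1) * a))
   = (- 1) ^ Suc (Suc n) * fact (2 * Suc n + 1) * a" by (simp add: algebra_simps)
 ultimately show ?case by simp
qed

section \<open>Tail integrals and their derivatives\<close>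

lemma has_vector_derivative_tail_integral:
 fixes f :: "real => complex"
 assumes int: "set_integrable lborel {0<..} f" and cont: "continuous_on {0<..<\<delta>} f" and r: "r \<in> {0<..<\<delta>}"
 shows "((\<lambda>r. LINT t:{r<..}|lborel. f t) has_vector_derivative - f r) (at r)"
proof -
 define a b where "a = r / 2" and "b = (r + \<delta>) / 2"
 have ab: "0 < a" "a < r" "r < b" "b < \<delta>" using r by (auto simp: a_def b_def)
 have c: "continuous_on {a..b} f" by (rule continuous_on_subset[OF cont]) (use ab in auto)
 have "((\<lambda>u. integral {a..u} f) has_vector_derivative f r) (at r within {a..b})"
  using ab by (intro integral_has_vector_derivative[OF c]) auto
 then have d: "((\<lambda>u. integral {a..u} f) has_vector_derivative f r) (at r)"
  using ab by (subst (asm) at_within_interior) (auto simp: interior_cbox)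
 have eq: "(LINT t:{a<..}|lborel. f t) - integral {a..u} f = (LINT t:{u<..}|lborel. f t)" if u: "u \<in> {a<..<b}" for u
 proof -
  have i: "set_integrable lborel A f" if "A \<subseteq> {0<..}" "A \<in> sets borel" for A
   using set_integrable_subset[OF int] that by simp
  have un: "{a<..} = {a<..u} \<union> {u<..}" using u by auto
  have "(LINT t:{a<..}|lborel. f t) = (LINT t:{a<..u}|lborel. f t) + (LINT t:{u<..}|lborel. f t)"
   unfolding un using ab u by (intro set_integral_Un i) auto
  moreover have "(LINT t:{a<..u}|lborel. f t) = (LINT t:{a..u}|lborel. f t)"
  proof (rule set_integral_cong_set)
   show "AE x in lborel. (x \<in> {a..u}) = (x \<in> {a<..u})" using AE_lborel_singleton[of a] by eventually_elim auto
   have m: "set_borel_measurable lborel A f" if "A \<subseteq> {0<..}" "A \<in> sets borel" for A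
    using borel_measurable_integrable[OF i[OF that, unfolded set_integrable_def]] unfolding set_borel_measurable_def .
   show "set_borel_measurable lborel {a..u} f" by (rule m) (use ab in auto)
   show "set_borel_measurable lborel {a<..u} f" by (rule m) (use ab in auto)
  qed
  moreover have "(LINT t:{a..u}|lborel. f t) = integral {a..u} f"
   by (rule set_borel_integral_eq_integral(2), rule i) (use ab in auto)
  ultimately show ?thesis by simp
 qed
 have "((\<lambda>u. (LINT t:{a<..}|lborel. f t) - integral {a..u} f) has_vector_derivative 0 - f r) (at r)"
  by (intro has_vector_derivative_diff has_vector_derivative_const d)
 then have "((\<lambda>u. LINT t:{u<..}|lborel. f t) has_vector_derivative 0 - f r) (at r)"
  by (rule has_vector_derivative_transform_within_open[where S="{a<..<b}"]) (use ab eq in auto)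
 then show ?thesis by simp
qed

text \<open>With \<open>n = m - 1\<close> and \<open>q\<close> the spherical mean times
  \<open>(1 - \<kappa> t^2) powr (- (1 / 2))\<close>, this is the averaged Radon transform up to a
  constant and a power of \<open>1 - \<kappa> r^2\<close>.\<close>

definition tail_moment :: "(real => complex) => nat => real => complex" where
 "tail_moment q n r = (LINT t:{r<..}|lborel. q t * of_real ((t\<^sup>2 - r\<^sup>2) ^ n * t))"

text \<open>The binomial theorem separates \<open>r\<close> from \<open>t\<close>: \<open>r\<close>
  survives only in polynomial coefficients and in the lower limit, so each term is differentiated by
  the fundamental theorem of calculus.\<close>

lemma tail_moment_expand:
 assumes int: "\<And>j. j \<le> n ==> set_integrable lborel {0<..} (\<lambda>t. q t * of_real (t ^ (2 * j + 1)))" and r: "r > 0"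
 shows "tail_moment q n r = (\<Sum>j\<le>n. of_real (of_nat (n choose j) * (- r\<^sup>2) ^ j) * (LINT t:{r<..}|lborel. q t * of_real (t ^ (2 * (n - j) + 1))))"
proof -
 have i: "set_integrable lborel {r<..} (\<lambda>t. q t * of_real (t ^ (2 * (n - j) + 1)))" for j
  by (rule set_integrable_subset[OF int]) (use r in auto)
 have "q t * of_real ((t\<^sup>2 - r\<^sup>2) ^ n * t)
   = (\<Sum>j\<le>n. of_real (of_nat (n choose j) * (- r\<^sup>2) ^ j) * (q t * of_real (t ^ (2 * (n - j) + 1))))" for t
 proof -
  have "(t\<^sup>2 - r\<^sup>2) ^ n = (- r\<^sup>2 + t^2) ^ n" by simp
  also have "\<dots> = (\<Sum>j\<le>n. of_nat (n choose j) * (- r\<^sup>2) ^ j * (t\<^sup>2) ^ (n - j))"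
   by (rule binomial_ring)
  finally show ?thesis by (simp add: sum_distrib_left sum_distrib_right power_mult[symmetric] mult_ac)
 qed
 then have "tail_moment q n r = (LINT t:{r<..}|lborel. (\<Sum>j\<le>n. of_real (of_nat (n choose j) * (- r\<^sup>2) ^ j) * (q t * of_real (t ^ (2 * (n - j) + 1)))))"
  by (simp add: tail_moment_def)
 also have "\<dots> = (\<Sum>j\<le>n. LINT t:{r<..}|lborel. of_real (of_nat (n choose j) * (- r\<^sup>2) ^ j) * (q t * of_real (t ^ (2 * (n - j) + 1))))"
  unfolding set_lebesgue_integral_def scaleR_sum_right by (rule Bochner_Integration.integral_sum)
   (use set_integrable_mult_right[OF i] in \<open>simp add: set_integrable_def\<close>)
 also have "\<dots> = (\<Sum>j\<le>n. of_real (of_nat (n choose j) * (- r\<^sup>2) ^ j) * (LINT t:{r<..}|lborel. q t * of_real (t ^ (2 * (n - j) + 1))))"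
  by (simp only: set_integral_mult_right)
 finally show ?thesis .
qed

text \<open>The boundary terms recombine to \<open>(r^2 - r^2)^n r q(r)\<close>, which is nonzero
  only for \<open>n = 0\<close>; the derivatives of the coefficients recombine to the lower moment
  by absorption, \<open>j * (n choose j) = n * (n - 1 choose j - 1)\<close>.\<close>

lemma tail_moment_deriv:
 assumes int: "\<And>j. j \<le> n ==> set_integrable lborel {0<..} (\<lambda>t. q t * of_real (t ^ (2 * j + 1)))"
  and cont: "continuous_on {0<..<\<delta>} q" and r: "r \<in> {0<..<\<delta>}"
 shows "(tail_moment q n has_vector_derivative
   (if n = 0 then - (of_real r * q r) else (- 2 * of_nat n) * (of_real r * tail_moment q (n - 1) r))) (at r)"
proof -
 let ?J = "\<lambda>j r. LINT t:{r<..}|lborel. q t * of_real (t ^ (2 * (n - j) + 1))"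
 let ?c = "\<lambda>j r. complex_of_real (of_nat (n choose j) * (- r\<^sup>2) ^ j)"
 let ?c' = "\<lambda>j r. complex_of_real (of_nat (n choose j) * (of_nat j * (- r\<^sup>2) ^ (j - 1) * (- 2 * r)))"
 have J: "(?J j has_vector_derivative - (q r * of_real (r ^ (2 * (n - j) + 1)))) (at r)" for j
  by (rule has_vector_derivative_tail_integral[OF int _ r]) (auto intro!: continuous_intros cont)
 have c: "(?c j has_vector_derivative ?c' j r) (at r)" for j by (rule has_vector_derivative_of_real)
    (auto intro!: derivative_eq_intros simp: has_real_derivative_iff_has_vector_derivative[symmetric])
 have "((\<lambda>r. \<Sum>j\<le>n. ?c j r * ?J j r) has_vector_derivative
   (\<Sum>j\<le>n. ?c j r * - (q r * of_real (r ^ (2 * (n - j) + 1))) + ?c' j r * ?J j r)) (at r)"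
  by (intro has_vector_derivative_sum has_vector_derivative_mult c J)
 also have "(\<Sum>j\<le>n. ?c j r * - (q r * of_real (r ^ (2 * (n - j) + 1))) + ?c' j r * ?J j r)
  = - (\<Sum>j\<le>n. ?c j r * (q r * of_real (r ^ (2 * (n - j) + 1)))) + (\<Sum>j\<le>n. ?c' j r * ?J j r)"
  by (simp only: sum.distrib mult_minus_right sum_negf)
 \<comment> \<open>The binomial theorem read backwards at \<open>t = r\<close>; \<open>0 ^ n\<close>
   is 1 for \<open>n = 0\<close>, the one case with a boundary term.\<close>
 also have "(\<Sum>j\<le>n. ?c j r * (q r * of_real (r ^ (2 * (n - j) + 1)))) = q r * of_real (0 ^ n * r)"
 proof -
  have "(- r\<^sup>2 + r^2) ^ n = (\<Sum>j\<le>n. of_nat (n choose j) * (- r\<^sup>2) ^ j * (r\<^sup>2) ^ (n - j))"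
   by (rule binomial_ring)
  then have "of_real (0 ^ n * r) = complex_of_real ((\<Sum>j\<le>n. of_nat (n choose j) * (- r\<^sup>2) ^ j * (r\<^sup>2) ^ (n - j)) * r)"
   by simp
  then show ?thesis by (simp add: sum_distrib_left sum_distrib_right power_mult[symmetric] mult_ac)
 qed
 also have "- (q r * of_real (0 ^ n * r)) + (\<Sum>j\<le>n. ?c' j r * ?J j r)
  = (if n = 0 then - (of_real r * q r) else (- 2 * of_nat n) * (of_real r * tail_moment q (n - 1) r))"
 proof (cases n)
  case (Suc l)
  have "(\<Sum>j\<le>n. ?c' j r * ?J j r) = (\<Sum>j\<le>l. ?c' (Suc j) r * ?J (Suc j) r)"
   by (simp add: Suc sum.atMost_Suc_shift del: sum.atMost_Suc)
  also have "\<dots> = (\<Sum>j\<le>l. (- 2 * of_nat n * of_real r) * (of_real (of_nat (l choose j) * (- r\<^sup>2) ^ j) *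
    (LINT t:{r<..}|lborel. q t * of_real (t ^ (2 * (l - j) + 1)))))"
  proof (rule sum.cong[OF refl])
   fix j
   have "of_nat (n choose Suc j) * (of_nat (Suc j) * (- r\<^sup>2) ^ j * (- 2 * r)) = (- 2 * of_nat n * r) * (of_nat (l choose j) * (- r\<^sup>2) ^ j)"
   proof -
    have "real (Suc j) * real (n choose Suc j) = real n * real (l choose j)"
     unfolding Suc of_nat_mult[symmetric] Suc_times_binomial ..
    then show ?thesis by (simp add: mult_ac)
   qed
   then have "?c' (Suc j) r = (- 2 * of_nat n * of_real r) * of_real (of_nat (l choose j) * (- r\<^sup>2) ^ j)"
    by (metis (no_types, lifting) diff_Suc_1 of_real_minus of_real_mult of_real_numeral of_real_of_nat_eq)
   then show "?c' (Suc j) r * ?J (Suc j) r = (- 2 * of_nat n * of_real r) * (of_real (of_nat (l choose j) * (- r\<^sup>2) ^ j) *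
    (LINT t:{r<..}|lborel. q t * of_real (t ^ (2 * (l - j) + 1))))" by (simp add: Suc)
  qed
  also have "\<dots> = (- 2 * of_nat n * of_real r) * tail_moment q l r"
   unfolding sum_distrib_left[symmetric] using r int by (subst tail_moment_expand) (auto simp: Suc)
  finally show ?thesis by (simp add: Suc mult.assoc)
 qed (simp add: tail_moment_def)
 finally have "((\<lambda>r. \<Sum>j\<le>n. ?c j r * ?J j r) has_vector_derivative
   (if n = 0 then - (of_real r * q r) else (- 2 * of_nat n) * (of_real r * tail_moment q (n - 1) r))) (at r)" .
 then show ?thesis by (rule has_vector_derivative_transform_within_open[where S="{0<..<\<delta>}"])
   (use r int in \<open>auto simp: tail_moment_expand\<close>)
qed

lemma has_nth_deriv_tail_moment:
 assumes \<delta>: "\<delta> > 0" and q: "smooth_on_reals {0<..<\<delta>} q" "jet_limit 0 a q"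
  and int: "\<And>j. j \<le> n ==> set_integrable lborel {0<..} (\<lambda>t. q t * of_real (t ^ (2 * j + 1)))"
  and eq: "\<And>r. r \<in> {0<..<\<delta>} ==> F r = c * tail_moment q n r"
 shows "has_nth_deriv_at_right_0 (2 * Suc n) F (c * ((- 1) ^ Suc n * fact (2 * n + 1) * a))"
proof -
 have cont: "continuous_on {0<..<\<delta>} q" using smooth_on_reals_has_deriv[OF q(1), of _ 0]
  by (intro continuous_at_imp_continuous_on ballI) (auto dest: has_vector_derivative_continuous)
 have "smooth_on_reals {0<..<\<delta>} (tail_moment q n) \<and> jet_limit (2 * Suc n) ((- 1) ^ Suc n * fact (2 * n + 1) * a) (tail_moment q n)"
 proof (rule jet_limit_recursion[OF \<delta> q, of "tail_moment q" n])
  fix r assume r: "r \<in> {0<..<\<delta>}"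
  have td: "(tail_moment q l has_vector_derivative
    (if l = 0 then - (of_real r * q r) else (- 2 * of_nat l) * (of_real r * tail_moment q (l - 1) r))) (at r)"
   if "l \<le> n" for l by (rule tail_moment_deriv[OF int cont r]) (use that in auto)
  show "(tail_moment q 0 has_vector_derivative - 1 * (of_real r * q r)) (at r)" using td[of 0] by simp
  fix l assume "l < n"
  then show "(tail_moment q (Suc l) has_vector_derivative - 2 * of_nat (Suc l) * (of_real r * tail_moment q l r)) (at r)"
   using td[of "Suc l"] by simp
 qed simp
 then have s: "smooth_on_reals {0<..<\<delta>} (tail_moment q n)"
  and j: "jet_limit (2 * Suc n) ((- 1) ^ Suc n * fact (2 * n + 1) * a) (tail_moment q n)" by auto
 note s' = smooth_on_reals_cmult(1)[OF s, of c] and j' = jet_limit_cmult[OF \<delta> s j, of c]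
 have op: "open {0<..<\<delta>}" by simp
 have nd: "nth_deriv i F r = nth_deriv i (\<lambda>r. c * tail_moment q n r) r" if "r \<in> {0<..<\<delta>}" for i r
  by (rule nth_deriv_cong_open[OF op eq that])
 show ?thesis unfolding has_nth_deriv_at_right_0_def
 proof
  show "\<forall>\<^sub>F r in at_right 0. \<forall>i<2 * Suc n. nth_deriv i F differentiable at r"
   using eventually_at_right_0[OF \<delta>]
  proof eventually_elim
   case (elim r)
   have "nth_deriv i F differentiable at r" for i by (rule differentiable_cong_open[OF op nd[symmetric] elim])
     (use s' elim in \<open>auto simp: smooth_on_reals_def\<close>)
   then show ?case by blast
  qed
  have "(nth_deriv (2 * Suc n) (\<lambda>r. c * tail_moment q n r) \<longlongrightarrow> c * ((- 1) ^ Suc n * fact (2 * n + 1) * a)) (at_right 0)"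
   using j' by (simp add: jet_limit_def)
  then show "(nth_deriv (2 * Suc n) F \<longlongrightarrow> c * ((- 1) ^ Suc n * fact (2 * n + 1) * a)) (at_right 0)"
   by (rule Lim_transform_eventually)
    (use eventually_at_right_0[OF \<delta>] in \<open>eventually_elim, simp only: nd\<close>)
 qed
qed

text \<open>\<open>n\<close> times differentiable in the real variable with jointly continuous
  derivatives, which for compact \<open>K\<close> permits differentiation under an integral over
  \<open>K\<close>. Derivatives are supplied as witnesses, so closure under sums and products is a
  plain induction on \<open>n\<close>.\<close>

primrec smooth_family :: "nat => real set => 'k::topological_space set => (real => 'k => complex) => bool" where
 "smooth_family 0 I K h \<longleftrightarrow> continuous_on (I \<times> K) (\<lambda>p. h (fst p) (snd p))"
| "smooth_family (Suc n) I K h \<longleftrightarrow> continuous_on (I \<times> K) (\<lambda>p. h (fst p) (snd p)) \<and>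
   (\<exists>h'. (\<forall>t\<in>I. \<forall>A\<in>K. ((\<lambda>t. h t A) has_vector_derivative h' t A) (at t)) \<and> smooth_family n I K h')"

lemma smooth_family_continuous:
 "smooth_family n I K h ==> continuous_on (I \<times> K) (\<lambda>p. h (fst p) (snd p))"
 by (cases n) auto

lemma smooth_family_SucI:
 assumes "continuous_on (I \<times> K) (\<lambda>p. h (fst p) (snd p))" "smooth_family n I K h'"
  and "\<And>t A. t \<in> I ==> A \<in> K ==> ((\<lambda>t. h t A) has_vector_derivative h' t A) (at t)"
 shows "smooth_family (Suc n) I K h" using assms by auto

lemma smooth_family_SucD: "smooth_family (Suc n) I K h ==> smooth_family n I K h"
proof (induction n arbitrary: h)
 case (Suc n)
 then obtain h' where h': "\<forall>t\<in>I. \<forall>A\<in>K. ((\<lambda>t. h t A) has_vector_derivative h' t A) (at t)" "smooth_family (Suc n) I K h'"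
  and c: "continuous_on (I \<times> K) (\<lambda>p. h (fst p) (snd p))"
  unfolding smooth_family.simps(2)[of "Suc n"] by blast
 then show ?case using Suc.IH[OF h'(2)] unfolding smooth_family.simps(2)[of n] by blast
qed simp

lemma smooth_family_cong:
 assumes "\<And>t A. t \<in> I ==> A \<in> K ==> h t A = g t A" "open I" "smooth_family n I K h"
 shows "smooth_family n I K g"
proof -
 have c: "continuous_on (I \<times> K) (\<lambda>p. g (fst p) (snd p))" using smooth_family_continuous[OF assms(3)]
  by (rule continuous_on_eq) (use assms(1) in auto)
 show ?thesis
 proof (cases n)
  case (Suc m)
  then obtain h' where h': "\<forall>t\<in>I. \<forall>A\<in>K. ((\<lambda>t. h t A) has_vector_derivative h' t A) (at t)" "smooth_family m I K h'"
   using assms(3) by auto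
  have "((\<lambda>t. g t A) has_vector_derivative h' t A) (at t)" if "t \<in> I" "A \<in> K" for t A
   by (rule has_vector_derivative_transform_within_open[where S=I and f="\<lambda>t. h t A"]) (use that h' assms(1,2) in auto)
  then show ?thesis using c h'(2) by (auto simp: Suc)
 qed (use c in simp)
qed

lemma smooth_family_param:
 assumes "continuous_on K c"
 shows "smooth_family n I K (\<lambda>t A. c A)"
proof -
 have c: "continuous_on (I \<times> K) (\<lambda>p. c (snd p))"
  by (rule continuous_on_compose2[OF assms]) (auto intro!: continuous_intros)
 have z: "smooth_family m I K (\<lambda>t A. 0)" for m by (induction m) (auto intro!: exI[of _ "\<lambda>t A. 0"])
 show ?thesis
 proof (cases n)
  case (Suc m)
  show ?thesis unfolding Suc using c by (rule smooth_family_SucI[OF _ z]) auto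
 qed (use c in simp)
qed

lemma smooth_family_add:
 "smooth_family n I K g ==> smooth_family n I K h ==> smooth_family n I K (\<lambda>t A. g t A + h t A)"
proof (induction n arbitrary: g h)
 case (Suc n)
 obtain g' h' where
  g': "\<forall>t\<in>I. \<forall>A\<in>K. ((\<lambda>t. g t A) has_vector_derivative g' t A) (at t)" "smooth_family n I K g'" and
  h': "\<forall>t\<in>I. \<forall>A\<in>K. ((\<lambda>t. h t A) has_vector_derivative h' t A) (at t)" "smooth_family n I K h'"
  using Suc.prems by auto
 have "smooth_family n I K (\<lambda>t A. g' t A + h' t A)" by (rule Suc.IH[OF g'(2) h'(2)])
 moreover have "\<forall>t\<in>I. \<forall>A\<in>K. ((\<lambda>t. g t A + h t A) has_vector_derivative g' t A + h' t A) (at t)"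
  using g'(1) h'(1) by (auto intro!: has_vector_derivative_add)
 ultimately show ?case
  by (intro smooth_family_SucI[OF continuous_on_add[OF Suc.prems[THEN smooth_family_continuous]]]) auto
qed (auto intro!: continuous_on_add)

lemma smooth_family_mult:
 "smooth_family n I K g ==> smooth_family n I K h ==> smooth_family n I K (\<lambda>t A. g t A * h t A)"
proof (induction n arbitrary: g h)
 case (Suc n)
 obtain g' h' where
  g': "\<forall>t\<in>I. \<forall>A\<in>K. ((\<lambda>t. g t A) has_vector_derivative g' t A) (at t)" "smooth_family n I K g'" and
  h': "\<forall>t\<in>I. \<forall>A\<in>K. ((\<lambda>t. h t A) has_vector_derivative h' t A) (at t)" "smooth_family n I K h'"
  using Suc.prems by auto
 have "smooth_family n I K (\<lambda>t A. g t A * h' t A + g' t A * h t A)"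
  by (rule smooth_family_add[OF Suc.IH[OF smooth_family_SucD[OF Suc.prems(1)] h'(2)]
     Suc.IH[OF g'(2) smooth_family_SucD[OF Suc.prems(2)]]])
 moreover have "\<forall>t\<in>I. \<forall>A\<in>K. ((\<lambda>t. g t A * h t A) has_vector_derivative g t A * h' t A + g' t A * h t A) (at t)"
  using g'(1) h'(1) by (auto intro!: has_vector_derivative_mult)
 ultimately show ?case
  by (intro smooth_family_SucI[OF continuous_on_mult[OF Suc.prems[THEN smooth_family_continuous]]]) auto
qed (auto intro!: continuous_on_mult)

lemma smooth_family_sum:
 assumes "finite B" "\<And>b. b \<in> B ==> smooth_family n I K (h b)"
 shows "smooth_family n I K (\<lambda>t A. \<Sum>b\<in>B. h b t A)" using assms
proof (induction B)
 case empty
 show ?case using smooth_family_param[of K "\<lambda>_. 0"] by simp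
next
 case (insert b B)
 then show ?case using smooth_family_add[of n I K "h b"] by simp
qed

lemma smooth_family_id: "smooth_family n I K (\<lambda>t A. of_real t)"
proof (cases n)
 case (Suc m)
 have "((\<lambda>t. complex_of_real t) has_vector_derivative 1) (at t)" for t
  by (auto intro!: derivative_eq_intros simp: has_vector_derivative_def scaleR_conv_of_real)
 then show ?thesis
  using smooth_family_param[of K "\<lambda>_. 1" m I] by (auto simp: Suc intro!: continuous_intros exI[of _ "\<lambda>t A. 1"])
qed (auto intro!: continuous_intros)

lemma smooth_family_powr:
 assumes "\<And>t. t \<in> I ==> \<kappa> * t^2 < 1"
 shows "smooth_family n I K (\<lambda>t A. of_real ((1 - \<kappa> * t^2) powr p))"
proof (induction n arbitrary: p)
 case 0
 show ?case using assms by (auto intro!: continuous_intros) fastforce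
next
 case (Suc n)
 let ?h' = "\<lambda>t A :: 'a. complex_of_real (- 2 * p * \<kappa>) * (of_real t * of_real ((1 - \<kappa> * t^2) powr (p - 1)))"
 have "((\<lambda>t. complex_of_real ((1 - \<kappa> * t^2) powr p)) has_vector_derivative ?h' t A) (at t)" if "t \<in> I" for t A
 proof -
  have "((\<lambda>t. (1 - \<kappa> * t^2) powr p) has_real_derivative - 2 * p * \<kappa> * (t * (1 - \<kappa> * t^2) powr (p - 1))) (at t)"
   using assms[OF that] by (auto intro!: derivative_eq_intros simp: powr_diff)
  from has_vector_derivative_of_real[OF this]
  show ?thesis by simp
 qed
 moreover have "smooth_family n I K ?h'"
  by (intro smooth_family_mult smooth_family_param smooth_family_id Suc.IH continuous_intros)
 moreover have "continuous_on (I \<times> K) (\<lambda>p'. complex_of_real ((1 - \<kappa> * (fst p')^2) powr p))"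
  using assms by (auto intro!: continuous_intros) fastforce
 ultimately show ?case by (intro smooth_family_SucI[of I K _ n ?h']) auto
qed

text \<open>The derivative along the curve is a combination of directional derivatives of
  \<open>g\<close>, that is of \<open>iter_deriv\<close> for longer lists; hence the induction over
  all \<open>vs\<close>. The moving direction \<open>w A\<close> is expanded in the basis to keep
  the lists independent of \<open>A\<close>. Writing the square root as a power lets
  \<open>smooth_family_powr\<close> handle its derivative.\<close>

lemma smooth_family_compose:
 fixes g :: "'a::euclidean_space => complex" and w :: "'k::topological_space => 'a"
 assumes g: "smooth_on_open U g" and w: "continuous_on K w"
  and I: "\<And>t. t \<in> I ==> \<kappa> * t^2 < 1"
  and U: "\<And>t A. t \<in> I ==> A \<in> K ==> t *\<^sub>R w A + (1 - \<kappa> * t^2) powr (1 / 2) *\<^sub>R x \<in> U"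
 shows "smooth_family n I K (\<lambda>t A. iter_deriv vs g (t *\<^sub>R w A + (1 - \<kappa> * t^2) powr (1 / 2) *\<^sub>R x))"
proof (induction n arbitrary: vs)
 let ?\<gamma> = "\<lambda>t A. t *\<^sub>R w A + (1 - \<kappa> * t^2) powr (1 / 2) *\<^sub>R x"
 have diff: "iter_deriv vs g differentiable (at y)" if "y \<in> U" for vs y
  using g that by (simp add: smooth_on_open_def)
 have cont: "continuous_on (I \<times> K) (\<lambda>p. iter_deriv vs g (?\<gamma> (fst p) (snd p)))" for vs
 proof (rule continuous_on_compose2[of U "iter_deriv vs g"])
  show "continuous_on U (iter_deriv vs g)"
   using diff by (intro continuous_at_imp_continuous_on ballI differentiable_imp_continuous_within) auto
  have "continuous_on (I \<times> K) (\<lambda>p. w (snd p))"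
   by (rule continuous_on_compose2[OF w continuous_on_snd[OF continuous_on_id]]) auto
  then show "continuous_on (I \<times> K) (\<lambda>p. ?\<gamma> (fst p) (snd p))"
   using I by (intro continuous_intros ballI) (auto dest: I)
 qed (use U in auto)
 {
  case 0
  show ?case using cont by simp
 next
  case (Suc n)
  let ?e = "\<lambda>t. - \<kappa> * t * (1 - \<kappa> * t^2) powr (- (1 / 2))"
  let ?h' = "\<lambda>t A. (\<Sum>b\<in>Basis. of_real (w A \<bullet> b) * iter_deriv (b # vs) g (?\<gamma> t A)) +
    (of_real (- \<kappa>) * of_real t * of_real ((1 - \<kappa> * t^2) powr (- (1 / 2)))) * iter_deriv (x # vs) g (?\<gamma> t A)"
  have "((\<lambda>t. iter_deriv vs g (?\<gamma> t A)) has_vector_derivative ?h' t A) (at t)" if t: "t \<in> I" "A \<in> K" for t A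
  proof -
   let ?D = "frechet_derivative (iter_deriv vs g) (at (?\<gamma> t A))"
   have D: "(iter_deriv vs g has_derivative ?D) (at (?\<gamma> t A))"
    using diff[OF U[OF t]] frechet_derivative_works by blast
   then interpret linear ?D by (rule has_derivative_linear)
   have d: "((\<lambda>t. (1 - \<kappa> * t^2) powr (1 / 2)) has_real_derivative ?e t) (at t)"
    using I[OF t(1)] by (auto intro!: derivative_eq_intros simp: powr_minus powr_diff powr_half_sqrt real_sqrt_mult[symmetric] divide_simps)
   have sv: "((\<lambda>t. f t *\<^sub>R v) has_vector_derivative f' *\<^sub>R v) (at t)"
    if "(f has_real_derivative f') (at t)" for f f' and v :: 'a
    using has_vector_derivative_scaleR[OF that has_vector_derivative_const[of v]] by simp
   have "((\<lambda>t. ?\<gamma> t A) has_vector_derivative (1 *\<^sub>R w A + ?e t *\<^sub>R x)) (at t)"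
    by (rule has_vector_derivative_add[OF sv[OF DERIV_ident] sv[OF d]])
   then have \<gamma>': "((\<lambda>t. ?\<gamma> t A) has_vector_derivative (w A + ?e t *\<^sub>R x)) (at t)" by simp
   have "((iter_deriv vs g \<circ> (\<lambda>t. ?\<gamma> t A)) has_vector_derivative ?D (w A + ?e t *\<^sub>R x)) (at t)"
    by (rule vector_derivative_diff_chain_within[OF \<gamma>' has_derivative_at_withinI[OF D]])
   moreover have "?D (w A) = (\<Sum>b\<in>Basis. (w A \<bullet> b) *\<^sub>R ?D b)"
    by (subst euclidean_representation[of "w A", symmetric]) (simp only: sum scale)
   moreover have "?D (w A + ?e t *\<^sub>R x) = ?D (w A) + ?e t *\<^sub>R ?D x" by (simp only: add scale)
   ultimately show ?thesis by (simp add: o_def scaleR_conv_of_real)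
  qed
  moreover have "smooth_family n I K ?h'"
  proof (rule smooth_family_add)
   show "smooth_family n I K (\<lambda>t A. \<Sum>b\<in>Basis. of_real (w A \<bullet> b) * iter_deriv (b # vs) g (?\<gamma> t A))"
   proof (rule smooth_family_sum[OF finite_Basis])
    fix b :: 'a
    have "continuous_on K (\<lambda>A. complex_of_real (w A \<bullet> b))" by (intro continuous_intros w)
    then show "smooth_family n I K (\<lambda>t A. of_real (w A \<bullet> b) * iter_deriv (b # vs) g (?\<gamma> t A))"
     by (rule smooth_family_mult[OF smooth_family_param Suc.IH])
   qed
   show "smooth_family n I K (\<lambda>t A. (of_real (- \<kappa>) * of_real t * of_real ((1 - \<kappa> * t^2) powr (- (1 / 2)))) * iter_deriv (x # vs) g (?\<gamma> t A))"
    by (rule smooth_family_mult[OF smooth_family_mult[OF smooth_family_mult[OF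
        smooth_family_param[OF continuous_on_const] smooth_family_id] smooth_family_powr[OF I]] Suc.IH])
  qed
  ultimately show ?case by (intro smooth_family_SucI[OF cont[of vs]]) auto
 }
qed

text \<open>A bound \<open>b\<close> for \<open>h'\<close> on a compact neighbourhood times
  \<open>K\<close> makes \<open>h\<close> Lipschitz in \<open>t\<close>, so the quotients
  \<open>?E\<close> of the remainder are dominated by \<open>2 * b\<close>, and dominated
  convergence along sequences applies.\<close>

lemma has_vector_derivative_integral_family:
 fixes K :: "'k::{metric_space, second_countable_topology} set" and h h' :: "real => 'k => complex"
 assumes \<mu>: "prob_space \<mu>" "sets \<mu> = sets (restrict_space borel K)" and K: "compact K" and I: "open I"
  and h: "continuous_on (I \<times> K) (\<lambda>p. h (fst p) (snd p))" and h': "continuous_on (I \<times> K) (\<lambda>p. h' (fst p) (snd p))"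
  and deriv: "\<And>t A. t \<in> I ==> A \<in> K ==> ((\<lambda>t. h t A) has_vector_derivative h' t A) (at t)"
  and t: "t \<in> I"
 shows "((\<lambda>t. LINT A|\<mu>. h t A) has_vector_derivative (LINT A|\<mu>. h' t A)) (at t)"
proof -
 interpret prob_space \<mu> by (rule \<mu>(1))
 have sp: "space \<mu> = K" using sets_eq_imp_space_eq[OF \<mu>(2)] by (simp add: space_restrict_space)
 obtain e where e: "e > 0" "cball t e \<subseteq> I" using I t open_contains_cball by blast
 have slice: "continuous_on K (\<lambda>A. f s A)"
  if "continuous_on (I \<times> K) (\<lambda>p. f (fst p) (snd p))" "s \<in> I" for f :: "real => 'k => complex" and s
 proof -
  have "continuous_on K (\<lambda>A. f (fst (s, A)) (snd (s, A)))"
   by (rule continuous_on_compose2[OF that(1)]) (use that(2) in \<open>auto intro!: continuous_intros\<close>)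
  then show ?thesis by simp
 qed
 have meas: "(\<lambda>A. f s A) \<in> borel_measurable \<mu>"
  if "continuous_on (I \<times> K) (\<lambda>p. f (fst p) (snd p))" "s \<in> I" for f :: "real => 'k => complex" and s
  unfolding measurable_cong_sets[OF \<mu>(2) refl] using slice[OF that] by (rule borel_measurable_continuous_on_restrict)
 have integ: "integrable \<mu> (\<lambda>A. f s A)"
  if f: "continuous_on (I \<times> K) (\<lambda>p. f (fst p) (snd p))" "s \<in> I" for f :: "real => 'k => complex" and s
 proof -
  have "bounded ((\<lambda>A. f s A) ` K)"
   using compact_continuous_image[OF slice[OF f] K] by (rule compact_imp_bounded)
  then obtain b where "\<And>A. A \<in> K ==> norm (f s A) \<le> b" by (auto simp: bounded_iff)
  then show ?thesis using meas[OF f] by (intro integrable_const_bound[where B=b]) (auto simp: sp)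
 qed
 have "compact ((\<lambda>p. h' (fst p) (snd p)) ` (cball t e \<times> K))"
  using e(2) by (intro compact_continuous_image continuous_on_subset[OF h'] compact_Times K) auto
 then obtain b0 where b0: "\<And>s A. s \<in> cball t e ==> A \<in> K ==> norm (h' s A) \<le> b0"
 proof -
  have "bounded ((\<lambda>p. h' (fst p) (snd p)) ` (cball t e \<times> K))"
   using \<open>compact ((\<lambda>p. h' (fst p) (snd p)) ` (cball t e \<times> K))\<close> by (rule compact_imp_bounded)
  then obtain c where "\<And>p. p \<in> cball t e \<times> K ==> norm (h' (fst p) (snd p)) \<le> c"
   unfolding bounded_iff by blast
  from this[of "(_, _)"] show thesis by (intro that[of c]) simp
 qed
 define b where "b = max b0 0"
 have b: "0 \<le> b" "\<And>s A. s \<in> cball t e ==> A \<in> K ==> norm (h' s A) \<le> b"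
  using b0 by (auto simp: b_def le_max_iff_disj)
 have lip: "norm (h s A - h t A) \<le> b * norm (s - t)" if s: "s \<in> cball t e" "A \<in> K" for s A
 proof (rule differentiable_bound[of "cball t e" "\<lambda>s. h s A" "\<lambda>s x. x *\<^sub>R h' s A"])
  fix y assume y: "y \<in> cball t e"
  show "((\<lambda>s. h s A) has_derivative (\<lambda>x. x *\<^sub>R h' y A)) (at y within cball t e)"
   using deriv[OF subsetD[OF e(2) y] s(2)] unfolding has_vector_derivative_def by (rule has_derivative_at_withinI)
  show "onorm (\<lambda>x. x *\<^sub>R h' y A) \<le> b"
  proof (rule onorm_bound[OF b(1)])
   show "norm (x *\<^sub>R h' y A) \<le> b * norm x" for x :: real
    using mult_left_mono[OF b(2)[OF y s(2)] norm_ge_zero[of x]] by (simp add: mult.commute)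
  qed
 qed (use s e in auto)
 let ?E = "\<lambda>s A. (1 / norm (s - t)) *\<^sub>R (h s A - (h t A + (s - t) *\<^sub>R h' t A))"
 have "((\<lambda>s. LINT A|\<mu>. ?E s A) \<longlongrightarrow> 0) (at t)" unfolding tendsto_at_iff_sequentially
 proof (intro allI impI)
  fix X assume X: "\<forall>i. X i \<in> UNIV - {t}" "X \<longlonglongrightarrow> t"
  obtain i0 where i0: "\<And>i. i \<ge> i0 ==> X i \<in> cball t e"
   using X(2) e(1) unfolding lim_sequentially by (metis dist_commute less_imp_le mem_cball)
  have XI: "X (i + i0) \<in> cball t e" for i using i0 by simp
  have XI': "X (i + i0) \<in> I" for i using XI e(2) by blast
  have "(\<lambda>i. LINT A|\<mu>. ?E (X (i + i0)) A) \<longlonglongrightarrow> (LINT A|\<mu>. (0::complex))"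
  proof (rule integral_dominated_convergence[where w="\<lambda>_. 2 * b"])
   show "(\<lambda>A. ?E (X (i + i0)) A) \<in> borel_measurable \<mu>" for i
    using meas[OF h XI'] meas[OF h t] meas[OF h' t] by measurable
   show "AE A in \<mu>. (\<lambda>i. ?E (X (i + i0)) A) \<longlonglongrightarrow> 0"
   proof (rule AE_I2)
    fix A assume "A \<in> space \<mu>"
    then have "A \<in> K" by (simp add: sp)
    from deriv[OF t this] have "((\<lambda>s. ?E s A) \<longlongrightarrow> 0) (at t)"
     unfolding has_vector_derivative_def has_derivative_within by simp
    then have "((\<lambda>s. ?E s A) \<circ> X) \<longlonglongrightarrow> 0"
     using X unfolding tendsto_at_iff_sequentially by blast
    then show "(\<lambda>i. ?E (X (i + i0)) A) \<longlonglongrightarrow> 0"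
     by (intro LIMSEQ_ignore_initial_segment[of "\<lambda>i. ?E (X i) A"]) (simp add: o_def)
   qed
   show "AE A in \<mu>. norm (?E (X (i + i0)) A) \<le> 2 * b" for i
   proof (rule AE_I2)
    fix A assume "A \<in> space \<mu>"
    then have A: "A \<in> K" by (simp add: sp)
    let ?s = "X (i + i0)"
    have "norm (h ?s A - (h t A + (?s - t) *\<^sub>R h' t A)) \<le> norm (h ?s A - h t A) + norm ((?s - t) *\<^sub>R h' t A)"
     using norm_triangle_ineq4[of "h ?s A - h t A" "(?s - t) *\<^sub>R h' t A"] by (simp add: algebra_simps)
    also have "\<dots> \<le> b * norm (?s - t) + norm (?s - t) * b"
     using lip[OF XI A] b(2)[of t A] e(1) A by (intro add_mono) (auto intro!: mult_left_mono)
    finally have "norm (h ?s A - (h t A + (?s - t) *\<^sub>R h' t A)) \<le> 2 * b * norm (?s - t)" by simp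
    moreover have "norm (?s - t) > 0" using X(1) by simp
    ultimately show "norm (?E ?s A) \<le> 2 * b" by (simp add: divide_le_eq)
   qed
  qed simp_all
  then have "(\<lambda>i. LINT A|\<mu>. ?E (X (i + i0)) A) \<longlonglongrightarrow> 0" by simp
  then have "(\<lambda>i. LINT A|\<mu>. ?E (X i) A) \<longlonglongrightarrow> 0" by (rule LIMSEQ_offset)
  then show "((\<lambda>s. LINT A|\<mu>. ?E s A) \<circ> X) \<longlonglongrightarrow> 0" by (simp add: o_def)
 qed
 moreover have "\<forall>\<^sub>F s in at t. (LINT A|\<mu>. ?E s A) =
   (1 / norm (s - t)) *\<^sub>R ((LINT A|\<mu>. h s A) - ((LINT A|\<mu>. h t A) + (s - t) *\<^sub>R (LINT A|\<mu>. h' t A)))"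
  unfolding eventually_at_topological
 proof (intro exI[of _ I] conjI I t ballI impI)
  fix s assume s: "s \<in> I"
  show "(LINT A|\<mu>. ?E s A) =
   (1 / norm (s - t)) *\<^sub>R ((LINT A|\<mu>. h s A) - ((LINT A|\<mu>. h t A) + (s - t) *\<^sub>R (LINT A|\<mu>. h' t A)))"
   using integ[OF h s] integ[OF h t] integ[OF h' t]
   by (simp add: Bochner_Integration.integral_diff Bochner_Integration.integral_add)
 qed
 ultimately have "((\<lambda>s. (1 / norm (s - t)) *\<^sub>R ((LINT A|\<mu>. h s A) - ((LINT A|\<mu>. h t A) + (s - t) *\<^sub>R (LINT A|\<mu>. h' t A)))) \<longlongrightarrow> 0) (at t)"
  by (rule Lim_transform_eventually)
 then show ?thesis unfolding has_vector_derivative_def has_derivative_within by (simp add: bounded_linear_scaleR_left)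
qed

text \<open>The interval is symmetric about 0, so every derivative of the mean is continuous at 0
  and has a finite limit there from the right; multiplied by a positive power of \<open>r\<close> it
  vanishes in the limit, as \<open>jet_limit\<close> demands.\<close>

lemma smooth_family_integral:
 fixes K :: "'k::{metric_space, second_countable_topology} set" and h :: "real => 'k => complex"
 assumes \<mu>: "prob_space \<mu>" "sets \<mu> = sets (restrict_space borel K)" and K: "compact K" and \<delta>: "\<delta> > 0"
  and h: "\<And>n. smooth_family n {-\<delta><..<\<delta>} K h"
 shows "smooth_on_reals {0<..<\<delta>} (\<lambda>t. LINT A|\<mu>. h t A)" and "jet_limit 0 (LINT A|\<mu>. h 0 A) (\<lambda>t. LINT A|\<mu>. h t A)"
proof -
 let ?I = "{-\<delta><..<\<delta>}" and ?F = "\<lambda>h t. LINT A|\<mu>. h t A"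
 have step: "\<exists>h'. (\<forall>n. smooth_family n ?I K h') \<and> (\<forall>t\<in>?I. (?F h has_vector_derivative ?F h' t) (at t))"
  if h: "\<And>n. smooth_family n ?I K h" for h :: "real => 'k => complex"
 proof -
  define h' where "h' t A = vector_derivative (\<lambda>t. h t A) (at t)" for t A
  have h'n: "smooth_family n ?I K h'" for n
  proof -
   obtain g where g: "\<forall>t\<in>?I. \<forall>A\<in>K. ((\<lambda>t. h t A) has_vector_derivative g t A) (at t)" "smooth_family n ?I K g"
    using h[of "Suc n"] by auto
   show ?thesis
    by (rule smooth_family_cong[OF _ _ g(2)]) (use g(1) in \<open>auto simp: h'_def intro: vector_derivative_at[symmetric]\<close>)
  qed
  have d: "((\<lambda>t. h t A) has_vector_derivative h' t A) (at t)" if "t \<in> ?I" "A \<in> K" for t A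
  proof -
   obtain g where "\<forall>t\<in>?I. \<forall>A\<in>K. ((\<lambda>t. h t A) has_vector_derivative g t A) (at t)"
    using h[of "Suc 0"] by auto
   with that have "((\<lambda>t. h t A) has_vector_derivative g t A) (at t)" by blast
   then show ?thesis unfolding h'_def by (metis vector_derivative_at)
  qed
  have "(?F h has_vector_derivative ?F h' t) (at t)" if "t \<in> ?I" for t
   using smooth_family_continuous[OF h] smooth_family_continuous[OF h'n] d that
   by (intro has_vector_derivative_integral_family[OF \<mu> K, of ?I]) auto
  with h'n show ?thesis by blast
 qed
 \<comment> \<open>Each iterated derivative of the mean is again the mean of a family that is smooth
   to all orders, so \<open>step\<close> can be repeated.\<close>
 have rep: "\<exists>g. (\<forall>n. smooth_family n ?I K g) \<and> (\<forall>t\<in>?I. nth_deriv i (?F h) t = ?F g t)" for i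
 proof (induction i)
  case 0
  then show ?case using h by auto
 next
  case (Suc i)
  then obtain g where g: "\<And>n. smooth_family n ?I K g" "\<And>t. t \<in> ?I ==> nth_deriv i (?F h) t = ?F g t"
   by blast
  from step[OF g(1)] obtain g' where g': "\<And>n. smooth_family n ?I K g'" "\<And>t. t \<in> ?I ==> (?F g has_vector_derivative ?F g' t) (at t)"
   by blast
  have "nth_deriv (Suc i) (?F h) t = ?F g' t" if "t \<in> ?I" for t
  proof -
   have "nth_deriv (Suc i) (?F h) t = vector_derivative (?F g) (at t)"
    unfolding nth_deriv_Suc by (rule vector_derivative_cong_open[of ?I]) (use g(2) that in auto)
   also have "\<dots> = ?F g' t" using g'(2)[OF that] by (rule vector_derivative_at)
   finally show ?thesis .
  qed
  with g'(1) show ?case by blast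
 qed
 have diff: "nth_deriv i (?F h) differentiable (at t)" if "t \<in> ?I" for i t
 proof -
  obtain g where g: "\<And>n. smooth_family n ?I K g" "\<And>t. t \<in> ?I ==> nth_deriv i (?F h) t = ?F g t"
   using rep by blast
  from step[OF g(1)] have "?F g differentiable (at t)" using that differentiableI_vector by blast
  then show ?thesis by (rule differentiable_cong_open[of ?I, rotated 3]) (use g(2) that in auto)
 qed
 then show "smooth_on_reals {0<..<\<delta>} (?F h)" unfolding smooth_on_reals_def using \<delta> by auto
 have lim: "(nth_deriv i (?F h) \<longlongrightarrow> nth_deriv i (?F h) 0) (at_right 0)" for i
 proof -
  have "isCont (nth_deriv i (?F h)) 0"
   using diff[of 0 i] \<delta> by (intro differentiable_imp_continuous_within) auto
  then show ?thesis by (simp add: isCont_def filterlim_at_split)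
 qed
 show "jet_limit 0 (?F h 0) (?F h)" unfolding jet_limit_def
 proof (intro conjI allI impI)
  show "(nth_deriv 0 (?F h) \<longlongrightarrow> ?F h 0) (at_right 0)" using lim[of 0] by simp
  fix i :: nat assume i: "1 \<le> i"
  have "((\<lambda>r. of_real r ^ i) \<longlongrightarrow> (of_real 0 :: complex) ^ i) (at_right 0)"
   by (intro tendsto_intros)
  from tendsto_mult[OF this lim[of i]] i
  show "((\<lambda>r. of_real r ^ i * nth_deriv (0 + i) (?F h) r) \<longlongrightarrow> 0) (at_right 0)"
   by (simp add: power_0_left)
 qed
qed

section \<open>The mean value of a function over shifted planes\<close>

lemma sphere_area_unit_ball:
 assumes "m \<ge> 1"
 shows "real (2 * m) * unit_ball_vol (real (2 * m)) = sphere_area (2 * m - 1)"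
proof -
 have "Gamma (real m + 1) = real m * Gamma (real m)"
  using assms by (intro Gamma_plus1) (auto dest: nonpos_Ints_nonpos)
 moreover have "Gamma (real m) > 0" using assms by (intro Gamma_real_pos) simp
 ultimately show ?thesis using assms by (simp add: unit_ball_vol_def sphere_area_def of_nat_diff field_simps)
qed

text \<open>A majorant independent of \<open>r\<close> and \<open>m\<close>, for functions that
  decay like the power \<open>Suc m\<close> of \<open>1 / (1 + t^2)\<close>.\<close>

definition radial_bound :: "real => real => real" where
 "radial_bound \<kappa> t = (if 0 < t \<and> \<kappa> * t^2 < 1 then t * (1 - \<kappa> * t^2) powr (- (1 / 2)) / (1 + t^2)^2 else 0)"

lemma radial_bound_nonneg: "0 \<le> radial_bound \<kappa> t" by (simp add: radial_bound_def)

lemma measurable_radial_bound [measurable]: "radial_bound \<kappa> \<in> borel_measurable borel"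
 unfolding radial_bound_def by measurable

lemma nn_integral_derivative_finite:
 fixes g g' :: "real => real"
 assumes ab: "a < b" and deriv: "\<And>x. x \<in> einterval a b ==> (g has_real_derivative g' x) (at x)"
  and cont: "continuous_on (einterval a b) g'" and nonneg: "\<And>x. x \<in> einterval a b ==> 0 \<le> g' x"
  and bound: "\<And>x. x \<in> einterval a b ==> g x \<in> {-1..0}"
 shows "(\<integral>\<^sup>+x. ennreal (g' x) * indicator (einterval a b) x \<partial>lborel) < \<infinity>"
proof -
 have "(\<integral>\<^sup>+x. ennreal (g' x) * indicator (einterval a b) x \<partial>lborel)
   = (\<integral>\<^sup>+x. indicator {-1..0} (g x) * ennreal (g' x) * indicator (einterval a b) x \<partial>lborel)"
  using bound by (intro nn_integral_cong) (auto split: split_indicator)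
 also have "\<dots> = (\<integral>\<^sup>+y. indicator {-1..0} y * indicator (g ` einterval a b) y \<partial>lborel)"
  by (rule nn_integral_substitution_einterval[symmetric]) (use assms in auto)
 also have "\<dots> \<le> (\<integral>\<^sup>+y. indicator {-1..0::real} y \<partial>lborel)"
  by (intro nn_integral_mono) (auto split: split_indicator)
 also have "\<dots> < \<infinity>" by simp
 finally show ?thesis .
qed

text \<open>Compare with explicit derivatives. For \<open>\<kappa> = 1\<close> the singularity at
  the equator is that of the derivative of \<open>- sqrt (1 - t^2)\<close>; otherwise the majorant
  lies below the derivative of \<open>- 1 / (2 * (1 + t^2))\<close>. Both primitives take values in
  [-1, 0].\<close>

lemma nn_integral_radial_bound_finite:
 assumes "\<kappa> = 0 \<or> \<kappa> = 1 \<or> \<kappa> = - 1"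
 shows "(\<integral>\<^sup>+t. ennreal (radial_bound \<kappa> t) \<partial>lborel) < \<infinity>"
proof (cases "\<kappa> = 1")
 case True
 let ?g = "\<lambda>t. - sqrt (1 - t\<^sup>2)" and ?g' = "\<lambda>t. t / sqrt (1 - t\<^sup>2)"
 have E: "einterval 0 1 = {0<..<1::real}" by (auto simp: einterval_def)
 have pos: "0 < 1 - t\<^sup>2" if "t \<in> {0<..<1}" for t :: real using that by (simp add: power2_less_1_iff abs_if)
 have "(\<integral>\<^sup>+t. ennreal (radial_bound \<kappa> t) \<partial>lborel) \<le> (\<integral>\<^sup>+t. ennreal (?g' t) * indicator (einterval 0 1) t \<partial>lborel)"
 proof (rule nn_integral_mono)
  fix t :: real
  show "ennreal (radial_bound \<kappa> t) \<le> ennreal (?g' t) * indicator (einterval 0 1) t"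
  proof (cases "t \<in> {0<..<1}")
   case t: True
   have "t * (1 - t\<^sup>2) powr (- (1 / 2)) / (1 + t^2)^2 \<le> t * (1 - t\<^sup>2) powr (- (1 / 2)) / 1"
   proof (intro divide_left_mono)
    have "1 \<le> 1 + t^2" by simp
    then show "1 \<le> (1 + t^2)^2" by (rule one_le_power)
    then show "0 < (1 + t^2)^2 * 1" by linarith
   qed (use t in auto)
   also have "\<dots> = ?g' t"
   proof -
    have "(1 - t\<^sup>2) powr (- (1 / 2)) = 1 / sqrt (1 - t\<^sup>2)"
     using less_imp_le[OF pos[OF t]] by (simp only: powr_minus_divide powr_half_sqrt)
    then show ?thesis by simp
   qed
   finally show ?thesis using t pos[OF t] True by (simp add: E radial_bound_def ennreal_leI)
  next
   case False
   have "\<not> (0 < t \<and> t\<^sup>2 < 1)" using False by (simp add: power2_less_1_iff abs_if)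
   then have "radial_bound \<kappa> t = 0" unfolding radial_bound_def True by (simp only: mult_1_left if_False)
   then show ?thesis by simp
  qed
 qed
 also have "\<dots> < \<infinity>"
 proof (rule nn_integral_derivative_finite[where g="?g"])
  fix t :: real assume "t \<in> einterval 0 1"
  then have t: "t \<in> {0<..<1}" by (simp add: E)
  show "(?g has_real_derivative ?g' t) (at t)"
   using pos[OF t] by (auto intro!: derivative_eq_intros simp: field_simps)
  show "0 \<le> ?g' t" using pos[OF t] t by simp
  show "?g t \<in> {-1..0}" using pos[OF t] by (auto intro!: real_sqrt_le_1_iff[THEN iffD2])
 qed (use pos in \<open>auto simp: E intro!: continuous_intros, force?\<close>)
 finally show ?thesis .
next
 case False
 then have \<kappa>: "\<kappa> \<le> 0" using assms by auto
 let ?g = "\<lambda>t::real. - (1 / (2 * (1 + t^2)))" and ?g' = "\<lambda>t::real. t / (1 + t^2)^2"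
 have E: "einterval 0 \<infinity> = {0::real<..}" by (auto simp: einterval_def)
 have nz: "1 + t^2 > 0" for t :: real by (simp add: add_pos_nonneg)
 have "(\<integral>\<^sup>+t. ennreal (radial_bound \<kappa> t) \<partial>lborel) \<le> (\<integral>\<^sup>+t. ennreal (?g' t) * indicator (einterval 0 \<infinity>) t \<partial>lborel)"
 proof (rule nn_integral_mono)
  fix t :: real
  show "ennreal (radial_bound \<kappa> t) \<le> ennreal (?g' t) * indicator (einterval 0 \<infinity>) t"
  proof (cases "t > 0")
   case t: True
   have "1 \<le> 1 - \<kappa> * t^2" using \<kappa> by (simp add: mult_nonpos_nonneg)
   then have "(1 - \<kappa> * t^2) powr (- (1 / 2)) \<le> 1"
    by (simp add: powr_minus inverse_le_1_iff ge_one_powr_ge_zero)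
   then have "t * (1 - \<kappa> * t^2) powr (- (1 / 2)) / (1 + t^2)^2 \<le> t * 1 / (1 + t^2)^2"
    using t by (intro divide_right_mono mult_left_mono) auto
   then show ?thesis using t by (simp add: E radial_bound_def ennreal_leI)
  next
   case False
   then show ?thesis by (simp add: radial_bound_def)
  qed
 qed
 also have "\<dots> < \<infinity>"
 proof (rule nn_integral_derivative_finite[where g="?g"])
  show "continuous_on (einterval 0 \<infinity>) ?g'"
   using nz by (intro continuous_intros ballI) (simp add: less_imp_neq[symmetric])
 next
  fix t :: real assume "t \<in> einterval 0 \<infinity>"
  then have t: "t > 0" by (simp add: E)
  have "(?g has_real_derivative 4 * t / (2 * (1 + t^2))^2) (at t)"
   using nz[of t] by (auto intro!: derivative_eq_intros simp: power2_eq_square)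
  also have "4 * t / (2 * (1 + t^2))^2 = ?g' t" by (simp only: power_mult_distrib) simp
  finally show "(?g has_real_derivative ?g' t) (at t)" .
  show "0 \<le> ?g' t" using t by simp
  have "2 * (1 + t^2) = 1 + (1 + 2 * t^2)" by simp
  moreover have "0 \<le> 1 + 2 * t^2" by simp
  ultimately have "1 \<le> 2 * (1 + t^2)" by (simp only: le_add_same_cancel1)
  then show "?g t \<in> {-1..0}" using nz[of t] by (simp add: divide_le_eq)
 qed simp
 finally show ?thesis .
qed

text \<open>The source of the decay order \<open>Suc m\<close>: \<open>m - 1\<close> of the powers
  absorb the kernel \<open>(t^2 - r^2) ^ (m - 1)\<close>, and the other two make the integral
  converge uniformly in \<open>r\<close>.\<close>

lemma radial_density_bound:
 assumes "0 < r" "m \<ge> 1"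
 shows "radial_density \<kappa> m r t / (1 + t^2) ^ Suc m \<le> radial_bound \<kappa> t"
proof (cases "r < t \<and> \<kappa> * t^2 < 1")
 case True
 then have t: "0 < t" "r\<^sup>2 \<le> t^2" using assms by (auto intro: power_mono)
 have q: "0 < 1 + t^2" by (simp add: add_pos_nonneg)
 have "(t\<^sup>2 - r\<^sup>2) ^ (m - 1) \<le> (1 + t^2) ^ (m - 1)"
  using t(2) zero_le_power2[of r] by (intro power_mono) linarith+
 then have "(t\<^sup>2 - r\<^sup>2) ^ (m - 1) * (t * (1 - \<kappa> * t^2) powr (- (1 / 2))) \<le> (1 + t^2) ^ (m - 1) * (t * (1 - \<kappa> * t^2) powr (- (1 / 2)))"
  using t by (intro mult_right_mono) auto
 then have "radial_density \<kappa> m r t / (1 + t^2) ^ Suc m \<le> (1 + t^2) ^ (m - 1) * (t * (1 - \<kappa> * t^2) powr (- (1 / 2))) / (1 + t^2) ^ Suc m"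
  using True q by (intro divide_right_mono) (auto simp: radial_density_def mult.assoc)
 also have "\<dots> = radial_bound \<kappa> t"
 proof -
  have "(1 + t^2) ^ Suc m = (1 + t^2) ^ (m - 1) * (1 + t^2)^2"
   using assms(2) by (cases m) (simp_all add: power2_eq_square)
  then show ?thesis using True t q by (simp add: radial_bound_def)
 qed
 finally show ?thesis .
qed (auto simp: radial_density_def radial_bound_nonneg)

lemma odd_moment_bound:
 assumes "0 < t" "\<kappa> * t^2 < 1" "j < m"
 shows "t ^ (2 * j + 1) * (1 - \<kappa> * t^2) powr (- (1 / 2)) / (1 + t^2) ^ Suc m \<le> radial_bound \<kappa> t"
proof -
 have q: "1 \<le> 1 + t^2" by simp
 have "t ^ (2 * j) = (t\<^sup>2) ^ j" by (simp add: power_mult)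
 also have "\<dots> \<le> (1 + t^2) ^ j" by (intro power_mono) auto
 also have "\<dots> \<le> (1 + t^2) ^ (m - 1)" using assms(3) q by (intro power_increasing) auto
 finally have "t ^ (2 * j) * (t * (1 - \<kappa> * t^2) powr (- (1 / 2))) \<le> (1 + t^2) ^ (m - 1) * (t * (1 - \<kappa> * t^2) powr (- (1 / 2)))"
  using assms by (intro mult_right_mono) auto
 then have "t ^ (2 * j + 1) * (1 - \<kappa> * t^2) powr (- (1 / 2)) / (1 + t^2) ^ Suc m
   \<le> (1 + t^2) ^ (m - 1) * (t * (1 - \<kappa> * t^2) powr (- (1 / 2))) / (1 + t^2) ^ Suc m"
  using q by (intro divide_right_mono) (auto simp: mult_ac)
 also have "\<dots> = radial_bound \<kappa> t"
 proof -
  have "(1 + t^2) ^ Suc m = (1 + t^2) ^ (m - 1) * (1 + t^2)^2"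
   using assms(3) by (cases m) (simp_all add: power2_eq_square)
  then show ?thesis using assms q by (simp add: radial_bound_def)
 qed
 finally show ?thesis .
qed

text \<open>Used in two ways. For a frame \<open>e\<close> of R^n and the distance parameter
  \<open>r\<close> it is the chart coordinate of the point with gnomonic coordinates
  \<open>z\<close>. For a frame of the ambient space and \<open>r = 1\<close> it is the point
  itself, the central projection of \<open>z\<close> to the sphere or hyperboloid.\<close>

definition klein_vector :: "(nat => 'a::real_vector) => real => nat => real => (nat => real) => 'a" where
 "klein_vector e \<kappa> k r z = (1 / sqrt (1 + \<kappa> * (cnorm k z)^2)) *\<^sub>R ((\<Sum>i<k. z i *\<^sub>R e i) + r *\<^sub>R e k)"

lemma norm_klein_vector:
 fixes e :: "nat => 'a::real_inner"
 assumes e: "\<And>i j. i \<le> k ==> j \<le> k ==> e i \<bullet> e j = (if i = j then 1 else 0)" and z: "0 < 1 + \<kappa> * (cnorm k z)^2"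
 shows "norm (klein_vector e \<kappa> k r z) = sqrt (((cnorm k z)^2 + r^2) / (1 + \<kappa> * (cnorm k z)^2))"
proof -
 let ?u = "\<Sum>i<k. z i *\<^sub>R e i"
 have "?u \<bullet> ?u = (\<Sum>i<k. \<Sum>j<k. z i * (z j * (if i = j then 1 else 0)))"
  unfolding inner_sum_left inner_sum_right by (intro sum.cong refl) (simp add: e)
 also have "\<dots> = (cnorm k z)^2"
  unfolding cnorm_power2 by (simp add: power2_eq_square if_distrib[of "\<lambda>x. _ * x"] cong: if_cong)
 finally have uu: "?u \<bullet> ?u = (cnorm k z)^2" .
 have ue: "?u \<bullet> e k = 0" unfolding inner_sum_left by (intro sum.neutral) (simp add: e)
 have "(norm (?u + r *\<^sub>R e k))^2 = (cnorm k z)^2 + r^2"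
  unfolding power2_norm_eq_inner using uu ue e[of k k]
  by (simp add: inner_add_left inner_add_right inner_commute power2_eq_square)
 then have "norm (?u + r *\<^sub>R e k) = sqrt ((cnorm k z)^2 + r^2)"
  by (metis norm_ge_zero real_sqrt_unique)
 then show ?thesis using z by (simp add: klein_vector_def real_sqrt_divide)
qed

section \<open>Integrals in gnomonic coordinates: bounds and continuity\<close>

lemma measurable_klein_vector [measurable]:
 fixes e :: "nat => 'a::euclidean_space"
 shows "klein_vector e \<kappa> k r \<in> borel_measurable (lborel_PiM k)"
proof -
 have [measurable]: "(\<lambda>z. z i) \<in> borel_measurable (lborel_PiM k)" if "i \<in> {..<k}" for i
  using that measurable_PiM_lborel_component by simp
 show ?thesis unfolding klein_vector_def by measurable
qed

lemma nn_integral_klein_bound_finite: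
 assumes \<kappa>: "\<kappa> = 0 \<or> \<kappa> = 1 \<or> \<kappa> = - 1" and m: "m \<ge> 1" and r: "0 < r" "\<kappa> * r^2 < 1" and C: "0 \<le> C"
 shows "(\<integral>\<^sup>+z. ennreal (C / (1 + (sqrt (((cnorm (2 * m) z)^2 + r^2) / (1 + \<kappa> * (cnorm (2 * m) z)^2)))\<^sup>2) ^ Suc m) *
   ennreal (klein_weight \<kappa> (2 * m) (cnorm (2 * m) z)) \<partial>lborel_PiM (2 * m)) < \<infinity>"
proof -
 let ?k = "2 * m"
 let ?w = "\<lambda>z. klein_weight \<kappa> ?k (cnorm ?k z)"
 let ?t = "\<lambda>z. sqrt (((cnorm ?k z)^2 + r^2) / (1 + \<kappa> * (cnorm ?k z)^2))"
 let ?b = "\<lambda>t. C / (1 + t^2) ^ Suc m"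
 have "(\<integral>\<^sup>+z. ennreal (?b (?t z)) * ennreal (?w z) \<partial>lborel_PiM ?k)
  = ennreal (real ?k * unit_ball_vol (real ?k) * (1 - \<kappa> * r^2) powr (- ((real ?k - 1) / 2))) *
   (\<integral>\<^sup>+t. ennreal (?b t) * ennreal (radial_density \<kappa> m r t) \<partial>lborel)"
  by (rule nn_integral_klein_radius[OF \<kappa> m r, of "\<lambda>t. ennreal (?b t)"]) measurable
 moreover have "(\<integral>\<^sup>+t. ennreal (?b t) * ennreal (radial_density \<kappa> m r t) \<partial>lborel) < \<infinity>"
 proof -
  have "(\<integral>\<^sup>+t. ennreal (?b t) * ennreal (radial_density \<kappa> m r t) \<partial>lborel) \<le> (\<integral>\<^sup>+t. ennreal C * ennreal (radial_bound \<kappa> t) \<partial>lborel)"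
  proof (rule nn_integral_mono)
   fix t
   have "?b t * radial_density \<kappa> m r t = C * (radial_density \<kappa> m r t / (1 + t^2) ^ Suc m)" by simp
   also have "\<dots> \<le> C * radial_bound \<kappa> t" by (intro mult_left_mono radial_density_bound r m C)
   finally show "ennreal (?b t) * ennreal (radial_density \<kappa> m r t) \<le> ennreal C * ennreal (radial_bound \<kappa> t)"
    using C r by (simp add: ennreal_mult[symmetric] radial_bound_nonneg radial_density_nonneg ennreal_leI)
  qed
  also have "\<dots> = ennreal C * (\<integral>\<^sup>+t. ennreal (radial_bound \<kappa> t) \<partial>lborel)"
   by (rule nn_integral_cmult) measurable
  also have "\<dots> < \<infinity>"
   using nn_integral_radial_bound_finite[OF \<kappa>] by (simp add: ennreal_mult_less_top)
  finally show ?thesis .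
 qed
 ultimately show ?thesis by (simp add: ennreal_mult_less_top)
qed

lemma norm_orthogonal_matrix_mult:
 "orthogonal_matrix A ==> norm (A *v v) = norm (v :: real^'n::finite)"
 by (metis orthogonal_transformation_matrix matrix_of_matrix_vector_mul matrix_vector_mul_linear orthogonal_transformation_norm)

lemma klein_vector_radius:
 fixes e :: "nat => 'a::real_inner"
 assumes e: "\<And>i j. i \<le> k ==> j \<le> k ==> e i \<bullet> e j = (if i = j then 1 else 0)"
  and r: "\<kappa> * r^2 < 1" and z: "klein_weight \<kappa> k (cnorm k z) \<noteq> 0"
 shows "norm (klein_vector e \<kappa> k r z) = sqrt (((cnorm k z)^2 + r^2) / (1 + \<kappa> * (cnorm k z)^2))"
  and "\<kappa> * (norm (klein_vector e \<kappa> k r z))^2 < 1"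
proof -
 have z: "0 < 1 + \<kappa> * (cnorm k z)^2" using z by (auto simp: klein_weight_def split: if_splits)
 show n: "norm (klein_vector e \<kappa> k r z) = sqrt (((cnorm k z)^2 + r^2) / (1 + \<kappa> * (cnorm k z)^2))"
  by (rule norm_klein_vector[OF e z])
 show "\<kappa> * (norm (klein_vector e \<kappa> k r z))^2 < 1"
  unfolding n using z r by (simp add: add_nonneg_nonneg divide_less_eq algebra_simps)
qed

text \<open>Dominated convergence: the majorant depends on \<open>z\<close> only through the norm of
  \<open>klein_vector\<close>, which rotations preserve. This is the continuity along the group that
  \<open>shifted_dual_radon_orbit\<close> asks for.\<close>

lemma continuous_klein_integral:
 fixes f :: "real^'n::finite => complex" and e :: "nat => real^'n"
 assumes \<kappa>: "\<kappa> = 0 \<or> \<kappa> = 1 \<or> \<kappa> = - 1" and m: "m \<ge> 1"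
  and e: "\<And>i j. i \<le> 2 * m ==> j \<le> 2 * m ==> e i \<bullet> e j = (if i = j then 1 else 0)"
  and f[measurable]: "f \<in> borel_measurable borel" and cont: "continuous_on {v. \<kappa> * (norm v)^2 < 1} f"
  and bound: "\<And>v. \<kappa> * (norm v)^2 < 1 ==> norm (f v) \<le> C / (1 + (norm v)^2) ^ Suc m"
  and r: "0 < r" "\<kappa> * r^2 < 1"
 shows "continuous_on orthogonal_matrices (\<lambda>A. LINT z|lborel_PiM (2 * m).
    klein_weight \<kappa> (2 * m) (cnorm (2 * m) z) *\<^sub>R f (A *v klein_vector e \<kappa> (2 * m) r z))"
 unfolding continuous_on_sequentially
proof (intro allI ballI impI, elim conjE)
 let ?k = "2 * m"
 let ?w = "\<lambda>z. klein_weight \<kappa> ?k (cnorm ?k z)"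
 let ?v = "klein_vector e \<kappa> ?k r"
 let ?t = "\<lambda>z. sqrt (((cnorm ?k z)^2 + r^2) / (1 + \<kappa> * (cnorm ?k z)^2))"
 let ?b = "\<lambda>t. C / (1 + t^2) ^ Suc m"
 fix X :: "nat => (real^'n)^'n" and A
 assume A: "A \<in> orthogonal_matrices" and X: "\<forall>n. X n \<in> orthogonal_matrices" "X \<longlonglongrightarrow> A"
 have C: "0 \<le> C" using order_trans[OF norm_ge_zero bound[of 0]] by simp
 have mv[measurable]: "(*v) B \<in> borel_measurable borel" for B :: "(real^'n)^'n"
  by (intro borel_measurable_continuous_onI continuous_intros)
 have "(\<lambda>n. LINT z|lborel_PiM ?k. ?w z *\<^sub>R f (X n *v ?v z)) \<longlonglongrightarrow> (LINT z|lborel_PiM ?k. ?w z *\<^sub>R f (A *v ?v z))"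
 proof (rule integral_dominated_convergence[where w="\<lambda>z. ?w z * ?b (?t z)"])
  show "(\<lambda>z. ?w z *\<^sub>R f (A *v ?v z)) \<in> borel_measurable (lborel_PiM ?k)"
   "(\<lambda>z. ?w z *\<^sub>R f (X n *v ?v z)) \<in> borel_measurable (lborel_PiM ?k)" for n by measurable
  show "integrable (lborel_PiM ?k) (\<lambda>z. ?w z * ?b (?t z))"
  proof (rule integrableI_bounded)
   have "(\<integral>\<^sup>+z. ennreal (norm (?w z * ?b (?t z))) \<partial>lborel_PiM ?k) = (\<integral>\<^sup>+z. ennreal (?b (?t z)) * ennreal (?w z) \<partial>lborel_PiM ?k)"
    using C by (intro nn_integral_cong) (simp add: ennreal_mult[symmetric] mult.commute abs_mult)
   then show "(\<integral>\<^sup>+z. ennreal (norm (?w z * ?b (?t z))) \<partial>lborel_PiM ?k) < \<infinity>"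
    using nn_integral_klein_bound_finite[OF \<kappa> m r C] by simp
  qed measurable
  show "AE z in lborel_PiM ?k. (\<lambda>n. ?w z *\<^sub>R f (X n *v ?v z)) \<longlonglongrightarrow> ?w z *\<^sub>R f (A *v ?v z)"
  proof (rule AE_I2)
   fix z
   show "(\<lambda>n. ?w z *\<^sub>R f (X n *v ?v z)) \<longlonglongrightarrow> ?w z *\<^sub>R f (A *v ?v z)"
   proof (cases "?w z = 0")
    case False
    have in_ball: "\<kappa> * (norm (B *v ?v z))^2 < 1" if "B \<in> orthogonal_matrices" for B
     using klein_vector_radius(2)[OF e r(2) False] that by (simp add: norm_orthogonal_matrix_mult)
    have "(\<lambda>n. X n *v ?v z) \<longlonglongrightarrow> A *v ?v z"
     unfolding matrix_vector_mult_def by (intro tendsto_intros X(2))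
    then have "(\<lambda>n. f (X n *v ?v z)) \<longlonglongrightarrow> f (A *v ?v z)"
     using in_ball A X(1) by (intro continuous_on_tendsto_compose[OF cont]) auto
    then show ?thesis by (intro tendsto_intros)
   qed simp
  qed
  show "AE z in lborel_PiM ?k. norm (?w z *\<^sub>R f (X n *v ?v z)) \<le> ?w z * ?b (?t z)" for n
  proof (rule AE_I2)
   fix z
   show "norm (?w z *\<^sub>R f (X n *v ?v z)) \<le> ?w z * ?b (?t z)"
   proof (cases "?w z = 0")
    case False
    have "norm (f (X n *v ?v z)) \<le> ?b (?t z)"
     using bound[of "X n *v ?v z"] klein_vector_radius[OF e r(2) False] X(1)
     by (simp add: norm_orthogonal_matrix_mult)
    then show ?thesis
     unfolding norm_scaleR abs_of_nonneg[OF klein_weight_nonneg] by (rule mult_left_mono[OF _ klein_weight_nonneg])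
   qed simp
  qed
 qed
 then show "((\<lambda>A. LINT z|lborel_PiM ?k. ?w z *\<^sub>R f (A *v ?v z)) \<circ> X) \<longlonglongrightarrow> (LINT z|lborel_PiM ?k. ?w z *\<^sub>R f (A *v ?v z))"
  by (simp add: o_def)
qed

locale haar_measure =
 fixes \<mu> :: "((real^'n::finite)^'n::finite) measure"
 assumes haar_prob: "prob_space \<mu>" and haar_sets: "sets \<mu> = sets borel_orthogonal"
  and haar_left: "\<And>B. orthogonal_matrix B ==> distr \<mu> \<mu> (\<lambda>A. B ** A) = \<mu>"
  and haar_right: "\<And>B. orthogonal_matrix B ==> distr \<mu> \<mu> (\<lambda>A. A ** B) = \<mu>"
begin

sublocale prob_space \<mu> by (rule haar_prob)

lemma haar_space: "space \<mu> = orthogonal_matrices" using sets_eq_imp_space_eq[OF haar_sets] by simp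

lemma measurable_haar_id: "(\<lambda>A. A) \<in> \<mu> \<rightarrow>\<^sub>M borel"
 unfolding measurable_cong_sets[OF haar_sets refl] by (rule measurable_restrict_space1) simp

lemma measurable_matrix_vector:
 "(\<lambda>p. fst p *v snd p) \<in> borel_measurable (\<mu> \<Otimes>\<^sub>M (borel :: (real^'n) measure))"
proof -
 have "(\<lambda>p. (fst p, snd p)) \<in> \<mu> \<Otimes>\<^sub>M (borel :: (real^'n) measure) \<rightarrow>\<^sub>M borel \<Otimes>\<^sub>M borel"
  by (rule measurable_Pair[OF measurable_compose[OF measurable_fst measurable_haar_id] measurable_snd])
 moreover have "(\<lambda>p :: ((real^'n)^'n) \<times> (real^'n). fst p *v snd p) \<in> borel_measurable (borel \<Otimes>\<^sub>M borel)"
  unfolding borel_prod matrix_vector_mult_def by (intro borel_measurable_continuous_onI continuous_intros)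
 ultimately show ?thesis using measurable_compose by fastforce
qed

text \<open>Some orthogonal \<open>B\<close> carries \<open>norm v *\<^sub>R e\<close> to
  \<open>v\<close>, and right invariance absorbs it.\<close>

lemma spherical_mean:
 fixes f :: "real^'n => complex"
 assumes f: "f \<in> borel_measurable borel" and e: "norm e = 1"
 shows "(LINT A|\<mu>. f (A *v v)) = (LINT A|\<mu>. f (A *v (norm v *\<^sub>R e)))"
proof -
 have "norm (norm v *\<^sub>R e) = norm v" using e by simp
 then obtain g where g: "orthogonal_transformation g" "g (norm v *\<^sub>R e) = v"
  using orthogonal_transformation_exists by metis
 define B where "B = matrix g"
 have B: "orthogonal_matrix B" "B *v (norm v *\<^sub>R e) = v"
  using g by (auto simp: B_def orthogonal_transformation_matrix matrix_works orthogonal_transformation_linear)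
 have m: "(\<lambda>A. f (A *v w)) \<in> borel_measurable \<mu>" for w
 proof -
  have "(\<lambda>A. A *v w) \<in> borel_measurable \<mu>"
  proof (rule measurable_compose[OF measurable_haar_id borel_measurable_continuous_onI])
   show "continuous_on UNIV (\<lambda>A :: (real^'n)^'n. A *v w)"
    unfolding matrix_vector_mult_def by (intro continuous_intros)
  qed
  then show ?thesis using f by (rule measurable_compose)
 qed
 have rm: "(\<lambda>A. A ** B) \<in> \<mu> \<rightarrow>\<^sub>M \<mu>"
  unfolding measurable_cong_sets[OF haar_sets haar_sets] using measurable_orthogonal_mult[OF B(1)] by auto
 have "(LINT A|\<mu>. f (A *v (norm v *\<^sub>R e))) = (LINT A|distr \<mu> \<mu> (\<lambda>A. A ** B). f (A *v (norm v *\<^sub>R e)))"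
  by (simp add: haar_right[OF B(1)])
 also have "\<dots> = (LINT A|\<mu>. f ((A ** B) *v (norm v *\<^sub>R e)))" by (rule integral_distr[OF rm m])
 also have "\<dots> = (LINT A|\<mu>. f (A *v v))" by (simp add: matrix_vector_mul_assoc[symmetric] B(2))
 finally show ?thesis ..
qed


text \<open>The identity for nonnegative functions is turned into an equality of image measures
  under the radius map; it then transfers to Bochner integrals of every Borel \<open>F\<close>,
  integrable or not.\<close>

lemma integral_klein_radius:
 fixes F :: "real => complex"
 assumes \<kappa>: "\<kappa> = 0 \<or> \<kappa> = 1 \<or> \<kappa> = - 1" and m: "m \<ge> 1" and r: "0 < r" "\<kappa> * r^2 < 1"
  and F[measurable]: "F \<in> borel_measurable borel"
 shows "(LINT z|lborel_PiM (2 * m). klein_weight \<kappa> (2 * m) (cnorm (2 * m) z) *\<^sub>R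
    F (sqrt (((cnorm (2 * m) z)^2 + r^2) / (1 + \<kappa> * (cnorm (2 * m) z)^2))))
  = of_real (sphere_area (2 * m - 1) * (1 - \<kappa> * r^2) powr (- ((real (2 * m) - 1) / 2))) *
   (LINT t|lborel. radial_density \<kappa> m r t *\<^sub>R F t)"
proof -
 let ?k = "2 * m"
 let ?P = "lborel_PiM ?k"
 let ?t = "\<lambda>z. sqrt (((cnorm ?k z)^2 + r^2) / (1 + \<kappa> * (cnorm ?k z)^2))"
 let ?w = "\<lambda>z. klein_weight \<kappa> ?k (cnorm ?k z)"
 define c where "c = sphere_area (?k - 1) * (1 - \<kappa> * r^2) powr (- ((real ?k - 1) / 2))"
 have c: "c = real ?k * unit_ball_vol (real ?k) * (1 - \<kappa> * r^2) powr (- ((real ?k - 1) / 2))" "0 \<le> c"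
  unfolding c_def sphere_area_unit_ball[OF m, symmetric] by simp_all
 have d0: "0 \<le> radial_density \<kappa> m r t" for t using r by (simp add: radial_density_nonneg)
 have "distr (density ?P ?w) borel ?t = density lborel (\<lambda>t. ennreal (c * radial_density \<kappa> m r t))"
 proof (rule measure_eqI)
  fix X assume "X \<in> sets (distr (density ?P ?w) borel ?t)"
  then have [measurable]: "X \<in> sets borel" by simp
  have "emeasure (distr (density ?P ?w) borel ?t) X = (\<integral>\<^sup>+z. indicator X (?t z) * ennreal (?w z) \<partial>?P)"
   by (simp add: nn_integral_indicator[symmetric] nn_integral_distr nn_integral_density mult.commute del: nn_integral_indicator)
  also have "\<dots> = ennreal c * (\<integral>\<^sup>+t. indicator X t * ennreal (radial_density \<kappa> m r t) \<partial>lborel)"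
   unfolding c by (rule nn_integral_klein_radius[OF \<kappa> m r]) measurable
  also have "\<dots> = (\<integral>\<^sup>+t. ennreal (c * radial_density \<kappa> m r t) * indicator X t \<partial>lborel)"
   using c(2) d0 by (subst nn_integral_cmult[symmetric]) (auto simp: ennreal_mult mult_ac)
  also have "\<dots> = emeasure (density lborel (\<lambda>t. ennreal (c * radial_density \<kappa> m r t))) X"
   by (simp add: emeasure_density)
  finally show "emeasure (distr (density ?P ?w) borel ?t) X = emeasure (density lborel (\<lambda>t. ennreal (c * radial_density \<kappa> m r t))) X" .
 qed simp
 then have "(LINT t|distr (density ?P ?w) borel ?t. F t) = (LINT t|density lborel (\<lambda>t. ennreal (c * radial_density \<kappa> m r t)). F t)"
  by simp
 moreover have "(LINT t|distr (density ?P ?w) borel ?t. F t) = (LINT z|?P. ?w z *\<^sub>R F (?t z))"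
  by (subst integral_distr) (auto simp: integral_density)
 moreover have "(LINT t|density lborel (\<lambda>t. ennreal (c * radial_density \<kappa> m r t)). F t) = (LINT t|lborel. (c * radial_density \<kappa> m r t) *\<^sub>R F t)"
  using c(2) d0 by (subst integral_density) auto
 moreover have "(LINT t|lborel. (c * radial_density \<kappa> m r t) *\<^sub>R F t) = c *\<^sub>R (LINT t|lborel. radial_density \<kappa> m r t *\<^sub>R F t)"
  by (simp only: scaleR_scaleR[symmetric] integral_scaleR_right)
 ultimately show ?thesis unfolding c_def by (simp add: scaleR_conv_of_real)
qed

lemma smooth_on_reals_cong:
 assumes "smooth_on_reals S F" "\<And>r. r \<in> S ==> F r = G r"
 shows "smooth_on_reals S G" unfolding smooth_on_reals_def
proof (intro conjI allI ballI)
 show S: "open S" using assms(1) by (simp add: smooth_on_reals_def)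
 fix i r assume r: "r \<in> S"
 show "nth_deriv i G differentiable (at r)"
  by (rule differentiable_cong_open[OF S nth_deriv_cong_open[OF S assms(2)] r])
   (use assms(1) r in \<open>auto simp: smooth_on_reals_def\<close>)
qed

lemma jet_limit_cong:
 assumes "\<delta> > 0" "jet_limit j a F" "\<And>r. r \<in> {0<..<\<delta>} ==> F r = G r"
 shows "jet_limit j a G"
proof -
 have ev: "eventually (\<lambda>r. nth_deriv i F r = nth_deriv i G r) (at_right 0)" for i
  using eventually_at_right_0[OF assms(1)]
  by eventually_elim (rule nth_deriv_cong_open[of "{0<..<\<delta>}"], use assms(3) in auto)
 show ?thesis unfolding jet_limit_def
 proof (intro conjI allI impI)
  show "(nth_deriv j G \<longlongrightarrow> a) (at_right 0)"
   using assms(2) tendsto_cong[OF ev[of j]] by (simp add: jet_limit_def)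
  fix i :: nat assume "1 \<le> i"
  then have "((\<lambda>r. of_real r ^ i * nth_deriv (j + i) F r) \<longlongrightarrow> 0) (at_right 0)"
   using assms(2) by (simp add: jet_limit_def)
  then show "((\<lambda>r. of_real r ^ i * nth_deriv (j + i) G r) \<longlongrightarrow> 0) (at_right 0)"
   by (rule Lim_transform_eventually) (use ev[of "j + i"] in \<open>eventually_elim, simp\<close>)
 qed
qed

text \<open>The hypotheses isolate what a geometry has to supply: a function \<open>f\<close> on the
  chart centred at \<open>x\<close>, its decay, its smoothness along rays near the centre, and the
  number \<open>c\<close> of sheets over the chart. The decay justifies Fubini, so rotations can be
  averaged before gnomonic coordinates are integrated.\<close>

theorem has_nth_deriv_mean:
 fixes f :: "real^'n => complex" and e :: "nat => real^'n"
 assumes \<kappa>: "\<kappa> = 0 \<or> \<kappa> = 1 \<or> \<kappa> = - 1" and m: "m \<ge> 1"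
  and e: "\<And>i j. i \<le> 2 * m ==> j \<le> 2 * m ==> e i \<bullet> e j = (if i = j then 1 else 0)"
  and f[measurable]: "f \<in> borel_measurable borel"
  and bound: "\<And>v. \<kappa> * (norm v)^2 < 1 ==> norm (f v) \<le> C / (1 + (norm v)^2) ^ Suc m"
  and \<delta>: "0 < \<delta>" "\<And>t. t \<in> {-\<delta><..<\<delta>} ==> \<kappa> * t^2 < 1"
  and smooth: "\<And>n. smooth_family n {-\<delta><..<\<delta>} orthogonal_matrices (\<lambda>t A. f (t *\<^sub>R (A *v e 0)))"
  and G: "\<And>r. r \<in> {0<..<\<delta>} ==> G r = c * (LINT A|\<mu>. (LINT z|lborel_PiM (2 * m).
    klein_weight \<kappa> (2 * m) (cnorm (2 * m) z) *\<^sub>R f (A *v klein_vector e \<kappa> (2 * m) r z)))"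
 shows "has_nth_deriv_at_right_0 (2 * m) (\<lambda>r. of_real ((1 - \<kappa> * r^2) powr ((real (2 * m) - 1) / 2)) * G r)
  (c * of_real ((- 1) ^ m * fact (2 * m - 1) * sphere_area (2 * m - 1)) * f 0)"
proof -
 let ?k = "2 * m"
 let ?P = "lborel_PiM ?k"
 define F where "F t = (LINT A|\<mu>. f (A *v (t *\<^sub>R e 0)))" for t
 \<comment> \<open>The value 0 beyond the equator of the sphere lets the tail integral run to
   infinity in all three geometries.\<close>
 define q where "q t = (if \<kappa> * t^2 < 1 then F t * of_real ((1 - \<kappa> * t^2) powr (- (1 / 2))) else 0)" for t
 have e0: "norm (e 0) = 1" using e[of 0 0] by (simp add: norm_eq_1)
 have C: "0 \<le> C" using order_trans[OF norm_ge_zero bound[of 0]] by simp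
 have Fm[measurable]: "F \<in> borel_measurable borel"
 proof -
  have "(\<lambda>p. (snd p, fst p *\<^sub>R e 0)) \<in> borel \<Otimes>\<^sub>M \<mu> \<rightarrow>\<^sub>M \<mu> \<Otimes>\<^sub>M borel"
   by measurable
  from measurable_compose[OF measurable_compose[OF this measurable_matrix_vector] f]
  have "(\<lambda>(t, A). f (A *v (t *\<^sub>R e 0))) \<in> borel_measurable (borel \<Otimes>\<^sub>M \<mu>)"
   by (simp add: case_prod_unfold)
  then show ?thesis unfolding F_def by (rule borel_measurable_lebesgue_integral)
 qed
 have qm[measurable]: "q \<in> borel_measurable borel" unfolding q_def by measurable
 have Fbound: "norm (F t) \<le> C / (1 + t^2) ^ Suc m" if t: "\<kappa> * t^2 < 1" for t
 proof -
  have b: "norm (f (A *v (t *\<^sub>R e 0))) \<le> C / (1 + t^2) ^ Suc m" if "A \<in> space \<mu>" for A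
   using bound[of "A *v (t *\<^sub>R e 0)"] that t e0 by (simp add: haar_space norm_orthogonal_matrix_mult)
  have "norm (F t) \<le> (LINT A|\<mu>. norm (f (A *v (t *\<^sub>R e 0))))"
   unfolding F_def by (rule Bochner_Integration.integral_norm_bound)
  also have "\<dots> \<le> (LINT A|\<mu>. C / (1 + t^2) ^ Suc m)"
  proof (rule integral_mono[OF integrable_norm])
   show "integrable \<mu> (\<lambda>A. f (A *v (t *\<^sub>R e 0)))"
   proof (rule integrable_const_bound[where B="C / (1 + t^2) ^ Suc m"])
    have "(\<lambda>A. (A, t *\<^sub>R e 0)) \<in> \<mu> \<rightarrow>\<^sub>M \<mu> \<Otimes>\<^sub>M borel"
     by measurable
    from measurable_compose[OF measurable_compose[OF this measurable_matrix_vector] f]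
    show "(\<lambda>A. f (A *v (t *\<^sub>R e 0))) \<in> borel_measurable \<mu>" by simp
   qed (use b in auto)
  qed (use b in auto)
  finally show ?thesis by (simp add: prob_space)
 qed
 have rb: "(\<integral>\<^sup>+t. ennreal (radial_bound \<kappa> t) \<partial>lborel) < \<infinity>"
  using \<kappa> by (rule nn_integral_radial_bound_finite)
 have int: "set_integrable lborel {0<..} (\<lambda>t. q t * of_real (t ^ (2 * j + 1)))" if j: "j < m" for j
  unfolding set_integrable_def
 proof (rule integrableI_bounded)
  have "(\<integral>\<^sup>+t. ennreal (norm (indicator {0<..} t *\<^sub>R (q t * of_real (t ^ (2 * j + 1))))) \<partial>lborel)
   \<le> (\<integral>\<^sup>+t. ennreal C * ennreal (radial_bound \<kappa> t) \<partial>lborel)"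
  proof (rule nn_integral_mono)
   fix t :: real
   show "ennreal (norm (indicator {0<..} t *\<^sub>R (q t * of_real (t ^ (2 * j + 1))))) \<le> ennreal C * ennreal (radial_bound \<kappa> t)"
   proof (cases "0 < t \<and> \<kappa> * t^2 < 1")
    case True
    then have "norm (indicator {0<..} t *\<^sub>R (q t * of_real (t ^ (2 * j + 1))))
      = norm (F t) * (t ^ (2 * j + 1) * (1 - \<kappa> * t^2) powr (- (1 / 2)))"
     by (simp add: q_def norm_mult norm_power)
    also have "\<dots> \<le> C / (1 + t^2) ^ Suc m * (t ^ (2 * j + 1) * (1 - \<kappa> * t^2) powr (- (1 / 2)))"
     using True by (intro mult_right_mono Fbound) auto
    also have "\<dots> = C * (t ^ (2 * j + 1) * (1 - \<kappa> * t^2) powr (- (1 / 2)) / (1 + t^2) ^ Suc m)"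
     by simp
    also have "\<dots> \<le> C * radial_bound \<kappa> t"
     using True j C by (intro mult_left_mono odd_moment_bound) auto
    finally show ?thesis using C by (simp add: ennreal_mult[symmetric] radial_bound_nonneg ennreal_leI)
   qed (auto simp: q_def)
  qed
  also have "\<dots> = ennreal C * (\<integral>\<^sup>+t. ennreal (radial_bound \<kappa> t) \<partial>lborel)"
   by (rule nn_integral_cmult) measurable
  also have "\<dots> < \<infinity>" using rb by (simp add: ennreal_mult_less_top)
  finally show "(\<integral>\<^sup>+t. ennreal (norm (indicator {0<..} t *\<^sub>R (q t * of_real (t ^ (2 * j + 1))))) \<partial>lborel) < \<infinity>" .
 qed measurable
 have mean: "(LINT A|\<mu>. (LINT z|?P. klein_weight \<kappa> ?k (cnorm ?k z) *\<^sub>R f (A *v klein_vector e \<kappa> ?k r z)))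
  = of_real (sphere_area (?k - 1) * (1 - \<kappa> * r^2) powr (- ((real ?k - 1) / 2))) * tail_moment q (m - 1) r"
  if r: "r \<in> {0<..<\<delta>}" for r
 proof -
  have r': "0 < r" "\<kappa> * r^2 < 1" using r \<delta>(2)[of r] by auto
  let ?w = "\<lambda>z. klein_weight \<kappa> ?k (cnorm ?k z)"
  let ?v = "klein_vector e \<kappa> ?k r"
  let ?t = "\<lambda>z. sqrt (((cnorm ?k z)^2 + r^2) / (1 + \<kappa> * (cnorm ?k z)^2))"
  let ?b = "\<lambda>t. C / (1 + t^2) ^ Suc m"
  interpret S: sigma_finite_measure ?P by (rule sigma_finite_lborel_PiM)
  interpret pair_sigma_finite \<mu> ?P ..
  have nv: "norm (?v z) = ?t z" "\<kappa> * (norm (?v z))^2 < 1" if "?w z \<noteq> 0" for z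
   using klein_vector_radius[OF e r'(2) that] by auto
  have jm: "(\<lambda>(A, z). ?w z *\<^sub>R f (A *v ?v z)) \<in> borel_measurable (\<mu> \<Otimes>\<^sub>M ?P)"
  proof -
   have "(\<lambda>p. (fst p, ?v (snd p))) \<in> \<mu> \<Otimes>\<^sub>M ?P \<rightarrow>\<^sub>M \<mu> \<Otimes>\<^sub>M borel"
    by measurable
   from measurable_compose[OF measurable_compose[OF this measurable_matrix_vector] f]
   have [measurable]: "(\<lambda>p. f (fst p *v ?v (snd p))) \<in> borel_measurable (\<mu> \<Otimes>\<^sub>M ?P)"
    by simp
   show ?thesis unfolding case_prod_unfold by measurable
  qed
  have dom: "norm (?w z *\<^sub>R f (A *v ?v z)) \<le> ?w z * ?b (?t z)" if "A \<in> space \<mu>" for A z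
  proof (cases "?w z = 0")
   case False
   have "norm (f (A *v ?v z)) \<le> ?b (?t z)"
    using bound[of "A *v ?v z"] nv[OF False] that by (simp add: haar_space norm_orthogonal_matrix_mult)
   then show ?thesis
    unfolding norm_scaleR abs_of_nonneg[OF klein_weight_nonneg] by (rule mult_left_mono[OF _ klein_weight_nonneg])
  qed simp
  have fin: "(\<integral>\<^sup>+z. ennreal (?b (?t z)) * ennreal (?w z) \<partial>?P) < \<infinity>"
   by (rule nn_integral_klein_bound_finite[OF \<kappa> m r' C])
  have integ: "integrable (\<mu> \<Otimes>\<^sub>M ?P) (\<lambda>(A, z). ?w z *\<^sub>R f (A *v ?v z))"
  proof (rule integrableI_bounded[OF jm])
   have "(\<integral>\<^sup>+p. ennreal (norm (case p of (A, z) => ?w z *\<^sub>R f (A *v ?v z))) \<partial>(\<mu> \<Otimes>\<^sub>M ?P))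
    \<le> (\<integral>\<^sup>+p. ennreal (?b (?t (snd p))) * ennreal (?w (snd p)) \<partial>(\<mu> \<Otimes>\<^sub>M ?P))"
   proof (rule nn_integral_mono)
    fix p assume "p \<in> space (\<mu> \<Otimes>\<^sub>M ?P)"
    then have "fst p \<in> space \<mu>" by (auto simp: space_pair_measure)
    from dom[OF this, of "snd p"] C
    show "ennreal (norm (case p of (A, z) => ?w z *\<^sub>R f (A *v ?v z))) \<le> ennreal (?b (?t (snd p))) * ennreal (?w (snd p))"
     by (simp add: case_prod_unfold ennreal_mult[symmetric] ennreal_leI mult.commute)
   qed
   also have "\<dots> = (\<integral>\<^sup>+A. (\<integral>\<^sup>+z. ennreal (?b (?t z)) * ennreal (?w z) \<partial>?P) \<partial>\<mu>)"
   proof -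
    have "(\<lambda>p. ennreal (?b (?t (snd p))) * ennreal (?w (snd p))) \<in> borel_measurable (\<mu> \<Otimes>\<^sub>M ?P)"
     by measurable
    from S.nn_integral_fst[OF this] show ?thesis by simp
   qed
   also have "\<dots> < \<infinity>" using fin by (simp add: emeasure_space_1)
   finally show "(\<integral>\<^sup>+p. ennreal (norm (case p of (A, z) => ?w z *\<^sub>R f (A *v ?v z))) \<partial>(\<mu> \<Otimes>\<^sub>M ?P)) < \<infinity>" .
  qed
  have "(LINT A|\<mu>. (LINT z|?P. ?w z *\<^sub>R f (A *v ?v z))) = (LINT z|?P. (LINT A|\<mu>. ?w z *\<^sub>R f (A *v ?v z)))"
   by (rule Fubini_integral[OF integ, symmetric])
  also have "\<dots> = (LINT z|?P. ?w z *\<^sub>R F (?t z))"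
  proof (rule Bochner_Integration.integral_cong[OF refl])
   fix z
   show "(LINT A|\<mu>. ?w z *\<^sub>R f (A *v ?v z)) = ?w z *\<^sub>R F (?t z)"
    using spherical_mean[OF f e0, of "?v z"] nv(1)[of z]
    by (cases "?w z = 0") (simp_all only: integral_scaleR_right F_def scaleR_zero_left Bochner_Integration.integral_zero simp_thms)
  qed
  also have "\<dots> = of_real (sphere_area (?k - 1) * (1 - \<kappa> * r^2) powr (- ((real ?k - 1) / 2))) * (LINT t|lborel. radial_density \<kappa> m r t *\<^sub>R F t)"
   by (rule integral_klein_radius[OF \<kappa> m r' Fm])
  also have "(LINT t|lborel. radial_density \<kappa> m r t *\<^sub>R F t) = tail_moment q (m - 1) r"
   unfolding tail_moment_def set_lebesgue_integral_def by (intro Bochner_Integration.integral_cong refl)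
    (simp add: radial_density_def q_def scaleR_conv_of_real mult_ac indicator_def)
  finally show ?thesis .
 qed
 \<comment> \<open>\<open>q\<close> is the mean of this family for small positive \<open>t\<close>,
   but the family is smooth on both sides of 0, and at \<open>t = 0\<close> its mean is
   \<open>f 0\<close>.\<close>
 let ?h = "\<lambda>t A. f (t *\<^sub>R (A *v e 0)) * of_real ((1 - \<kappa> * t^2) powr (- (1 / 2)))"
 have h: "smooth_family n {-\<delta><..<\<delta>} orthogonal_matrices ?h" for n
  by (rule smooth_family_mult[OF smooth smooth_family_powr[OF \<delta>(2)]])
 have hq: "(LINT A|\<mu>. ?h t A) = q t" if "t \<in> {0<..<\<delta>}" for t
  using \<delta>(2)[of t] that by (simp add: q_def F_def matrix_vector_mult_scaleR)
 have h0: "(LINT A|\<mu>. ?h 0 A) = f 0" by (simp add: prob_space)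
 note sf = smooth_family_integral[OF haar_prob haar_sets compact_orthogonal_matrices \<delta>(1) h]
 have q: "smooth_on_reals {0<..<\<delta>} q" "jet_limit 0 (f 0) q"
  using smooth_on_reals_cong[OF sf(1) hq] jet_limit_cong[OF \<delta>(1) sf(2) hq] unfolding h0 by auto
 have "has_nth_deriv_at_right_0 (2 * Suc (m - 1)) (\<lambda>r. of_real ((1 - \<kappa> * r^2) powr ((real ?k - 1) / 2)) * G r)
  ((c * of_real (sphere_area (?k - 1))) * ((- 1) ^ Suc (m - 1) * fact (2 * (m - 1) + 1) * f 0))"
 proof (rule has_nth_deriv_tail_moment[OF \<delta>(1) q])
  fix r assume r: "r \<in> {0<..<\<delta>}"
  have "(1 - \<kappa> * r^2) powr ((real ?k - 1) / 2) * (1 - \<kappa> * r^2) powr (- ((real ?k - 1) / 2)) = 1"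
   using \<delta>(2)[of r] r by (simp add: powr_minus)
  then have "complex_of_real ((1 - \<kappa> * r^2) powr ((real ?k - 1) / 2)) * of_real ((1 - \<kappa> * r^2) powr (- ((real ?k - 1) / 2))) = 1"
   by (metis of_real_1 of_real_mult)
  moreover have "p * (c * (a * p' * T)) = c * a * (p * p') * T" for p p' a T :: complex by simp
  ultimately show "of_real ((1 - \<kappa> * r^2) powr ((real ?k - 1) / 2)) * G r
    = (c * of_real (sphere_area (?k - 1))) * tail_moment q (m - 1) r"
   unfolding G[OF r] mean[OF r] of_real_mult by (simp only: mult_1_right)
 qed (use int m in auto)
 moreover have e1: "2 * Suc (m - 1) = ?k" "Suc (m - 1) = m" "2 * (m - 1) + 1 = ?k - 1" using m by auto
 moreover have "(c * of_real (sphere_area (?k - 1))) * ((- 1) ^ m * fact (?k - 1) * f 0)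
   = c * of_real ((- 1) ^ m * fact (?k - 1) * sphere_area (?k - 1)) * f 0"
  by (simp only: of_real_mult of_real_power of_real_minus of_real_1 of_real_fact mult_ac)
 ultimately show ?thesis by (simp only:)
qed

end

section \<open>Volumes of totally geodesic submanifolds\<close>

text \<open>Every permutation other than the identity picks a factor off the diagonal.\<close>

lemma gram_det_orthogonal:
 assumes "\<And>i j. i < k ==> j < k ==> g (v i) (v j) = (if i = j then c else 0)"
 shows "gram_det g k v = c ^ k"
proof -
 have z: "of_int (sign p) * (\<Prod>i<k. g (v i) (v (p i))) = (if p = id then c ^ k else 0)" if p: "p permutes {..<k}" for p
 proof (cases "p = id")
  case False
  then obtain i where i: "p i \<noteq> i" by (auto simp: fun_eq_iff)
  then have "i < k" using p by (auto simp: permutes_def)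
  moreover have "p i < k" using permutes_in_image[OF p, of i] \<open>i < k\<close> by simp
  ultimately have "g (v i) (v (p i)) = 0" using assms i by simp
  then have "(\<Prod>i<k. g (v i) (v (p i))) = 0" using \<open>i < k\<close> by (intro prod_zero) auto
  then show ?thesis using False by simp
 qed (simp add: assms)
 have "gram_det g k v = (\<Sum>p | p permutes {..<k}. if p = id then c ^ k else 0)"
  unfolding gram_det_def by (intro sum.cong) (use z in auto)
 also have "\<dots> = c ^ k" by (simp add: sum.delta[OF finite_permutations] permutes_id)
 finally show ?thesis .
qed

text \<open>Both integrals are those of the identity against the image measures, and these are
  compared on Borel sets. Integrability of \<open>u\<close> and \<open>v\<close> does not enter, so
  identities for nonnegative functions carry over directly.\<close>

lemma integral_eq_of_nn_integral:
 fixes u :: "'a => complex" and v :: "'b => complex"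
 assumes u[measurable]: "u \<in> borel_measurable M" and v[measurable]: "v \<in> borel_measurable N"
  and eq: "\<And>B. B \<in> sets borel ==> (\<integral>\<^sup>+x. indicator B (u x) \<partial>M) = (\<integral>\<^sup>+x. indicator B (v x) \<partial>N)"
 shows "(LINT x|M. u x) = (LINT x|N. v x)"
proof -
 have "distr M borel u = distr N borel v"
 proof (rule measure_eqI)
  fix B assume "B \<in> sets (distr M borel u)"
  then have [measurable]: "B \<in> sets borel" by simp
  have "emeasure (distr M borel u) B = (\<integral>\<^sup>+x. indicator B (u x) \<partial>M)"
   by (simp add: nn_integral_indicator[symmetric] nn_integral_distr del: nn_integral_indicator)
  also have "\<dots> = (\<integral>\<^sup>+x. indicator B (v x) \<partial>N)" by (rule eq) measurable
  also have "\<dots> = emeasure (distr N borel v) B"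
   by (simp add: nn_integral_indicator[symmetric] nn_integral_distr del: nn_integral_indicator)
  finally show "emeasure (distr M borel u) B = emeasure (distr N borel v) B" .
 qed simp
 then have "(LINT x|distr M borel u. x) = (LINT x|distr N borel v. x)" by simp
 then show ?thesis by (simp add: integral_distr)
qed

text \<open>Both sides are linear in \<open>v\<close>, and they agree on the frame because each
  \<open>s l\<close> squares to 1.\<close>

lemma frame_expand:
 fixes g :: "'a::real_vector => 'a => real"
 assumes b: "form_frame g m s b" and s: "\<And>i. i < m ==> s i = 1 \<or> s i = - 1"
  and g: "\<And>u. linear (g u)" and v: "v \<in> span (b ` {..<m})"
 shows "v = (\<Sum>l<m. (s l * g (b l) v) *\<^sub>R b l)"
proof -
 let ?P = "{v. v = (\<Sum>l<m. (s l * g (b l) v) *\<^sub>R b l)}"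
 have "subspace ?P"
 proof (rule subspaceI)
  show "0 \<in> ?P" using linear_0[OF g] by simp
  show "x + y \<in> ?P" if "x \<in> ?P" "y \<in> ?P" for x y
   using that by (simp add: linear_add[OF g] distrib_left scaleR_left_distrib sum.distrib)
  show "c *\<^sub>R x \<in> ?P" if "x \<in> ?P" for x c
  proof -
   have "(\<Sum>l<m. (s l * g (b l) (c *\<^sub>R x)) *\<^sub>R b l) = c *\<^sub>R (\<Sum>l<m. (s l * g (b l) x) *\<^sub>R b l)"
    unfolding scaleR_sum_right by (intro sum.cong) (simp_all add: linear_scale[OF g] mult_ac)
   then show ?thesis using that by simp
  qed
 qed
 moreover have "b j \<in> ?P" if j: "j < m" for j
 proof -
  have "(\<Sum>l<m. (s l * g (b l) (b j)) *\<^sub>R b l) = (\<Sum>l<m. if l = j then b j else 0)"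
   using b j s[OF j] by (intro sum.cong) (auto simp: form_frame_def)
  then show ?thesis using j by simp
 qed
 ultimately have "span (b ` {..<m}) \<subseteq> ?P" by (intro span_minimal) auto
 with v show ?thesis by blast
qed

text \<open>
 The coordinates with respect to two frames of the same span differ by a map preserving the
 standard form with the signs \<open>s\<close>, hence by a map preserving Lebesgue measure.
\<close>

lemma nn_integral_frame_change:
 fixes g :: "'a::euclidean_space => 'a => real"
 assumes m: "m \<le> CARD('n::finite)" and b: "form_frame g m s b" and b': "form_frame g m s b'"
  and s: "\<And>i. i < m ==> s i = 1 \<or> s i = - 1" and g: "\<And>u. linear (g u)" and sym: "\<And>u v. g u v = g v u"
  and span: "\<And>i. i < m ==> b i \<in> span (b' ` {..<m})" "p - p' \<in> span (b' ` {..<m})"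
  and h[measurable]: "h \<in> borel_measurable borel"
 shows "(\<integral>\<^sup>+y. h (p + (\<Sum>i<m. y i *\<^sub>R b i)) \<partial>lborel_PiM m) = (\<integral>\<^sup>+y. h (p' + (\<Sum>i<m. y i *\<^sub>R b' i)) \<partial>lborel_PiM m)"
proof -
 define a where "a l i = s l * g (b' l) (b i)" for l i
 define t where "t l = s l * g (b' l) (p - p')" for l
 have exp: "v = (\<Sum>l<m. (s l * g (b' l) v) *\<^sub>R b' l)" if "v \<in> span (b' ` {..<m})" for v
  by (rule frame_expand[OF b' _ g that]) (rule s)
 have bi: "b i = (\<Sum>l<m. a l i *\<^sub>R b' l)" if "i < m" for i
  using exp[OF span(1)[OF that]] by (simp add: a_def)
 have pt: "p - p' = (\<Sum>l<m. t l *\<^sub>R b' l)" using exp[OF span(2)] by (simp add: t_def)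
 have a: "(\<Sum>l<m. s l * a l i * a l j) = (if i = j then s i else 0)" if "i < m" "j < m" for i j
 proof -
  have "(if i = j then s i else 0) = g (b i) (b j)" using b that by (simp add: form_frame_def)
  also have "\<dots> = (\<Sum>l<m. a l j * g (b i) (b' l))"
   by (subst bi[OF that(2)]) (simp add: linear_sum[OF g] linear_scale[OF g])
  also have "\<dots> = (\<Sum>l<m. s l * a l i * a l j)"
  proof (rule sum.cong[OF refl])
   fix l assume "l \<in> {..<m}"
   then have "s l * s l = 1" using s[of l] by auto
   then have "s l * a l i = g (b i) (b' l)" by (simp add: a_def sym[of "b' l"] mult.assoc[symmetric])
   then show "a l j * g (b i) (b' l) = s l * a l i * a l j" by simp
  qed
  finally show ?thesis ..
 qed
 have [measurable]: "(\<lambda>z. z i) \<in> borel_measurable (lborel_PiM m)" if "i \<in> {..<m}" for i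
  using that measurable_PiM_lborel_component by simp
 have pt': "p + (\<Sum>i<m. y i *\<^sub>R b i) = p' + (\<Sum>l<m. (t l + (\<Sum>i<m. a l i * y i)) *\<^sub>R b' l)" for y
 proof -
  have "(\<Sum>i<m. y i *\<^sub>R b i) = (\<Sum>i<m. \<Sum>l<m. (a l i * y i) *\<^sub>R b' l)"
  proof (rule sum.cong[OF refl])
   fix i assume "i \<in> {..<m}"
   then have "y i *\<^sub>R b i = y i *\<^sub>R (\<Sum>l<m. a l i *\<^sub>R b' l)" using bi by simp
   then show "y i *\<^sub>R b i = (\<Sum>l<m. (a l i * y i) *\<^sub>R b' l)"
    by (simp add: scaleR_sum_right mult.commute)
  qed
  also have "\<dots> = (\<Sum>l<m. (\<Sum>i<m. a l i * y i) *\<^sub>R b' l)"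
   by (subst sum.swap) (simp add: scaleR_sum_left)
  finally have "(\<Sum>i<m. y i *\<^sub>R b i) = (\<Sum>l<m. (\<Sum>i<m. a l i * y i) *\<^sub>R b' l)" .
  moreover have "p = p' + (\<Sum>l<m. t l *\<^sub>R b' l)" using pt by (simp add: algebra_simps)
  ultimately show ?thesis by (simp add: scaleR_left_distrib sum.distrib)
 qed
 have "(\<integral>\<^sup>+y. h (p' + (\<Sum>i<m. y i *\<^sub>R b' i)) \<partial>lborel_PiM m)
   = (\<integral>\<^sup>+y. h (p' + (\<Sum>l<m. (\<lambda>l\<in>{..<m}. t l + (\<Sum>i<m. a l i * y i)) l *\<^sub>R b' l)) \<partial>lborel_PiM m)"
  by (rule nn_integral_PiM_affine[where 'n='n, symmetric, OF m s a]) (simp_all, measurable)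
 also have "\<dots> = (\<integral>\<^sup>+y. h (p + (\<Sum>i<m. y i *\<^sub>R b i)) \<partial>lborel_PiM m)"
  unfolding pt' by (intro nn_integral_cong arg_cong[where f=h] arg_cong2[where f="(+)"] sum.cong) auto
 finally show ?thesis ..
qed

lemma restrict_space_UNIV_eq: "restrict_space M UNIV = M"
 by (rule measure_eqI) (auto simp: sets_restrict_space emeasure_restrict_space)

text \<open>Replaces the frame picked by \<open>SOME\<close> by a given one: in the given
  coordinates the Gram determinant is again 1, and two frames of one plane differ by a Euclidean
  motion of R^k.\<close>

lemma integral_flat_volume:
 fixes f :: "real^'n::finite => complex" and p :: "real^'n"
 assumes k: "k \<le> CARD('n)" and f: "continuous_on UNIV f"
  and b: "form_frame inner k (\<lambda>_. 1) b" and \<xi>: "\<xi> = (+) p ` span (b ` {..<k})"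
 shows "(LINT x|flat_volume k \<xi>. f x) = (LINT z|lborel_PiM k. f (p + (\<Sum>i<k. z i *\<^sub>R b i)))"
proof -
 define pb :: "(real^'n) \<times> (nat => real^'n)" where "pb = (SOME (p, b). form_frame inner k (\<lambda>_. 1) b \<and> \<xi> = (+) p ` span (b ` {..<k}))"
 define p' b' where "p' = fst pb" and "b' = snd pb"
 have "case pb of (p, b) => form_frame inner k (\<lambda>_. 1) b \<and> \<xi> = (+) p ` span (b ` {..<k})"
  unfolding pb_def by (rule someI[of _ "(p, b)"]) (use b \<xi> in simp)
 then have b': "form_frame inner k (\<lambda>_. 1) b'" and \<xi>': "\<xi> = (+) p' ` span (b' ` {..<k})"
  by (auto simp: p'_def b'_def split: prod.splits)
 let ?\<psi> = "\<lambda>c. p' + (\<Sum>i<k. c i *\<^sub>R b' i)"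
 have [measurable]: "(\<lambda>z. z i) \<in> borel_measurable (lborel_PiM k)" if "i \<in> {..<k}" for i
  using that measurable_PiM_lborel_component by simp
 have fm[measurable]: "f \<in> borel_measurable borel" using f by (rule borel_measurable_continuous_onI)
 have vd: "vector_derivative (\<lambda>t. ?\<psi> (c(i := t))) (at (c i)) = b' i" if "i < k" for c :: "nat => real" and i
 proof (rule vector_derivative_at)
  have "?\<psi> (c(i := t)) = (p' + (\<Sum>j\<in>{..<k} - {i}. c j *\<^sub>R b' j)) + t *\<^sub>R b' i" for t
  proof -
   have "(\<Sum>j<k. (c(i := t)) j *\<^sub>R b' j) = t *\<^sub>R b' i + (\<Sum>j\<in>{..<k} - {i}. c j *\<^sub>R b' j)"
    using that by (subst sum.remove[of _ i]) (auto intro!: sum.cong)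
   then show ?thesis by simp
  qed
  moreover have "((\<lambda>t. (p' + (\<Sum>j\<in>{..<k} - {i}. c j *\<^sub>R b' j)) + t *\<^sub>R b' i) has_vector_derivative b' i) (at (c i))"
   by (auto intro!: derivative_eq_intros simp: has_vector_derivative_def)
  ultimately show "((\<lambda>t. ?\<psi> (c(i := t))) has_vector_derivative b' i) (at (c i))" by (simp only:)
 qed
 have gram: "gram_det inner k (\<lambda>i. vector_derivative (\<lambda>t. ?\<psi> (c(i := t))) (at (c i))) = 1" for c
 proof -
  have "gram_det inner k (\<lambda>i. vector_derivative (\<lambda>t. ?\<psi> (c(i := t))) (at (c i))) = 1 ^ k"
  proof (rule gram_det_orthogonal)
   fix i j assume ij: "i < k" "j < k"
   show "vector_derivative (\<lambda>t. ?\<psi> (c(i := t))) (at (c i)) \<bullet> vector_derivative (\<lambda>t. ?\<psi> (c(j := t))) (at (c j))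
     = (if i = j then 1 else 0)" unfolding vd[OF ij(1)] vd[OF ij(2)] using b' ij by (simp add: form_frame_def)
  qed
  then show ?thesis by simp
 qed
 have "flat_volume k \<xi> = riemannian_volume inner k UNIV ?\<psi> \<xi>"
  unfolding flat_volume_def pb_def[symmetric] by (simp add: p'_def b'_def split: prod.splits)
 also have "\<dots> = distr (lborel_PiM k) (restrict_space borel \<xi>) ?\<psi>"
  unfolding riemannian_volume_def gram by (simp add: density_1 restrict_space_UNIV_eq)
 finally have vol: "flat_volume k \<xi> = distr (lborel_PiM k) (restrict_space borel \<xi>) ?\<psi>" .
 have \<psi>m: "?\<psi> \<in> lborel_PiM k \<rightarrow>\<^sub>M restrict_space borel \<xi>"
 proof (rule measurable_restrict_space2)
  show "?\<psi> \<in> space (lborel_PiM k) \<rightarrow> \<xi>"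
   unfolding \<xi>' by (auto intro!: imageI span_sum span_scale intro: span_base)
 qed measurable
 have "(LINT x|flat_volume k \<xi>. f x) = (LINT z|lborel_PiM k. f (?\<psi> z))"
  unfolding vol by (rule integral_distr[OF \<psi>m]) (rule measurable_restrict_space1, measurable)
 also have "\<dots> = (LINT z|lborel_PiM k. f (p + (\<Sum>i<k. z i *\<^sub>R b i)))"
 proof (rule integral_eq_of_nn_integral)
  fix B :: "complex set" assume [measurable]: "B \<in> sets borel"
  have "p \<in> \<xi>" unfolding \<xi> using span_0 by (auto simp: image_iff)
  then have pp': "p - p' \<in> span (b' ` {..<k})" unfolding \<xi>' by auto
  moreover have "b i \<in> span (b' ` {..<k})" if "i < k" for i
  proof -
   have "p + b i \<in> \<xi>" unfolding \<xi> using that by (auto intro!: imageI span_base)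
   then have "p + b i - p' \<in> span (b' ` {..<k})" unfolding \<xi>' by auto
   from span_diff[OF this pp'] show ?thesis by simp
  qed
  ultimately show "(\<integral>\<^sup>+z. indicator B (f (?\<psi> z)) \<partial>lborel_PiM k) = (\<integral>\<^sup>+z. indicator B (f (p + (\<Sum>i<k. z i *\<^sub>R b i))) \<partial>lborel_PiM k)"
   using b b' by (intro nn_integral_frame_change[where 'n='n and g=inner and s="\<lambda>_. 1", symmetric, OF k])
    (auto simp: inner_commute intro!: bounded_linear.linear bounded_linear_inner_right)
 qed measurable
 finally show ?thesis .
qed

text \<open>
 The form \<open>qform \<kappa>\<close> on \<open>\<real>\<^sup>n \<times> \<real>\<close> is the inner product for \<open>\<kappa> = 1\<close> and the Lorentz form for
 \<open>\<kappa> = - 1\<close>; it allows the sphere and the hyperboloid to be treated together.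
\<close>

definition qform :: "real => 'a::real_inner \<times> real => 'a \<times> real => real" where
 "qform \<kappa> u v = \<kappa> * (fst u \<bullet> fst v) + snd u * snd v"

definition qsign :: "real => nat => nat => real" where
 "qsign \<kappa> k i = (if i = k then 1 else \<kappa>)"

definition qpoints :: "real => ('a::real_inner \<times> real) set" where
 "qpoints \<kappa> = {x. qform \<kappa> x x = 1 \<and> (\<kappa> = - 1 \<longrightarrow> snd x > 0)}"

text \<open>The last vector is a point of the sphere or of the upper sheet, the centre of both
  projections; the others are unit tangent vectors there, on which the form has the value
  \<open>\<kappa>\<close>.\<close>

definition qframe :: "real => nat => (nat => 'a::real_inner \<times> real) => bool" where
 "qframe \<kappa> k b \<longleftrightarrow> form_frame (qform \<kappa>) (Suc k) (qsign \<kappa> k) b \<and> (\<kappa> = - 1 \<longrightarrow> snd (b k) > 0)"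

section \<open>The common form of the sphere and the hyperboloid\<close>

lemma qform_commute: "qform \<kappa> u v = qform \<kappa> v u" by (simp add: qform_def inner_commute mult.commute)

lemma qform_linear: "linear (qform \<kappa> u)"
 by (rule linearI) (simp_all add: qform_def inner_add_right algebra_simps)

lemma qform_simps:
 "qform \<kappa> u (v + w) = qform \<kappa> u v + qform \<kappa> u w" "qform \<kappa> (v + w) u = qform \<kappa> v u + qform \<kappa> w u"
 "qform \<kappa> u (v - w) = qform \<kappa> u v - qform \<kappa> u w" "qform \<kappa> (v - w) u = qform \<kappa> v u - qform \<kappa> w u"
 "qform \<kappa> u (c *\<^sub>R v) = c * qform \<kappa> u v" "qform \<kappa> (c *\<^sub>R v) u = c * qform \<kappa> v u"
 by (simp_all add: qform_def inner_add_left inner_add_right inner_diff_left inner_diff_right algebra_simps)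

lemma qform_sum:
 "qform \<kappa> u (\<Sum>i\<in>I. v i) = (\<Sum>i\<in>I. qform \<kappa> u (v i))" "qform \<kappa> (\<Sum>i\<in>I. v i) u = (\<Sum>i\<in>I. qform \<kappa> (v i) u)"
 by (simp_all add: linear_sum[OF qform_linear] qform_commute[of _ _ u])

lemma qform_one: "qform 1 = inner" by (simp add: fun_eq_iff qform_def inner_prod_def)

lemma qform_minus_one: "qform (- 1) = lform" by (simp add: fun_eq_iff qform_def lform_def)

lemma qpoints_one: "qpoints 1 = sphere 0 1" by (auto simp: qpoints_def qform_one norm_eq_1)

lemma qpoints_minus_one: "qpoints (- 1) = hyperboloid" by (simp add: qpoints_def qform_minus_one hyperboloid_def)

lemma closed_qpoints: "closed (qpoints \<kappa> :: ('a::real_inner \<times> real) set)"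
proof -
 \<comment> \<open>Relaxing \<open>0 < snd x\<close> to \<open>0 \<le> snd x\<close> adds no point:
   on the hyperboloid \<open>snd x = 0\<close> would give a negative squared norm.\<close>
 have "qpoints \<kappa> = {x. qform \<kappa> x x = 1} \<inter> {x :: 'a \<times> real. \<kappa> = - 1 \<longrightarrow> 0 \<le> snd x}"
  by (auto simp: qpoints_def qform_def less_le) (smt (verit) inner_ge_zero)
 also have "closed \<dots>" unfolding qform_def
  by (intro closed_Int closed_Collect_eq closed_Collect_imp closed_Collect_le open_Collect_const continuous_intros)
 finally show ?thesis .
qed

text \<open>Vectors with positive value of the form lie in one of two opposite cones, where
  \<open>norm (fst u) < |snd u|\<close>. In opposite cones the Lorentz product would be at most 0,
  by Cauchy-Schwarz for the first components.\<close>

lemma snd_pos_of_forward: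
 assumes "qform (- 1) u u > 0" "qform (- 1) b b > 0" "snd b > 0" "qform (- 1) u b > 0"
 shows "snd u > 0"
proof (rule ccontr)
 assume "\<not> snd u > 0"
 then have u: "0 \<le> - snd u" by simp
 have "(norm (fst u))^2 \<le> (- snd u)^2" "(norm (fst b))^2 \<le> (snd b)^2"
  using assms(1,2) unfolding power2_norm_eq_inner by (simp_all add: qform_def power2_eq_square)
 then have "norm (fst u) \<le> - snd u" "norm (fst b) \<le> snd b" using u assms(3) by (auto intro: power2_le_imp_le)
 then have "norm (fst u) * norm (fst b) \<le> - snd u * snd b" using u by (intro mult_mono) auto
 moreover have "- (fst u \<bullet> fst b) \<le> norm (fst u) * norm (fst b)"
  using Cauchy_Schwarz_ineq2[of "fst u" "fst b"] by linarith
 ultimately show False using assms(4) by (simp add: qform_def)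
qed

definition frame_comb :: "nat => (nat => 'a::real_vector) => (nat => real) => real => 'a" where
 "frame_comb k b y s = (\<Sum>i<k. y i *\<^sub>R b i) + s *\<^sub>R b k"

lemma qform_frame_comb:
 assumes "qframe \<kappa> k b"
 shows "qform \<kappa> (frame_comb k b y s) (frame_comb k b y' s') = \<kappa> * (\<Sum>i<k. y i * y' i) + s * s'"
proof -
 have b: "qform \<kappa> (b i) (b j) = (if i = j then qsign \<kappa> k i else 0)" if "i \<le> k" "j \<le> k" for i j
  using assms that by (simp add: qframe_def form_frame_def less_Suc_eq_le)
 have 1: "qform \<kappa> (\<Sum>i<k. y i *\<^sub>R b i) (\<Sum>i<k. y' i *\<^sub>R b i) = \<kappa> * (\<Sum>i<k. y i * y' i)"
 proof -
  have "qform \<kappa> (\<Sum>i<k. y i *\<^sub>R b i) (\<Sum>i<k. y' i *\<^sub>R b i) = (\<Sum>i<k. \<Sum>j<k. if i = j then y i * y' i * \<kappa> else 0)"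
   unfolding qform_sum(2) unfolding qform_sum(1) by (intro sum.cong refl) (auto simp: qform_simps b qsign_def)
  also have "\<dots> = (\<Sum>i<k. y i * y' i * \<kappa>)" by (intro sum.cong refl) simp
  finally show ?thesis by (simp add: sum_distrib_left mult_ac)
 qed
 have 2: "qform \<kappa> (\<Sum>i<k. w i *\<^sub>R b i) (b k) = 0" for w
  unfolding qform_sum by (intro sum.neutral) (simp add: qform_simps b)
 have 3: "qform \<kappa> (b k) (\<Sum>i<k. w i *\<^sub>R b i) = 0" for w using 2 by (simp add: qform_commute)
 show ?thesis unfolding frame_comb_def by (simp add: qform_simps 1 2 3 b qsign_def)
qed

lemma frame_comb_last: "b k = frame_comb k b (\<lambda>_. 0) 1" by (simp add: frame_comb_def)

lemma klein_vector_frame_comb: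
 "klein_vector b \<kappa> k 1 z = (1 / sqrt (1 + \<kappa> * (cnorm k z)^2)) *\<^sub>R frame_comb k b z 1"
 by (simp add: klein_vector_def frame_comb_def)

lemma qform_frame_comb_one:
 assumes "qframe \<kappa> k b"
 shows "qform \<kappa> (frame_comb k b z 1) (frame_comb k b z 1) = 1 + \<kappa> * (cnorm k z)^2"
  and "qform \<kappa> (frame_comb k b z 1) (b k) = 1" unfolding qform_frame_comb[OF assms] cnorm_power2
 by (simp add: power2_eq_square) (subst frame_comb_last[of b k], simp only: qform_frame_comb[OF assms], simp)

lemma snd_frame_comb_pos:
 assumes b: "qframe (- 1) k b" and z: "0 < 1 - (cnorm k z)\<^sup>2"
 shows "0 < snd (frame_comb k b z 1)"
proof (rule snd_pos_of_forward)
 show "0 < qform (- 1) (frame_comb k b z 1) (frame_comb k b z 1)" "0 < qform (- 1) (frame_comb k b z 1) (b k)"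
  using z by (simp_all add: qform_frame_comb_one[OF b])
 show "0 < snd (b k)" "0 < qform (- 1) (b k) (b k)" using b by (auto simp: qframe_def form_frame_def qsign_def)
qed

lemma klein_vector_qpoints:
 assumes b: "qframe \<kappa> k b" and z: "0 < 1 + \<kappa> * (cnorm k z)^2"
 shows "klein_vector b \<kappa> k 1 z \<in> qpoints \<kappa>"
proof -
 have "qform \<kappa> (klein_vector b \<kappa> k 1 z) (klein_vector b \<kappa> k 1 z) = 1"
  using z by (simp add: klein_vector_frame_comb qform_simps qform_frame_comb_one[OF b])
 moreover have "snd (klein_vector b \<kappa> k 1 z) > 0" if "\<kappa> = - 1"
  using snd_frame_comb_pos[of k b z] b z that by (simp add: klein_vector_frame_comb)
 ultimately show ?thesis by (simp add: qpoints_def)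
qed

text \<open>The origin of the exponent in \<open>klein_weight\<close>: if \<open>q\<close> is the
  value of the form on a direction, this is the integral over the part of the line on which the form
  is at most 1. The two signs of \<open>s\<close> are the two half-lines.\<close>

lemma nn_integral_abs_power:
 assumes q: "q > 0"
 shows "(\<integral>\<^sup>+s. ennreal (\<bar>s\<bar> ^ k) * (if s\<^sup>2 * q \<le> 1 \<and> 0 < s then 1 else 0) \<partial>lborel) = ennreal (q powr (- ((real k + 1) / 2)) / (real k + 1))"
  and "(\<integral>\<^sup>+s. ennreal (\<bar>s\<bar> ^ k) * (if s\<^sup>2 * q \<le> 1 \<and> s < 0 then 1 else 0) \<partial>lborel) = ennreal (q powr (- ((real k + 1) / 2)) / (real k + 1))"
proof -
 define a where "a = 1 / sqrt q"
 have a: "a > 0" using q by (simp add: a_def)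
 have iff: "s\<^sup>2 * q \<le> 1 \<longleftrightarrow> s \<le> a" if "0 < s" for s
 proof -
  have "s\<^sup>2 * q \<le> 1 \<longleftrightarrow> (s * sqrt q)\<^sup>2 \<le> 1\<^sup>2"
   using q by (simp add: power_mult_distrib)
  also have "\<dots> \<longleftrightarrow> s * sqrt q \<le> 1" using that q by (intro power_mono_iff) auto
  finally show ?thesis using q by (simp add: a_def field_simps)
 qed
 have "a ^ Suc k = q powr (- ((real k + 1) / 2))"
 proof -
  have "a = q powr (- (1 / 2))" using q by (simp add: a_def powr_minus_divide powr_half_sqrt)
  then have "a ^ Suc k = (q powr (- (1 / 2))) powr real (Suc k)" using a by (simp only: powr_realpow)
  also have "\<dots> = q powr (- (1 / 2) * real (Suc k))" by (rule powr_powr)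
  also have "- (1 / 2) * real (Suc k) = - ((real k + 1) / 2)" by (simp add: field_simps)
  finally show ?thesis .
 qed
 moreover have "(\<integral>\<^sup>+s. ennreal (s ^ k) * indicator {0..a} s \<partial>lborel) = ennreal (a ^ Suc k / (real k + 1) - 0 ^ Suc k / (real k + 1))"
 proof (rule nn_integral_FTC_Icc)
  fix s :: real
  show "((\<lambda>s. s ^ Suc k / (real k + 1)) has_real_derivative s ^ k) (at s)"
   using DERIV_cdivide[OF DERIV_pow[of "Suc k" s UNIV], of "real k + 1"] by (simp del: power_Suc add: add.commute)
 qed (use a in auto)
 moreover have "(\<integral>\<^sup>+s. ennreal (\<bar>s\<bar> ^ k) * (if s\<^sup>2 * q \<le> 1 \<and> 0 < s then 1 else 0) \<partial>lborel) = (\<integral>\<^sup>+s. ennreal (s ^ k) * indicator {0..a} s \<partial>lborel)"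
  by (rule nn_integral_cong_AE, use AE_lborel_singleton[of "0::real"] in eventually_elim)
   (use iff in \<open>auto split: split_indicator\<close>)
 ultimately show 1: "(\<integral>\<^sup>+s. ennreal (\<bar>s\<bar> ^ k) * (if s\<^sup>2 * q \<le> 1 \<and> 0 < s then 1 else 0) \<partial>lborel) = ennreal (q powr (- ((real k + 1) / 2)) / (real k + 1))"
  by simp
 have "(\<integral>\<^sup>+s. ennreal (\<bar>s\<bar> ^ k) * (if s\<^sup>2 * q \<le> 1 \<and> s < 0 then 1 else 0) \<partial>lborel)
   = ennreal \<bar>- 1\<bar> * (\<integral>\<^sup>+s. ennreal (\<bar>0 + - 1 * s\<bar> ^ k) * (if (0 + - 1 * s)\<^sup>2 * q \<le> 1 \<and> 0 + - 1 * s < 0 then 1 else 0) \<partial>lborel)"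
  by (rule nn_integral_real_affine) auto
 also have "\<dots> = (\<integral>\<^sup>+s. ennreal (\<bar>s\<bar> ^ k) * (if s\<^sup>2 * q \<le> 1 \<and> 0 < s then 1 else 0) \<partial>lborel)"
  by simp
 finally show "(\<integral>\<^sup>+s. ennreal (\<bar>s\<bar> ^ k) * (if s\<^sup>2 * q \<le> 1 \<and> s < 0 then 1 else 0) \<partial>lborel) = ennreal (q powr (- ((real k + 1) / 2)) / (real k + 1))"
  using 1 by simp
qed

lemma measurable_abs_power:
 "(\<lambda>s :: real. ennreal (\<bar>s\<bar> ^ k) * (if s\<^sup>2 * q \<le> 1 \<and> 0 < s then 1 else 0)) \<in> borel_measurable lborel"
 "(\<lambda>s :: real. ennreal (\<bar>s\<bar> ^ k) * (if s\<^sup>2 * q \<le> 1 \<and> s < 0 then 1 else 0)) \<in> borel_measurable lborel"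
 by measurable

text \<open>
 The right-hand side depends only on the span of the frame: it integrates over the cone generated
 by the submanifold.
\<close>

lemma nn_integral_klein_cone:
 fixes h :: "'a::euclidean_space \<times> real => ennreal"
 assumes \<kappa>: "\<kappa> = 1 \<or> \<kappa> = - 1" and b: "qframe \<kappa> k b" and k: "k \<ge> 1"
  and h[measurable]: "h \<in> borel_measurable borel" and even: "\<kappa> = 1 ==> (\<And>v. h (- v) = h v)"
 defines "H \<equiv> \<lambda>v. if 0 < qform \<kappa> v v \<and> qform \<kappa> v v \<le> 1 \<and> (\<kappa> = - 1 \<longrightarrow> 0 < snd v)
   then h ((1 / sqrt (qform \<kappa> v v)) *\<^sub>R v) else 0"
 shows "H \<in> borel_measurable borel"
  and "(\<integral>\<^sup>+y. H (\<Sum>i<Suc k. y i *\<^sub>R b i) \<partial>lborel_PiM (Suc k))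
   = ennreal ((if \<kappa> = 1 then 2 else 1) / (real k + 1)) *
    (\<integral>\<^sup>+z. h (klein_vector b \<kappa> k 1 z) * ennreal (klein_weight \<kappa> k (cnorm k z)) \<partial>lborel_PiM k)"
proof -
 interpret product_sigma_finite "\<lambda>_. lborel :: real measure" ..
 interpret S: sigma_finite_measure "lborel_PiM k" by (rule sigma_finite_lborel_PiM)
 interpret pair_sigma_finite "lborel_PiM k" "lborel :: real measure" ..
 have [measurable]: "(\<lambda>z. z i) \<in> borel_measurable (lborel_PiM m)" if "i \<in> {..<m}" for i m
  using that measurable_PiM_lborel_component by simp
 have qm[measurable]: "(\<lambda>v :: 'a \<times> real. qform \<kappa> v v) \<in> borel_measurable borel"
  unfolding qform_def by (intro borel_measurable_continuous_onI continuous_intros)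
 have sm[measurable]: "(snd :: 'a \<times> real => real) \<in> borel_measurable borel"
  by (intro borel_measurable_continuous_onI continuous_intros)
 show Hm[measurable]: "H \<in> borel_measurable borel" unfolding H_def by measurable
 \<comment> \<open>Describes when \<open>s *\<^sub>R frame_comb k b z 1\<close> lies in the
   truncated cone; negative \<open>s\<close> counts only on the sphere.\<close>
 define A where "A s z \<longleftrightarrow> 0 < 1 + \<kappa> * (cnorm k z)^2 \<and> s\<^sup>2 * (1 + \<kappa> * (cnorm k z)^2) \<le> 1 \<and> (\<kappa> = - 1 \<longrightarrow> 0 < s)" for s :: real and z
 have Hs: "H (s *\<^sub>R frame_comb k b z 1) = (if A s z then h (klein_vector b \<kappa> k 1 z) else 0)" if s: "s \<noteq> 0" for s z
 proof (cases "0 < 1 + \<kappa> * (cnorm k z)^2")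
  case True
  let ?u = "frame_comb k b z 1" and ?q = "1 + \<kappa> * (cnorm k z)^2"
  have Q: "qform \<kappa> (s *\<^sub>R ?u) (s *\<^sub>R ?u) = s^2 * ?q"
   by (simp add: qform_simps qform_frame_comb_one[OF b] power2_eq_square)
  have "0 < s^2 * ?q" using True s by simp
  moreover have "(\<kappa> = - 1 \<longrightarrow> 0 < snd (s *\<^sub>R ?u)) \<longleftrightarrow> (\<kappa> = - 1 \<longrightarrow> 0 < s)"
   using snd_frame_comb_pos[of k b z] b True by (auto simp: zero_less_mult_iff)
  ultimately have "H (s *\<^sub>R ?u) = (if A s z then h ((1 / sqrt (s\<^sup>2 * ?q)) *\<^sub>R s *\<^sub>R ?u) else 0)"
   unfolding H_def Q A_def using True by auto
  also have "(1 / sqrt (s\<^sup>2 * ?q)) *\<^sub>R s *\<^sub>R ?u = (s / \<bar>s\<bar>) *\<^sub>R klein_vector b \<kappa> k 1 z"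
   by (simp add: klein_vector_frame_comb real_sqrt_mult)
  also have "(if A s z then h ((s / \<bar>s\<bar>) *\<^sub>R klein_vector b \<kappa> k 1 z) else 0) = (if A s z then h (klein_vector b \<kappa> k 1 z) else 0)"
  proof (cases "s > 0")
   case False
   then have "s / \<bar>s\<bar> = - 1" using s by simp
   moreover have "\<kappa> = 1" if "A s z" using that False \<kappa> by (auto simp: A_def)
   ultimately show ?thesis using even by auto
  qed simp
  finally show ?thesis .
 next
  case False
  have "qform \<kappa> (s *\<^sub>R frame_comb k b z 1) (s *\<^sub>R frame_comb k b z 1) = s^2 * (1 + \<kappa> * (cnorm k z)^2)"
   by (simp only: qform_simps qform_frame_comb_one[OF b] power2_eq_square mult.assoc)
  also have "\<dots> \<le> 0" using False by (intro mult_nonneg_nonpos) auto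
  finally have "\<not> 0 < qform \<kappa> (s *\<^sub>R frame_comb k b z 1) (s *\<^sub>R frame_comb k b z 1)"
   by (simp only: not_less)
  then show ?thesis using False by (simp add: H_def A_def)
 qed
 have ins: "insert k {..<k} = {..<Suc k}" by auto
 have Fm: "(\<lambda>y. H (\<Sum>i<Suc k. y i *\<^sub>R b i)) \<in> borel_measurable (lborel_PiM (Suc k))"
  by measurable
 have "(\<integral>\<^sup>+y. H (\<Sum>i<Suc k. y i *\<^sub>R b i) \<partial>lborel_PiM (Suc k))
   = (\<integral>\<^sup>+s. (\<integral>\<^sup>+x. H (\<Sum>i<Suc k. (x(k := s)) i *\<^sub>R b i) \<partial>lborel_PiM k) \<partial>lborel)"
  using product_nn_integral_insert_rev[of "{..<k}" k "\<lambda>y. H (\<Sum>i<Suc k. y i *\<^sub>R b i)"] Fm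
  unfolding ins by simp
 \<comment> \<open>Projective coordinates on the cone: the first \<open>k\<close> coordinates become
   \<open>s z\<close>, with Jacobian \<open>|s| ^ k\<close>. A negative \<open>s\<close> leads to
   the antipodal point, where \<open>h\<close> has the same value.\<close>
 also have "\<dots> = (\<integral>\<^sup>+s. (\<integral>\<^sup>+z. ennreal (\<bar>s\<bar> ^ k) * (if A s z then h (klein_vector b \<kappa> k 1 z) else 0) \<partial>lborel_PiM k) \<partial>lborel)"
 proof (rule nn_integral_cong_AE, use AE_lborel_singleton[of "0::real"] in eventually_elim)
  fix s :: real assume s: "s \<noteq> 0"
  have m1: "(\<lambda>x. H (\<Sum>i<Suc k. (x(k := s)) i *\<^sub>R b i)) \<in> borel_measurable (lborel_PiM k)"
  proof -
   have "(\<Sum>i<Suc k. (x(k := s)) i *\<^sub>R b i) = (\<Sum>i<k. x i *\<^sub>R b i) + s *\<^sub>R b k" for x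
    by simp
   then show ?thesis by simp
  qed
  have "(\<integral>\<^sup>+x. H (\<Sum>i<Suc k. (x(k := s)) i *\<^sub>R b i) \<partial>lborel_PiM k)
   = ennreal (\<bar>s\<bar> ^ card {..<k}) * (\<integral>\<^sup>+z. H (\<Sum>i<Suc k. ((\<lambda>i\<in>{..<k}. s * z i)(k := s)) i *\<^sub>R b i) \<partial>lborel_PiM k)"
   by (rule nn_integral_PiM_scale[OF _ s m1]) simp
  also have "(\<integral>\<^sup>+z. H (\<Sum>i<Suc k. ((\<lambda>i\<in>{..<k}. s * z i)(k := s)) i *\<^sub>R b i) \<partial>lborel_PiM k)
   = (\<integral>\<^sup>+z. (if A s z then h (klein_vector b \<kappa> k 1 z) else 0) \<partial>lborel_PiM k)"
  proof (rule nn_integral_cong)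
   fix z
   have "(\<Sum>i<Suc k. ((\<lambda>i\<in>{..<k}. s * z i)(k := s)) i *\<^sub>R b i) = s *\<^sub>R frame_comb k b z 1"
    by (simp add: frame_comb_def scaleR_right_distrib scaleR_sum_right)
   then show "H (\<Sum>i<Suc k. ((\<lambda>i\<in>{..<k}. s * z i)(k := s)) i *\<^sub>R b i) = (if A s z then h (klein_vector b \<kappa> k 1 z) else 0)"
    using Hs[OF s] by (simp only:)
  qed
  finally show "(\<integral>\<^sup>+x. H (\<Sum>i<Suc k. (x(k := s)) i *\<^sub>R b i) \<partial>lborel_PiM k)
   = (\<integral>\<^sup>+z. ennreal (\<bar>s\<bar> ^ k) * (if A s z then h (klein_vector b \<kappa> k 1 z) else 0) \<partial>lborel_PiM k)"
   by (subst nn_integral_cmult) (simp_all add: A_def)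
 qed
 also have "\<dots> = (\<integral>\<^sup>+z. (\<integral>\<^sup>+s. ennreal (\<bar>s\<bar> ^ k) * (if A s z then h (klein_vector b \<kappa> k 1 z) else 0) \<partial>lborel) \<partial>lborel_PiM k)"
  unfolding A_def by (rule Fubini') measurable
 also have "\<dots> = (\<integral>\<^sup>+z. ennreal ((if \<kappa> = 1 then 2 else 1) / (real k + 1)) *
   (h (klein_vector b \<kappa> k 1 z) * ennreal (klein_weight \<kappa> k (cnorm k z))) \<partial>lborel_PiM k)"
 proof (rule nn_integral_cong)
  fix z
  let ?q = "1 + \<kappa> * (cnorm k z)^2" and ?h = "h (klein_vector b \<kappa> k 1 z)"
  show "(\<integral>\<^sup>+s. ennreal (\<bar>s\<bar> ^ k) * (if A s z then ?h else 0) \<partial>lborel)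
   = ennreal ((if \<kappa> = 1 then 2 else 1) / (real k + 1)) * (?h * ennreal (klein_weight \<kappa> k (cnorm k z)))"
  proof (cases "0 < ?q")
   case True
   let ?p = "\<lambda>s. ennreal (\<bar>s\<bar> ^ k) * (if s\<^sup>2 * ?q \<le> 1 \<and> 0 < s then 1 else 0)"
   let ?n = "\<lambda>s. ennreal (\<bar>s\<bar> ^ k) * (if s\<^sup>2 * ?q \<le> 1 \<and> s < 0 then 1 else 0)"
   have w: "klein_weight \<kappa> k (cnorm k z) = ?q powr (- ((real k + 1) / 2))"
    using True by (simp add: klein_weight_def)
   have "(\<integral>\<^sup>+s. ennreal (\<bar>s\<bar> ^ k) * (if A s z then ?h else 0) \<partial>lborel)
    = (\<integral>\<^sup>+s. ?h * (?p s + (if \<kappa> = 1 then ?n s else 0)) \<partial>lborel)"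
   proof (rule nn_integral_cong_AE, use AE_lborel_singleton[of "0::real"] in eventually_elim)
    fix s :: real assume "s \<noteq> 0"
    then have "0 < s \<or> s < 0" by linarith
    then show "ennreal (\<bar>s\<bar> ^ k) * (if A s z then ?h else 0) = ?h * (?p s + (if \<kappa> = 1 then ?n s else 0))"
     using \<kappa> True by (auto simp: A_def mult.commute)
   qed
   also have "\<dots> = ?h * ((\<integral>\<^sup>+s. ?p s \<partial>lborel) + (\<integral>\<^sup>+s. (if \<kappa> = 1 then ?n s else 0) \<partial>lborel))"
   proof -
    have m: "(\<lambda>s. if \<kappa> = 1 then ?n s else 0) \<in> borel_measurable lborel"
     by (cases "\<kappa> = 1") (use measurable_abs_power(2)[of k ?q] in simp_all)
    have "(\<integral>\<^sup>+s. ?h * (?p s + (if \<kappa> = 1 then ?n s else 0)) \<partial>lborel) = ?h * (\<integral>\<^sup>+s. (?p s + (if \<kappa> = 1 then ?n s else 0)) \<partial>lborel)"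
     by (rule nn_integral_cmult[OF borel_measurable_add[OF measurable_abs_power(1) m]])
    moreover have "(\<integral>\<^sup>+s. (?p s + (if \<kappa> = 1 then ?n s else 0)) \<partial>lborel) = (\<integral>\<^sup>+s. ?p s \<partial>lborel) + (\<integral>\<^sup>+s. (if \<kappa> = 1 then ?n s else 0) \<partial>lborel)"
     by (rule nn_integral_add[OF measurable_abs_power(1) m])
    ultimately show ?thesis by (simp only:)
   qed
   also have "(\<integral>\<^sup>+s. ?p s \<partial>lborel) = ennreal (klein_weight \<kappa> k (cnorm k z) / (real k + 1))"
    unfolding w by (rule nn_integral_abs_power(1)[OF True])
   also have "(\<integral>\<^sup>+s. (if \<kappa> = 1 then ?n s else 0) \<partial>lborel) = (if \<kappa> = 1 then ennreal (klein_weight \<kappa> k (cnorm k z) / (real k + 1)) else 0)"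
    unfolding w using nn_integral_abs_power(2)[OF True, of k] by (cases "\<kappa> = 1") (simp_all only: if_True if_False simp_thms, simp)
   also have "ennreal (klein_weight \<kappa> k (cnorm k z) / (real k + 1)) + (if \<kappa> = 1 then ennreal (klein_weight \<kappa> k (cnorm k z) / (real k + 1)) else 0)
    = ennreal ((if \<kappa> = 1 then 2 else 1) / (real k + 1)) * ennreal (klein_weight \<kappa> k (cnorm k z))"
    by (simp add: ennreal_mult[symmetric] ennreal_plus[symmetric] del: ennreal_plus)
   finally show ?thesis by (simp only: mult_ac)
  next
   case False
   then show ?thesis by (simp add: A_def klein_weight_def)
  qed
 qed
 also have "\<dots> = ennreal ((if \<kappa> = 1 then 2 else 1) / (real k + 1)) *
    (\<integral>\<^sup>+z. h (klein_vector b \<kappa> k 1 z) * ennreal (klein_weight \<kappa> k (cnorm k z)) \<partial>lborel_PiM k)"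
  by (rule nn_integral_cmult) measurable
 finally show "(\<integral>\<^sup>+y. H (\<Sum>i<Suc k. y i *\<^sub>R b i) \<partial>lborel_PiM (Suc k))
   = ennreal ((if \<kappa> = 1 then 2 else 1) / (real k + 1)) *
    (\<integral>\<^sup>+z. h (klein_vector b \<kappa> k 1 z) * ennreal (klein_weight \<kappa> k (cnorm k z)) \<partial>lborel_PiM k)" .
qed

lemma borel_qpoints: "qpoints \<kappa> \<in> sets (borel :: ('a::real_inner \<times> real) measure)"
 using closed_qpoints by (rule borel_closed)

lemma qpoints_uminus: "- v \<in> qpoints 1 \<longleftrightarrow> v \<in> qpoints 1"
 by (simp add: qpoints_def qform_def)

lemma borel_measurable_qpoints_extension:
 fixes f :: "'a::real_inner \<times> real => complex"
 assumes "continuous_on (qpoints \<kappa>) f"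
 shows "(\<lambda>v. if v \<in> qpoints \<kappa> then f v else 0) \<in> borel_measurable borel"
proof -
 have "(\<lambda>v. if v \<in> qpoints \<kappa> then f v else 0) = (\<lambda>v. indicator (qpoints \<kappa>) v *\<^sub>R f v)"
  by auto
 then show ?thesis using borel_measurable_continuous_on_indicator[OF borel_qpoints assms] by simp
qed

text \<open>Up to one positive finite factor both sides are integrals over the same cone, where the
  passage between the frames is linear and preserves Lebesgue measure. The function \<open>f\<close>
  enters through indicators of its values.\<close>

lemma klein_integral_frame_independent:
 fixes f :: "(real^'n) \<times> real => complex"
 assumes \<kappa>: "\<kappa> = 1 \<or> \<kappa> = - 1" and b: "qframe \<kappa> k b" and b': "qframe \<kappa> k b'" and k: "k \<ge> 1" "k < CARD('n)"
  and span: "\<And>i. i \<le> k ==> b i \<in> span (b' ` {..k})"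
  and f: "continuous_on (qpoints \<kappa>) f" and even: "\<kappa> = 1 ==> (\<And>v. v \<in> qpoints \<kappa> ==> f (- v) = f v)"
 shows "(LINT z|lborel_PiM k. klein_weight \<kappa> k (cnorm k z) *\<^sub>R f (klein_vector b \<kappa> k 1 z))
  = (LINT z|lborel_PiM k. klein_weight \<kappa> k (cnorm k z) *\<^sub>R f (klein_vector b' \<kappa> k 1 z))"
proof -
 define f0 where "f0 v = (if v \<in> qpoints \<kappa> then f v else 0)" for v
 have f0m[measurable]: "f0 \<in> borel_measurable borel"
  unfolding f0_def by (rule borel_measurable_qpoints_extension[OF f])
 have even0: "f0 (- v) = f0 v" if "\<kappa> = 1" for v using even that by (auto simp: f0_def qpoints_uminus)
 let ?D = "density (lborel_PiM k) (\<lambda>z. ennreal (klein_weight \<kappa> k (cnorm k z)))"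
 have eq: "(LINT z|lborel_PiM k. klein_weight \<kappa> k (cnorm k z) *\<^sub>R f (klein_vector b \<kappa> k 1 z)) = (LINT z|?D. f0 (klein_vector b \<kappa> k 1 z))"
  if b: "qframe \<kappa> k b" for b
 proof -
  have "(LINT z|lborel_PiM k. klein_weight \<kappa> k (cnorm k z) *\<^sub>R f (klein_vector b \<kappa> k 1 z)) = (LINT z|lborel_PiM k. klein_weight \<kappa> k (cnorm k z) *\<^sub>R f0 (klein_vector b \<kappa> k 1 z))"
   by (intro Bochner_Integration.integral_cong refl) (use klein_vector_qpoints[OF b] in \<open>auto simp: f0_def klein_weight_def\<close>)
  also have "\<dots> = (LINT z|?D. f0 (klein_vector b \<kappa> k 1 z))"
   by (rule integral_density[symmetric]) (auto simp: klein_weight_nonneg)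
  finally show ?thesis .
 qed
 show ?thesis unfolding eq[OF b] eq[OF b']
 proof (rule integral_eq_of_nn_integral)
  fix B :: "complex set" assume [measurable]: "B \<in> sets borel"
  define h where "h v = (indicator B (f0 v) :: ennreal)" for v
  have hm[measurable]: "h \<in> borel_measurable borel" unfolding h_def by measurable
  have he: "h (- v) = h v" if "\<kappa> = 1" for v using even0 that by (simp add: h_def)
  have D: "(\<integral>\<^sup>+z. indicator B (f0 (klein_vector b \<kappa> k 1 z)) \<partial>?D) = (\<integral>\<^sup>+z. h (klein_vector b \<kappa> k 1 z) * ennreal (klein_weight \<kappa> k (cnorm k z)) \<partial>lborel_PiM k)" for b :: "nat => (real^'n) \<times> real"
   by (subst nn_integral_density) (simp_all add: h_def mult.commute)
  let ?H = "\<lambda>v. if 0 < qform \<kappa> v v \<and> qform \<kappa> v v \<le> 1 \<and> (\<kappa> = - 1 \<longrightarrow> 0 < snd v)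
   then h ((1 / sqrt (qform \<kappa> v v)) *\<^sub>R v) else 0"
  note cone = nn_integral_klein_cone[OF \<kappa> _ k(1) hm he]
  have "(\<integral>\<^sup>+y. ?H (0 + (\<Sum>i<Suc k. y i *\<^sub>R b i)) \<partial>lborel_PiM (Suc k)) = (\<integral>\<^sup>+y. ?H (0 + (\<Sum>i<Suc k. y i *\<^sub>R b' i)) \<partial>lborel_PiM (Suc k))"
   by (rule nn_integral_frame_change[of "Suc k" "qform \<kappa>" "qsign \<kappa> k" b b', where 'n = 'n])
    (use b b' k \<kappa> span qform_linear qform_commute cone(1)[OF b] in \<open>auto simp: qframe_def qsign_def lessThan_Suc_atMost less_Suc_eq_le span_zero simp del: scaleR_eq_0_iff\<close>)
  from this[unfolded add_0] have "ennreal ((if \<kappa> = 1 then 2 else 1) / (real k + 1)) * (\<integral>\<^sup>+z. h (klein_vector b \<kappa> k 1 z) * ennreal (klein_weight \<kappa> k (cnorm k z)) \<partial>lborel_PiM k)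
   = ennreal ((if \<kappa> = 1 then 2 else 1) / (real k + 1)) * (\<integral>\<^sup>+z. h (klein_vector b' \<kappa> k 1 z) * ennreal (klein_weight \<kappa> k (cnorm k z)) \<partial>lborel_PiM k)"
   by (intro trans[OF trans[OF cone(2)[OF b, symmetric] _] cone(2)[OF b']])
  then show "(\<integral>\<^sup>+z. indicator B (f0 (klein_vector b \<kappa> k 1 z)) \<partial>?D) = (\<integral>\<^sup>+z. indicator B (f0 (klein_vector b' \<kappa> k 1 z)) \<partial>?D)"
   unfolding D by (auto simp: ennreal_mult_cancel_left split: if_splits)
 qed measurable
qed

lemma frame_comb_unit:
 assumes "i < k"
 shows "b i = frame_comb k b (\<lambda>l. if l = i then 1 else 0) 0"
proof -
 have "(if l = i then 1 else 0 :: real) *\<^sub>R b l = (if l = i then b l else 0)" for l by simp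
 then show ?thesis using assms by (simp add: frame_comb_def)
qed

section \<open>Stereographic charts and the volume of great spheres and hyperbolic subspaces\<close>

lemma stereo_frame_comb:
 "stereo \<kappa> k b c = inverse (1 + \<kappa> * (cnorm k c)^2) *\<^sub>R frame_comb k b (\<lambda>i. 2 * c i) (1 - \<kappa> * (cnorm k c)^2)"
 by (simp add: stereo_def frame_comb_def cnorm_power2 Let_def)

lemma stereo_domain_cnorm: "stereo_domain \<kappa> k = {c. 0 < 1 + \<kappa> * (cnorm k c)^2}"
 by (simp add: stereo_domain_def cnorm_power2)

lemma has_vector_derivative_stereo:
 fixes b :: "nat => 'a::real_normed_vector"
 assumes i: "i < k" and c: "c \<in> stereo_domain \<kappa> k"
 defines "u \<equiv> 1 + \<kappa> * (cnorm k c)^2"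
 shows "((\<lambda>t. stereo \<kappa> k b (c(i := t))) has_vector_derivative
  (inverse u *\<^sub>R (2 *\<^sub>R b i - (2 * \<kappa> * c i) *\<^sub>R b k)
   - (2 * \<kappa> * c i * inverse (u\<^sup>2)) *\<^sub>R frame_comb k b (\<lambda>i. 2 * c i) (1 - \<kappa> * (cnorm k c)^2))) (at (c i))"
proof -
 define S where "S = (\<Sum>j\<in>{..<k} - {i}. (c j)\<^sup>2)"
 define N where "N = (\<Sum>j\<in>{..<k} - {i}. (2 * c j) *\<^sub>R b j)"
 have q: "(cnorm k (c(i := t)))\<^sup>2 = S + t^2" for t
  unfolding cnorm_power2 S_def using i by (subst sum.remove[of _ i]) auto
 have n: "(\<Sum>j<k. (2 * (c(i := t)) j) *\<^sub>R b j) = N + (2 * t) *\<^sub>R b i" for t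
  unfolding N_def using i by (subst sum.remove[of _ i]) auto
 have st: "stereo \<kappa> k b (c(i := t)) = inverse (1 + \<kappa> * (S + t^2)) *\<^sub>R (N + (2 * t) *\<^sub>R b i + (1 - \<kappa> * (S + t^2)) *\<^sub>R b k)" for t
  by (simp only: stereo_frame_comb q frame_comb_def n)
 have qc: "(cnorm k c)^2 = S + (c i)^2" using q[of "c i"] by simp
 have fc: "frame_comb k b (\<lambda>i. 2 * c i) (1 - \<kappa> * (cnorm k c)^2) = N + (2 * c i) *\<^sub>R b i + (1 - \<kappa> * (S + (c i)^2)) *\<^sub>R b k"
  using n[of "c i"] by (simp add: frame_comb_def qc)
 have u: "u = 1 + \<kappa> * (S + (c i)^2)" "u > 0" using c by (simp_all add: u_def qc stereo_domain_cnorm)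
 have d1: "((\<lambda>t. inverse (1 + \<kappa> * (S + t^2))) has_real_derivative - (2 * \<kappa> * c i * inverse (u\<^sup>2))) (at (c i))"
  using u by (auto intro!: derivative_eq_intros simp: power2_eq_square)
 have d2: "((\<lambda>t. N + (2 * t) *\<^sub>R b i + (1 - \<kappa> * (S + t^2)) *\<^sub>R b k) has_vector_derivative (2 *\<^sub>R b i - (2 * \<kappa> * c i) *\<^sub>R b k)) (at (c i))"
  by (auto intro!: derivative_eq_intros simp: has_vector_derivative_def algebra_simps)
 have "((\<lambda>t. inverse (1 + \<kappa> * (S + t^2)) *\<^sub>R (N + (2 * t) *\<^sub>R b i + (1 - \<kappa> * (S + t^2)) *\<^sub>R b k)) has_vector_derivative
  (inverse u *\<^sub>R (2 *\<^sub>R b i - (2 * \<kappa> * c i) *\<^sub>R b k)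
   + (- (2 * \<kappa> * c i * inverse (u\<^sup>2))) *\<^sub>R (N + (2 * c i) *\<^sub>R b i + (1 - \<kappa> * (S + (c i)^2)) *\<^sub>R b k))) (at (c i))"
  unfolding u(1)[symmetric] using has_vector_derivative_scaleR[OF d1 d2] by (simp only: u(1)[symmetric])
 then show ?thesis unfolding st fc by simp
qed

text \<open>Stereographic projection is conformal: the coordinate derivatives are orthogonal with
  the common square \<open>(2 / (1 + \<kappa> |c|^2))^2\<close>. The metric is
  \<open>\<kappa> * qform \<kappa>\<close>, since the Lorentz form is negative on the tangent spaces
  of the hyperboloid.\<close>

lemma gram_det_stereo:
 fixes b :: "nat => 'a::real_inner \<times> real"
 assumes \<kappa>: "\<kappa> = 1 \<or> \<kappa> = - 1" and b: "qframe \<kappa> k b" and c: "c \<in> stereo_domain \<kappa> k"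
 shows "sqrt (gram_det (\<lambda>u v. \<kappa> * qform \<kappa> u v) k
      (\<lambda>i. vector_derivative (\<lambda>t. stereo \<kappa> k b (c(i := t))) (at (c i)))) = (2 / (1 + \<kappa> * (cnorm k c)^2)) ^ k"
proof -
 define q where "q = \<kappa> * (cnorm k c)^2"
 define u where "u = 1 + q"
 define N where "N = frame_comb k b (\<lambda>i. 2 * c i) (1 - q)"
 have u: "u > 0" using c by (simp add: stereo_domain_cnorm u_def q_def)
 have kk: "\<kappa> * \<kappa> = 1" using \<kappa> by auto
 have NN: "qform \<kappa> N N = u^2"
 proof -
  have "(\<Sum>i<k. 2 * c i * (2 * c i)) = 4 * (cnorm k c)^2"
   by (simp add: cnorm_power2 sum_distrib_left) (simp add: power2_eq_square)
  then have "qform \<kappa> N N = 4 * q + (1 - q) * (1 - q)" by (simp add: N_def qform_frame_comb[OF b] q_def)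
  then show ?thesis by (simp add: u_def power2_eq_square algebra_simps)
 qed
 have Nk: "qform \<kappa> N (b k) = 1 - q" by (subst frame_comb_last[of b k]) (simp add: N_def qform_frame_comb[OF b])
 have Ni: "qform \<kappa> N (b i) = 2 * \<kappa> * c i" if "i < k" for i
 proof -
  have "(\<Sum>l<k. 2 * c l * (if l = i then 1 else 0)) = 2 * c i"
   using that by (simp add: if_distrib[of "\<lambda>x. _ * x"] cong: if_cong)
  then show ?thesis by (subst frame_comb_unit[OF that, of b]) (simp add: N_def qform_frame_comb[OF b])
 qed
 have bb: "qform \<kappa> (b i) (b j) = (if i = j then qsign \<kappa> k i else 0)" if "i \<le> k" "j \<le> k" for i j
  using b that by (simp add: qframe_def form_frame_def less_Suc_eq_le)
 have "gram_det (\<lambda>u v. \<kappa> * qform \<kappa> u v) k (\<lambda>i. vector_derivative (\<lambda>t. stereo \<kappa> k b (c(i := t))) (at (c i))) = ((2 / u)^2) ^ k"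
 proof (rule gram_det_orthogonal)
  fix i j assume i: "i < k" and j: "j < k"
  define E where "E i = 2 *\<^sub>R b i - (2 * \<kappa> * c i) *\<^sub>R b k" for i
  have vd: "vector_derivative (\<lambda>t. stereo \<kappa> k b (c(i := t))) (at (c i)) = inverse u *\<^sub>R E i - (2 * \<kappa> * c i * inverse (u\<^sup>2)) *\<^sub>R N" if "i < k" for i
   using vector_derivative_at[OF has_vector_derivative_stereo[OF that c, of b]] by (simp add: u_def q_def N_def E_def)
  have EE: "qform \<kappa> (E i) (E j) = (if i = j then 4 * \<kappa> else 0) + 4 * (\<kappa> * \<kappa>) * c i * c j"
   using i j by (simp add: E_def qform_simps bb qsign_def algebra_simps)
  have NE: "qform \<kappa> N (E i) = 2 * \<kappa> * c i * u" if "i < k" for i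
   using that by (simp add: E_def qform_simps Ni Nk u_def algebra_simps)
  have EN: "qform \<kappa> (E i) N = 2 * \<kappa> * c i * u" if "i < k" for i
   using NE[OF that] by (simp only: qform_commute[of \<kappa> "E i"])
  have "qform \<kappa> (inverse u *\<^sub>R E i - (2 * \<kappa> * c i * inverse (u\<^sup>2)) *\<^sub>R N) (inverse u *\<^sub>R E j - (2 * \<kappa> * c j * inverse (u\<^sup>2)) *\<^sub>R N)
   = inverse (u\<^sup>2) * qform \<kappa> (E i) (E j) - inverse u * (2 * \<kappa> * c j * inverse (u\<^sup>2)) * (2 * \<kappa> * c i * u)
    - inverse u * (2 * \<kappa> * c i * inverse (u\<^sup>2)) * (2 * \<kappa> * c j * u) + (2 * \<kappa> * c i * inverse (u\<^sup>2)) * (2 * \<kappa> * c j * inverse (u\<^sup>2)) * u^2"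
   by (simp only: qform_simps NN NE[OF j] EN[OF i]) (simp add: algebra_simps power2_eq_square)
  \<comment> \<open>The terms containing \<open>c i * c j\<close> occur with coefficients 4, - 4, -
    4 and 4, and cancel.\<close>
  also have "\<dots> = (if i = j then 4 * \<kappa> else 0) * inverse (u\<^sup>2)"
   unfolding EE using u kk by (simp add: field_simps power2_eq_square)
  finally have fq: "qform \<kappa> (inverse u *\<^sub>R E i - (2 * \<kappa> * c i * inverse (u\<^sup>2)) *\<^sub>R N) (inverse u *\<^sub>R E j - (2 * \<kappa> * c j * inverse (u\<^sup>2)) *\<^sub>R N)
   = (if i = j then 4 * \<kappa> else 0) * inverse (u\<^sup>2)" .
  have "\<kappa> * ((if i = j then 4 * \<kappa> else 0) * inverse (u\<^sup>2)) = (if i = j then 4 * (\<kappa> * \<kappa>) * inverse (u\<^sup>2) else 0)"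
   by simp
  then show "\<kappa> * qform \<kappa> (vector_derivative (\<lambda>t. stereo \<kappa> k b (c(i := t))) (at (c i))) (vector_derivative (\<lambda>t. stereo \<kappa> k b (c(j := t))) (at (c j)))
   = (if i = j then (2 / u)\<^sup>2 else 0)"
   unfolding vd[OF i] vd[OF j] fq kk by (simp add: divide_inverse power_mult_distrib power_inverse)
 qed
 then show ?thesis using u by (simp add: u_def q_def real_sqrt_power)
qed


lemma stereo_qpoints:
 fixes b :: "nat => 'a::real_inner \<times> real"
 assumes b: "qframe \<kappa> k b" and c: "c \<in> stereo_domain \<kappa> k"
 shows "stereo \<kappa> k b c \<in> qpoints \<kappa> \<inter> span (b ` {..k})"
proof -
 define q where "q = \<kappa> * (cnorm k c)^2"
 define N where "N = frame_comb k b (\<lambda>i. 2 * c i) (1 - q)"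
 have u: "1 + q > 0" using c by (simp add: stereo_domain_cnorm q_def)
 have st: "stereo \<kappa> k b c = inverse (1 + q) *\<^sub>R N" by (simp add: stereo_frame_comb q_def N_def)
 have NN: "qform \<kappa> N N = (1 + q)^2"
 proof -
  have "(\<Sum>i<k. 2 * c i * (2 * c i)) = 4 * (cnorm k c)^2"
   by (simp add: cnorm_power2 sum_distrib_left) (simp add: power2_eq_square)
  then have "qform \<kappa> N N = 4 * q + (1 - q) * (1 - q)" by (simp add: N_def qform_frame_comb[OF b] q_def)
  then show ?thesis by (simp add: power2_eq_square algebra_simps)
 qed
 have Nk: "qform \<kappa> N (b k) = 1 - q" by (subst frame_comb_last[of b k]) (simp add: N_def qform_frame_comb[OF b])
 have 1: "qform \<kappa> (stereo \<kappa> k b c) (stereo \<kappa> k b c) = 1"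
 proof -
  have "qform \<kappa> (stereo \<kappa> k b c) (stereo \<kappa> k b c) = inverse (1 + q) * (inverse (1 + q) * (1 + q)^2)"
   by (simp only: st qform_simps NN)
  moreover have "inverse v * (inverse v * v^2) = 1" if "v > 0" for v :: real
   using that by (simp add: power2_eq_square field_simps)
  ultimately show ?thesis using u by (simp only:)
 qed
 have 2: "0 < snd (stereo \<kappa> k b c)" if k: "\<kappa> = - 1"
 proof (rule snd_pos_of_forward)
  show "0 < qform (- 1) (stereo \<kappa> k b c) (stereo \<kappa> k b c)" using 1 k by simp
  show "0 < snd (b k)" "0 < qform (- 1) (b k) (b k)" using b k by (auto simp: qframe_def form_frame_def qsign_def)
  have "q \<le> 0" using k by (simp add: q_def)
  moreover have "qform \<kappa> (stereo \<kappa> k b c) (b k) = inverse (1 + q) * (1 - q)"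
   by (simp only: st qform_simps Nk)
  ultimately have "0 < qform \<kappa> (stereo \<kappa> k b c) (b k)" using u by simp
  then show "0 < qform (- 1) (stereo \<kappa> k b c) (b k)" unfolding k[symmetric] .
 qed
 have 3: "stereo \<kappa> k b c \<in> span (b ` {..k})" unfolding stereo_frame_comb frame_comb_def
  by (intro span_scale span_add span_sum span_base) auto
 show ?thesis using 1 2 3 by (simp add: qpoints_def)
qed

text \<open>The double-angle formula for points: \<open>2 c / (1 - \<kappa> |c|^2)\<close> are the
  gnomonic coordinates of the stereographic point. Beyond the equator, where the denominator is
  negative, central projection returns the antipode; hence the sign.\<close>

lemma klein_vector_stereo:
 assumes u: "0 < 1 + \<kappa> * (cnorm k c)^2" and n: "\<kappa> * (cnorm k c)^2 \<noteq> 1" and \<kappa>: "\<kappa> = 1 \<or> \<kappa> = - 1"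
 shows "klein_vector b \<kappa> k 1 (\<lambda>i\<in>{..<k}. 2 / (1 - \<kappa> * (cnorm k c)^2) * c i)
  = sgn (1 - \<kappa> * (cnorm k c)^2) *\<^sub>R stereo \<kappa> k b c"
proof -
 define q where "q = \<kappa> * (cnorm k c)^2"
 define z where "z = (\<lambda>i\<in>{..<k}. 2 / (1 - q) * c i)"
 have q: "0 < 1 + q" "1 - q \<noteq> 0" using u n by (auto simp: q_def)
 have "\<kappa> * (cnorm k z)^2 = (2 / (1 - q))^2 * q"
  by (simp only: z_def cnorm_scale power_mult_distrib power2_abs q_def) (simp only: mult_ac)
 then have "1 + \<kappa> * (cnorm k z)^2 = ((1 + q) / (1 - q))^2"
  using q by (simp add: power_divide field_simps) (simp add: power2_eq_square algebra_simps)
 then have s: "sqrt (1 + \<kappa> * (cnorm k z)^2) = (1 + q) / \<bar>1 - q\<bar>"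
  using q by (simp add: real_sqrt_abs)
 have "frame_comb k b z 1 = inverse (1 - q) *\<^sub>R frame_comb k b (\<lambda>i. 2 * c i) (1 - q)"
  using q by (simp add: frame_comb_def z_def scaleR_right_distrib scaleR_sum_right divide_inverse mult_ac)
 then have "klein_vector b \<kappa> k 1 z = (\<bar>1 - q\<bar> / (1 + q) * inverse (1 - q)) *\<^sub>R frame_comb k b (\<lambda>i. 2 * c i) (1 - q)"
  by (simp add: klein_vector_frame_comb s)
 also have "\<bar>1 - q\<bar> / (1 + q) * inverse (1 - q) = sgn (1 - q) * inverse (1 + q)"
 proof -
  have "a * d / e * inverse d = a * inverse e" if "d \<noteq> 0" "e \<noteq> 0" for a d e :: real
   using that by (simp add: field_simps)
  moreover have "\<bar>1 - q\<bar> = sgn (1 - q) * (1 - q)" by (simp only: abs_sgn mult.commute)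
  moreover have "1 + q \<noteq> 0" using q by linarith
  ultimately show ?thesis using q(2) by (simp only:)
 qed
 finally show ?thesis by (simp only: stereo_frame_comb scaleR_scaleR z_def q_def)
qed

text \<open>Radius 1 is the equator in the stereographic chart of the sphere, where gnomonic
  coordinates are infinite.\<close>

lemma AE_cnorm_neq_1:
 assumes "k \<ge> 1"
 shows "AE z in lborel_PiM k. cnorm k z \<noteq> 1"
proof -
 have "(\<integral>\<^sup>+z. indicator {1} (cnorm k z) \<partial>lborel_PiM k) = (0 :: ennreal)"
 proof -
  have "(\<integral>\<^sup>+s. indicator {1} s * ennreal (k * s ^ (k - 1)) * indicator {0<..} s \<partial>lborel) = (\<integral>\<^sup>+s. 0 \<partial>(lborel :: real measure))"
   by (rule nn_integral_cong_AE, use AE_lborel_singleton[of "1::real"] in eventually_elim) simp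
  then show ?thesis using nn_integral_radial[OF assms, of "indicator {1}"] by simp
 qed
 then have "AE z in lborel_PiM k. (indicator {1} (cnorm k z) :: ennreal) = 0"
  by (subst (asm) nn_integral_0_iff_AE) measurable
 then show ?thesis by eventually_elim (auto split: split_indicator_asm)
qed

text \<open>Gnomonic coordinates see a great sphere as pairs of antipodal points, on which
  \<open>f\<close> is constant; so the sphere is counted twice. In hyperbolic space the two models
  correspond one to one.\<close>

lemma integral_stereo_volume:
 fixes f :: "(real^'n) \<times> real => complex"
 assumes \<kappa>: "\<kappa> = 1 \<or> \<kappa> = - 1" and b: "qframe \<kappa> k b" and k: "k \<ge> 1"
  and f: "continuous_on (qpoints \<kappa>) f" and even: "\<kappa> = 1 ==> (\<And>v. v \<in> qpoints \<kappa> ==> f (- v) = f v)"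
  and \<xi>: "\<xi> = qpoints \<kappa> \<inter> span (b ` {..k})"
 shows "(LINT x|riemannian_volume (\<lambda>u v. \<kappa> * qform \<kappa> u v) k (stereo_domain \<kappa> k) (stereo \<kappa> k b) \<xi>. f x)
  = (if \<kappa> = 1 then 2 else 1) * (LINT z|lborel_PiM k. klein_weight \<kappa> k (cnorm k z) *\<^sub>R f (klein_vector b \<kappa> k 1 z))"
proof -
 \<comment> \<open>\<open>f\<close> is arbitrary off \<open>qpoints \<kappa>\<close>; its extension
   by 0 is Borel on the whole space, and on the sphere still even.\<close>
 define f0 where "f0 v = (if v \<in> qpoints \<kappa> then f v else 0)" for v
 have f0m[measurable]: "f0 \<in> borel_measurable borel"
  unfolding f0_def by (rule borel_measurable_qpoints_extension[OF f])
 have even0: "f0 (- v) = f0 v" if "\<kappa> = 1" for v using even that by (auto simp: f0_def qpoints_uminus)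
 define U where "U = stereo_domain \<kappa> k"
 define a :: real where "a = (if \<kappa> = 1 then 2 else 1)"
 have [measurable]: "(\<lambda>z. z i) \<in> borel_measurable (lborel_PiM k)" if "i \<in> {..<k}" for i
  using that measurable_PiM_lborel_component by simp
 have Um: "{c \<in> space (lborel_PiM k). 0 < 1 + \<kappa> * (cnorm k c)^2} \<in> sets (lborel_PiM k)"
  by measurable
 have USm[measurable]: "U \<inter> space (lborel_PiM k) \<in> sets (lborel_PiM k)"
  using Um by (simp add: U_def stereo_domain_cnorm Int_def conj_commute)
 have stm[measurable]: "stereo \<kappa> k b \<in> borel_measurable (lborel_PiM k)"
  unfolding stereo_frame_comb[abs_def] frame_comb_def by measurable
 define w where "w c = ennreal ((2 / (1 + \<kappa> * (cnorm k c)^2)) ^ k)" for c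
 have wm[measurable]: "w \<in> borel_measurable (lborel_PiM k)" unfolding w_def by measurable
 let ?R = "restrict_space (lborel_PiM k) U"
 let ?D = "density ?R w"
 have D: "density ?R (\<lambda>c. ennreal (sqrt (gram_det (\<lambda>u v. \<kappa> * qform \<kappa> u v) k
      (\<lambda>i. vector_derivative (\<lambda>t. stereo \<kappa> k b (c(i := t))) (at (c i)))))) = ?D" (is "density ?R ?g = _")
 proof (rule density_cong)
  have e: "?g c = w c" if "c \<in> space ?R" for c
   using that gram_det_stereo[OF \<kappa> b, of c] by (simp add: space_restrict_space w_def U_def)
  show "AE c in ?R. ?g c = w c" using e by (intro AE_I2)
  show wR: "w \<in> borel_measurable ?R" by (rule measurable_restrict_space1[OF wm])
  show "?g \<in> borel_measurable ?R" using wR measurable_cong[of ?R ?g w borel] e by blast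
 qed
 have st: "stereo \<kappa> k b \<in> ?D \<rightarrow>\<^sub>M restrict_space borel \<xi>"
 proof (rule measurable_restrict_space2)
  show "stereo \<kappa> k b \<in> space ?D \<rightarrow> \<xi>"
   using stereo_qpoints[OF b] by (auto simp: space_restrict_space U_def \<xi>)
  show "stereo \<kappa> k b \<in> borel_measurable ?D" using measurable_restrict_space1[OF stm, of U] by simp
 qed
 have fm: "f \<in> borel_measurable (restrict_space borel \<xi>)"
  by (rule borel_measurable_continuous_on_restrict, rule continuous_on_subset[OF f]) (simp add: \<xi>)
 have "(LINT x|riemannian_volume (\<lambda>u v. \<kappa> * qform \<kappa> u v) k (stereo_domain \<kappa> k) (stereo \<kappa> k b) \<xi>. f x) = (LINT c|?D. f (stereo \<kappa> k b c))"
  unfolding riemannian_volume_def U_def[symmetric] D by (rule integral_distr[OF st fm])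
 also have "\<dots> = (LINT z|density (lborel_PiM k) (\<lambda>z. ennreal (a * klein_weight \<kappa> k (cnorm k z))). f0 (klein_vector b \<kappa> k 1 z))"
 proof (rule integral_eq_of_nn_integral)
  show fst: "(\<lambda>c. f (stereo \<kappa> k b c)) \<in> borel_measurable ?D" using measurable_compose[OF st fm] .
  fix B :: "complex set" assume [measurable]: "B \<in> sets borel"
  define h where "h v = (indicator B (f0 v) :: ennreal)" for v
  have hm[measurable]: "h \<in> borel_measurable borel" unfolding h_def by measurable
  have ifm: "(\<lambda>c. indicator B (f (stereo \<kappa> k b c)) :: ennreal) \<in> borel_measurable ?R"
   using measurable_compose[OF fst, of "indicator B" borel] by simp
  have "(\<integral>\<^sup>+c. indicator B (f (stereo \<kappa> k b c)) \<partial>?D) = (\<integral>\<^sup>+c. w c * indicator B (f (stereo \<kappa> k b c)) \<partial>?R)"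
   by (rule nn_integral_density[OF measurable_restrict_space1[OF wm] ifm])
  also have "\<dots> = (\<integral>\<^sup>+c. w c * indicator B (f (stereo \<kappa> k b c)) * indicator U c \<partial>lborel_PiM k)"
   by (rule nn_integral_restrict_space[OF USm])
  also have "\<dots> = (\<integral>\<^sup>+c. h (klein_vector b \<kappa> k 1 (\<lambda>i\<in>{..<k}. 2 / (1 - \<kappa> * (cnorm k c)^2) * c i))
    * ennreal (if 1 + \<kappa> * (cnorm k c)^2 > 0 then (2 / (1 + \<kappa> * (cnorm k c)^2)) ^ k else 0) \<partial>lborel_PiM k)"
  proof (rule nn_integral_cong_AE, use AE_cnorm_neq_1[OF k] in eventually_elim)
   fix c assume c: "cnorm k c \<noteq> 1"
   show "w c * indicator B (f (stereo \<kappa> k b c)) * indicator U c = h (klein_vector b \<kappa> k 1 (\<lambda>i\<in>{..<k}. 2 / (1 - \<kappa> * (cnorm k c)^2) * c i))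
    * ennreal (if 1 + \<kappa> * (cnorm k c)^2 > 0 then (2 / (1 + \<kappa> * (cnorm k c)^2)) ^ k else 0)"
   proof (cases "c \<in> U")
    case True
    then have u: "0 < 1 + \<kappa> * (cnorm k c)^2" by (simp add: U_def stereo_domain_cnorm)
    have n: "\<kappa> * (cnorm k c)^2 \<noteq> 1"
    proof
     assume *: "\<kappa> * (cnorm k c)^2 = 1"
     have "\<kappa> \<noteq> - 1"
     proof
      assume "\<kappa> = - 1"
      then have "- ((cnorm k c)^2) = 1" using * by (simp only: mult_minus1)
      then show False using zero_le_power2[of "cnorm k c"] by linarith
     qed
     then have "\<kappa> = 1" using \<kappa> by blast
     then have "(cnorm k c)^2 = 1" using * by simp
     moreover have "0 \<le> cnorm k c" by (simp add: cnorm_def sum_nonneg)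
     ultimately show False using c by (simp add: power2_eq_1_iff)
    qed
    have s: "stereo \<kappa> k b c \<in> qpoints \<kappa>" using stereo_qpoints[OF b, of c] True by (simp add: U_def)
    have "sgn (1 - \<kappa> * (cnorm k c)^2) = 1 \<or> \<kappa> = 1 \<and> sgn (1 - \<kappa> * (cnorm k c)^2) = - 1"
    proof (cases "\<kappa> = 1")
     case True
     then show ?thesis using n by (simp add: sgn_if)
    next
     case False
     then have "0 < 1 - \<kappa> * (cnorm k c)^2" using \<kappa> by (auto intro: add_pos_nonneg)
     then show ?thesis by (simp only: sgn_pos simp_thms)
    qed
    then have "f0 (sgn (1 - \<kappa> * (cnorm k c)^2) *\<^sub>R stereo \<kappa> k b c) = f0 (stereo \<kappa> k b c)"
     using even0[of "stereo \<kappa> k b c"] by (elim disjE conjE) (simp_all only: scaleR_one scaleR_minus_left)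
    then have "h (klein_vector b \<kappa> k 1 (\<lambda>i\<in>{..<k}. 2 / (1 - \<kappa> * (cnorm k c)^2) * c i)) = indicator B (f (stereo \<kappa> k b c))"
     unfolding h_def klein_vector_stereo[OF u n \<kappa>] using s by (simp add: f0_def)
    then show ?thesis using u True by (simp add: w_def mult.commute)
   next
    case False
    then show ?thesis by (simp add: U_def stereo_domain_cnorm)
   qed
  qed
  also have "\<dots> = (if \<kappa> = 1 then 2 else 1) * (\<integral>\<^sup>+z. h (klein_vector b \<kappa> k 1 z) * ennreal (klein_weight \<kappa> k (cnorm k z)) \<partial>lborel_PiM k)"
   by (rule nn_integral_stereo_Klein[OF \<kappa> k]) measurable
  also have "\<dots> = ennreal a * (\<integral>\<^sup>+z. h (klein_vector b \<kappa> k 1 z) * ennreal (klein_weight \<kappa> k (cnorm k z)) \<partial>lborel_PiM k)"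
   by (simp add: a_def)
  also have "\<dots> = (\<integral>\<^sup>+z. ennreal a * (h (klein_vector b \<kappa> k 1 z) * ennreal (klein_weight \<kappa> k (cnorm k z))) \<partial>lborel_PiM k)"
   by (rule nn_integral_cmult[symmetric]) measurable
  also have "\<dots> = (\<integral>\<^sup>+z. ennreal (a * klein_weight \<kappa> k (cnorm k z)) * h (klein_vector b \<kappa> k 1 z) \<partial>lborel_PiM k)"
   by (rule nn_integral_cong) (simp add: ennreal_mult klein_weight_nonneg a_def mult_ac)
  also have "\<dots> = (\<integral>\<^sup>+z. indicator B (f0 (klein_vector b \<kappa> k 1 z)) \<partial>density (lborel_PiM k) (\<lambda>z. ennreal (a * klein_weight \<kappa> k (cnorm k z))))"
   unfolding h_def by (rule nn_integral_density[symmetric]) measurable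
  finally show "(\<integral>\<^sup>+c. indicator B (f (stereo \<kappa> k b c)) \<partial>?D) = (\<integral>\<^sup>+z. indicator B (f0 (klein_vector b \<kappa> k 1 z)) \<partial>density (lborel_PiM k) (\<lambda>z. ennreal (a * klein_weight \<kappa> k (cnorm k z))))" .
 qed measurable
 also have "\<dots> = (LINT z|lborel_PiM k. (a * klein_weight \<kappa> k (cnorm k z)) *\<^sub>R f0 (klein_vector b \<kappa> k 1 z))"
  by (rule integral_density) (auto simp: klein_weight_nonneg a_def)
 also have "\<dots> = (LINT z|lborel_PiM k. a *\<^sub>R (klein_weight \<kappa> k (cnorm k z) *\<^sub>R f (klein_vector b \<kappa> k 1 z)))"
  by (intro Bochner_Integration.integral_cong refl) (use klein_vector_qpoints[OF b] in \<open>auto simp: f0_def klein_weight_def\<close>)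
 also have "\<dots> = a *\<^sub>R (LINT z|lborel_PiM k. klein_weight \<kappa> k (cnorm k z) *\<^sub>R f (klein_vector b \<kappa> k 1 z))"
  by (rule integral_scaleR_right)
 also have "\<dots> = (if \<kappa> = 1 then 2 else 1) * (LINT z|lborel_PiM k. klein_weight \<kappa> k (cnorm k z) *\<^sub>R f (klein_vector b \<kappa> k 1 z))"
  by (simp add: a_def scaleR_conv_of_real)
 finally show ?thesis .
qed

text \<open>The frame picked in \<open>sphere_volume\<close> may differ from \<open>b\<close>. All
  vectors of \<open>b\<close> are points of \<open>\<xi>\<close>, so they lie in the span of the
  picked frame, and frame independence applies.\<close>

lemma integral_sphere_volume:
 fixes f :: "(real^'n) \<times> real => complex"
 assumes b: "qframe 1 k b" and k: "k \<ge> 1" "k < CARD('n)"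
  and f: "continuous_on (qpoints 1) f" and even: "\<And>v. v \<in> qpoints 1 ==> f (- v) = f v"
  and \<xi>: "\<xi> = qpoints 1 \<inter> span (b ` {..k})"
 shows "(LINT x|sphere_volume k \<xi>. f x) = 2 * (LINT z|lborel_PiM k. klein_weight 1 k (cnorm k z) *\<^sub>R f (klein_vector b 1 k 1 z))"
proof -
 have q1: "qsign 1 k = (\<lambda>_. 1)" by (simp add: qsign_def fun_eq_iff)
 let ?P = "\<lambda>b. form_frame inner (Suc k) (\<lambda>_. 1) b \<and> \<xi> = sphere 0 1 \<inter> span (b ` {..k})"
 have P: "?P b \<longleftrightarrow> qframe 1 k b \<and> \<xi> = qpoints 1 \<inter> span (b ` {..k})" for b
  by (simp add: qframe_def qform_one q1 qpoints_one)
 have "?P (SOME b. ?P b)" by (rule someI[of ?P b]) (use P b \<xi> in blast)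
 then obtain b' where b'_def: "b' = (SOME b. ?P b)" and b': "qframe 1 k b'" "\<xi> = qpoints 1 \<inter> span (b' ` {..k})"
  using P by blast
 have span: "b i \<in> span (b' ` {..k})" if "i \<le> k" for i
 proof -
  have "b i \<in> qpoints 1" using b that by (simp add: qpoints_def qframe_def form_frame_def q1)
  then have "b i \<in> \<xi>" using that by (auto simp: \<xi> span_base)
  then show ?thesis using b'(2) by simp
 qed
 have "(LINT x|sphere_volume k \<xi>. f x) = 2 * (LINT z|lborel_PiM k. klein_weight 1 k (cnorm k z) *\<^sub>R f (klein_vector b' 1 k 1 z))"
  using integral_stereo_volume[OF _ b'(1) k(1) f even b'(2)] unfolding sphere_volume_def Let_def b'_def[symmetric]
  by (simp add: qform_one)
 then show ?thesis using klein_integral_frame_independent[OF _ b b'(1) k span f even] by simp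
qed

text \<open>Among the vectors of \<open>b\<close> only \<open>b k\<close> is a point of
  \<open>\<xi>\<close>; the spacelike ones are first combined with \<open>b k\<close> into points of
  the hyperboloid to show that they lie in the span of the frame picked in
  \<open>hyp_volume\<close>.\<close>

lemma integral_hyp_volume:
 fixes f :: "(real^'n) \<times> real => complex"
 assumes b: "qframe (- 1) k b" and k: "k \<ge> 1" "k < CARD('n)"
  and f: "continuous_on (qpoints (- 1)) f"
  and \<xi>: "\<xi> = qpoints (- 1) \<inter> span (b ` {..k})"
 shows "(LINT x|hyp_volume k \<xi>. f x) = (LINT z|lborel_PiM k. klein_weight (- 1) k (cnorm k z) *\<^sub>R f (klein_vector b (- 1) k 1 z))"
proof -
 have q1: "qsign (- 1) k = lorentz_sign k" by (simp add: qsign_def lorentz_sign_def fun_eq_iff)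
 let ?P = "\<lambda>b. form_frame lform (Suc k) (lorentz_sign k) b \<and> b k \<in> hyperboloid \<and> \<xi> = hyperboloid \<inter> span (b ` {..k})"
 have P: "?P b \<longleftrightarrow> qframe (- 1) k b \<and> \<xi> = qpoints (- 1) \<inter> span (b ` {..k})" for b
  by (auto simp: qframe_def qform_minus_one q1 qpoints_minus_one hyperboloid_def form_frame_def lorentz_sign_def)
 have "?P (SOME b. ?P b)" by (rule someI[of ?P b]) (use P b \<xi> in blast)
 then obtain b' where b'_def: "b' = (SOME b. ?P b)" and b': "qframe (- 1) k b'" "\<xi> = qpoints (- 1) \<inter> span (b' ` {..k})"
  using P by blast
 have bb: "qform (- 1) (b i) (b j) = (if i = j then qsign (- 1) k i else 0)" if "i \<le> k" "j \<le> k" for i j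
  using b that by (simp add: qframe_def form_frame_def less_Suc_eq_le)
 have sub: "v \<in> span (b' ` {..k})" if "v \<in> qpoints (- 1)" "v \<in> span (b ` {..k})" for v
  using that \<xi> b'(2) by blast
 have sk: "0 < snd (b k)" using b by (simp add: qframe_def)
 have bk: "b k \<in> span (b' ` {..k})"
  by (rule sub) (use sk in \<open>simp_all add: qpoints_def bb qsign_def span_base\<close>)
 have span: "b i \<in> span (b' ` {..k})" if i: "i \<le> k" for i
 proof (cases "i = k")
  case False
  \<comment> \<open>The coefficient \<open>sqrt 2\<close> gives the form the value 2 - 1 = 1, so
    \<open>?v\<close> is a point of the hyperboloid.\<close>
  let ?v = "sqrt 2 *\<^sub>R b k + b i"
  have vv: "qform (- 1) ?v ?v = 1" and vk: "qform (- 1) ?v (b k) = sqrt 2"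
   using i False by (simp_all add: qform_simps bb qsign_def)
  have "0 < snd ?v"
   by (rule snd_pos_of_forward[of ?v "b k"]) (use vv vk sk in \<open>simp_all add: bb qsign_def\<close>)
  then have "?v \<in> qpoints (- 1)" using vv by (simp add: qpoints_def)
  then have "?v \<in> span (b' ` {..k})"
   by (rule sub) (use i in \<open>intro span_add span_scale span_base imageI, auto\<close>)
  then have "?v - sqrt 2 *\<^sub>R b k \<in> span (b' ` {..k})" using bk by (intro span_diff span_scale)
  then show ?thesis by simp
 qed (use bk in simp)
 have "(LINT x|hyp_volume k \<xi>. f x) = (LINT z|lborel_PiM k. klein_weight (- 1) k (cnorm k z) *\<^sub>R f (klein_vector b' (- 1) k 1 z))"
  using integral_stereo_volume[OF _ b'(1) k(1) f _ b'(2)] unfolding hyp_volume_def Let_def b'_def[symmetric]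
  by (simp add: qform_minus_one)
 then show ?thesis using klein_integral_frame_independent[OF _ b b'(1) k span f] by simp
qed

section \<open>Euclidean space\<close>

lemma dim_form_frame:
 fixes g :: "'a::euclidean_space => 'a => real"
 assumes b: "form_frame g m s b" and s: "\<And>i. i < m ==> s i \<noteq> 0" and g: "\<And>u. linear (g u)"
 shows "dim (span (b ` {..<m})) = m"
proof -
 have inj: "inj_on b {..<m}"
 proof (rule inj_onI, rule ccontr)
  fix i j assume ij: "i \<in> {..<m}" "j \<in> {..<m}" "b i = b j" "i \<noteq> j"
  have "g (b i) (b j) = (if i = j then s i else 0)" "g (b i) (b i) = (if i = i then s i else 0)"
   using b ij(1,2) unfolding form_frame_def lessThan_iff by blast+
  then show False using s[of i] ij(1,4) unfolding ij(3) by simp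
 qed
 have "independent (b ` {..<m})" unfolding dependent_def
 proof clarify
  fix i assume i: "i < m" and d: "b i \<in> span (b ` {..<m} - {b i})"
  have "g (b i) (b i) = 0"
  proof (rule linear_eq_0_on_span[OF g _ d])
   fix v assume "v \<in> b ` {..<m} - {b i}"
   then obtain j where "j < m" "v = b j" "j \<noteq> i" by auto
   then show "g (b i) v = 0" using b i by (simp add: form_frame_def)
  qed
  then show False using b i s[OF i] by (simp add: form_frame_def)
 qed
 then show ?thesis using dim_span_eq_card_independent[of "b ` {..<m}"] card_image[OF inj] by simp
qed

lemma orthonormal_frame_of_subspace:
 fixes S :: "'a::euclidean_space set"
 assumes "subspace S"
 obtains b where "form_frame inner (dim S) (\<lambda>_. 1) b" "span (b ` {..<dim S}) = S"
proof -
 obtain B where B: "B \<subseteq> S" "pairwise orthogonal B" "\<And>x. x \<in> B ==> norm x = 1" "independent B" "card B = dim S" "span B = S"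
  using orthonormal_basis_subspace[OF assms] by metis
 have "finite B" using B(4) by (rule independent_imp_finite)
 then obtain b where b: "bij_betw b {0..<dim S} B" using ex_bij_betw_nat_finite[of B] B(5) by auto
 then have "bij_betw b {..<dim S} B" by (simp add: atLeast0LessThan)
 then have im: "b ` {..<dim S} = B" and inj: "inj_on b {..<dim S}" by (auto simp: bij_betw_def)
 have "form_frame inner (dim S) (\<lambda>_. 1) b" unfolding form_frame_def
 proof (intro allI impI)
  fix i j assume ij: "i < dim S" "j < dim S"
  then have m: "b i \<in> B" "b j \<in> B" using im by auto
  show "b i \<bullet> b j = (if i = j then 1 else 0)"
  proof (cases "i = j")
   case False
   then have "b i \<noteq> b j" using inj ij by (auto simp: inj_on_def)
   then show ?thesis using B(2) m False by (auto simp: pairwise_def orthogonal_def)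
  qed (use B(3)[OF m(1)] in \<open>simp add: norm_eq_1\<close>)
 qed
 then show ?thesis using that im B(6) by simp
qed

lemma orthonormal_frame_exists:
 assumes "m \<le> CARD('n::finite)"
 obtains e :: "nat => real^'n" where "form_frame inner m (\<lambda>_. 1) e"
proof -
 obtain e :: "nat => real^'n" where "form_frame inner (dim (UNIV :: (real^'n) set)) (\<lambda>_. 1) e"
  using orthonormal_frame_of_subspace[of "UNIV :: (real^'n) set"] by auto
 then have "form_frame inner m (\<lambda>_. 1) e" using assms by (simp add: form_frame_def dim_UNIV)
 then show ?thesis by (rule that)
qed

text \<open>Induction on the number of vectors, with one reflection in each step.\<close>

lemma orthogonal_matrix_of_frames:
 fixes e b :: "nat => real^'n"
 assumes "form_frame inner m (\<lambda>_. 1) e" "form_frame inner m (\<lambda>_. 1) b"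
 shows "\<exists>A. orthogonal_matrix A \<and> (\<forall>i<m. A *v e i = b i)" using assms
proof (induction m)
 case 0
 show ?case using orthogonal_matrix_id by auto
next
 case (Suc m)
 have e: "e i \<bullet> e j = (if i = j then 1 else 0)" and b: "b i \<bullet> b j = (if i = j then 1 else 0)" if "i \<le> m" "j \<le> m" for i j
  using Suc.prems that by (auto simp: form_frame_def less_Suc_eq_le)
 obtain A :: "(real^'n)^'n" where A: "orthogonal_matrix A" "\<And>i. i < m ==> A *v e i = b i"
  using Suc.IH Suc.prems by (auto simp: form_frame_def)
 have Aip: "(A *v v) \<bullet> (A *v w) = v \<bullet> w" for v w
  using A(1) orthogonal_transformation_matrix[of "(*v) A"] by (auto simp: orthogonal_transformation_def)
 define u v where "u = A *v e m" and "v = b m"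
 have uu: "u \<bullet> u = 1" and vv: "v \<bullet> v = 1" using e[of m m] b[of m m] by (simp_all add: u_def v_def Aip)
 have ub: "u \<bullet> b i = 0" if "i < m" for i using e[of m i] that Aip[of "e m" "e i"] by (simp add: A(2) u_def)
 have vb: "v \<bullet> b i = 0" if "i < m" for i using b[of m i] that by (simp add: v_def)
 show ?case
 proof (cases "u = v")
  case True
  then show ?thesis using A by (auto simp: u_def v_def less_Suc_eq)
 next
  case False
  define d where "d = u - v"
  \<comment> \<open>The reflection in the hyperplane orthogonal to \<open>u - v\<close>. It takes
    \<open>u\<close> to \<open>v\<close> and fixes every \<open>b i\<close> with
    \<open>i < m\<close>, since these are orthogonal to both.\<close>
  define R where "R y = y - (2 * (d \<bullet> y) / (d \<bullet> d)) *\<^sub>R d" for y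
  have dd: "d \<bullet> d \<noteq> 0" using False by (simp add: d_def)
  have "linear R" by (rule linearI) (simp_all add: R_def inner_add_right algebra_simps add_divide_distrib)
  moreover have "R y \<bullet> R z = y \<bullet> z" for y z
  proof -
   have "R y \<bullet> R z = y \<bullet> z - (2 * (d \<bullet> z) / (d \<bullet> d)) * (d \<bullet> y) - (2 * (d \<bullet> y) / (d \<bullet> d)) * (d \<bullet> z)
    + (2 * (d \<bullet> y) / (d \<bullet> d)) * ((2 * (d \<bullet> z) / (d \<bullet> d)) * (d \<bullet> d))"
    by (simp add: R_def inner_diff_left inner_diff_right inner_commute[of y d])
   also have "\<dots> = y \<bullet> z" using dd by (simp add: field_simps)
   finally show ?thesis .
  qed
  ultimately have Ro: "orthogonal_transformation R" by (simp add: orthogonal_transformation_def)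
  define B where "B = matrix R ** A"
  have "orthogonal_matrix B"
   using Ro A(1) by (auto simp: B_def orthogonal_transformation_matrix intro: orthogonal_matrix_mul)
  moreover have B: "B *v y = R (A *v y)" for y
   by (simp add: B_def matrix_vector_mul_assoc[symmetric] matrix_works orthogonal_transformation_linear[OF Ro])
  moreover have "R (b i) = b i" if "i < m" for i
   using ub[OF that] vb[OF that] by (simp add: R_def d_def inner_diff_left)
  moreover have "R u = v"
  proof -
   have "d \<bullet> d = 2 * (d \<bullet> u)"
    using uu vv by (simp add: d_def inner_diff_left inner_diff_right inner_commute)
   then have "2 * (d \<bullet> u) / (d \<bullet> d) = 1" using dd by (simp only: divide_self not_False_eq_True)
   then have "R u = u - 1 *\<^sub>R d" by (simp only: R_def)
   then show ?thesis by (simp add: d_def)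
  qed
  ultimately show ?thesis using A(2) by (intro exI[of _ B]) (auto simp: less_Suc_eq u_def v_def)
 qed
qed

section \<open>Planes at a given distance from a point\<close>

lemma continuous_on_matrix_vector: "continuous_on S (\<lambda>A :: (real^'n)^'m. A *v v)"
 unfolding matrix_vector_mult_def by (intro continuous_intros)

lemma inner_orthogonal_matrix:
 assumes "orthogonal_matrix A"
 shows "(A *v v) \<bullet> (A *v w) = v \<bullet> (w :: real^'n)"
 using assms orthogonal_transformation_matrix[of "(*v) A"] by (auto simp: orthogonal_transformation_def)

text \<open>By Pythagoras \<open>x + r *\<^sub>R b k\<close> is the nearest point, because
  \<open>b k\<close> is orthogonal to the directions of the plane.\<close>

lemma frame_plane:
 fixes b :: "nat => real^'n" and x :: "real^'n"
 assumes b: "form_frame inner (Suc k) (\<lambda>_. 1) b" and r: "r > 0"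
 defines "\<xi> \<equiv> (+) (x + r *\<^sub>R b k) ` span (b ` {..<k})"
 shows "affine \<xi>" "aff_dim \<xi> = int k" "infdist x \<xi> = r"
proof -
 show "affine \<xi>" unfolding \<xi>_def using affine_translation subspace_imp_affine[OF subspace_span] by blast
 have "form_frame inner k (\<lambda>_. 1) b" using b by (simp add: form_frame_def)
 then have "dim (span (b ` {..<k})) = k"
  by (rule dim_form_frame) (auto intro: bounded_linear.linear bounded_linear_inner_right)
 then show "aff_dim \<xi> = int k"
  unfolding \<xi>_def aff_dim_translation_eq aff_dim_subspace[OF subspace_span] by simp
 have bk: "b k \<bullet> b k = 1" using b by (simp add: form_frame_def)
 have min: "r \<le> dist x y" if y: "y \<in> \<xi>" for y
 proof -
  obtain w where w: "w \<in> span (b ` {..<k})" "y = x + r *\<^sub>R b k + w" using y by (auto simp: \<xi>_def)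
  have "b k \<bullet> w = 0" by (rule linear_eq_0_on_span[OF _ _ w(1)])
    (use b in \<open>auto simp: form_frame_def intro: bounded_linear.linear bounded_linear_inner_right\<close>)
  then have "(norm (r *\<^sub>R b k + w))^2 = r^2 + (norm w)^2" unfolding power2_norm_eq_inner
   by (simp add: inner_add_left inner_add_right bk inner_commute[of w "b k"] power2_eq_square)
  then have "r\<^sup>2 \<le> (norm (r *\<^sub>R b k + w))^2" by simp
  then have "r \<le> norm (r *\<^sub>R b k + w)" by (rule power2_le_imp_le) simp
  then show ?thesis
  proof -
   have "x - y = - (r *\<^sub>R b k + w)" by (simp add: w(2))
   then show ?thesis
    using \<open>r \<le> norm (r *\<^sub>R b k + w)\<close> by (simp only: dist_norm norm_minus_cancel)
  qed
 qed
 have mem: "x + r *\<^sub>R b k \<in> \<xi>" unfolding \<xi>_def using span_zero by force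
 have "dist x (x + r *\<^sub>R b k) = r" using r bk by (simp add: dist_norm norm_eq_1)
 then have "(INF y\<in>\<xi>. dist x y) = r"
  by (intro cInf_eq_minimum) (use mem min in \<open>auto intro: image_eqI[OF _ mem]\<close>)
 then show "infdist x \<xi> = r" using mem by (subst infdist_notempty) auto
qed

text \<open>The nearest point \<open>p\<close> supplies the last vector
  \<open>(p - x) /\<^sub>R r\<close>, and an orthonormal basis of the direction space supplies the
  others.\<close>

lemma plane_frame:
 fixes \<xi> :: "(real^'n) set"
 assumes \<xi>: "affine \<xi>" "aff_dim \<xi> = int k" "infdist x \<xi> = r" and r: "r > 0"
 obtains b where "form_frame inner (Suc k) (\<lambda>_. 1) b" "\<xi> = (+) (x + r *\<^sub>R b k) ` span (b ` {..<k})"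
proof -
 have ne: "\<xi> \<noteq> {}" using \<xi>(3) r by (auto simp: infdist_def)
 have cl: "closed \<xi>" using \<xi>(1) by (rule affine_closed)
 obtain p where p: "p \<in> \<xi>" "infdist x \<xi> = dist x p" using infdist_attains_inf[OF cl] ne by blast
 define S where "S = (\<lambda>y. y - p) ` \<xi>"
 have S: "subspace S" unfolding S_def by (rule affine_diffs_subspace_subtract[OF \<xi>(1) p(1)])
 have "dim S = k" using aff_dim_subspace[OF S] \<xi>(2) by (simp add: S_def aff_dim_translation_eq_subtract)
 then obtain b0 where b0: "form_frame inner k (\<lambda>_. 1) b0" "span (b0 ` {..<k}) = S"
  using orthonormal_frame_of_subspace[OF S] by metis
 have orth: "(p - x) \<bullet> s = 0" if s: "s \<in> S" for s
 proof -
  \<comment> \<open>At the nearest point of a convex set every direction into the set makes an angle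
    of at least 90 degrees with \<open>x - p\<close>; in a linear direction space \<open>w\<close>
    and \<open>- w\<close> both occur, which forces orthogonality.\<close>
  have le: "(x - p) \<bullet> w \<le> 0" if w: "w \<in> S" for w
  proof -
   obtain y where "y \<in> \<xi>" "w = y - p" using w by (auto simp: S_def)
   then show ?thesis
    using any_closest_point_dot[of \<xi> p y x] cl p affine_imp_convex[OF \<xi>(1)] infdist_le by metis
  qed
  have "- s \<in> S" using S s by (rule subspace_neg)
  then show ?thesis using le[OF s] le[of "- s"] by (simp add: inner_diff_left)
 qed
 define b where "b i = (if i = k then (p - x) /\<^sub>R r else b0 i)" for i
 have pr: "norm (p - x) = r" using p \<xi>(3) by (simp add: dist_norm norm_minus_commute)
 have im: "b ` {..<k} = b0 ` {..<k}" by (intro image_cong) (auto simp: b_def)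
 have bS: "b0 i \<in> S" if "i < k" for i using that b0(2) span_base[of "b0 i" "b0 ` {..<k}"] by auto
 have "form_frame inner (Suc k) (\<lambda>_. 1) b" unfolding form_frame_def
 proof (intro allI impI)
  fix i j assume ij: "i < Suc k" "j < Suc k"
  consider "i = k" "j = k" | "i = k" "j < k" | "i < k" "j = k" | "i < k" "j < k" using ij by linarith
  then show "b i \<bullet> b j = (if i = j then 1 else 0)"
  proof cases
   case 1
   then show ?thesis using pr r by (simp add: b_def power2_norm_eq_inner[symmetric] power2_eq_square)
  next
   case 2
   then show ?thesis using orth[OF bS[of j]] by (simp add: b_def)
  next
   case 3
   then show ?thesis using orth[OF bS[of i]] by (simp add: b_def inner_commute)
  next
   case 4
   then show ?thesis using b0(1) by (simp add: b_def form_frame_def)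
  qed
 qed
 moreover have "\<xi> = (+) (x + r *\<^sub>R b k) ` span (b ` {..<k})"
 proof -
  have "x + r *\<^sub>R b k = p" using r by (simp add: b_def)
  then have "(+) (x + r *\<^sub>R b k) ` span (b ` {..<k}) = (+) p ` S" by (simp only: im b0(2))
  also have "\<dots> = \<xi>" by (simp add: S_def image_image)
  finally show ?thesis ..
 qed
 ultimately show ?thesis by (rule that)
qed

lemma set_gdist_euclidean:
 "\<xi> \<noteq> {} ==> set_gdist (euclidean_geometry k) x \<xi> = infdist x \<xi>"
 by (simp add: set_gdist_def euclidean_geometry_def infdist_notempty)

lemma submfds_at_euclidean:
 fixes x :: "real^'n"
 assumes r: "r > 0"
 shows "submfds_at (euclidean_geometry k) x r = {\<xi>. affine \<xi> \<and> aff_dim \<xi> = int k \<and> infdist x \<xi> = r}"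
proof -
 have ne: "\<xi> \<noteq> {}" if "aff_dim \<xi> = int k" for \<xi> :: "(real^'n) set" using that by auto
 have rh: "rho (euclidean_geometry k) x \<xi> = set_gdist (euclidean_geometry k) x \<xi>" for \<xi>
  by (simp add: rho_def euclidean_geometry_def)
 have sb: "submfds (euclidean_geometry k) = {\<xi>. affine \<xi> \<and> aff_dim \<xi> = int k}"
  by (simp add: euclidean_geometry_def)
 show ?thesis unfolding submfds_at_def
 proof (intro Collect_cong)
  fix \<xi> :: "(real^'n) set"
  show "(\<xi> \<in> submfds (euclidean_geometry k) \<and> rho (euclidean_geometry k) x \<xi> = r) = (affine \<xi> \<and> aff_dim \<xi> = int k \<and> infdist x \<xi> = r)"
   unfolding sb rh using set_gdist_euclidean[OF ne, of \<xi> k x] by auto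
 qed
qed

lemma orthogonal_action_euclidean:
 fixes e :: "nat => real^'n"
 assumes e: "form_frame inner (Suc k) (\<lambda>_. 1) e" and r: "r > 0"
 shows "orthogonal_action (euclidean_geometry k) x r (\<lambda>A y. x + A *v (y - x)) ((+) (x + r *\<^sub>R e k) ` span (e ` {..<k}))"
  and "(\<lambda>y. x + A *v (y - x)) ` ((+) (x + r *\<^sub>R e k) ` span (e ` {..<k})) = (+) (x + r *\<^sub>R (A *v e k)) ` span ((\<lambda>i. A *v e i) ` {..<k})"
proof -
 let ?G = "euclidean_geometry k" and ?\<alpha> = "\<lambda>A y. x + A *v (y - x)" and ?\<xi> = "\<lambda>e. (+) (x + r *\<^sub>R e k) ` span (e ` {..<k})"
 show im: "?\<alpha> A ` ?\<xi> e = ?\<xi> (\<lambda>i. A *v e i)" for A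
 proof -
  have "span ((\<lambda>i. A *v e i) ` {..<k}) = (*v) A ` span (e ` {..<k})"
   using linear_span_image[of "(*v) A" "e ` {..<k}"] by (simp add: image_image)
  then show ?thesis by (simp add: image_image matrix_vector_right_distrib matrix_vector_mult_scaleR algebra_simps)
 qed
 have pts: "points ?G = UNIV" and gd: "gdist ?G = dist" by (simp_all add: euclidean_geometry_def)
 have frame: "form_frame inner (Suc k) (\<lambda>_. 1) (\<lambda>i. A *v e i)" if "orthogonal_matrix A" for A
  using e inner_orthogonal_matrix[OF that] by (simp add: form_frame_def)
 have ne: "?\<xi> e \<noteq> {}" using span_zero by blast
 have cl: "closed (?\<xi> e)" by (intro closed_translation closed_subspace subspace_span)
 show "orthogonal_action ?G x r ?\<alpha> (?\<xi> e)"
 proof (unfold_locales, unfold pts gd set_gdist_euclidean[OF ne])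
  fix A B :: "(real^'n)^'n" and y z :: "real^'n" and g :: "real^'n => real^'n"
  show "x + A *v (y - x) \<in> UNIV" by simp
  show "dist (x + A *v (y - x)) (x + A *v (z - x)) = dist y z" if "orthogonal_matrix A"
   using norm_orthogonal_matrix_mult[OF that, of "y - z"] by (simp add: dist_norm matrix_vector_mult_diff_distrib)
  show "x + (A ** B) *v (y - x) = x + A *v (x + B *v (y - x) - x)" by (simp add: matrix_vector_mul_assoc)
  show "x + mat 1 *v (y - x) = y" "x + A *v (x - x) = x" by simp_all
  show "continuous_on orthogonal_matrices (\<lambda>A. x + A *v (y - x))"
   by (intro continuous_intros continuous_on_matrix_vector)
  show "continuous_on UNIV (\<lambda>y. x + A *v (y - x))"
   unfolding matrix_vector_mult_def by (intro continuous_intros)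
  show "?\<xi> e \<subseteq> UNIV" by simp
  show "continuous_on UNIV (\<lambda>y. infdist y (?\<xi> e))" by (intro continuous_intros)
  show "infdist y (?\<xi> e) = 0 \<longleftrightarrow> y \<in> ?\<xi> e"
   using in_closed_iff_infdist_zero[OF cl ne] by simp
  show "\<exists>A. orthogonal_matrix A \<and> (\<forall>y\<in>UNIV. g y = x + A *v (y - x))" if g: "g \<in> stabilizer ?G x"
  proof -
   \<comment> \<open>The stabilizer consists of distance-preserving bijections; after translation to
     0, such a map of Euclidean space is linear.\<close>
   define h where "h v = g (x + v) - x" for v
   have "orthogonal_transformation h" unfolding orthogonal_transformation_isometry
    proof (intro conjI allI)
    show "h 0 = 0" using g by (simp add: h_def stabilizer_def)
    show "dist (h v) (h w) = dist v w" for v w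
    proof -
     have "dist (h v) (h w) = dist (g (x + v)) (g (x + w))" by (simp add: h_def dist_norm)
     also have "\<dots> = dist (x + v) (x + w)" using g by (simp add: stabilizer_def pts gd)
     finally show ?thesis by simp
    qed
   qed
   then have "orthogonal_matrix (matrix h)" "matrix h *v v = h v" for v
    using orthogonal_transformation_matrix[of h] matrix_works[of h v] orthogonal_transformation_linear[of h] by simp_all
   then show ?thesis by (intro exI[of _ "matrix h"]) (simp add: h_def)
  qed
  show "submfds_at ?G x r = {?\<alpha> A ` ?\<xi> e | A. orthogonal_matrix A}" unfolding submfds_at_euclidean[OF r]
  proof (intro equalityI subsetI)
   fix \<xi> assume "\<xi> \<in> {?\<alpha> A ` ?\<xi> e | A. orthogonal_matrix A}"
   then obtain A where A: "orthogonal_matrix A" "\<xi> = ?\<alpha> A ` ?\<xi> e" by blast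
   show "\<xi> \<in> {\<xi>. affine \<xi> \<and> aff_dim \<xi> = int k \<and> infdist x \<xi> = r}"
    unfolding A(2) im using frame_plane[OF frame[OF A(1)] r, of x] by simp
  next
   fix \<xi> assume "\<xi> \<in> {\<xi>. affine \<xi> \<and> aff_dim \<xi> = int k \<and> infdist x \<xi> = r}"
   then obtain b where b: "form_frame inner (Suc k) (\<lambda>_. 1) b" "\<xi> = ?\<xi> b"
    using plane_frame[OF _ _ _ r] by blast
   obtain A where A: "orthogonal_matrix A" "\<And>i. i < Suc k ==> A *v e i = b i"
    using orthogonal_matrix_of_frames[OF e b(1)] by blast
   have E: "?\<xi> (\<lambda>i. A *v e i) = ?\<xi> b"
   proof -
    have "(\<lambda>i. A *v e i) ` {..<k} = b ` {..<k}" by (intro image_cong) (simp_all add: A(2))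
    then show ?thesis by (simp only: A(2)[OF lessI])
   qed
   have "\<xi> = ?\<alpha> A ` ?\<xi> e" unfolding im E by (rule b(2))
   then show "\<xi> \<in> {?\<alpha> A ` ?\<xi> e | A. orthogonal_matrix A}" using A(1) by (intro CollectI exI conjI)
  qed
 qed
qed

text \<open>Decay about 0 becomes decay about \<open>x\<close> through
  \<open>1 + |v| \<le> (1 + |x|) (1 + |x + v|)\<close>; the exponent \<open>2 * Suc m\<close>
  matches the power \<open>Suc m\<close> of \<open>1 + |v|^2\<close>.\<close>

lemma schwartz_decay:
 fixes f :: "'a::real_normed_vector => complex"
 assumes "schwartz f"
 obtains C where "\<And>v. norm (f (x + v)) \<le> C / (1 + (norm v)^2) ^ Suc m"
proof -
 have "bdd_above (range (\<lambda>x. (1 + norm x) ^ (2 * Suc m) * norm (iter_deriv [] f x)))"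
 proof -
  have "\<forall>N vs. bdd_above (range (\<lambda>x. (1 + norm x) ^ N * norm (iter_deriv vs f x)))"
   using assms unfolding schwartz_def by (rule conjunct2)
  from this[rule_format, of "2 * Suc m" "[]"] show ?thesis .
 qed
 then obtain M where M: "\<And>y. (1 + norm y) ^ (2 * Suc m) * norm (f y) \<le> M" by (auto simp: bdd_above_def)
 show ?thesis
 proof (rule that)
  fix v :: 'a
  have "1 + (norm v)^2 \<le> (1 + norm v)^2" by (simp add: power2_sum)
  also have "\<dots> \<le> ((1 + norm x) * (1 + norm (x + v)))\<^sup>2"
  proof (rule power_mono)
   have "norm v \<le> norm (x + v) + norm x" using norm_triangle_ineq4[of "x + v" x] by simp
   then have "1 + norm v \<le> 1 + norm x + norm (x + v) + norm x * norm (x + v)"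
    using mult_nonneg_nonneg[OF norm_ge_zero[of x] norm_ge_zero[of "x + v"]] by linarith
   then show "1 + norm v \<le> (1 + norm x) * (1 + norm (x + v))" by (simp add: algebra_simps)
  qed simp
  finally have "(1 + (norm v)^2) ^ Suc m \<le> (((1 + norm x) * (1 + norm (x + v)))\<^sup>2) ^ Suc m"
   by (intro power_mono) auto
  also have "\<dots> = (1 + norm x) ^ (2 * Suc m) * (1 + norm (x + v)) ^ (2 * Suc m)"
   by (simp only: power_mult[symmetric] power_mult_distrib)
  finally have "(1 + (norm v)^2) ^ Suc m * norm (f (x + v)) \<le> (1 + norm x) ^ (2 * Suc m) * (1 + norm (x + v)) ^ (2 * Suc m) * norm (f (x + v))"
   by (rule mult_right_mono) simp
  also have "\<dots> \<le> (1 + norm x) ^ (2 * Suc m) * M" unfolding mult.assoc by (intro mult_left_mono M) simp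
  finally have "norm (f (x + v)) * (1 + (norm v)^2) ^ Suc m \<le> (1 + norm x) ^ (2 * Suc m) * M"
   by (simp only: mult.commute)
  moreover have "0 < (1 + (norm v)^2) ^ Suc m" by (intro zero_less_power add_pos_nonneg) auto
  ultimately show "norm (f (x + v)) \<le> (1 + norm x) ^ (2 * Suc m) * M / (1 + (norm v)^2) ^ Suc m"
   by (simp only: pos_le_divide_eq)
 qed
qed

context haar_measure
begin

theorem euclidean_inversion:
 fixes f :: "real^'n => complex"
 assumes f: "schwartz f" and m: "m \<ge> 1" "2 * m < CARD('n)"
 shows "has_nth_deriv_at_right_0 (2 * m)
  (\<lambda>r. shifted_dual_radon (euclidean_geometry (2 * m)) r (radon (euclidean_geometry (2 * m)) f) x)
  (of_real ((- 1) ^ m * fact (2 * m - 1) * sphere_area (2 * m - 1)) * f x)"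
proof -
 let ?k = "2 * m"
 obtain e :: "nat => real^'n" where e: "form_frame inner (Suc ?k) (\<lambda>_. 1) e"
  using orthonormal_frame_exists[where 'n = 'n and m = "Suc ?k"] m by auto
 have e': "e i \<bullet> e j = (if i = j then 1 else 0)" if "i \<le> 2 * m" "j \<le> 2 * m" for i j
  using e that by (simp add: form_frame_def less_Suc_eq_le)
 obtain C where C: "\<And>v. norm (f (x + v)) \<le> C / (1 + (norm v)^2) ^ Suc m"
  using schwartz_decay[OF f] by metis
 have sm: "smooth_on_open UNIV f" using f by (simp add: schwartz_def)
 have cont: "continuous_on UNIV f"
 proof -
  have "iter_deriv [] f differentiable (at y)" for y using sm unfolding smooth_on_open_def by blast
  then show ?thesis by (intro continuous_at_imp_continuous_on ballI differentiable_imp_continuous_within) simp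
 qed
 have contx: "continuous_on S (\<lambda>v. f (x + v))" for S
  by (rule continuous_on_compose2[OF cont]) (auto intro!: continuous_intros)
 have fm: "(\<lambda>v. f (x + v)) \<in> borel_measurable borel" by (rule borel_measurable_continuous_onI[OF contx])
 \<comment> \<open>For \<open>\<kappa> = 0\<close> the curve of \<open>smooth_family_compose\<close>
   is a straight line through \<open>x\<close>, and the half-length 1 of the interval is an
   arbitrary choice.\<close>
 have smooth: "smooth_family n {-1<..<1} orthogonal_matrices (\<lambda>t A. f (x + t *\<^sub>R (A *v e 0)))" for n
  using smooth_family_compose[OF sm, of orthogonal_matrices "\<lambda>A. A *v e 0" "{-1<..<1}" 0 x n "[]"]
  by (simp add: continuous_on_matrix_vector add.commute)
 have kv: "klein_vector e 0 ?k r z = (\<Sum>i<?k. z i *\<^sub>R e i) + r *\<^sub>R e ?k" for r z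
  by (simp add: klein_vector_def)
 have w: "klein_weight 0 ?k s = 1" for s by (simp add: klein_weight_def)
 have G: "shifted_dual_radon (euclidean_geometry ?k) r (radon (euclidean_geometry ?k) f) x
  = 1 * (LINT A|\<mu>. (LINT z|lborel_PiM ?k. klein_weight 0 ?k (cnorm ?k z) *\<^sub>R f (x + A *v klein_vector e 0 ?k r z)))"
  if r: "r \<in> {0<..<1}" for r
 proof -
  let ?\<xi> = "(+) (x + r *\<^sub>R e ?k) ` span (e ` {..<?k})"
  interpret act: orthogonal_action "euclidean_geometry ?k" x r "\<lambda>A y. x + A *v (y - x)" ?\<xi>
   by (rule orthogonal_action_euclidean(1)[OF e]) (use r in simp)
  have rad: "radon (euclidean_geometry ?k) f ((\<lambda>y. x + A *v (y - x)) ` ?\<xi>)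
   = (LINT z|lborel_PiM ?k. klein_weight 0 ?k (cnorm ?k z) *\<^sub>R f (x + A *v klein_vector e 0 ?k r z))"
   if A: "orthogonal_matrix A" for A
  proof -
   have Ae: "form_frame inner ?k (\<lambda>_. 1) (\<lambda>i. A *v e i)"
    using e inner_orthogonal_matrix[OF A] by (simp add: form_frame_def)
   have "radon (euclidean_geometry ?k) f ((\<lambda>y. x + A *v (y - x)) ` ?\<xi>)
    = (LINT y|flat_volume ?k ((\<lambda>y. x + A *v (y - x)) ` ?\<xi>). f y)"
    by (simp add: radon_def euclidean_geometry_def)
   also have "\<dots> = (LINT z|lborel_PiM ?k. f (x + r *\<^sub>R (A *v e ?k) + (\<Sum>i<?k. z i *\<^sub>R (A *v e i))))"
    by (rule integral_flat_volume[OF _ cont Ae orthogonal_action_euclidean(2)[OF e]]) (use m r in simp_all)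
   also have "\<dots> = (LINT z|lborel_PiM ?k. klein_weight 0 ?k (cnorm ?k z) *\<^sub>R f (x + A *v klein_vector e 0 ?k r z))"
    unfolding kv w
    by (simp add: matrix_vector_right_distrib matrix_vector_mult_scaleR linear_sum[OF matrix_vector_mul_linear] add_ac)
   finally show ?thesis .
  qed
  have "continuous_on orthogonal_matrices (\<lambda>A. LINT z|lborel_PiM ?k. klein_weight 0 ?k (cnorm ?k z) *\<^sub>R f (x + A *v klein_vector e 0 ?k r z))"
   by (rule continuous_klein_integral[of 0 m e "\<lambda>v. f (x + v)" C r]) (use e' fm contx C m r in auto)
  then have "continuous_on orthogonal_matrices (\<lambda>A. radon (euclidean_geometry ?k) f ((\<lambda>y. x + A *v (y - x)) ` ?\<xi>))"
   by (rule continuous_on_eq) (simp add: rad)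
  then have "shifted_dual_radon (euclidean_geometry ?k) r (radon (euclidean_geometry ?k) f) x
   = (LINT A|\<mu>. radon (euclidean_geometry ?k) f ((\<lambda>y. x + A *v (y - x)) ` ?\<xi>))"
   by (intro act.shifted_dual_radon_orbit haar_prob haar_sets haar_left haar_right)
  also have "\<dots> = (LINT A|\<mu>. (LINT z|lborel_PiM ?k. klein_weight 0 ?k (cnorm ?k z) *\<^sub>R f (x + A *v klein_vector e 0 ?k r z)))"
   by (intro Bochner_Integration.integral_cong refl rad) (simp add: haar_space)
  finally show ?thesis by simp
 qed
 have "has_nth_deriv_at_right_0 ?k
  (\<lambda>r. of_real ((1 - 0 * r^2) powr ((real ?k - 1) / 2)) * shifted_dual_radon (euclidean_geometry ?k) r (radon (euclidean_geometry ?k) f) x)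
  (1 * of_real ((- 1) ^ m * fact (?k - 1) * sphere_area (?k - 1)) * f (x + 0))"
  by (rule has_nth_deriv_mean[of 0 m e "\<lambda>v. f (x + v)" C 1]) (use e' fm C m smooth G in auto)
 then show ?thesis by simp
qed

end

section \<open>The sphere and hyperbolic space\<close>

text \<open>The reverse Cauchy-Schwarz inequality on the upper sheet, from
  \<open>(1 + a b)^2 \<le> (1 + a^2) (1 + b^2)\<close> for the norms \<open>a\<close>,
  \<open>b\<close> of the first components. It keeps the argument of \<open>arcosh\<close> in its
  proper range.\<close>

lemma qform_ge_1:
 assumes "u \<in> qpoints (- 1)" "v \<in> qpoints (- 1)"
 shows "1 \<le> qform (- 1) u v"
proof -
 have u: "(snd u)^2 = 1 + (norm (fst u))^2" "0 < snd u" and v: "(snd v)^2 = 1 + (norm (fst v))^2" "0 < snd v"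
  using assms unfolding power2_norm_eq_inner by (auto simp: qpoints_def qform_def power2_eq_square)
 have "(1 + norm (fst u) * norm (fst v))^2 + (norm (fst u) - norm (fst v))^2 = (snd u)^2 * (snd v)^2"
  unfolding u(1) v(1) by (simp add: power2_eq_square algebra_simps)
 then have "(1 + norm (fst u) * norm (fst v))^2 \<le> (snd u * snd v)^2"
  using zero_le_power2[of "norm (fst u) - norm (fst v)"] unfolding power_mult_distrib by linarith
 then have "1 + norm (fst u) * norm (fst v) \<le> snd u * snd v" by (rule power2_le_imp_le) (use u v in simp)
 moreover have "fst u \<bullet> fst v \<le> norm (fst u) * norm (fst v)" by (rule norm_cauchy_schwarz)
 ultimately show ?thesis by (simp add: qform_def)
qed

lemma qform_le_1:
 assumes "u \<in> qpoints 1" "v \<in> qpoints 1"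
 shows "\<bar>qform 1 u v\<bar> \<le> 1"
proof -
 have "norm u = 1" "norm v = 1" using assms by (simp_all add: qpoints_one)
 then show ?thesis using Cauchy_Schwarz_ineq2[of u v] by (simp add: qform_one)
qed

text \<open>The orthogonal complement of a unit vector is definite with the sign of \<open>\<kappa>\<close>.\<close>

lemma qform_orthogonal_zero:
 assumes \<kappa>: "\<kappa> = 1 \<or> \<kappa> = - 1" and c: "qform \<kappa> c c = 1" "qform \<kappa> y c = 0" and y: "\<kappa> * qform \<kappa> y y \<le> 0"
 shows "y = 0"
proof (cases "\<kappa> = 1")
 case True
 then have "y \<bullet> y \<le> 0" using y by (simp add: qform_one)
 then have "y \<bullet> y = 0" using inner_ge_zero[of y] by linarith
 then show ?thesis by simp
next
 case False
 then have k: "\<kappa> = - 1" using \<kappa> by simp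
 let ?a = "(norm (fst y))^2" and ?w = "(norm (fst c))^2"
 have t: "(snd c)^2 = 1 + ?w" and st: "snd y * snd c = fst y \<bullet> fst c" and a: "?a \<le> (snd y)^2"
  using c y k unfolding power2_norm_eq_inner by (simp_all add: qform_def power2_eq_square)
 have "(fst y \<bullet> fst c)^2 \<le> ?a * ?w"
  using Cauchy_Schwarz_ineq[of "fst y" "fst c"] by (simp add: power2_norm_eq_inner)
 then have "(snd y)^2 * (1 + ?w) \<le> ?a * ?w" unfolding st[symmetric] power_mult_distrib t .
 moreover have "?a * ?w \<le> (snd y)^2 * ?w" using a by (rule mult_right_mono) simp
 ultimately have "(snd y)^2 * (1 + ?w) \<le> (snd y)^2 * ?w" by (rule order_trans)
 then have "(snd y)^2 \<le> 0" by (simp add: distrib_left)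
 then have "snd y = 0" "?a \<le> 0" using a by simp_all
 then show ?thesis by (simp add: prod_eq_iff)
qed

lemma origin_qpoints: "(0, 1) \<in> qpoints \<kappa>" by (simp add: qpoints_def qform_def)

lemma qform_origin: "qform \<kappa> (0, 1) v = snd v" "qform \<kappa> v (0, 1) = snd v" by (simp_all add: qform_def)

text \<open>Reflection along \<open>x - (0, 1)\<close>. It exchanges \<open>x\<close> with the
  centre of the standard chart and is its own inverse, so a general \<open>x\<close> is reduced to
  the origin.\<close>

lemma point_reflection_exists:
 fixes x :: "'a::real_inner \<times> real"
 assumes \<kappa>: "\<kappa> = 1 \<or> \<kappa> = - 1" and x: "x \<in> qpoints \<kappa>"
 obtains T where "linear T" "\<And>y z. qform \<kappa> (T y) (T z) = qform \<kappa> y z" "\<And>y. T (T y) = y"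
  "T (0, 1) = x" "\<And>y. y \<in> qpoints \<kappa> ==> T y \<in> qpoints \<kappa>"
proof -
 obtain T where T: "linear T" "\<And>y z. qform \<kappa> (T y) (T z) = qform \<kappa> y z" "\<And>y. T (T y) = y" "T (0, 1) = x"
 proof (cases "x = (0, 1)")
  case True
  then show ?thesis by (intro that[of "\<lambda>y. y"]) (simp_all add: linear_id[unfolded id_def])
 next
  case False
  define d where "d = x - (0, 1)"
  have xx: "qform \<kappa> x x = 1" using x by (simp add: qpoints_def)
  have dd: "qform \<kappa> d d = 2 - 2 * snd x" by (simp add: d_def qform_simps xx qform_origin)
  \<comment> \<open>A reflection needs a direction on which the form does not vanish; here the value
    0 would force \<open>snd x = 1\<close> and then \<open>fst x = 0\<close>.\<close>
  have "qform \<kappa> d d \<noteq> 0"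
  proof
   assume "qform \<kappa> d d = 0"
   then have "snd x = 1" using dd by simp
   moreover from this have "\<kappa> * (fst x \<bullet> fst x) = 0" using xx by (simp add: qform_def)
   then have "fst x = 0" using \<kappa> by auto
   ultimately show False using False by (simp add: prod_eq_iff)
  qed
  define T where "T y = y - (2 * qform \<kappa> d y / qform \<kappa> d d) *\<^sub>R d" for y
  have dT: "qform \<kappa> d (T y) = - qform \<kappa> d y" for y
   using \<open>qform \<kappa> d d \<noteq> 0\<close> by (simp add: T_def qform_simps)
  show ?thesis
  proof (rule that[of T])
   show "linear T" by (rule linearI) (simp_all add: T_def qform_simps algebra_simps add_divide_distrib)
   show "qform \<kappa> (T y) (T z) = qform \<kappa> y z" for y z
   proof -
    have "qform \<kappa> (T y) (T z) = qform \<kappa> y (T z) - 2 * qform \<kappa> d y / qform \<kappa> d d * qform \<kappa> d (T z)"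
     unfolding T_def[of y] by (simp only: qform_simps)
    also have "\<dots> = qform \<kappa> y z - 2 * qform \<kappa> d z / qform \<kappa> d d * qform \<kappa> y d + 2 * qform \<kappa> d y / qform \<kappa> d d * qform \<kappa> d z"
     unfolding dT by (simp add: T_def qform_simps)
    finally show ?thesis by (simp add: qform_commute[of \<kappa> y d])
   qed
   show "T (T y) = y" for y unfolding T_def[of "T y"] dT by (simp add: T_def)
   have "2 * qform \<kappa> d (0, 1) = - qform \<kappa> d d"
    unfolding dd by (simp add: d_def qform_simps qform_origin)
   then have "2 * qform \<kappa> d (0, 1) / qform \<kappa> d d = - 1"
    using \<open>qform \<kappa> d d \<noteq> 0\<close> by (simp only: minus_divide_left[symmetric] divide_self not_False_eq_True)
   then have "T (0, 1) = (0, 1) - (- 1) *\<^sub>R d" by (simp only: T_def)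
   then show "T (0, 1) = x" by (simp add: d_def)
  qed
 qed
 moreover have "T y \<in> qpoints \<kappa>" if y: "y \<in> qpoints \<kappa>" for y
 proof -
  \<comment> \<open>The last coordinate is the product with the origin, which \<open>T\<close> moves
    to \<open>x\<close>; so \<open>T\<close> keeps the upper sheet by
    \<open>qform_ge_1\<close>.\<close>
  have "snd (T y) > 0" if k: "\<kappa> = - 1"
  proof -
   have "snd (T y) = qform \<kappa> (T (0, 1)) (T (T y))" by (simp only: T(2) qform_origin)
   also have "\<dots> = qform \<kappa> x y" by (simp only: T(3,4))
   finally show ?thesis using qform_ge_1[of x y] x y k by simp
  qed
  then show ?thesis using y T(2)[of y y] by (simp add: qpoints_def)
 qed
 ultimately show ?thesis by (rule that)
qed

text \<open>
 The projection of \<open>y\<close> to the span of the frame, and the value of the form on it, on which the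
 distance of \<open>y\<close> from the submanifold depends.
\<close>

definition qproj :: "real => nat => (nat => 'a::real_inner \<times> real) => 'a \<times> real => 'a \<times> real" where
 "qproj \<kappa> k b y = (\<Sum>l<Suc k. (qsign \<kappa> k l * qform \<kappa> (b l) y) *\<^sub>R b l)"

definition qheight :: "real => nat => (nat => 'a::real_inner \<times> real) => 'a \<times> real => real" where
 "qheight \<kappa> k b y = (\<Sum>l<Suc k. qsign \<kappa> k l * (qform \<kappa> (b l) y)^2)"

lemma qframeD:
 assumes "qframe \<kappa> k b"
 shows "i \<le> k ==> j \<le> k ==> qform \<kappa> (b i) (b j) = (if i = j then qsign \<kappa> k i else 0)" "b k \<in> qpoints \<kappa>"
 using assms by (auto simp: qframe_def form_frame_def less_Suc_eq_le qpoints_def qsign_def)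

lemma qproj_span: "qproj \<kappa> k b y \<in> span (b ` {..k})"
 unfolding qproj_def by (intro span_sum span_scale span_base imageI) simp

lemma qform_qproj:
 assumes \<kappa>: "\<kappa> = 1 \<or> \<kappa> = - 1" and b: "qframe \<kappa> k b" and w: "w \<in> span (b ` {..k})"
 shows "qform \<kappa> (qproj \<kappa> k b y) w = qform \<kappa> y w"
proof -
 have "qform \<kappa> (qproj \<kappa> k b y - y) w = 0"
 proof (rule linear_eq_0_on_span[OF qform_linear _ w])
  fix v assume "v \<in> b ` {..k}"
  then obtain j where j: "j \<le> k" "v = b j" by auto
  have "qform \<kappa> (qproj \<kappa> k b y) (b j) = (\<Sum>l<Suc k. if l = j then qsign \<kappa> k j * qform \<kappa> (b j) y * qsign \<kappa> k j else 0)"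
   unfolding qproj_def qform_sum by (intro sum.cong refl) (use j in \<open>auto simp: qform_simps qframeD[OF b]\<close>)
  also have "\<dots> = qform \<kappa> (b j) y" using j \<kappa> by (auto simp: qsign_def less_Suc_eq_le)
  finally show "qform \<kappa> (qproj \<kappa> k b y - y) v = 0"
   by (simp only: j qform_simps qform_commute[of \<kappa> y] right_minus_eq)
 qed
 then show ?thesis by (simp add: qform_simps)
qed

lemma qheight_qproj:
 assumes \<kappa>: "\<kappa> = 1 \<or> \<kappa> = - 1" and b: "qframe \<kappa> k b"
 shows "qform \<kappa> (qproj \<kappa> k b y) (qproj \<kappa> k b y) = qheight \<kappa> k b y"
proof -
 have "qform \<kappa> (qproj \<kappa> k b y) (qproj \<kappa> k b y) = qform \<kappa> y (qproj \<kappa> k b y)"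
  by (rule qform_qproj[OF \<kappa> b qproj_span])
 also have "\<dots> = qheight \<kappa> k b y" unfolding qproj_def qheight_def qform_sum
  by (intro sum.cong refl) (simp add: qform_simps power2_eq_square qform_commute[of \<kappa> y] mult.assoc)
 finally show ?thesis .
qed

text \<open>The difference between \<open>y\<close> and its projection is orthogonal to the unit
  vector \<open>b k\<close>, hence the form is definite of sign \<open>\<kappa>\<close> on it, with
  value \<open>1 - qheight \<kappa> k b y\<close>. The value 0 means that \<open>y\<close> is its
  own projection.\<close>

lemma qheight_bound:
 assumes \<kappa>: "\<kappa> = 1 \<or> \<kappa> = - 1" and b: "qframe \<kappa> k b" and y: "y \<in> qpoints \<kappa>"
 shows "0 \<le> \<kappa> * (1 - qheight \<kappa> k b y)" and "qheight \<kappa> k b y = 1 \<longleftrightarrow> y \<in> span (b ` {..k})"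
  and "0 \<le> qheight \<kappa> k b y"
proof -
 let ?p = "qproj \<kappa> k b y"
 have yp: "qform \<kappa> y ?p = qheight \<kappa> k b y"
  using qform_qproj[OF \<kappa> b qproj_span[of \<kappa> k b y], of y] qheight_qproj[OF \<kappa> b, of y] by simp
 have yy: "qform \<kappa> y y = 1" using y by (simp add: qpoints_def)
 have q: "qform \<kappa> (y - ?p) (y - ?p) = 1 - qheight \<kappa> k b y"
  by (simp add: qform_simps yp yy qheight_qproj[OF \<kappa> b] qform_commute[of \<kappa> ?p y])
 have o: "qform \<kappa> (y - ?p) (b k) = 0"
  using qform_qproj[OF \<kappa> b, of "b k" y] by (simp add: qform_simps span_base)
 have cc: "qform \<kappa> (b k) (b k) = 1" using qframeD(2)[OF b] by (simp add: qpoints_def)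
 have z: "y = ?p" if "\<kappa> * (1 - qheight \<kappa> k b y) \<le> 0"
  using qform_orthogonal_zero[OF \<kappa> cc o] that q by simp
 show 1: "0 \<le> \<kappa> * (1 - qheight \<kappa> k b y)"
 proof (rule ccontr)
  assume n: "\<not> 0 \<le> \<kappa> * (1 - qheight \<kappa> k b y)"
  then have "y = ?p" by (intro z) simp
  then have "1 - qheight \<kappa> k b y = 0" using q by (simp add: qform_def)
  then show False using n by simp
 qed
 show "qheight \<kappa> k b y = 1 \<longleftrightarrow> y \<in> span (b ` {..k})"
 proof
  assume "qheight \<kappa> k b y = 1"
  then have "y = ?p" by (intro z) simp
  then show "y \<in> span (b ` {..k})" using qproj_span by metis
 next
  assume "y \<in> span (b ` {..k})"
  then have "qform \<kappa> ?p y = 1" using qform_qproj[OF \<kappa> b] yy by simp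
  then show "qheight \<kappa> k b y = 1" using yp by (simp add: qform_commute)
 qed
 show "0 \<le> qheight \<kappa> k b y"
 proof (cases "\<kappa> = 1")
  case True
  then show ?thesis using qheight_qproj[OF \<kappa> b, of y] by (metis inner_ge_zero qform_one)
 qed (use 1 \<kappa> in auto)
qed

section \<open>Distances and submanifolds in the curved spaces\<close>

definition curved_geometry :: "real => nat => ((real^'n) \<times> real) geometry" where
 "curved_geometry \<kappa> k = (if \<kappa> = 1 then spherical_geometry k else hyperbolic_geometry k)"

definition curved_dist :: "real => real => real" where
 "curved_dist \<kappa> t = (if \<kappa> = 1 then arccos t else arcosh t)"

lemma curved_geometry_points: "\<kappa> = 1 \<or> \<kappa> = - 1 ==> points (curved_geometry \<kappa> k) = qpoints \<kappa>"
 by (auto simp: curved_geometry_def spherical_geometry_def hyperbolic_geometry_def qpoints_one qpoints_minus_one)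

lemma curved_geometry_gdist: "\<kappa> = 1 \<or> \<kappa> = - 1 ==> gdist (curved_geometry \<kappa> k) y z = curved_dist \<kappa> (qform \<kappa> y z)"
 by (auto simp: curved_geometry_def spherical_geometry_def hyperbolic_geometry_def hyp_dist_def curved_dist_def qform_one qform_minus_one)

lemma curved_dist_eq_iff:
 assumes \<kappa>: "\<kappa> = 1 \<or> \<kappa> = - 1" and "y \<in> qpoints \<kappa>" "z \<in> qpoints \<kappa>" "y' \<in> qpoints \<kappa>" "z' \<in> qpoints \<kappa>"
 shows "curved_dist \<kappa> (qform \<kappa> y z) = curved_dist \<kappa> (qform \<kappa> y' z') \<longleftrightarrow> qform \<kappa> y z = qform \<kappa> y' z'"
proof (cases "\<kappa> = 1")
 case True
 then show ?thesis using qform_le_1[of y z] qform_le_1[of y' z'] assms by (simp add: curved_dist_def arccos_eq_iff)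
next
 case False
 then have k: "\<kappa> = - 1" using \<kappa> by simp
 have "1 \<le> qform \<kappa> y z" "1 \<le> qform \<kappa> y' z'"
  using qform_ge_1[of y z] qform_ge_1[of y' z'] assms k by simp_all
 moreover have "arcosh a = arcosh c \<longleftrightarrow> a = c" if "1 \<le> a" "1 \<le> c" for a c :: real
  using cosh_arcosh_real[OF that(1)] cosh_arcosh_real[OF that(2)] by metis
 ultimately show ?thesis using False by (simp only: curved_dist_def if_False)
qed

lemma dim_qframe:
 assumes \<kappa>: "\<kappa> = 1 \<or> \<kappa> = - 1" and b: "qframe \<kappa> k (b :: nat => (real^'n) \<times> real)"
 shows "dim (span (b ` {..k})) = Suc k" unfolding lessThan_Suc_atMost[symmetric]
 by (rule dim_form_frame[of "qform \<kappa>" _ "qsign \<kappa> k"]) (use b \<kappa> qform_linear in \<open>auto simp: qframe_def qsign_def\<close>)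

lemma curved_geometry_submfds:
 assumes \<kappa>: "\<kappa> = 1 \<or> \<kappa> = - 1"
 shows "submfds (curved_geometry \<kappa> k) = {qpoints \<kappa> \<inter> span (b ` {..k}) | b :: nat => (real^'n) \<times> real. qframe \<kappa> k b}"
proof (cases "\<kappa> = 1")
 case True
 have fr: "qframe 1 k b \<longleftrightarrow> form_frame inner (Suc k) (\<lambda>_. 1) b" for b :: "nat => (real^'n) \<times> real"
  by (simp add: qframe_def qform_one qsign_def form_frame_def)
 have "{sphere 0 1 \<inter> W | W :: ((real^'n) \<times> real) set. subspace W \<and> dim W = k + 1} = {qpoints 1 \<inter> span (b ` {..k}) | b. qframe 1 k b}"
 proof (intro equalityI subsetI)
  fix \<xi> assume "\<xi> \<in> {sphere 0 1 \<inter> W | W :: ((real^'n) \<times> real) set. subspace W \<and> dim W = k + 1}"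
  then obtain W :: "((real^'n) \<times> real) set" where W: "\<xi> = qpoints 1 \<inter> W" "subspace W" "dim W = Suc k"
   by (auto simp: qpoints_one)
  obtain b where "form_frame inner (dim W) (\<lambda>_. 1) b" "span (b ` {..<dim W}) = W"
   using orthonormal_frame_of_subspace[OF W(2)] by metis
  then have "qframe 1 k b" "\<xi> = qpoints 1 \<inter> span (b ` {..k})"
   unfolding W(3) fr lessThan_Suc_atMost by (simp_all add: W(1))
  then show "\<xi> \<in> {qpoints 1 \<inter> span (b ` {..k}) | b. qframe 1 k b}" by blast
 next
  fix \<xi> :: "((real^'n) \<times> real) set" assume "\<xi> \<in> {qpoints 1 \<inter> span (b ` {..k}) | b. qframe 1 k b}"
  then obtain b where b: "qframe 1 k b" "\<xi> = sphere 0 1 \<inter> span (b ` {..k})" by (auto simp: qpoints_one)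
  have "dim (span (b ` {..k})) = k + 1" using dim_qframe[OF _ b(1)] by simp
  then show "\<xi> \<in> {sphere 0 1 \<inter> W | W. subspace W \<and> dim W = k + 1}"
   using b(2) subspace_span by blast
 qed
 then show ?thesis using True by (simp add: curved_geometry_def spherical_geometry_def)
next
 case False
 then have k: "\<kappa> = - 1" using \<kappa> by simp
 have fr: "qframe (- 1) k b \<longleftrightarrow> form_frame lform (Suc k) (lorentz_sign k) b \<and> snd (b k) > 0" for b :: "nat => (real^'n) \<times> real"
  by (simp add: qframe_def qform_minus_one qsign_def lorentz_sign_def form_frame_def)
 let ?L = "{hyperboloid \<inter> W | W :: ((real^'n) \<times> real) set. subspace W \<and> dim W = k + 1 \<and>
     (\<exists>b. form_frame lform (Suc k) (lorentz_sign k) b \<and> W = span (b ` {..k})) \<and>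
     hyperboloid \<inter> W \<noteq> {}}"
 have "?L = {qpoints (- 1) \<inter> span (b ` {..k}) | b. qframe (- 1) k b}"
 proof (intro equalityI subsetI)
  fix \<xi> assume "\<xi> \<in> ?L"
  then obtain b :: "nat => (real^'n) \<times> real" where b: "form_frame lform (Suc k) (lorentz_sign k) b" "\<xi> = qpoints (- 1) \<inter> span (b ` {..k})"
   by (auto simp: qpoints_minus_one)
  \<comment> \<open>The timelike vector of a Lorentz frame may point to the lower sheet; reversing
    it changes neither the span nor the frame relations.\<close>
  define b' where "b' i = (if snd (b k) < 0 \<and> i = k then - b k else b i)" for i
  have "lform (b k) (b k) = 1" using b(1) by (simp add: form_frame_def lorentz_sign_def)
  have "snd (b k) \<noteq> 0"
  proof
   assume "snd (b k) = 0"
   then have "fst (b k) \<bullet> fst (b k) = - 1" using \<open>lform (b k) (b k) = 1\<close> by (simp add: lform_def)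
   then show False using inner_ge_zero[of "fst (b k)"] by linarith
  qed
  then have "snd (b' k) > 0" by (simp add: b'_def)
  moreover have "form_frame lform (Suc k) (lorentz_sign k) b'"
  proof -
   define \<sigma> :: "nat => real" where "\<sigma> i = (if snd (b k) < 0 \<and> i = k then - 1 else 1)" for i
   have "b' i = \<sigma> i *\<^sub>R b i" for i by (simp add: b'_def \<sigma>_def)
   then have "lform (b' i) (b' j) = \<sigma> i * \<sigma> j * lform (b i) (b j)" for i j
    by (simp add: lform_def algebra_simps)
   moreover have "\<sigma> i * \<sigma> i = 1" for i by (simp add: \<sigma>_def)
   ultimately show ?thesis using b(1) by (simp add: form_frame_def)
  qed
  moreover have "span (b' ` {..k}) = span (b ` {..k})"
  proof (intro equalityI span_minimal subspace_span subsetI)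
   fix v assume "v \<in> b' ` {..k}"
   then obtain i where "i \<le> k" "v = b' i" by auto
   moreover from this have "b i \<in> span (b ` {..k})" "b k \<in> span (b ` {..k})" by (simp_all add: span_base)
   ultimately show "v \<in> span (b ` {..k})" by (simp add: b'_def span_neg)
  next
   fix v assume "v \<in> b ` {..k}"
   then obtain i where "i \<le> k" "v = b i" by auto
   moreover have "b i = (if snd (b k) < 0 \<and> i = k then - b' i else b' i)" by (simp add: b'_def)
   moreover have "b' i \<in> span (b' ` {..k})" using \<open>i \<le> k\<close> by (simp add: span_base)
   ultimately show "v \<in> span (b' ` {..k})" using span_neg[of "b' i" "b' ` {..k}"] by presburger
  qed
  ultimately show "\<xi> \<in> {qpoints (- 1) \<inter> span (b ` {..k}) | b. qframe (- 1) k b}" using b(2) fr by blast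
 next
  fix \<xi> :: "((real^'n) \<times> real) set" assume "\<xi> \<in> {qpoints (- 1) \<inter> span (b ` {..k}) | b. qframe (- 1) k b}"
  then obtain b where b: "qframe (- 1) k b" "\<xi> = hyperboloid \<inter> span (b ` {..k})"
   by (auto simp: qpoints_minus_one)
  have "dim (span (b ` {..k})) = k + 1" using dim_qframe[OF _ b(1)] by simp
  moreover have "b k \<in> hyperboloid \<inter> span (b ` {..k})"
   using qframeD(2)[OF b(1)] by (simp add: qpoints_minus_one span_base)
  moreover have "form_frame lform (Suc k) (lorentz_sign k) b" using b(1) fr by blast
  ultimately show "\<xi> \<in> ?L" using b(2) subspace_span by blast
 qed
 then show ?thesis using k by (simp add: curved_geometry_def hyperbolic_geometry_def)
qed

text \<open>\<open>qheight\<close> is the squared cosine or hyperbolic cosine of the distance: the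
  nearest point is the projection scaled to value 1 of the form, by Cauchy-Schwarz on the sphere and
  its reverse on the hyperboloid.\<close>

lemma curved_set_gdist:
 fixes b :: "nat => (real^'n) \<times> real"
 assumes \<kappa>: "\<kappa> = 1 \<or> \<kappa> = - 1" and b: "qframe \<kappa> k b" and y: "y \<in> qpoints \<kappa>"
 shows "set_gdist (curved_geometry \<kappa> k) y (qpoints \<kappa> \<inter> span (b ` {..k})) = curved_dist \<kappa> (sqrt (qheight \<kappa> k b y))"
proof -
 let ?\<xi> = "qpoints \<kappa> \<inter> span (b ` {..k})" and ?h = "qheight \<kappa> k b y" and ?p = "qproj \<kappa> k b y"
 note bd = qheight_bound[OF \<kappa> b y]
 have pz: "qform \<kappa> y z = qform \<kappa> ?p z" if "z \<in> ?\<xi>" for z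
  using qform_qproj[OF \<kappa> b, of z y] that by simp
 have pp: "qform \<kappa> ?p ?p = ?h" by (rule qheight_qproj[OF \<kappa> b])
 have bk: "b k \<in> ?\<xi>" using qframeD(2)[OF b] by (simp add: span_base)
 have "\<exists>z\<in>?\<xi>. qform \<kappa> y z = sqrt ?h"
 proof (cases "?h = 0")
  \<comment> \<open>Here \<open>y\<close> is orthogonal to the subspace and its projection is 0,
    which cannot be normalized; every point of the submanifold is then at the same distance, and
    \<open>b k\<close> is taken.\<close>
  case True
  then have "\<kappa> = 1" using bd(1) \<kappa> by auto
  then have "?p = 0" using pp True by (simp add: qform_one)
  then have "qform \<kappa> y (b k) = sqrt ?h" using pz[OF bk] True by (simp add: qform_def)
  then show ?thesis using bk by blast
 next
  case False
  then have h: "?h > 0" using bd(3) by simp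
  let ?z = "(1 / sqrt ?h) *\<^sub>R ?p"
  have zz: "qform \<kappa> ?z ?z = 1" using h by (simp add: qform_simps pp)
  have "0 < snd ?z" if k: "\<kappa> = - 1"
  proof (rule snd_pos_of_forward[of _ "b k"])
   show "0 < qform (- 1) ?z ?z" using zz k by simp
   show "0 < qform (- 1) (b k) (b k)" "0 < snd (b k)" using qframeD(2)[OF b] k by (simp_all add: qpoints_def)
   have "1 \<le> qform \<kappa> ?p (b k)" using pz[OF bk] qform_ge_1[of y "b k"] y qframeD(2)[OF b] k by simp
   then have "0 < qform \<kappa> ?z (b k)" using h by (simp add: qform_simps)
   then show "0 < qform (- 1) ?z (b k)" unfolding k[symmetric] .
  qed
  then have z: "?z \<in> ?\<xi>" using zz by (simp add: qpoints_def span_scale qproj_span)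
  moreover have "qform \<kappa> y ?z = sqrt ?h" unfolding pz[OF z] using h by (simp add: qform_simps pp real_div_sqrt)
  ultimately show ?thesis by blast
 qed
 then obtain z0 where z0: "z0 \<in> ?\<xi>" "qform \<kappa> y z0 = sqrt ?h" by blast
 have le: "curved_dist \<kappa> (sqrt ?h) \<le> curved_dist \<kappa> (qform \<kappa> y z)" if z: "z \<in> ?\<xi>" for z
 proof (cases "\<kappa> = 1")
  case True
  have "norm z = 1" "(norm ?p)^2 = ?h"
   using z pp True by (simp_all add: qpoints_one qform_one power2_norm_eq_inner)
  then have "norm ?p = sqrt ?h" by (metis norm_ge_zero real_sqrt_unique)
  then have "qform \<kappa> y z \<le> sqrt ?h"
   using pz[OF z] norm_cauchy_schwarz[of ?p z] \<open>norm z = 1\<close> True by (simp add: qform_one)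
  moreover have "- 1 \<le> qform \<kappa> y z" using qform_le_1[of y z] y z True by auto
  moreover have "sqrt ?h \<le> 1" using bd(1) True by simp
  ultimately show ?thesis using True by (simp add: curved_dist_def arccos_le_arccos)
 next
  case False
  then have k: "\<kappa> = - 1" using \<kappa> by simp
  have z0q: "z0 \<in> qpoints (- 1)" "z \<in> qpoints (- 1)" using z0 z k by auto
  have h: "1 \<le> sqrt ?h" using bd(1) k by simp
  have p1: "(1 / sqrt ?h) *\<^sub>R ?p \<in> qpoints (- 1)"
  proof -
   let ?z = "(1 / sqrt ?h) *\<^sub>R ?p"
   have h0: "?h > 0" using bd(1) k by simp
   have zz: "qform (- 1) ?z ?z = 1" using h0 pp k by (simp add: qform_simps)
   have "0 < snd ?z"
   proof (rule snd_pos_of_forward[of _ "b k"])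
    show "0 < qform (- 1) ?z ?z" using zz by simp
    show "0 < qform (- 1) (b k) (b k)" "0 < snd (b k)" using qframeD(2)[OF b] k by (simp_all add: qpoints_def)
    show "0 < qform (- 1) ?z (b k)"
     using pz[OF bk] qform_ge_1[of y "b k"] y qframeD(2)[OF b] k h0 by (simp add: qform_simps)
   qed
   then show ?thesis using zz by (simp add: qpoints_def)
  qed
  have "1 \<le> qform (- 1) ((1 / sqrt ?h) *\<^sub>R ?p) z" using p1 z0q(2) by (rule qform_ge_1)
  then have "sqrt ?h \<le> qform \<kappa> ?p z" using h k by (simp add: qform_simps field_simps)
  then have "sqrt ?h \<le> qform \<kappa> y z" using pz[OF z] by simp
  moreover from this have "1 \<le> qform \<kappa> y z" using h by linarith
  ultimately have "\<not> arcosh (qform \<kappa> y z) < arcosh (sqrt ?h)"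
   using arcosh_less_iff_real[of "qform \<kappa> y z" "sqrt ?h"] h by linarith
  then show ?thesis using False by (simp add: curved_dist_def)
 qed
 have "(INF z\<in>?\<xi>. curved_dist \<kappa> (qform \<kappa> y z)) = curved_dist \<kappa> (sqrt ?h)"
 proof (rule cInf_eq_minimum)
  show "curved_dist \<kappa> (sqrt ?h) \<in> (\<lambda>z. curved_dist \<kappa> (qform \<kappa> y z)) ` ?\<xi>"
   using z0 by (metis imageI)
 qed (use le in blast)
 then show ?thesis by (simp add: set_gdist_def curved_geometry_gdist[OF \<kappa>])
qed

lemma curved_rho:
 fixes b :: "nat => (real^'n) \<times> real"
 assumes \<kappa>: "\<kappa> = 1 \<or> \<kappa> = - 1" and b: "qframe \<kappa> k b" and y: "y \<in> qpoints \<kappa>"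
 shows "rho (curved_geometry \<kappa> k) y (qpoints \<kappa> \<inter> span (b ` {..k})) = sqrt (\<kappa> * (1 - qheight \<kappa> k b y))"
proof (cases "\<kappa> = 1")
 case True
 then have "sqrt (qheight \<kappa> k b y) \<le> 1" "0 \<le> sqrt (qheight \<kappa> k b y)"
  using qheight_bound[OF \<kappa> b y] by simp_all
 then have "sin (arccos (sqrt (qheight \<kappa> k b y))) = sqrt (1 - (sqrt (qheight \<kappa> k b y))\<^sup>2)"
  by (intro sin_arccos) linarith+
 then show ?thesis unfolding rho_def curved_set_gdist[OF assms] using True qheight_bound(3)[OF \<kappa> b y]
  by (simp add: curved_geometry_def spherical_geometry_def curved_dist_def)
next
 case False
 then have k: "\<kappa> = - 1" using \<kappa> by simp
 then have "1 \<le> sqrt (qheight \<kappa> k b y)" using qheight_bound(1)[OF \<kappa> b y] by simp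
 then have "sinh (arcosh (sqrt (qheight \<kappa> k b y))) = sqrt ((sqrt (qheight \<kappa> k b y))^2 - 1)"
  by (rule sinh_arcosh_real)
 then show ?thesis unfolding rho_def curved_set_gdist[OF assms] using k qheight_bound(3)[OF \<kappa> b y]
  by (simp add: curved_geometry_def hyperbolic_geometry_def curved_dist_def)
qed

text \<open>The last vector is the point of the submanifold nearest to the origin
  \<open>(0, 1)\<close>, lying over \<open>r *\<^sub>R e k\<close>; the others are
  horizontal.\<close>

definition origin_frame :: "real => nat => real => (nat => real^'n) => nat => (real^'n) \<times> real" where
 "origin_frame \<kappa> k r e i = (if i = k then (r *\<^sub>R e k, sqrt (1 - \<kappa> * r^2)) else (e i, 0))"

lemma qframe_origin_frame:
 assumes e: "form_frame inner (Suc k) (\<lambda>_. 1) e" and r: "\<kappa> * r^2 < 1"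
 shows "qframe \<kappa> k (origin_frame \<kappa> k r e)"
 using e r by (auto simp: qframe_def form_frame_def origin_frame_def qform_def qsign_def power2_eq_square)

lemma qheight_origin_frame:
 assumes "\<kappa> * r^2 < 1"
 shows "qheight \<kappa> k (origin_frame \<kappa> k r e) (0, 1) = 1 - \<kappa> * r^2"
 using assms by (simp add: qheight_def qform_origin origin_frame_def qsign_def)

text \<open>The scaled projection \<open>v\<close> of the origin is the nearest point. Pairing with
  \<open>v\<close> is a multiple of the last coordinate, so the horizontal vectors of the subspace
  are exactly those orthogonal to \<open>v\<close>; an orthonormal basis of them completes the
  frame.\<close>

lemma origin_frame_exists:
 fixes b :: "nat => (real^'n) \<times> real"
 assumes \<kappa>: "\<kappa> = 1 \<or> \<kappa> = - 1" and b: "qframe \<kappa> k b" and h: "qheight \<kappa> k b (0, 1) = 1 - \<kappa> * r^2"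
  and r: "0 < r" "\<kappa> * r^2 < 1"
 obtains e where "form_frame inner (Suc k) (\<lambda>_. 1) e" "span (b ` {..k}) = span (origin_frame \<kappa> k r e ` {..k})"
proof -
 let ?W = "span (b ` {..k})"
 define p where "p = qproj \<kappa> k b (0, 1)"
 define s where "s = sqrt (1 - \<kappa> * r^2)"
 have s: "s > 0" "s * s = 1 - \<kappa> * r^2" using r by (simp_all add: s_def)
 define v where "v = (1 / s) *\<^sub>R p"
 have pW: "p \<in> ?W" unfolding p_def by (rule qproj_span)
 then have vW: "v \<in> ?W" unfolding v_def by (rule span_scale)
 have pw: "qform \<kappa> p w = snd w" if "w \<in> ?W" for w
  using qform_qproj[OF \<kappa> b that, of "(0, 1)"] by (simp add: p_def qform_origin)
 have vw: "qform \<kappa> v w = snd w / s" if "w \<in> ?W" for w using pw[OF that] by (simp add: v_def qform_simps)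
 have "qform \<kappa> p p = s * s" using qheight_qproj[OF \<kappa> b, of "(0, 1)"] h s(2) by (simp add: p_def)
 then have sp: "snd p = s * s" using pw[OF pW] by simp
 then have sv: "snd v = s" using s(1) by (simp add: v_def)
 have "qform \<kappa> v v = 1" using vw[OF vW] sv s(1) by simp
 then have "\<kappa> * (fst v \<bullet> fst v) = \<kappa> * r^2" using s(2) sv by (simp add: qform_def)
 then have fv: "fst v \<bullet> fst v = r^2" using \<kappa> by auto
 define V where "V = {w \<in> ?W. snd w = 0}"
 have V: "subspace V" by (rule subspaceI) (auto simp: V_def span_zero span_add span_scale)
 have U: "subspace (fst ` V)" using linear_subspace_image[OF linear_fst V] .
 \<comment> \<open>The dimension of the horizontal part is left open; comparing the dimensions of
   the two spans at the end gives \<open>j = k\<close>.\<close>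
 define j where "j = dim (fst ` V)"
 obtain e0 where e0: "form_frame inner j (\<lambda>_. 1) e0" "span (e0 ` {..<j}) = fst ` V"
  using orthonormal_frame_of_subspace[OF U] unfolding j_def by metis
 have lift: "(u, 0) \<in> V" if "u \<in> fst ` V" for u using that by (auto simp: V_def)
 have e0V: "(e0 i, 0) \<in> V" if "i < j" for i
  using that e0(2) span_base[of "e0 i" "e0 ` {..<j}"] by (intro lift) auto
 have e0v: "e0 i \<bullet> fst v = 0" if "i < j" for i
 proof -
  have "qform \<kappa> v (e0 i, 0) = 0" using vw[of "(e0 i, 0)"] e0V[OF that] by (simp add: V_def)
  then show ?thesis using \<kappa> by (auto simp: qform_def inner_commute)
 qed
 define e where "e i = (if i = j then fst v /\<^sub>R r else e0 i)" for i
 let ?b = "origin_frame \<kappa> j r e"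
 have e: "form_frame inner (Suc j) (\<lambda>_. 1) e" unfolding form_frame_def
 proof (intro allI impI)
  fix i l assume il: "i < Suc j" "l < Suc j"
  consider "i = j" "l = j" | "i = j" "l < j" | "i < j" "l = j" | "i < j" "l < j" using il by linarith
  then show "e i \<bullet> e l = (if i = l then 1 else 0)"
  proof cases
   case 1
   then show ?thesis using fv r(1) by (simp add: e_def power2_eq_square field_simps)
  next
   case 2
   then show ?thesis using e0v[of l] by (simp add: e_def inner_commute)
  next
   case 3
   then show ?thesis using e0v[of i] by (simp add: e_def)
  next
   case 4
   then show ?thesis using e0(1) by (simp add: e_def form_frame_def)
  qed
 qed
 have bj: "?b j = v" using r(1) sv by (simp add: origin_frame_def e_def s_def prod_eq_iff)
 have bi: "?b i = (e0 i, 0)" if "i < j" for i using that by (simp add: origin_frame_def e_def)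
 have sub: "span (?b ` {..j}) \<subseteq> ?W"
 proof (intro span_minimal subspace_span subsetI)
  fix w assume "w \<in> ?b ` {..j}"
  then obtain i where "i \<le> j" "w = ?b i" by auto
  then show "w \<in> ?W" using vW bj bi[of i] e0V[of i] by (cases "i = j") (auto simp: V_def)
 qed
 have sup: "?W \<subseteq> span (?b ` {..j})"
 proof
  fix w assume w: "w \<in> ?W"
  let ?w = "w - (snd w / s) *\<^sub>R v"
  have "?w \<in> V" using w vW s(1) sv by (simp add: V_def span_diff span_scale)
  then have fw: "fst ?w \<in> span (e0 ` {..<j})" unfolding e0(2) by (rule imageI)
  have sw: "snd ?w = 0" using \<open>?w \<in> V\<close> by (simp add: V_def)
  have lin: "linear (\<lambda>u :: real^'n. (u, 0 :: real))" by (rule linearI) simp_all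
  have "(fst ?w, 0 :: real) \<in> span ((\<lambda>u. (u, 0 :: real)) ` e0 ` {..<j})"
   using imageI[OF fw, of "\<lambda>u. (u, 0 :: real)"] by (simp only: linear_span_image[OF lin])
  moreover have "(\<lambda>u. (u, 0 :: real)) ` e0 ` {..<j} \<subseteq> ?b ` {..j}"
  proof -
   have "(\<lambda>u. (u, 0 :: real)) ` e0 ` {..<j} = ?b ` {..<j}"
    unfolding image_image by (intro image_cong) (simp_all add: bi)
   also have "\<dots> \<subseteq> ?b ` {..j}" by (intro image_mono) auto
   finally show ?thesis .
  qed
  ultimately have "(fst ?w, 0 :: real) \<in> span (?b ` {..j})" by (rule subsetD[OF span_mono, rotated])
  moreover have "?w = (fst ?w, 0 :: real)" using sw by (simp add: prod_eq_iff)
  ultimately have "?w \<in> span (?b ` {..j})" by (simp only:)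
  moreover have "v \<in> span (?b ` {..j})" using bj by (metis atMost_iff imageI order_refl span_base)
  ultimately have "?w + (snd w / s) *\<^sub>R v \<in> span (?b ` {..j})" by (intro span_add span_scale)
  then show "w \<in> span (?b ` {..j})" by simp
 qed
 have eq: "?W = span (?b ` {..j})" using sub sup by blast
 have "Suc k = Suc j"
  using dim_qframe[OF \<kappa> b] dim_qframe[OF \<kappa> qframe_origin_frame[OF e r(2)]] unfolding eq by simp
 then show ?thesis using that[of e] e eq by simp
qed

section \<open>The isometries that fix the centre\<close>

abbreviation rotation :: "(real^'n)^'n => (real^'n) \<times> real => (real^'n) \<times> real" where
 "rotation A y \<equiv> (A *v fst y, snd y)"

lemma linear_rotation: "linear (rotation A)"
 by (rule linearI) (simp_all add: matrix_vector_right_distrib matrix_vector_mult_scaleR)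

lemma qform_rotation: "orthogonal_matrix A ==> qform \<kappa> (rotation A y) (rotation A z) = qform \<kappa> y z"
 by (simp add: qform_def inner_orthogonal_matrix)

lemma rotation_qpoints: "orthogonal_matrix A ==> y \<in> qpoints \<kappa> ==> rotation A y \<in> qpoints \<kappa>"
 by (simp add: qpoints_def qform_rotation)

lemma rotation_origin_frame: "rotation A (origin_frame \<kappa> k r e i) = origin_frame \<kappa> k r (\<lambda>i. A *v e i) i"
 by (simp add: origin_frame_def matrix_vector_mult_scaleR)

text \<open>\<open>T\<close> carries \<open>x\<close> to the origin \<open>(0, 1)\<close>, where the
  orthogonal group acts by rotating the first component; \<open>act\<close> is this action
  conjugated back to \<open>x\<close>.\<close>

locale point_reflection =
 fixes \<kappa> :: real and x :: "(real^'n::finite) \<times> real" and T :: "(real^'n) \<times> real => (real^'n) \<times> real"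
 assumes kappa: "\<kappa> = 1 \<or> \<kappa> = - 1" and T_linear: "linear T"
  and T_form: "qform \<kappa> (T y) (T z) = qform \<kappa> y z" and T_T: "T (T y) = y"
  and T_origin: "T (0, 1) = x" and T_points: "y \<in> qpoints \<kappa> ==> T y \<in> qpoints \<kappa>"
begin

definition act :: "(real^'n)^'n => (real^'n) \<times> real => (real^'n) \<times> real" where
 "act A y = T (rotation A (T y))"

definition submfd :: "nat => real => (nat => real^'n) => ((real^'n) \<times> real) set" where
 "submfd k r e = qpoints \<kappa> \<inter> span ((\<lambda>i. T (origin_frame \<kappa> k r e i)) ` {..k})"

lemma x_points: "x \<in> qpoints \<kappa>" using T_points[OF origin_qpoints] by (simp add: T_origin)

lemma T_x: "T x = (0, 1)" using T_T[of "(0, 1)"] by (simp add: T_origin)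

lemma linear_act: "linear (act A)"
 unfolding act_def using linear_compose[OF linear_compose[OF T_linear linear_rotation] T_linear] by (simp add: o_def)

lemma act_form: "orthogonal_matrix A ==> qform \<kappa> (act A y) (act A z) = qform \<kappa> y z"
 by (simp only: act_def T_form qform_rotation)

lemma act_qpoints: "orthogonal_matrix A ==> y \<in> qpoints \<kappa> ==> act A y \<in> qpoints \<kappa>"
 unfolding act_def by (intro T_points rotation_qpoints)

lemma act_mult: "act (A ** B) y = act A (act B y)" by (simp add: act_def T_T matrix_vector_mul_assoc)

lemma act_one: "act (mat 1) y = y" by (simp add: act_def T_T)

lemma act_inverse:
 assumes "orthogonal_matrix A"
 shows "act A (act (transpose A) y) = y" "act (transpose A) (act A y) = y"
 using orthogonal_matrix_inverse[OF assms] act_one by (simp_all add: act_mult[symmetric])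

lemma act_submfd:
 assumes A: "orthogonal_matrix A"
 shows "act A ` submfd k r e = submfd k r (\<lambda>i. A *v e i)"
proof -
 have A': "orthogonal_matrix (transpose A)" using A by (simp add: orthogonal_matrix_transpose)
 have inj: "inj (act A)" using act_inverse(2)[OF A] by (metis injI)
 have pts: "act A ` qpoints \<kappa> = qpoints \<kappa>"
 proof (intro equalityI subsetI)
  fix y :: "(real^'n) \<times> real" assume "y \<in> qpoints \<kappa>"
  then have "act (transpose A) y \<in> qpoints \<kappa>" by (rule act_qpoints[OF A'])
  then show "y \<in> act A ` qpoints \<kappa>" using act_inverse(1)[OF A, of y] by (metis imageI)
 qed (use act_qpoints[OF A] in blast)
 have "act A (T (origin_frame \<kappa> k r e i)) = T (origin_frame \<kappa> k r (\<lambda>i. A *v e i) i)" for i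
  by (simp only: act_def T_T rotation_origin_frame)
 then have "act A ` span ((\<lambda>i. T (origin_frame \<kappa> k r e i)) ` {..k}) = span ((\<lambda>i. T (origin_frame \<kappa> k r (\<lambda>i. A *v e i) i)) ` {..k})"
  unfolding linear_span_image[OF linear_act, symmetric] image_image by (simp only:)
 then show ?thesis unfolding submfd_def image_Int[OF inj] pts by (simp only:)
qed

lemma qframe_T:
 assumes "qframe \<kappa> k b"
 shows "qframe \<kappa> k (\<lambda>i. T (b i))"
 using assms T_points[OF qframeD(2)[OF assms]] by (auto simp: qframe_def form_frame_def T_form qpoints_def)

lemma qheight_T: "qheight \<kappa> k (\<lambda>i. T (b i)) y = qheight \<kappa> k b (T y)"
proof -
 have "qform \<kappa> (T (b l)) y = qform \<kappa> (b l) (T y)" for l using T_form[of "b l" "T y"] by (simp add: T_T)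
 then show ?thesis by (simp add: qheight_def)
qed

lemma submfds_at_curved:
 assumes e: "form_frame inner (Suc k) (\<lambda>_. 1) e" and r: "0 < r" "\<kappa> * r^2 < 1"
 shows "submfds_at (curved_geometry \<kappa> k) x r = {act A ` submfd k r e | A. orthogonal_matrix A}"
proof (intro equalityI subsetI)
 fix \<xi> assume "\<xi> \<in> submfds_at (curved_geometry \<kappa> k) x r"
 then obtain b where b: "qframe \<kappa> k b" "\<xi> = qpoints \<kappa> \<inter> span (b ` {..k})" and "rho (curved_geometry \<kappa> k) x \<xi> = r"
  by (auto simp: submfds_at_def curved_geometry_submfds[OF kappa])
 then have "sqrt (\<kappa> * (1 - qheight \<kappa> k b x)) = r" using curved_rho[OF kappa b(1) x_points] by simp
 then have "\<kappa> * (1 - qheight \<kappa> k b x) = r^2"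
  using qheight_bound(1)[OF kappa b(1) x_points] by (metis real_sqrt_pow2)
 then have "qheight \<kappa> k b x = 1 - \<kappa> * r^2" using kappa by auto
 then have h: "qheight \<kappa> k (\<lambda>i. T (b i)) (0, 1) = 1 - \<kappa> * r^2"
  by (simp add: qheight_T T_origin)
 obtain e' where e': "form_frame inner (Suc k) (\<lambda>_. 1) e'"
  "span ((\<lambda>i. T (b i)) ` {..k}) = span (origin_frame \<kappa> k r e' ` {..k})"
  using origin_frame_exists[OF kappa qframe_T[OF b(1)] h r] by metis
 obtain A where A: "orthogonal_matrix A" "\<And>i. i < Suc k ==> A *v e i = e' i"
  using orthogonal_matrix_of_frames[OF e e'(1)] by blast
 have "span (b ` {..k}) = T ` span ((\<lambda>i. T (b i)) ` {..k})"
  unfolding linear_span_image[OF T_linear, symmetric] image_image by (simp only: T_T)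
 also have "\<dots> = span ((\<lambda>i. T (origin_frame \<kappa> k r e' i)) ` {..k})"
  unfolding e'(2) linear_span_image[OF T_linear, symmetric] image_image by (rule refl)
 also have "(\<lambda>i. T (origin_frame \<kappa> k r e' i)) ` {..k} = (\<lambda>i. T (origin_frame \<kappa> k r (\<lambda>i. A *v e i) i)) ` {..k}"
  by (intro image_cong refl) (simp add: origin_frame_def A(2))
 finally have "\<xi> = act A ` submfd k r e" unfolding act_submfd[OF A(1)] unfolding submfd_def b(2) by (simp only:)
 then show "\<xi> \<in> {act A ` submfd k r e | A. orthogonal_matrix A}" using A(1) by blast
next
 fix \<xi> assume "\<xi> \<in> {act A ` submfd k r e | A. orthogonal_matrix A}"
 then obtain A where A: "orthogonal_matrix A" "\<xi> = submfd k r (\<lambda>i. A *v e i)" by (auto simp: act_submfd)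
 have "form_frame inner (Suc k) (\<lambda>_. 1) (\<lambda>i. A *v e i)"
  using e inner_orthogonal_matrix[OF A(1)] by (simp add: form_frame_def)
 then have b: "qframe \<kappa> k (\<lambda>i. T (origin_frame \<kappa> k r (\<lambda>i. A *v e i) i))"
  by (intro qframe_T qframe_origin_frame r)
 have "qheight \<kappa> k (\<lambda>i. T (origin_frame \<kappa> k r (\<lambda>i. A *v e i) i)) x = 1 - \<kappa> * r^2"
  unfolding qheight_T T_x by (rule qheight_origin_frame[OF r(2)])
 then have "rho (curved_geometry \<kappa> k) x \<xi> = sqrt (\<kappa> * \<kappa> * r^2)"
  unfolding A(2) submfd_def curved_rho[OF kappa b x_points] by (simp add: mult.assoc)
 also have "\<dots> = r" using kappa r(1) by auto
 finally show "\<xi> \<in> submfds_at (curved_geometry \<kappa> k) x r"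
  using b A(2) unfolding submfds_at_def curved_geometry_submfds[OF kappa] submfd_def by blast
qed

text \<open>An isometry fixing the origin is determined by the images of the points over the axes.\<close>

lemma stabilizer_act:
 assumes g: "g \<in> stabilizer (curved_geometry \<kappa> k) x"
 shows "\<exists>A. orthogonal_matrix A \<and> (\<forall>y\<in>qpoints \<kappa>. g y = act A y)"
proof -
 have gp: "g y \<in> qpoints \<kappa>" if "y \<in> qpoints \<kappa>" for y
  using g that by (auto simp: stabilizer_def curved_geometry_points[OF kappa] bij_betw_def)
 have gf: "qform \<kappa> (g y) (g z) = qform \<kappa> y z" if "y \<in> qpoints \<kappa>" "z \<in> qpoints \<kappa>" for y z
  using g that curved_dist_eq_iff[OF kappa gp[OF that(1)] gp[OF that(2)] that]
  by (auto simp: stabilizer_def curved_geometry_points[OF kappa] curved_geometry_gdist[OF kappa])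
 have gx: "g x = x" using g by (simp add: stabilizer_def)
 define h where "h y = T (g (T y))" for y
 have hf: "qform \<kappa> (h y) (h z) = qform \<kappa> y z" if "y \<in> qpoints \<kappa>" "z \<in> qpoints \<kappa>" for y z
  using that by (simp add: h_def T_form gf T_points)
 have ho: "h (0, 1) = (0, 1)" by (simp add: h_def T_origin gx T_x)
 have hs: "snd (h y) = snd y" if "y \<in> qpoints \<kappa>" for y
  using hf[OF origin_qpoints that] by (simp add: ho qform_origin)
 \<comment> \<open>The height \<open>sqrt (1 - \<kappa>)\<close> puts the point on the sphere or the
   hyperboloid over a unit vector. As \<open>h\<close> preserves the form and the last coordinate,
   pairing with the image of \<open>P j\<close> reads off the \<open>j\<close>-th
   coordinate.\<close>
 define P :: "'n => (real^'n) \<times> real" where "P j = (axis j 1, sqrt (1 - \<kappa>))" for j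
 have P: "P j \<in> qpoints \<kappa>" for j using kappa by (auto simp: P_def qpoints_def qform_def inner_axis_axis)
 define c where "c j = fst (h (P j))" for j
 have hc: "fst (h y) \<bullet> c j = fst y $ j" if "y \<in> qpoints \<kappa>" for y j
 proof -
  have "\<kappa> * (fst (h y) \<bullet> c j) = \<kappa> * (fst y $ j)"
   using hf[OF that P[of j]] hs[OF that] hs[OF P[of j]] by (simp add: qform_def c_def) (simp add: P_def inner_axis)
  then show ?thesis using kappa by auto
 qed
 define B :: "(real^'n)^'n" where "B = (\<chi> i. c i)"
 have "c i \<bullet> c j = (if i = j then 1 else 0)" for i j
  using hc[OF P[of i], of j] by (simp add: c_def) (simp add: P_def axis_def)
 then have "orthogonal_matrix B"
  unfolding orthogonal_matrix_orthonormal_rows by (auto simp: row_def B_def norm_eq_1 orthogonal_def)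
 moreover have "B *v fst (h y) = fst y" if "y \<in> qpoints \<kappa>" for y
  using hc[OF that] by (simp add: vec_eq_iff matrix_vector_mul_component B_def inner_commute)
 ultimately have "transpose B *v fst y = fst (h y)" if "y \<in> qpoints \<kappa>" for y
  using that orthogonal_matrix_inverse(1)[of B] by (metis matrix_vector_mul_assoc matrix_vector_mul_lid)
 then have h: "h y = rotation (transpose B) y" if "y \<in> qpoints \<kappa>" for y
  using that hs[OF that] by (simp add: prod_eq_iff)
 have "g y = act (transpose B) y" if "y \<in> qpoints \<kappa>" for y
 proof -
  have "g y = T (h (T y))" by (simp only: h_def T_T)
  then show ?thesis by (simp only: h[OF T_points[OF that]] act_def)
 qed
 then show ?thesis
  using \<open>orthogonal_matrix B\<close> by (intro exI[of _ "transpose B"]) (simp add: orthogonal_matrix_transpose)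
qed

lemma orthogonal_action_curved:
 assumes e: "form_frame inner (Suc k) (\<lambda>_. 1) e" and r: "0 < r" "\<kappa> * r^2 < 1"
 shows "orthogonal_action (curved_geometry \<kappa> k) x r act (submfd k r e)"
proof -
 let ?G = "curved_geometry \<kappa> k" and ?b = "\<lambda>i. T (origin_frame \<kappa> k r e i)"
 have b: "qframe \<kappa> k ?b" by (intro qframe_T qframe_origin_frame e r)
 note pts = curved_geometry_points[OF kappa] and gd = curved_geometry_gdist[OF kappa]
 have sd: "set_gdist ?G y (submfd k r e) = curved_dist \<kappa> (sqrt (qheight \<kappa> k ?b y))" if "y \<in> qpoints \<kappa>" for y
  unfolding submfd_def by (rule curved_set_gdist[OF kappa b that])
 note bd = qheight_bound[OF kappa b]
 show ?thesis
 proof (unfold_locales, unfold pts gd)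
  fix A B :: "(real^'n)^'n" and y z :: "(real^'n) \<times> real" and g :: "(real^'n) \<times> real => (real^'n) \<times> real"
  show "act A y \<in> qpoints \<kappa>" if "orthogonal_matrix A" "y \<in> qpoints \<kappa>"
   using that by (rule act_qpoints)
  show "curved_dist \<kappa> (qform \<kappa> (act A y) (act A z)) = curved_dist \<kappa> (qform \<kappa> y z)" if "orthogonal_matrix A"
   by (simp only: act_form[OF that])
  show "act (A ** B) y = act A (act B y)" "act (mat 1) y = y" by (rule act_mult act_one)+
  show "act A x = x" by (simp add: act_def T_x T_origin)
  have Tc: "continuous_on S T" for S using T_linear by (simp add: linear_continuous_on linear_conv_bounded_linear)
  show "continuous_on orthogonal_matrices (\<lambda>A. act A y)"
   unfolding act_def by (intro continuous_on_compose2[OF Tc[of UNIV]] continuous_intros continuous_on_matrix_vector) auto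
  show "continuous_on (qpoints \<kappa>) (act A)"
   using linear_act by (simp add: linear_continuous_on linear_conv_bounded_linear)
  show "\<exists>A. orthogonal_matrix A \<and> (\<forall>y\<in>qpoints \<kappa>. g y = act A y)" if "g \<in> stabilizer ?G x"
   using that by (rule stabilizer_act)
  show "submfds_at ?G x r = {act A ` submfd k r e | A. orthogonal_matrix A}" by (rule submfds_at_curved[OF e r])
  show "submfd k r e \<subseteq> qpoints \<kappa>" by (simp add: submfd_def)
  have hc: "continuous_on (qpoints \<kappa>) (\<lambda>y. sqrt (qheight \<kappa> k ?b y))"
   unfolding qheight_def qform_def by (intro continuous_intros)
  have "continuous_on (qpoints \<kappa>) (\<lambda>y. curved_dist \<kappa> (sqrt (qheight \<kappa> k ?b y)))"
  proof (cases "\<kappa> = 1")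
   case True
   have "- 1 \<le> sqrt (qheight \<kappa> k ?b y) \<and> sqrt (qheight \<kappa> k ?b y) \<le> 1" if y: "y \<in> qpoints \<kappa>" for y
   proof -
    have "0 \<le> sqrt (qheight \<kappa> k ?b y)" "sqrt (qheight \<kappa> k ?b y) \<le> 1"
     using bd[OF y] True by simp_all
    then show ?thesis by linarith
   qed
   then show ?thesis using True continuous_on_arccos[OF hc] by (simp add: curved_dist_def)
  next
   case False
   then have "1 \<le> sqrt (qheight \<kappa> k ?b y)" if "y \<in> qpoints \<kappa>" for y
    using bd(1)[OF that] kappa by auto
   then show ?thesis
    using False continuous_on_compose2[OF continuous_on_arcosh[OF order_refl] hc] by (simp add: curved_dist_def image_subset_iff)
  qed
  then show "continuous_on (qpoints \<kappa>) (\<lambda>y. set_gdist ?G y (submfd k r e))"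
   by (rule continuous_on_eq) (simp add: sd)
  show "set_gdist ?G y (submfd k r e) = 0 \<longleftrightarrow> y \<in> submfd k r e" if y: "y \<in> qpoints \<kappa>"
  proof -
   have "curved_dist \<kappa> (sqrt (qheight \<kappa> k ?b y)) = 0 \<longleftrightarrow> sqrt (qheight \<kappa> k ?b y) = 1"
   proof (cases "\<kappa> = 1")
    case True
    have "0 \<le> sqrt (qheight \<kappa> k ?b y)" "sqrt (qheight \<kappa> k ?b y) \<le> 1"
     using bd[OF y] True by simp_all
    then have "sqrt (qheight \<kappa> k ?b y) \<in> {-1..1}" unfolding atLeastAtMost_iff by linarith
    then have "arccos (sqrt (qheight \<kappa> k ?b y)) = 0 \<longleftrightarrow> sqrt (qheight \<kappa> k ?b y) = 1"
     by (rule arccos_eq_0_iff)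
    then show ?thesis using True by (simp add: curved_dist_def)
   next
    case False
    then have "1 \<le> sqrt (qheight \<kappa> k ?b y)" using bd(1)[OF y] kappa by auto
    then show ?thesis
     using False arcosh_eq_0_iff_real[of "sqrt (qheight \<kappa> k ?b y)"] by (simp only: curved_dist_def if_False)
   qed
   then show ?thesis unfolding sd[OF y] using bd(2)[OF y] y by (simp add: submfd_def)
  qed
 qed
qed

text \<open>The identity \<open>1 - \<kappa> |v|^2 = (1 - \<kappa> r^2) / (1 + \<kappa>
  |z|^2)\<close> says that the central projection of \<open>z\<close> has the height of the chart
  over \<open>v\<close>. So the moved submanifold is described by
  \<open>klein_vector e \<kappa> k r z\<close> and a rotation alone.\<close>

lemma klein_vector_T:
 assumes A: "orthogonal_matrix A" and e: "form_frame inner (Suc k) (\<lambda>_. 1) e"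
  and r: "\<kappa> * r^2 < 1" and z: "0 < 1 + \<kappa> * (cnorm k z)^2"
 defines "v \<equiv> A *v klein_vector e \<kappa> k r z"
 shows "klein_vector (\<lambda>i. T (origin_frame \<kappa> k r (\<lambda>i. A *v e i) i)) \<kappa> k 1 z = T (v, sqrt (1 - \<kappa> * (norm v)^2))"
  and "\<kappa> * (norm v)^2 < 1"
proof -
 let ?q = "1 + \<kappa> * (cnorm k z)^2"
 have e': "e i \<bullet> e j = (if i = j then 1 else 0)" if "i \<le> k" "j \<le> k" for i j
  using e that by (simp add: form_frame_def less_Suc_eq_le)
 have "norm v = sqrt (((cnorm k z)^2 + r^2) / ?q)"
  unfolding v_def norm_orthogonal_matrix_mult[OF A] by (rule norm_klein_vector[OF e' z])
 then have "(norm v)^2 = ((cnorm k z)^2 + r^2) / ?q" using z by simp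
 then have n: "1 - \<kappa> * (norm v)^2 = (1 - \<kappa> * r^2) / ?q" using z by (simp add: field_simps)
 moreover have "0 < (1 - \<kappa> * r^2) / ?q" using z r by simp
 ultimately show "\<kappa> * (norm v)^2 < 1" by linarith
 let ?s = "sqrt (1 - \<kappa> * r^2)" and ?c = "1 / sqrt ?q"
 have v: "v = ?c *\<^sub>R ((\<Sum>i<k. z i *\<^sub>R (A *v e i)) + r *\<^sub>R (A *v e k))"
  unfolding v_def klein_vector_def
  by (simp add: matrix_vector_mult_scaleR matrix_vector_right_distrib linear_sum[OF matrix_vector_mul_linear])
 have "klein_vector (\<lambda>i. T (origin_frame \<kappa> k r (\<lambda>i. A *v e i) i)) \<kappa> k 1 z
  = ?c *\<^sub>R ((\<Sum>i<k. z i *\<^sub>R T (A *v e i, 0)) + T (r *\<^sub>R (A *v e k), ?s))"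
  by (simp add: klein_vector_def origin_frame_def)
 also have "\<dots> = T (?c *\<^sub>R ((\<Sum>i<k. z i *\<^sub>R (A *v e i, 0)) + (r *\<^sub>R (A *v e k), ?s)))"
  by (simp only: linear_cmul[OF T_linear] linear_add[OF T_linear] linear_sum[OF T_linear])
 also have "?c *\<^sub>R ((\<Sum>i<k. z i *\<^sub>R (A *v e i, 0)) + (r *\<^sub>R (A *v e k), ?s)) = (v, ?s / sqrt ?q)"
  unfolding v by (simp add: prod_eq_iff fst_sum snd_sum)
 also have "?s / sqrt ?q = sqrt (1 - \<kappa> * (norm v)^2)" unfolding n by (simp add: real_sqrt_divide)
 finally show "klein_vector (\<lambda>i. T (origin_frame \<kappa> k r (\<lambda>i. A *v e i) i)) \<kappa> k 1 z = T (v, sqrt (1 - \<kappa> * (norm v)^2))" .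
qed

lemma radon_curved:
 fixes f :: "(real^'n) \<times> real => complex"
 assumes A: "orthogonal_matrix A" and e: "form_frame inner (Suc k) (\<lambda>_. 1) e" and r: "0 < r" "\<kappa> * r^2 < 1"
  and k: "k \<ge> 1" "k < CARD('n)"
  and f: "continuous_on (qpoints \<kappa>) f" and even: "\<kappa> = 1 ==> (\<And>v. v \<in> qpoints \<kappa> ==> f (- v) = f v)"
 shows "radon (curved_geometry \<kappa> k) f (act A ` submfd k r e) = (if \<kappa> = 1 then 2 else 1) *
  (LINT z|lborel_PiM k. klein_weight \<kappa> k (cnorm k z) *\<^sub>R
   (\<lambda>v. if \<kappa> * (norm v)^2 < 1 then f (T (v, sqrt (1 - \<kappa> * (norm v)^2))) else 0) (A *v klein_vector e \<kappa> k r z))"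
proof -
 let ?b = "\<lambda>i. T (origin_frame \<kappa> k r (\<lambda>i. A *v e i) i)"
 have "form_frame inner (Suc k) (\<lambda>_. 1) (\<lambda>i. A *v e i)"
  using e inner_orthogonal_matrix[OF A] by (simp add: form_frame_def)
 then have b: "qframe \<kappa> k ?b" by (intro qframe_T qframe_origin_frame r)
 have \<xi>: "act A ` submfd k r e = qpoints \<kappa> \<inter> span (?b ` {..k})"
  unfolding act_submfd[OF A] by (rule submfd_def)
 have "radon (curved_geometry \<kappa> k) f (act A ` submfd k r e) = (if \<kappa> = 1 then 2 else 1) *
  (LINT z|lborel_PiM k. klein_weight \<kappa> k (cnorm k z) *\<^sub>R f (klein_vector ?b \<kappa> k 1 z))"
 proof (cases "\<kappa> = 1")
  case True
  have "vol (curved_geometry \<kappa> k :: ((real^'n) \<times> real) geometry) = sphere_volume k"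
   using True by (simp add: curved_geometry_def spherical_geometry_def)
  then show ?thesis
   using integral_sphere_volume[of k ?b f "act A ` submfd k r e"] b k f even \<xi> True unfolding radon_def by simp
 next
  case False
  then have "\<kappa> = - 1" using kappa by simp
  have "vol (curved_geometry \<kappa> k :: ((real^'n) \<times> real) geometry) = hyp_volume k"
   using False by (simp add: curved_geometry_def hyperbolic_geometry_def)
  then show ?thesis
   using integral_hyp_volume[of k ?b f "act A ` submfd k r e"] b k f \<xi> \<open>\<kappa> = - 1\<close> unfolding radon_def by simp
 qed
 also have "(LINT z|lborel_PiM k. klein_weight \<kappa> k (cnorm k z) *\<^sub>R f (klein_vector ?b \<kappa> k 1 z))
  = (LINT z|lborel_PiM k. klein_weight \<kappa> k (cnorm k z) *\<^sub>R
   (\<lambda>v. if \<kappa> * (norm v)^2 < 1 then f (T (v, sqrt (1 - \<kappa> * (norm v)^2))) else 0) (A *v klein_vector e \<kappa> k r z))"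
 proof (intro Bochner_Integration.integral_cong refl)
  fix z
  show "klein_weight \<kappa> k (cnorm k z) *\<^sub>R f (klein_vector ?b \<kappa> k 1 z) = klein_weight \<kappa> k (cnorm k z) *\<^sub>R
   (\<lambda>v. if \<kappa> * (norm v)^2 < 1 then f (T (v, sqrt (1 - \<kappa> * (norm v)^2))) else 0) (A *v klein_vector e \<kappa> k r z)"
  proof (cases "0 < 1 + \<kappa> * (cnorm k z)^2")
   case True
   then show ?thesis using klein_vector_T[OF A e r(2) True] by simp
  next
   case False
   then show ?thesis by (simp add: klein_weight_def)
  qed
 qed
 finally show ?thesis .
qed

end

section \<open>The inversion formula on the curved spaces\<close>

lemma smooth_on_submanifold_continuous:
 assumes f: "smooth_on_submanifold X f"
 shows "continuous_on X f" unfolding continuous_on_eq_continuous_within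
proof
 fix p assume p: "p \<in> X"
 obtain U g where g: "p \<in> U" "smooth_on_open U g" "\<And>x. x \<in> X \<inter> U ==> g x = f x"
  using f p unfolding smooth_on_submanifold_def by meson
 have U: "open U" and "iter_deriv [] g differentiable (at p)" using g(1,2) unfolding smooth_on_open_def by blast+
 then have "continuous (at p) g" by (simp add: differentiable_imp_continuous_within)
 then have "(g \<longlongrightarrow> g p) (at p within X)"
  unfolding continuous_at by (rule tendsto_within_subset) simp
 moreover have "\<forall>\<^sub>F y in at p within X. g y = f y"
  unfolding eventually_at_topological using U g by blast
 ultimately have "(f \<longlongrightarrow> g p) (at p within X)" by (rule Lim_transform_eventually)
 then show "continuous (at p within X) f" using g(1,3) p by (simp add: continuous_within)
qed

text \<open>Multiply by the conjugate \<open>sqrt (1 - \<kappa> * t^2) + 1\<close>, which is at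
  least 1. Bounds how far the curve through \<open>x\<close> in the chart leaves
  \<open>x\<close>.\<close>

lemma abs_sqrt_one_minus:
 fixes t :: real
 assumes "\<kappa> = 1 \<or> \<kappa> = - 1" "\<bar>t\<bar> < 1"
 shows "\<bar>sqrt (1 - \<kappa> * t^2) - 1\<bar> \<le> \<bar>t\<bar>"
proof -
 have t: "t\<^sup>2 \<le> \<bar>t\<bar>" "t\<^sup>2 < 1"
  using assms(2) mult_left_mono[of "\<bar>t\<bar>" 1 "\<bar>t\<bar>"] by (simp_all add: power2_eq_square abs_square_less_1[unfolded power2_eq_square])
 have "\<kappa> * t^2 \<le> t^2" using assms(1) by (elim disjE) simp_all
 then have p: "0 \<le> 1 - \<kappa> * t^2" using t(2) by linarith
 have "(sqrt (1 - \<kappa> * t^2) - 1) * (sqrt (1 - \<kappa> * t^2) + 1) = - \<kappa> * t^2"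
  using p by (simp add: algebra_simps)
 then have "\<bar>sqrt (1 - \<kappa> * t^2) - 1\<bar> * \<bar>sqrt (1 - \<kappa> * t^2) + 1\<bar> = t^2"
  using assms(1) by (auto simp: abs_mult[symmetric])
 moreover have "1 \<le> \<bar>sqrt (1 - \<kappa> * t^2) + 1\<bar>" using p real_sqrt_ge_zero[OF p] by linarith
 ultimately have "\<bar>sqrt (1 - \<kappa> * t^2) - 1\<bar> \<le> t^2"
  using mult_left_mono[of 1 "\<bar>sqrt (1 - \<kappa> * t^2) + 1\<bar>" "\<bar>sqrt (1 - \<kappa> * t^2) - 1\<bar>"] by simp
 then show ?thesis using t(1) by linarith
qed

context haar_measure
begin

theorem curved_inversion:
 fixes f :: "(real^'n) \<times> real => complex"
 assumes \<kappa>: "\<kappa> = 1 \<or> \<kappa> = - 1" and m: "m \<ge> 1" "2 * m < CARD('n)"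
  and f: "smooth_on_submanifold (qpoints \<kappa>) f" and even: "\<kappa> = 1 ==> (\<And>v. v \<in> qpoints \<kappa> ==> f (- v) = f v)"
  and decay: "\<kappa> = - 1 ==> (\<And>y. y \<in> qpoints \<kappa> ==> norm (f y) \<le> M / snd y ^ (2 * Suc m))"
  and x: "x \<in> qpoints \<kappa>"
 shows "has_nth_deriv_at_right_0 (2 * m)
  (\<lambda>r. of_real ((1 - \<kappa> * r^2) powr ((real (2 * m) - 1) / 2)) *
   shifted_dual_radon (curved_geometry \<kappa> (2 * m)) r (radon (curved_geometry \<kappa> (2 * m)) f) x)
  ((if \<kappa> = 1 then 2 else 1) * of_real ((- 1) ^ m * fact (2 * m - 1) * sphere_area (2 * m - 1)) * f x)"
proof -
 let ?k = "2 * m"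
 obtain T where T: "linear T" "\<And>y z. qform \<kappa> (T y) (T z) = qform \<kappa> y z" "\<And>y. T (T y) = y"
  "T (0, 1) = x" "\<And>y. y \<in> qpoints \<kappa> ==> T y \<in> qpoints \<kappa>"
  using point_reflection_exists[OF \<kappa> x] by metis
 interpret R: point_reflection \<kappa> x T by (rule point_reflection.intro[OF \<kappa> T])
 obtain e :: "nat => real^'n" where e: "form_frame inner (Suc ?k) (\<lambda>_. 1) e"
  using orthonormal_frame_exists[where 'n = 'n and m = "Suc ?k"] m by auto
 have e': "e i \<bullet> e j = (if i = j then 1 else 0)" if "i \<le> 2 * m" "j \<le> 2 * m" for i j
  using e that by (simp add: form_frame_def less_Suc_eq_le)
 have e0: "norm (e 0) = 1" using e'[of 0 0] by (simp add: norm_eq_1)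
 have cont: "continuous_on (qpoints \<kappa>) f" using f by (rule smooth_on_submanifold_continuous)
 define F where "F v = (if \<kappa> * (norm v)^2 < 1 then f (T (v, sqrt (1 - \<kappa> * (norm v)^2))) else 0)" for v
 have pt: "(v, sqrt (1 - \<kappa> * (norm v)^2)) \<in> qpoints \<kappa>" if "\<kappa> * (norm v)^2 < 1" for v :: "real^'n"
  using that by (simp add: qpoints_def qform_def power2_norm_eq_inner add_pos_nonneg)
 have Tc: "continuous_on S T" for S using R.T_linear by (simp add: linear_continuous_on linear_conv_bounded_linear)
 let ?B = "{v :: real^'n. \<kappa> * (norm v)^2 < 1}"
 have "continuous_on ?B (\<lambda>v. f (T (v, sqrt (1 - \<kappa> * (norm v)^2))))"
 proof (rule continuous_on_compose2[OF cont])
  show "continuous_on ?B (\<lambda>v. T (v, sqrt (1 - \<kappa> * (norm v)^2)))"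
   by (rule continuous_on_compose2[OF Tc[of UNIV]]) (auto intro!: continuous_intros)
  show "(\<lambda>v. T (v, sqrt (1 - \<kappa> * (norm v)^2))) ` ?B \<subseteq> qpoints \<kappa>"
   using pt R.T_points by blast
 qed
 then have Fc: "continuous_on ?B F" by (rule continuous_on_eq) (simp add: F_def)
 have "open ?B" by (intro open_Collect_less continuous_intros)
 then have "(\<lambda>v. indicator ?B v *\<^sub>R F v) \<in> borel_measurable borel"
  by (intro borel_measurable_continuous_on_indicator Fc borel_open)
 moreover have "(\<lambda>v. indicator ?B v *\<^sub>R F v) = F" by (auto simp: F_def fun_eq_iff)
 ultimately have Fm: "F \<in> borel_measurable borel" by simp
 have "\<exists>C. \<forall>v. \<kappa> * (norm v)^2 < 1 \<longrightarrow> norm (F v) \<le> C / (1 + (norm v)^2) ^ Suc m"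
 proof (cases "\<kappa> = 1")
  case True
  have "compact (f ` qpoints \<kappa>)" by (rule compact_continuous_image[OF cont]) (simp add: True qpoints_one)
  then obtain D where D: "\<And>y. y \<in> qpoints \<kappa> ==> norm (f y) \<le> D"
   using compact_imp_bounded by (fastforce simp: bounded_iff)
  \<comment> \<open>The chart of the sphere is bounded, \<open>|v| < 1\<close>, so the decay
    hypothesis amounts to boundedness of \<open>f\<close>.\<close>
  have "norm (F v) \<le> D * 2 ^ Suc m / (1 + (norm v)^2) ^ Suc m" if v: "\<kappa> * (norm v)^2 < 1" for v
  proof -
   have le: "norm (F v) \<le> D" using v D[OF R.T_points[OF pt[OF v]]] by (simp add: F_def)
   have "0 < (1 + (norm v)^2) ^ Suc m" by (intro zero_less_power add_pos_nonneg) auto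
   moreover have "(1 + (norm v)^2) ^ Suc m \<le> 2 ^ Suc m" using v True by (intro power_mono) auto
   then have "norm (F v) * (1 + (norm v)^2) ^ Suc m \<le> D * 2 ^ Suc m"
    using le order_trans[OF norm_ge_zero le] by (intro mult_mono) auto
   ultimately show ?thesis by (simp only: pos_le_divide_eq)
  qed
  then show ?thesis by blast
 next
  case False
  then have k: "\<kappa> = - 1" using \<kappa> by simp
  have sx: "0 < snd x" using x k by (simp add: qpoints_def)
  have M: "0 \<le> M" using order_trans[OF norm_ge_zero decay[OF k origin_qpoints]] by simp
  have "norm (F v) \<le> M * (2 * snd x) ^ (2 * Suc m) / (1 + (norm v)^2) ^ Suc m" for v
  proof -
   have v: "\<kappa> * (norm v)^2 < 1" using zero_le_power2[of "norm v"] unfolding k by linarith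
   define w where "w = sqrt (1 - \<kappa> * (norm v)^2)"
   define y where "y = T (v, w)"
   have y: "y \<in> qpoints \<kappa>" unfolding y_def w_def by (rule R.T_points[OF pt[OF v]])
   have sy: "0 < snd y" using y k by (simp add: qpoints_def)
   have w2: "w\<^sup>2 = 1 + (norm v)^2" "0 < w" using k by (simp_all add: w_def add_pos_nonneg)
   have fst_le: "norm (fst u) \<le> snd u" if "u \<in> qpoints \<kappa>" for u :: "(real^'n) \<times> real"
   proof (rule power2_le_imp_le)
    show "(norm (fst u))^2 \<le> (snd u)^2" "0 \<le> snd u"
     using that k unfolding power2_norm_eq_inner by (simp_all add: qpoints_def qform_def power2_eq_square)
   qed
   \<comment> \<open>The decay of \<open>f\<close> is known in terms of \<open>snd y\<close>, the
     hyperbolic cosine of the distance from the origin, but the chart is centred at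
     \<open>x\<close>, where that role falls to \<open>w\<close>. The two heights are compared up to
     the constant \<open>2 * snd x\<close>.\<close>
   have "w = qform \<kappa> (T y) (0, 1)" by (simp add: y_def R.T_T qform_origin)
   also have "\<dots> = qform \<kappa> y x" using R.T_form[of y x] by (simp add: R.T_x)
   also have "\<dots> \<le> norm (fst y) * norm (fst x) + snd y * snd x"
    using Cauchy_Schwarz_ineq2[of "fst y" "fst x"] k by (simp add: qform_def)
   also have "\<dots> \<le> snd y * snd x + snd y * snd x"
    using fst_le[OF y] fst_le[OF x] sy by (intro add_right_mono mult_mono) auto
   finally have "w ^ (2 * Suc m) \<le> (2 * snd x * snd y) ^ (2 * Suc m)" using w2(2) by (intro power_mono) auto
   then have "w ^ (2 * Suc m) \<le> (2 * snd x) ^ (2 * Suc m) * snd y ^ (2 * Suc m)"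
    by (simp only: power_mult_distrib)
   moreover have "w ^ (2 * Suc m) = (1 + (norm v)^2) ^ Suc m"
    unfolding w2(1)[symmetric] by (simp only: power_mult[symmetric])
   ultimately have le: "(1 + (norm v)^2) ^ Suc m \<le> (2 * snd x) ^ (2 * Suc m) * snd y ^ (2 * Suc m)" by simp
   have pos: "0 < (1 + (norm v)^2) ^ Suc m" "0 < snd y ^ (2 * Suc m)"
    using sy by (intro zero_less_power add_pos_nonneg; simp)+
   have "norm (F v) = norm (f y)" using v by (simp add: F_def y_def w_def)
   also have "\<dots> \<le> M / snd y ^ (2 * Suc m)" by (rule decay[OF k y])
   finally have "norm (F v) * snd y ^ (2 * Suc m) \<le> M" using pos(2) by (simp only: pos_le_divide_eq)
   have "norm (F v) * (1 + (norm v)^2) ^ Suc m \<le> norm (F v) * ((2 * snd x) ^ (2 * Suc m) * snd y ^ (2 * Suc m))"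
    by (intro mult_left_mono le) simp
   also have "\<dots> = (norm (F v) * snd y ^ (2 * Suc m)) * (2 * snd x) ^ (2 * Suc m)" by (simp only: mult_ac)
   also have "\<dots> \<le> M * (2 * snd x) ^ (2 * Suc m)"
    by (intro mult_right_mono) (use \<open>norm (F v) * snd y ^ (2 * Suc m) \<le> M\<close> sx in simp_all)
   finally show ?thesis using pos(1) by (simp only: pos_le_divide_eq)
  qed
  then show ?thesis by blast
 qed
 then obtain C where C: "\<And>v. \<kappa> * (norm v)^2 < 1 ==> norm (F v) \<le> C / (1 + (norm v)^2) ^ Suc m"
  by blast
 obtain U g where g: "x \<in> U" "smooth_on_open U g" "\<And>y. y \<in> qpoints \<kappa> \<inter> U ==> g y = f y"
  using f x unfolding smooth_on_submanifold_def by meson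
 have "open U" using g(2) by (simp add: smooth_on_open_def)
 then obtain \<epsilon> where \<epsilon>: "\<epsilon> > 0" "ball x \<epsilon> \<subseteq> U"
  using g(1) by (rule openE)
 have "bounded_linear T" using R.T_linear by (simp add: linear_conv_bounded_linear)
 then obtain K where K: "K > 0" "\<And>y. norm (T y) \<le> norm y * K" using bounded_linear.pos_bounded by blast
 \<comment> \<open>The curve leaves \<open>x\<close> by at most \<open>|t| (K + norm x)\<close>,
   because \<open>W A\<close> has norm at most \<open>K\<close>; this choice keeps it in the ball
   where the smooth extension \<open>g\<close> of \<open>f\<close> is available.\<close>
 define \<delta> where "\<delta> = min (1 / 2) (\<epsilon> / (K + norm x + 1))"
 have Kx: "0 < K + norm x + 1" using K(1) norm_ge_zero[of x] by linarith
 have \<delta>: "0 < \<delta>" using \<epsilon>(1) Kx by (simp add: \<delta>_def)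
 have \<delta>t: "\<bar>t\<bar> < 1" "\<kappa> * t^2 < 1" "\<bar>t\<bar> * (K + norm x + 1) < \<epsilon>" if t: "t \<in> {-\<delta><..<\<delta>}" for t
 proof -
  have t': "\<bar>t\<bar> < 1 / 2" "\<bar>t\<bar> < \<epsilon> / (K + norm x + 1)"
   using t by (auto simp: \<delta>_def)
  then show "\<bar>t\<bar> < 1" "\<bar>t\<bar> * (K + norm x + 1) < \<epsilon>"
   using Kx by (simp_all only: pos_less_divide_eq)
  then have "t\<^sup>2 < 1" by (simp add: abs_square_less_1)
  moreover have "\<kappa> * t^2 \<le> t^2" using \<kappa> by (elim disjE) simp_all
  ultimately show "\<kappa> * t^2 < 1" by linarith
 qed
 define W where "W A = T (A *v e 0, 0)" for A :: "(real^'n)^'n"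
 have path: "T (t *\<^sub>R (A *v e 0), sqrt (1 - \<kappa> * t^2)) = t *\<^sub>R W A + (1 - \<kappa> * t^2) powr (1 / 2) *\<^sub>R x"
  if "\<kappa> * t^2 < 1" for t and A :: "(real^'n)^'n"
 proof -
  have "(t *\<^sub>R (A *v e 0), sqrt (1 - \<kappa> * t^2)) = t *\<^sub>R (A *v e 0, 0) + sqrt (1 - \<kappa> * t^2) *\<^sub>R (0, 1)"
   by simp
  then show ?thesis
   using that by (simp only: linear_add[OF R.T_linear] linear_cmul[OF R.T_linear] R.T_origin W_def) (simp add: powr_half_sqrt)
 qed
 have inU: "t *\<^sub>R W A + (1 - \<kappa> * t^2) powr (1 / 2) *\<^sub>R x \<in> U" if t: "t \<in> {-\<delta><..<\<delta>}" and A: "orthogonal_matrix A" for t and A :: "(real^'n)^'n"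
 proof -
  have "norm (A *v e 0, 0 :: real) = 1" using norm_orthogonal_matrix_mult[OF A, of "e 0"] e0 by (simp add: norm_Pair)
  then have W: "norm (W A) \<le> K" using K(2)[of "(A *v e 0, 0)"] by (simp add: W_def)
  let ?s = "sqrt (1 - \<kappa> * t^2)"
  have "norm (t *\<^sub>R W A + (?s - 1) *\<^sub>R x) \<le> \<bar>t\<bar> * norm (W A) + \<bar>?s - 1\<bar> * norm x"
   using norm_triangle_ineq[of "t *\<^sub>R W A" "(?s - 1) *\<^sub>R x"] by simp
  also have "\<dots> \<le> \<bar>t\<bar> * K + \<bar>t\<bar> * norm x"
   using abs_sqrt_one_minus[OF \<kappa> \<delta>t(1)[OF t]] W by (intro add_mono mult_left_mono mult_right_mono) auto
  also have "\<dots> \<le> \<bar>t\<bar> * (K + norm x + 1)" by (simp add: distrib_left)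
  also have "\<dots> < \<epsilon>" by (rule \<delta>t(3)[OF t])
  finally have "norm (t *\<^sub>R W A + (?s - 1) *\<^sub>R x) < \<epsilon>" .
  moreover have "(t *\<^sub>R W A + ?s *\<^sub>R x) - x = t *\<^sub>R W A + (?s - 1) *\<^sub>R x"
   by (simp add: algebra_simps)
  ultimately have "dist x (t *\<^sub>R W A + ?s *\<^sub>R x) < \<epsilon>"
   by (simp only: dist_norm norm_minus_commute[of x])
  then have "t *\<^sub>R W A + ?s *\<^sub>R x \<in> U" using \<epsilon>(2) by auto
  then show ?thesis using \<delta>t(2)[OF t] by (simp add: powr_half_sqrt)
 qed
 have smooth: "smooth_family n {-\<delta><..<\<delta>} orthogonal_matrices (\<lambda>t A. F (t *\<^sub>R (A *v e 0)))" for n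
 proof (rule smooth_family_cong)
  have "continuous_on orthogonal_matrices W"
   unfolding W_def by (intro continuous_on_compose2[OF Tc[of UNIV]] continuous_intros continuous_on_matrix_vector) auto
  then show "smooth_family n {-\<delta><..<\<delta>} orthogonal_matrices
    (\<lambda>t A. iter_deriv [] g (t *\<^sub>R W A + (1 - \<kappa> * t^2) powr (1 / 2) *\<^sub>R x))"
   by (intro smooth_family_compose[OF g(2)]) (use \<delta>t(2) inU in auto)
  fix t and A :: "(real^'n)^'n" assume t: "t \<in> {-\<delta><..<\<delta>}" and A: "A \<in> orthogonal_matrices"
  then have A': "orthogonal_matrix A" by simp
  have n: "(norm (t *\<^sub>R (A *v e 0)))\<^sup>2 = t^2"
   using norm_orthogonal_matrix_mult[OF A', of "e 0"] e0 by simp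
  have "t *\<^sub>R W A + (1 - \<kappa> * t^2) powr (1 / 2) *\<^sub>R x \<in> qpoints \<kappa>"
   using R.T_points[OF pt[of "t *\<^sub>R (A *v e 0)"]] \<delta>t(2)[OF t] unfolding n path[OF \<delta>t(2)[OF t]] by simp
  then show "iter_deriv [] g (t *\<^sub>R W A + (1 - \<kappa> * t^2) powr (1 / 2) *\<^sub>R x) = F (t *\<^sub>R (A *v e 0))"
   using g(3) inU[OF t A'] \<delta>t(2)[OF t] unfolding F_def n path[OF \<delta>t(2)[OF t]] by simp
 qed simp
 have G: "shifted_dual_radon (curved_geometry \<kappa> ?k) r (radon (curved_geometry \<kappa> ?k) f) x
  = (if \<kappa> = 1 then 2 else 1) * (LINT A|\<mu>. (LINT z|lborel_PiM ?k. klein_weight \<kappa> ?k (cnorm ?k z) *\<^sub>R F (A *v klein_vector e \<kappa> ?k r z)))"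
  if rr: "r \<in> {0<..<\<delta>}" for r
 proof -
  have r: "0 < r" "\<kappa> * r^2 < 1" using rr \<delta>t(2)[of r] by auto
  interpret act: orthogonal_action "curved_geometry \<kappa> ?k" x r R.act "R.submfd ?k r e"
   by (rule R.orthogonal_action_curved[OF e r])
  have rad: "radon (curved_geometry \<kappa> ?k) f (R.act A ` R.submfd ?k r e)
   = (if \<kappa> = 1 then 2 else 1) * (LINT z|lborel_PiM ?k. klein_weight \<kappa> ?k (cnorm ?k z) *\<^sub>R F (A *v klein_vector e \<kappa> ?k r z))"
   if A: "orthogonal_matrix A" for A unfolding F_def using R.radon_curved[OF A e r _ m(2) cont even] m(1) by simp
  have "continuous_on orthogonal_matrices (\<lambda>A. LINT z|lborel_PiM ?k. klein_weight \<kappa> ?k (cnorm ?k z) *\<^sub>R F (A *v klein_vector e \<kappa> ?k r z))"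
   by (rule continuous_klein_integral[of \<kappa> m e F C r]) (use \<kappa> e' Fm Fc C m r in auto)
  then have "continuous_on orthogonal_matrices (\<lambda>A. (if \<kappa> = 1 then 2 else 1) * (LINT z|lborel_PiM ?k. klein_weight \<kappa> ?k (cnorm ?k z) *\<^sub>R F (A *v klein_vector e \<kappa> ?k r z)))"
   by (rule continuous_on_mult_left)
  then have "continuous_on orthogonal_matrices (\<lambda>A. radon (curved_geometry \<kappa> ?k) f (R.act A ` R.submfd ?k r e))"
   by (rule continuous_on_eq) (simp add: rad)
  then have "shifted_dual_radon (curved_geometry \<kappa> ?k) r (radon (curved_geometry \<kappa> ?k) f) x
   = (LINT A|\<mu>. radon (curved_geometry \<kappa> ?k) f (R.act A ` R.submfd ?k r e))"
   by (intro act.shifted_dual_radon_orbit haar_prob haar_sets haar_left haar_right)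
  also have "\<dots> = (LINT A|\<mu>. (if \<kappa> = 1 then 2 else 1) * (LINT z|lborel_PiM ?k. klein_weight \<kappa> ?k (cnorm ?k z) *\<^sub>R F (A *v klein_vector e \<kappa> ?k r z)))"
   by (intro Bochner_Integration.integral_cong refl rad) (simp add: haar_space)
  finally show ?thesis by simp
 qed
 have "has_nth_deriv_at_right_0 ?k
  (\<lambda>r. of_real ((1 - \<kappa> * r^2) powr ((real ?k - 1) / 2)) * shifted_dual_radon (curved_geometry \<kappa> ?k) r (radon (curved_geometry \<kappa> ?k) f) x)
  ((if \<kappa> = 1 then 2 else 1) * of_real ((- 1) ^ m * fact (?k - 1) * sphere_area (?k - 1)) * F 0)"
  using \<kappa> by (intro has_nth_deriv_mean[OF _ m(1) e' Fm C \<delta> \<delta>t(2) smooth G]) auto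
 moreover have "F 0 = f x" by (simp add: F_def R.T_origin)
 ultimately show ?thesis by simp
qed

end

text \<open>Take the identity operator and the exponent \<open>n\<close> in the definition of rapid
  decrease; with \<open>d\<close> the distance from the origin,
  \<open>exp d = cosh d + sinh d\<close> is at least \<open>cosh d = snd y\<close>.\<close>

lemma hyperbolic_decay:
 fixes f :: "(real^'n) \<times> real => complex"
 assumes f: "hyp_rapidly_decreasing f"
 obtains M where "\<And>y. y \<in> qpoints (- 1) ==> norm (f y) \<le> M / snd y ^ n"
proof -
 have "bdd_above ((\<lambda>x. exp (real n * hyp_dist x (0, 1)) * norm (f x)) ` hyperboloid)"
  using f[unfolded hyp_rapidly_decreasing_def, rule_format, OF enveloping_operators.one, of "real n"] by simp
 then obtain M where M: "\<And>y. y \<in> hyperboloid ==> exp (real n * hyp_dist y (0, 1)) * norm (f y) \<le> M"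
  by (auto simp: bdd_above_def)
 show ?thesis
 proof (rule that)
  fix y :: "(real^'n) \<times> real" assume y: "y \<in> qpoints (- 1)"
  have s: "1 \<le> snd y" using qform_ge_1[OF y origin_qpoints] by (simp add: qform_origin)
  have "hyp_dist y (0, 1) = arcosh (snd y)" by (simp add: hyp_dist_def lform_def)
  also have "\<dots> = ln (snd y + sqrt ((snd y)^2 - 1))" using s by (rule arcosh_real_def)
  finally have d: "hyp_dist y (0, 1) = ln (snd y + sqrt ((snd y)^2 - 1))" .
  have q: "0 \<le> sqrt ((snd y)^2 - 1)" using s by (simp add: one_le_power)
  then have "exp (hyp_dist y (0, 1)) = snd y + sqrt ((snd y)^2 - 1)"
   unfolding d using s by (intro exp_ln) linarith
  then have "snd y \<le> exp (hyp_dist y (0, 1))" using q by linarith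
  then have "snd y ^ n \<le> exp (real n * hyp_dist y (0, 1))"
   unfolding exp_of_nat_mult using s by (intro power_mono) auto
  then have "snd y ^ n * norm (f y) \<le> exp (real n * hyp_dist y (0, 1)) * norm (f y)"
   by (rule mult_right_mono) simp
  also have "\<dots> \<le> M" using M y by (simp add: qpoints_minus_one)
  finally have "norm (f y) * snd y ^ n \<le> M" by (simp only: mult.commute)
  moreover have "0 < snd y ^ n" using s by simp
  ultimately show "norm (f y) \<le> M / snd y ^ n" by (simp only: pos_le_divide_eq)
 qed
qed

theorem theorem2p2:
  fixes k :: nat
  assumes "CARD('n::finite) \<ge> 2" and "1 \<le> k" and "k \<le> CARD('n) - 1" and "even k"
  shows
    "(\<forall>f :: real^'n \<Rightarrow> complex. schwartz f \<longrightarrow>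
       (\<forall>x. has_nth_deriv_at_right_0 k
          (\<lambda>r. shifted_dual_radon (euclidean_geometry k) r (radon (euclidean_geometry k) f) x)
          (of_real ((- 1) ^ (k div 2) * fact (k - 1) * sphere_area (k - 1)) * f x))) \<and>
     (\<forall>f :: (real^'n) \<times> real \<Rightarrow> complex.
       smooth_on_submanifold (sphere 0 1) f \<and> (\<forall>x\<in>sphere 0 1. f (- x) = f x) \<longrightarrow>
       (\<forall>x\<in>sphere 0 1. has_nth_deriv_at_right_0 k
          (\<lambda>r. of_real ((1 - r\<^sup>2) powr ((real k - 1) / 2)) *
            shifted_dual_radon (spherical_geometry k) r (radon (spherical_geometry k) f) x)
          (of_real (2 * (- 1) ^ (k div 2) * fact (k - 1) * sphere_area (k - 1)) * f x))) \<and>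
     (\<forall>f :: (real^'n) \<times> real \<Rightarrow> complex.
       smooth_on_submanifold hyperboloid f \<and> hyp_rapidly_decreasing f \<longrightarrow>
       (\<forall>x\<in>hyperboloid. has_nth_deriv_at_right_0 k
          (\<lambda>r. of_real ((1 + r\<^sup>2) powr ((real k - 1) / 2)) *
            shifted_dual_radon (hyperbolic_geometry k) r (radon (hyperbolic_geometry k) f) x)
          (of_real ((- 1) ^ (k div 2) * fact (k - 1) * sphere_area (k - 1)) * f x)))"
proof -
 obtain m where km: "k = 2 * m" using \<open>even k\<close> by (elim evenE)
 then have m: "1 \<le> m" "2 * m < CARD('n)" "k div 2 = m" using assms by auto
 obtain \<mu> :: "((real^'n)^'n) measure" where "prob_space \<mu>" "sets \<mu> = sets borel_orthogonal"
  "\<And>B. orthogonal_matrix B ==> distr \<mu> \<mu> (\<lambda>A. B ** A) = \<mu>" "\<And>B. orthogonal_matrix B ==> distr \<mu> \<mu> (\<lambda>A. A ** B) = \<mu>"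
  using haar_exists by blast
 then interpret haar_measure \<mu> by (rule haar_measure.intro)
 show ?thesis
 proof (intro conjI allI impI ballI)
  fix f :: "real^'n => complex" and x
  assume "schwartz f"
  then show "has_nth_deriv_at_right_0 k
    (\<lambda>r. shifted_dual_radon (euclidean_geometry k) r (radon (euclidean_geometry k) f) x)
    (of_real ((- 1) ^ (k div 2) * fact (k - 1) * sphere_area (k - 1)) * f x)"
   unfolding m(3) unfolding km by (rule euclidean_inversion[OF _ m(1,2)])
 next
  fix f :: "(real^'n) \<times> real => complex" and x :: "(real^'n) \<times> real"
  assume f: "smooth_on_submanifold (sphere 0 1) f \<and> (\<forall>x\<in>sphere 0 1. f (- x) = f x)" and x: "x \<in> sphere 0 1"
  have "has_nth_deriv_at_right_0 (2 * m)
   (\<lambda>r. of_real ((1 - 1 * r^2) powr ((real (2 * m) - 1) / 2)) *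
    shifted_dual_radon (curved_geometry 1 (2 * m)) r (radon (curved_geometry 1 (2 * m)) f) x)
   ((if (1 :: real) = 1 then 2 else 1) * of_real ((- 1) ^ m * fact (2 * m - 1) * sphere_area (2 * m - 1)) * f x)"
   by (rule curved_inversion[OF _ m(1,2)]) (use f x in \<open>simp_all add: qpoints_one\<close>)
  then show "has_nth_deriv_at_right_0 k
    (\<lambda>r. of_real ((1 - r\<^sup>2) powr ((real k - 1) / 2)) *
     shifted_dual_radon (spherical_geometry k) r (radon (spherical_geometry k) f) x)
    (of_real (2 * (- 1) ^ (k div 2) * fact (k - 1) * sphere_area (k - 1)) * f x)"
   unfolding m(3) unfolding km by (simp add: curved_geometry_def mult.assoc)
 next
  fix f :: "(real^'n) \<times> real => complex" and x :: "(real^'n) \<times> real"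
  assume f: "smooth_on_submanifold hyperboloid f \<and> hyp_rapidly_decreasing f" and x: "x \<in> hyperboloid"
  obtain M where M: "\<And>y. y \<in> qpoints (- 1) ==> norm (f y) \<le> M / snd y ^ (2 * Suc m)"
   using hyperbolic_decay[OF conjunct2[OF f]] by metis
  have "has_nth_deriv_at_right_0 (2 * m)
   (\<lambda>r. of_real ((1 - (- 1) * r^2) powr ((real (2 * m) - 1) / 2)) *
    shifted_dual_radon (curved_geometry (- 1) (2 * m)) r (radon (curved_geometry (- 1) (2 * m)) f) x)
   ((if (- 1 :: real) = 1 then 2 else 1) * of_real ((- 1) ^ m * fact (2 * m - 1) * sphere_area (2 * m - 1)) * f x)"
   by (rule curved_inversion[OF _ m(1,2) _ _ M]) (use f x in \<open>simp_all add: qpoints_minus_one\<close>)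
  then show "has_nth_deriv_at_right_0 k
    (\<lambda>r. of_real ((1 + r^2) powr ((real k - 1) / 2)) *
     shifted_dual_radon (hyperbolic_geometry k) r (radon (hyperbolic_geometry k) f) x)
    (of_real ((- 1) ^ (k div 2) * fact (k - 1) * sphere_area (k - 1)) * f x)"
   unfolding m(3) unfolding km by (simp add: curved_geometry_def mult.assoc)
 qed
qed

end
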